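(* Let $q$ be an odd prime power with $\operatorname{char}\mathbb F_q\ne3$, let $\varepsilon\in\mathbb F_q^\times$, let $r$ be a prime different from $\operatorname{char}\mathbb F_q$, and let $\overline C_\varepsilon$ be the base change to $\overline{\mathbb F}_q$ of the smooth projective closure of $x_1+x_2+x_3=0$, $x_1x_2x_3=\varepsilon$. The $S_3$-action on $\overline C_\varepsilon$ by permuting coordinates acts on $H^1_{\mathrm{ét}}(\overline C_\varepsilon,\mathbb Q_r)$ through the sign character. Let $B$ be a finite étale cubic $\mathbb F_q$-algebra, $\tau_B\in S_3$ the Frobenius permutation of its three geometric embeddings (up to conjugacy), $C_{\varepsilon,B}$ the smooth projective compactification of $\operatorname{Tr}_{B/\mathbb F_q}(x)=0$, $\operatorname{Norm}_{B/\mathbb F_q}(x)=\varepsilon$, and $A_q(\varepsilon)=\#E_\varepsilon(\mathbb F_q)-q-1$ where $E_\varepsilon:V^2=-4U^3-27\varepsilon^2$ (projective). Then $\#C_{\varepsilon,B}(\mathbb F_q)=q+1+\operatorname{sgn}(\tau_B)A_q(\varepsilon)$; the number of $\mathbb F_q$-rational points at infinity is the number of fixed points of $\tau_B$ on $\{1,2,3\}$; and $N_B(\varepsilon)=\#\{x\in B^\times:\operatorname{Tr}(x)=0,\operatorname{Norm}(x)=\varepsilon\}$ equals $q+1+\operatorname{sgn}(\tau_B)A_q(\varepsilon)-\#\operatorname{Fix}(\tau_B)$. Thus $N_B(\varepsilon)=\#E_\varepsilon(\mathbb F_q)-3$ for $B=\mathbb F_q^3$, $2q+1-\#E_\varepsilon(\mathbb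 F_q)$ for $B=\mathbb F_q\times\mathbb F_{q^2}$, and $\#E_\varepsilon(\mathbb F_q)$ for $B=\mathbb F_{q^3}$. *)

theory Defs
  imports
    "HOL-Analysis.Analysis"
    "HOL-Algebra.Algebraic_Closure_Type"
    "HOL-Combinatorics.Permutations"
    "HOL-Number_Theory.Cong"
begin

no_notation fps_nth (infixl \<open>$\<close> 75)

section \<open>Finite \'etale algebras over a field\<close>

text \<open>An algebra over the field \<open>'a\<close> is a commutative ring \<open>'b\<close> together with its structure
  homomorphism \<open>\<iota> :: 'a \<Rightarrow> 'b\<close>.\<close>

definition is_ring_hom :: "('a::comm_ring_1 \<Rightarrow> 'b::comm_ring_1) \<Rightarrow> bool" where
  "is_ring_hom f \<longleftrightarrow> f 1 = 1 \<and> (\<forall>x y. f (x + y) = f x + f y) \<and> (\<forall>x y. f (x * y) = f x * f y)"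

definition alg_hom ::
  "('a::field \<Rightarrow> 'b::comm_ring_1) \<Rightarrow> ('a \<Rightarrow> 'c::comm_ring_1) \<Rightarrow> ('b \<Rightarrow> 'c) \<Rightarrow> bool" where
  "alg_hom \<iota> \<kappa> f \<longleftrightarrow> is_ring_hom f \<and> (\<forall>c. f (\<iota> c) = \<kappa> c)"

definition alg_basis :: "('a::field \<Rightarrow> 'b::comm_ring_1) \<Rightarrow> ('n::finite \<Rightarrow> 'b) \<Rightarrow> bool" where
  "alg_basis \<iota> b \<longleftrightarrow> (\<forall>x. \<exists>!c::'a^'n. x = (\<Sum>i\<in>UNIV. \<iota> (c $ i) * b i))"

definition coords :: "('a::field \<Rightarrow> 'b::comm_ring_1) \<Rightarrow> ('n::finite \<Rightarrow> 'b) \<Rightarrow> 'b \<Rightarrow> 'a^'n" where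
  "coords \<iota> b x = (THE c. x = (\<Sum>i\<in>UNIV. \<iota> (c $ i) * b i))"

definition mult_matrix :: "('a::field \<Rightarrow> 'b::comm_ring_1) \<Rightarrow> ('n::finite \<Rightarrow> 'b) \<Rightarrow> 'b \<Rightarrow> 'a^'n^'n" where
  "mult_matrix \<iota> b x = (\<chi> i j. coords \<iota> b (x * b j) $ i)"

text \<open>A finite \'etale algebra is a finite product of finite separable field extensions. The product
  decomposition is given by orthogonal idempotents \<open>e\<close>; the factor \<open>e B\<close> is a field with unit \<open>e\<close>,
  and \<open>e * poly (map_poly \<iota> p) x\<close> is the value of \<open>p\<close> at the element \<open>e * x\<close> of that factor.\<close>

definition etale_decomposition :: "('a::field \<Rightarrow> 'b::comm_ring_1) \<Rightarrow> 'b set \<Rightarrow> bool" where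
  "etale_decomposition \<iota> S \<longleftrightarrow>
     finite S \<and> (\<forall>e\<in>S. e \<noteq> 0 \<and> e * e = e) \<and> (\<forall>e\<in>S. \<forall>e'\<in>S. e \<noteq> e' \<longrightarrow> e * e' = 0) \<and> \<Sum>S = 1 \<and>
     (\<forall>e\<in>S. \<forall>x. e * x \<noteq> 0 \<longrightarrow> (\<exists>y. (e * x) * (e * y) = e)) \<and>
     (\<forall>e\<in>S. \<forall>x. \<exists>p::'a poly. coprime p (pderiv p) \<and> e * poly (map_poly \<iota> p) x = 0)"

definition cubic_etale :: "('a::field \<Rightarrow> 'b::comm_ring_1) \<Rightarrow> bool" where
  "cubic_etale \<iota> \<longleftrightarrow>
     is_ring_hom \<iota> \<and> (\<exists>b :: 3 \<Rightarrow> 'b. alg_basis \<iota> b) \<and> (\<exists>S. etale_decomposition \<iota> S)"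

definition cubic_trace :: "('a::field \<Rightarrow> 'b::comm_ring_1) \<Rightarrow> 'b \<Rightarrow> 'a" where
  "cubic_trace \<iota> x = trace (mult_matrix \<iota> (SOME b :: 3 \<Rightarrow> 'b. alg_basis \<iota> b) x)"

definition cubic_norm :: "('a::field \<Rightarrow> 'b::comm_ring_1) \<Rightarrow> 'b \<Rightarrow> 'a" where
  "cubic_norm \<iota> x = det (mult_matrix \<iota> (SOME b :: 3 \<Rightarrow> 'b. alg_basis \<iota> b) x)"

definition geom_embeddings :: "('a::field \<Rightarrow> 'b::comm_ring_1) \<Rightarrow> ('b \<Rightarrow> 'a alg_closure) set" where
  "geom_embeddings \<iota> = {\<phi>. alg_hom \<iota> to_ac \<phi>}"

text \<open>The permutations of the three-element type \<open>3\<close> that represent the action of Frobenius on the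
  geometric embeddings, under any numbering \<open>e\<close> of these; this is a conjugacy class.\<close>

definition frobenius_perm :: "('a::{field,finite} \<Rightarrow> 'b::comm_ring_1) \<Rightarrow> (3 \<Rightarrow> 3) \<Rightarrow> bool" where
  "frobenius_perm \<iota> \<tau> \<longleftrightarrow> bij \<tau> \<and>
     (\<exists>e. bij_betw e UNIV (geom_embeddings \<iota>) \<and> (\<forall>i x. e (\<tau> i) x = e i x ^ CARD('a)))"

definition alg_iso1 :: "('a::field \<Rightarrow> 'b::comm_ring_1) \<Rightarrow> ('a \<Rightarrow> 'c::comm_ring_1) \<Rightarrow> bool" where
  "alg_iso1 \<iota> \<kappa> \<longleftrightarrow> (\<exists>f. alg_hom \<iota> \<kappa> f \<and> bij f)"

definition alg_iso2 ::
  "('a::field \<Rightarrow> 'b::comm_ring_1) \<Rightarrow> ('a \<Rightarrow> 'c::comm_ring_1) \<Rightarrow> ('a \<Rightarrow> 'd::comm_ring_1) \<Rightarrow> bool" where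
  "alg_iso2 \<iota> \<kappa> \<mu> \<longleftrightarrow> (\<exists>f g. alg_hom \<iota> \<kappa> f \<and> alg_hom \<iota> \<mu> g \<and> bij (\<lambda>x. (f x, g x)))"

definition alg_iso3 ::
  "('a::field \<Rightarrow> 'b::comm_ring_1) \<Rightarrow> ('a \<Rightarrow> 'c::comm_ring_1) \<Rightarrow> ('a \<Rightarrow> 'd::comm_ring_1)
    \<Rightarrow> ('a \<Rightarrow> 'e::comm_ring_1) \<Rightarrow> bool" where
  "alg_iso3 \<iota> \<kappa> \<mu> \<nu> \<longleftrightarrow>
     (\<exists>f g h. alg_hom \<iota> \<kappa> f \<and> alg_hom \<iota> \<mu> g \<and> alg_hom \<iota> \<nu> h \<and> bij (\<lambda>x. (f x, g x, h x)))"


section \<open>The curves\<close>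

definition proj_points :: "('k::field \<Rightarrow> 'v::zero \<Rightarrow> 'v) \<Rightarrow> 'v set \<Rightarrow> 'v set set" where
  "proj_points sc S = (\<lambda>v. {sc c v | c. c \<noteq> 0}) ` (S - {0})"

text \<open>The projective closure of \<open>x\<^sub>1 + x\<^sub>2 + x\<^sub>3 = 0\<close>, \<open>x\<^sub>1 x\<^sub>2 x\<^sub>3 = \<epsilon>\<close>; the coordinate \<open>None\<close> is
  the homogenizing one.\<close>

definition proj_curve :: "'k::field \<Rightarrow> ('k^(3 option)) set set" where
  "proj_curve \<epsilon> = proj_points (*s)
     {v. (\<Sum>i\<in>UNIV. v $ Some i) = 0 \<and> (\<Prod>i\<in>UNIV. v $ Some i) = \<epsilon> * (v $ None) ^ 3}"

definition perm_point :: "(3 \<Rightarrow> 3) \<Rightarrow> ('k::field^(3 option)) set \<Rightarrow> ('k^(3 option)) set" where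
  "perm_point \<sigma> P = (\<lambda>v. \<chi> j. v $ map_option (inv_into UNIV \<sigma>) j) ` P"

text \<open>Jacobian criterion: the gradients of the two equations are linearly independent at every point,
  so that the projective closure is already smooth.\<close>

lemma proj_curve_smooth:
  fixes \<epsilon> a b :: "'k::field" and v :: "'k^(3 option)"
  assumes "CHAR('k) \<noteq> 3" "\<epsilon> \<noteq> 0" "P \<in> proj_curve \<epsilon>" "v \<in> P"
    and proj: "\<And>i. a * 1 + b * (\<Prod>j\<in>UNIV - {i}. v $ Some j) = 0"
    and hom: "a * 0 + b * (- 3 * \<epsilon> * (v $ None) ^ 2) = 0"
  shows "a = 0 \<and> b = 0"
proof (rule ccontr)
  assume "\<not> (a = 0 \<and> b = 0)"
  with proj[of 1] have b: "b \<noteq> 0" by auto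
  have three: "(3::'k) \<noteq> 0"
  proof
    assume "(3::'k) = 0"
    hence "of_nat 3 = (0::'k)" by simp
    hence "CHAR('k) dvd 3" by (simp only: of_nat_eq_0_iff_char_dvd)
    moreover have "Factorial_Ring.prime (3::nat)" by simp
    ultimately have "CHAR('k) = 1" using assms(1) by (auto simp: prime_nat_iff)
    thus False by simp
  qed
  have z: "v $ None = 0"
    using hom b assms(2) three by simp
  obtain w c where w: "w \<noteq> 0" "c \<noteq> 0" "v = c *s w" "(\<Sum>i\<in>UNIV. w $ Some i) = 0"
      "(\<Prod>i\<in>UNIV. w $ Some i) = \<epsilon> * (w $ None) ^ 3"
    using assms(3,4) unfolding proj_curve_def proj_points_def by blast
  define x y u where "x = w $ Some 1" and "y = w $ Some 2" and "u = w $ Some 3"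
  have v: "v $ Some 1 = c * x" "v $ Some 2 = c * y" "v $ Some 3 = c * u"
    by (simp_all add: w(3) x_def y_def u_def)
  have wn: "w $ None = 0" using z w(2,3) by simp
  have s: "x + y + u = 0" using w(4) by (simp add: sum_3 x_def y_def u_def)
  have p: "x * y * u = 0" using w(5) wn unfolding UNIV_3 by (simp add: x_def y_def u_def mult.assoc)
  have D: "UNIV - {1} = {2, 3::3}" "UNIV - {2} = {1, 3::3}" "UNIV - {3} = {1, 2::3}"
    unfolding UNIV_3 by auto
  have e: "a + b * (c * y * (c * u)) = 0" "a + b * (c * x * (c * u)) = 0"
      "a + b * (c * x * (c * y)) = 0"
    using proj[of 1] proj[of 2] proj[of 3] unfolding D by (simp_all add: v)
  consider "x = 0" | "y = 0" | "u = 0" using p by auto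
  hence "a = 0" using e by cases simp_all
  hence prods: "y * u = 0" "x * u = 0" "x * y = 0" using e b w(2) by auto
  have "x = 0 \<and> y = 0 \<and> u = 0"
  proof (cases "x = 0")
    case True
    with s prods show ?thesis by (cases "y = 0") simp_all
  next
    case False
    with s prods show ?thesis by simp
  qed
  hence "w $ Some i = 0" for i
    using exhaust_3[of i] unfolding x_def y_def u_def by metis
  hence "w $ j = 0" for j
    using wn by (cases j) simp_all
  with w(1) show False by (simp add: vec_eq_iff)
qed

text \<open>The rational points of the projective closure of \<open>Tr x = 0\<close>, \<open>Norm x = \<epsilon>\<close>, as lines in
  \<open>B \<oplus> F\<^sub>q\<close>. The embeddings of \<open>B\<close> identify this curve over the algebraic closure with
  \<^const>\<open>proj_curve\<close>, so it is smooth.\<close>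

definition twisted_curve ::
  "('a::field \<Rightarrow> 'b::comm_ring_1) \<Rightarrow> 'a \<Rightarrow> ('b \<times> 'a) set set" where
  "twisted_curve \<iota> \<epsilon> = proj_points (\<lambda>c (x, z). (\<iota> c * x, c * z))
     {(x, z). cubic_trace \<iota> x = 0 \<and> cubic_norm \<iota> x = \<epsilon> * z ^ 3}"

definition twisted_curve_infinity ::
  "('a::field \<Rightarrow> 'b::comm_ring_1) \<Rightarrow> 'a \<Rightarrow> ('b \<times> 'a) set set" where
  "twisted_curve_infinity \<iota> \<epsilon> = {P \<in> twisted_curve \<iota> \<epsilon>. \<forall>(x, z)\<in>P. z = 0}"

definition norm_trace_count :: "('a::field \<Rightarrow> 'b::comm_ring_1) \<Rightarrow> 'a \<Rightarrow> nat" where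
  "norm_trace_count \<iota> \<epsilon> = card {x. x dvd 1 \<and> cubic_trace \<iota> x = 0 \<and> cubic_norm \<iota> x = \<epsilon>}"

definition ell_curve :: "'a::field \<Rightarrow> ('a^3) set set" where
  "ell_curve \<epsilon> = proj_points (*s)
     {v. (v $ 2) ^ 2 * v $ 3 = - 4 * (v $ 1) ^ 3 - 27 * \<epsilon> ^ 2 * (v $ 3) ^ 3}"

definition ell_A :: "'a::{field,finite} \<Rightarrow> int" where
  "ell_A \<epsilon> = int (card (ell_curve \<epsilon>)) - int CARD('a) - 1"


section \<open>First \'etale cohomology of a projective variety over an algebraically closed field\<close>

text \<open>A variety \<open>Y\<close> is the set of its closed points, each a line in \<open>'k^'n\<close> without the origin.
  \<open>graded_poly L A d f\<close>: \<open>f\<close> is a polynomial in the functions in \<open>L\<close> and \<open>A\<close>, homogeneous of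
  degree \<open>d\<close> when the members of \<open>L\<close> have weight 1 and those of \<open>A\<close> weight 0.\<close>

type_synonym ('k, 'n) point = "('k^'n) set"

inductive graded_poly ::
  "('p \<Rightarrow> 'k::comm_ring_1) set \<Rightarrow> ('p \<Rightarrow> 'k) set \<Rightarrow> nat \<Rightarrow> ('p \<Rightarrow> 'k) \<Rightarrow> bool" for L A where
  const: "graded_poly L A 0 (\<lambda>_. c)"
| proj_coord: "l \<in> L \<Longrightarrow> graded_poly L A 1 l"
| affine_coord: "a \<in> A \<Longrightarrow> graded_poly L A 0 a"
| add: "graded_poly L A d f \<Longrightarrow> graded_poly L A d g \<Longrightarrow> graded_poly L A d (\<lambda>p. f p + g p)"
| mult: "graded_poly L A d f \<Longrightarrow> graded_poly L A e g \<Longrightarrow> graded_poly L A (d + e) (\<lambda>p. f p * g p)"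

definition form :: "nat \<Rightarrow> ('k::comm_ring_1^'n \<Rightarrow> 'k) \<Rightarrow> bool" where
  "form d f \<longleftrightarrow> graded_poly (range (\<lambda>i v. v $ i)) {} d f"

text \<open>Polynomial functions on the product of projective space with the affine plane.\<close>

definition form2 :: "nat \<Rightarrow> (('k::comm_ring_1^'n) \<times> 'k \<times> 'k \<Rightarrow> 'k) \<Rightarrow> bool" where
  "form2 d f \<longleftrightarrow>
     graded_poly (range (\<lambda>i (v, t, u). v $ i)) {\<lambda>(v, t, u). t, \<lambda>(v, t, u). u} d f"

definition zariski_open_in :: "('k::field, 'n::finite) point set \<Rightarrow> ('k, 'n) point set \<Rightarrow> bool" where
  "zariski_open_in Y V \<longleftrightarrow> V \<subseteq> Y \<and>
     (\<forall>P\<in>V. \<exists>d f. form d f \<and> (\<forall>v\<in>P. f v \<noteq> 0) \<and> (\<forall>Q\<in>Y. (\<forall>v\<in>Q. f v \<noteq> 0) \<longrightarrow> Q \<in> V))"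

definition regular_on ::
  "('k::field, 'n::finite) point set \<Rightarrow> (('k, 'n) point \<Rightarrow> 'k) \<Rightarrow> bool" where
  "regular_on V \<phi> \<longleftrightarrow>
     (\<forall>P\<in>V. \<exists>d f g. form d f \<and> form d g \<and> (\<forall>v\<in>P. g v \<noteq> 0) \<and>
        (\<forall>Q\<in>V. \<forall>v\<in>Q. g v \<noteq> 0 \<longrightarrow> \<phi> Q = f v / g v))"

text \<open>A standard \'etale morphism to \<open>Y\<close>: over an open set \<open>base\<close>, the locus of the \<open>t\<close> in the affine
  line with \<open>eqn(t) = 0\<close> and \<open>loc(t) \<noteq> 0\<close>, where \<open>eqn\<close> is monic with regular coefficients and its
  derivative is invertible on this locus. Every \'etale morphism is Zariski-locally of this form,
  so the families of standard \'etale morphisms are cofinal among the \'etale coverings.\<close>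

record (overloaded) ('k, 'n) chart =
  base :: "('k, 'n) point set"
  eqn :: "('k, 'n) point \<Rightarrow> 'k poly"
  loc :: "('k, 'n) point \<Rightarrow> 'k poly"

definition chart_fibre :: "('k::field, 'n::finite) chart \<Rightarrow> ('k, 'n) point \<Rightarrow> 'k set" where
  "chart_fibre c P = {t. P \<in> base c \<and> poly (eqn c P) t = 0 \<and> poly (loc c P) t \<noteq> 0}"

definition standard_etale :: "('k::field, 'n::finite) point set \<Rightarrow> ('k, 'n) chart \<Rightarrow> bool" where
  "standard_etale Y c \<longleftrightarrow>
     zariski_open_in Y (base c) \<and>
     (\<exists>d. \<forall>P\<in>base c. Polynomial.degree (eqn c P) = d \<and> Polynomial.lead_coeff (eqn c P) = 1) \<and>
     (\<exists>d. \<forall>P\<in>base c. Polynomial.degree (loc c P) \<le> d) \<and>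
     (\<forall>i. regular_on (base c) (\<lambda>P. Polynomial.coeff (eqn c P) i)) \<and>
     (\<forall>i. regular_on (base c) (\<lambda>P. Polynomial.coeff (loc c P) i)) \<and>
     (\<forall>P. \<forall>t\<in>chart_fibre c P. poly (pderiv (eqn c P)) t \<noteq> 0)"

text \<open>The covering space \<open>U\<close> of a covering is the disjoint union of its charts; its fibre over \<open>P\<close>
  consists of the pairs of a chart number and a point of that chart.\<close>

definition fibre :: "('k::field, 'n::finite) chart list \<Rightarrow> ('k, 'n) point \<Rightarrow> (nat \<times> 'k) set" where
  "fibre cs P = {(i, t). i < length cs \<and> t \<in> chart_fibre (cs ! i) P}"

definition etale_covering :: "('k::field, 'n::finite) point set \<Rightarrow> ('k, 'n) chart list \<Rightarrow> bool" where
  "etale_covering Y cs \<longleftrightarrow> (\<forall>c\<in>set cs. standard_etale Y c) \<and> (\<forall>P\<in>Y. fibre cs P \<noteq> {})"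

text \<open>Sections of the constant sheaf \<open>\<int>/m\<close> over a fibre product \<open>U \<times>\<^sub>Y U'\<close> are represented by
  integer-valued functions \<open>w P u u'\<close> (\<open>u\<close>, \<open>u'\<close> in the fibres over \<open>P\<close>) whose residue modulo \<open>m\<close>
  is locally constant in the Zariski topology; functions congruent modulo \<open>m\<close> represent the same
  section.\<close>

type_synonym ('k, 'n) cochain = "('k, 'n) point \<Rightarrow> nat \<times> 'k \<Rightarrow> nat \<times> 'k \<Rightarrow> int"

definition const_section ::
  "nat \<Rightarrow> ('k::field, 'n::finite) chart list \<Rightarrow> ('k, 'n) chart list \<Rightarrow> ('k, 'n) cochain \<Rightarrow> bool" where
  "const_section m cs cs' w \<longleftrightarrow>
     (\<forall>P i t j u. (i, t) \<in> fibre cs P \<and> (j, u) \<in> fibre cs' P \<longrightarrow>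
        (\<exists>d f. form2 d f \<and> (\<forall>v\<in>P. f (v, t, u) \<noteq> 0) \<and>
           (\<forall>Q t' u'. (i, t') \<in> fibre cs Q \<and> (j, u') \<in> fibre cs' Q \<and>
              (\<forall>v\<in>Q. f (v, t', u') \<noteq> 0) \<longrightarrow> [w Q (i, t') (j, u') = w P (i, t) (j, u)] (mod int m))))"

definition cech_cocycle ::
  "('k::field, 'n::finite) point set \<Rightarrow> nat \<Rightarrow> ('k, 'n) chart list \<times> ('k, 'n) cochain \<Rightarrow> bool" where
  "cech_cocycle Y m = (\<lambda>(cs, g). etale_covering Y cs \<and> const_section m cs cs g \<and>
     (\<forall>P. \<forall>u\<in>fibre cs P. \<forall>v\<in>fibre cs P. \<forall>w\<in>fibre cs P.
        [g P u v + g P v w = g P u w] (mod int m)))"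

text \<open>Two cocycles define the same \v{C}ech class iff they become cohomologous on the common
  refinement \<open>U \<times>\<^sub>Y U'\<close> of their coverings; the 0-cochain \<open>w\<close> there is a section over \<open>U \<times>\<^sub>Y U'\<close>.
  (Restriction of \v{C}ech \<open>H\<^sup>1\<close> to a refinement is injective, so no further refinement is
  needed.)  \v{C}ech and derived functor cohomology agree in degree 1.\<close>

definition cohomologous ::
  "('k::field, 'n::finite) point set \<Rightarrow> nat \<Rightarrow>
    (('k, 'n) chart list \<times> ('k, 'n) cochain) rel" where
  "cohomologous Y m = {((cs, g), (cs', g')).
     cech_cocycle Y m (cs, g) \<and> cech_cocycle Y m (cs', g') \<and>
     (\<exists>w. const_section m cs cs' w \<and>
       (\<forall>P. \<forall>u\<in>fibre cs P. \<forall>v\<in>fibre cs P. \<forall>u'\<in>fibre cs' P. \<forall>v'\<in>fibre cs' P.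
          [g P u v - g' P u' v' = w P u u' - w P v v'] (mod int m)))}"

type_synonym ('k, 'n) cech_class = "(('k, 'n) chart list \<times> ('k, 'n) cochain) set"

definition H1 :: "('k::field, 'n::finite) point set \<Rightarrow> nat \<Rightarrow> ('k, 'n) cech_class set" where
  "H1 Y m = Collect (cech_cocycle Y m) // cohomologous Y m"

definition H1_smult ::
  "('k::field, 'n::finite) point set \<Rightarrow> nat \<Rightarrow> int \<Rightarrow> ('k, 'n) cech_class \<Rightarrow> ('k, 'n) cech_class" where
  "H1_smult Y m z a = cohomologous Y m `` ((\<lambda>(cs, g). (cs, \<lambda>P u v. z * g P u v)) ` a)"

definition chart_pullback ::
  "('k::field, 'n::finite) point set \<Rightarrow> (('k, 'n) point \<Rightarrow> ('k, 'n) point) \<Rightarrow> ('k, 'n) chart \<Rightarrow> ('k, 'n) chart"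
  where
  "chart_pullback Y s c =
     \<lparr>base = {P \<in> Y. s P \<in> base c}, eqn = (\<lambda>P. eqn c (s P)), loc = (\<lambda>P. loc c (s P))\<rparr>"

definition H1_pullback ::
  "('k::field, 'n::finite) point set \<Rightarrow> nat \<Rightarrow> (('k, 'n) point \<Rightarrow> ('k, 'n) point)
    \<Rightarrow> ('k, 'n) cech_class \<Rightarrow> ('k, 'n) cech_class" where
  "H1_pullback Y m s a =
     cohomologous Y m `` ((\<lambda>(cs, g). (map (chart_pullback Y s) cs, \<lambda>P. g (s P))) ` a)"

text \<open>\<open>H\<^sup>1(Y, \<int>\<^sub>r)\<close> is the inverse limit of the \<open>H\<^sup>1(Y, \<int>/r\<^sup>n)\<close>; the transition maps are induced by
  reduction of coefficients, which does not change the representing integer-valued function.\<close>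

definition H1_adic ::
  "('k::field, 'n::finite) point set \<Rightarrow> nat \<Rightarrow> (nat \<Rightarrow> ('k, 'n) cech_class) set" where
  "H1_adic Y r = {\<alpha>. \<forall>n. \<alpha> n \<in> H1 Y (r ^ n) \<and> cohomologous Y (r ^ n) `` \<alpha> (Suc n) = \<alpha> n}"

text \<open>\<open>H\<^sup>1(Y, \<rat>\<^sub>r) = H\<^sup>1(Y, \<int>\<^sub>r) \<otimes> \<rat>\<^sub>r\<close> is the localization of \<open>H\<^sup>1(Y, \<int>\<^sub>r)\<close> at the powers of \<open>r\<close>,
  because \<open>\<rat>\<^sub>r = \<int>\<^sub>r[1/r]\<close>; the pair \<open>(\<alpha>, k)\<close> stands for the fraction \<open>\<alpha> / r\<^sup>k\<close>.\<close>

definition H1_frac_rel ::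
  "('k::field, 'n::finite) point set \<Rightarrow> nat \<Rightarrow> ((nat \<Rightarrow> ('k, 'n) cech_class) \<times> nat) rel" where
  "H1_frac_rel Y r = {((\<alpha>, k), (\<beta>, l)). \<alpha> \<in> H1_adic Y r \<and> \<beta> \<in> H1_adic Y r \<and>
     (\<exists>j. \<forall>n. H1_smult Y (r ^ n) (int r ^ (j + l)) (\<alpha> n) = H1_smult Y (r ^ n) (int r ^ (j + k)) (\<beta> n))}"

type_synonym ('k, 'n) rational_class = "((nat \<Rightarrow> ('k, 'n) cech_class) \<times> nat) set"

definition H1_rational ::
  "('k::field, 'n::finite) point set \<Rightarrow> nat \<Rightarrow> ('k, 'n) rational_class set" where
  "H1_rational Y r = (H1_adic Y r \<times> UNIV) // H1_frac_rel Y r"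

definition H1_rational_smult ::
  "('k::field, 'n::finite) point set \<Rightarrow> nat \<Rightarrow> int \<Rightarrow> ('k, 'n) rational_class \<Rightarrow> ('k, 'n) rational_class"
  where
  "H1_rational_smult Y r z \<xi> =
     H1_frac_rel Y r `` ((\<lambda>(\<alpha>, k). (\<lambda>n. H1_smult Y (r ^ n) z (\<alpha> n), k)) ` \<xi>)"

definition H1_rational_pullback ::
  "('k::field, 'n::finite) point set \<Rightarrow> nat \<Rightarrow> (('k, 'n) point \<Rightarrow> ('k, 'n) point)
    \<Rightarrow> ('k, 'n) rational_class \<Rightarrow> ('k, 'n) rational_class" where
  "H1_rational_pullback Y r s \<xi> =
     H1_frac_rel Y r `` ((\<lambda>(\<alpha>, k). (\<lambda>n. H1_pullback Y (r ^ n) s (\<alpha> n), k)) ` \<xi>)"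

end

theory Submission
  imports Defs
begin

text \<open>The sign action. It suffices to show that the reflection \<open>s\<close> exchanging two coordinates acts as
  \<open>-1\<close> on the classes modulo \<open>m = r\<^sup>n\<close>. A cocycle \<open>g\<close>, viewed with values in the \<open>m\<close>-th roots of
  unity, becomes a coboundary over the generic point (Hilbert 90): there is a rational function \<open>h\<close>
  on the covering whose ratios are \<open>\<zeta>\<^sup>g\<close>, and \<open>F = h\<^sup>m\<close> is a rational function on the curve all of
  whose orders are divisible by \<open>m\<close>. The quotient of the curve by \<open>s\<close> is a projective line, with
  coordinate \<open>u = z / x\<^sub>i\<close>, and the norm \<open>F (F \<circ> s)\<close> descends to it; on a line a function with orders
  divisible by \<open>m\<close> is an \<open>m\<close>-th power, say \<open>R\<^sup>m\<close>. Hence \<open>h (h \<circ> s) / R\<close> is a root of unity, and its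
  logarithm, which extends to a locally constant section everywhere, exhibits \<open>g + s\<^sup>* g\<close> as a
  coboundary.

  The point counts. The three embeddings identify \<open>B\<close> with the tuples \<open>a\<close> over the algebraic closure
  satisfying \<open>a \<circ> \<tau> = a\<^sup>q\<close>, trace and norm becoming sum and product. Grouping the tuples by their
  second elementary symmetric function \<open>U\<close>, one counts the ways to number the roots of
  \<open>T\<^sup>3 + U T - \<epsilon>\<close> compatibly with Frobenius. If Frobenius permutes the roots by \<open>f\<close>, this is the
  number of \<open>\<rho>\<close> with \<open>\<rho> \<circ> \<tau> = f \<circ> \<rho>\<close>, which depends only on the signs and the fixed points of \<open>\<tau>\<close>
  and \<open>f\<close>; and \<open>sgn f\<close> is read off from the square roots of the discriminant \<open>-4 U\<^sup>3 - 27 \<epsilon>\<^sup>2\<close>, which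
  are the points of the elliptic curve above \<open>U\<close>.\<close>

hide_const (open) Polynomials.degree Polynomials.lead_coeff up_ring.coeff Coset.order
  up_ring.monom module.smult Divisibility.prime

section \<open>Germs of polynomial functions on a projective curve\<close>

text \<open>Neither a function field nor local rings are constructed. A rational function is a
  pointwise function that agrees with a quotient of forms along \<open>cofin Y\<close>, and it is
  regular at \<open>P\<close> if it does so along \<open>near Y P\<close>. The irreducibility behind
  this is that a form which does not vanish identically on the curve has finitely many zeros. The
  same predicates, with fibre coordinates \<open>t\<close> and \<open>u\<close>, describe functions
  on the coverings. One obstacle is that a cochain is only locally constant, so that \<zeta> to the
  power \<open>g\<close> is a priori an arbitrary function of the point; its rationality comes from
  a linear system for its interpolation coefficients. Another is that \<open>h\<close> has zeros and
  poles, where \<open>h (h \<circ> s) / R\<close> cannot be evaluated. As the covering is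
  unramified, \<open>h\<close> is there a power of a uniformizer of the curve times a unit, and the
  powers cancel. Odd characteristic provides the quotient line, characteristic other than 3 makes
  the finite branch points simple, and invertibility of \<open>r\<close> provides all
  \<open>m\<close>-th roots of unity.\<close>

definition cofin :: "'p set \<Rightarrow> 'p filter" where
  "cofin Y = inf cofinite (principal Y)"

text \<open>On an irreducible curve the Zariski neighbourhoods of \<open>P\<close> are the cofinite sets containing
  \<open>P\<close>.\<close>

definition near :: "'p set \<Rightarrow> 'p \<Rightarrow> 'p filter" where
  "near Y P = sup (cofin Y) (principal {P})"

lemma eventually_cofin: "eventually \<Phi> (cofin Y) \<longleftrightarrow> finite {P\<in>Y. \<not> \<Phi> P}"
proof -
  have "{P\<in>Y. \<not> \<Phi> P} = {x. \<not> (x \<in> Y \<longrightarrow> \<Phi> x)}" by auto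
  then show ?thesis
    by (simp add: cofin_def eventually_inf_principal eventually_cofinite)
qed

lemma eventually_near: "eventually \<Phi> (near Y P) \<longleftrightarrow> eventually \<Phi> (cofin Y) \<and> \<Phi> P"
  by (simp add: near_def eventually_sup eventually_principal)

lemma cofin_le_near: "cofin Y \<le> near Y P"
  by (simp add: near_def)

lemma eventually_cofin_mem: "\<forall>\<^sub>F P in cofin Y. P \<in> Y"
  by (simp add: eventually_cofin)

lemma eventually_near_mem: "P \<in> Y \<Longrightarrow> \<forall>\<^sub>F Q in near Y P. Q \<in> Y"
  by (simp add: eventually_near eventually_cofin_mem)

lemma eventually_cofin_near:
  assumes "eventually \<Phi> (cofin Y)"
  shows "\<forall>\<^sub>F P in cofin Y. eventually \<Phi> (near Y P)"
  using assms by (simp add: eventually_near)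

lemma form_scale:
  assumes "form d f" shows "f (c *s v) = c ^ d * f v"
  using assms unfolding form_def
  by (induction arbitrary: v rule: graded_poly.induct) (auto simp: algebra_simps power_add)

lemma form2_scale:
  assumes "form2 d f" shows "f (c *s v, t, u) = c ^ d * f (v, t, u)"
proof -
  have "f (c *s fst p, snd p) = c ^ d * f p" if "form2 d f" for p
    using that unfolding form2_def
    by (induction arbitrary: p rule: graded_poly.induct)
       (auto simp: algebra_simps power_add split: prod.splits)
  from this[OF assms, of "(v, t, u)"] show ?thesis by simp
qed

lemma form_const: "form 0 (\<lambda>_. c)"
  and form_coord: "form 1 (\<lambda>v. v $ i)"
  and form_add: "form d f \<Longrightarrow> form d g \<Longrightarrow> form d (\<lambda>v. f v + g v)"
  and form_mult: "form d f \<Longrightarrow> form e g \<Longrightarrow> form (d + e) (\<lambda>v. f v * g v)"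
  unfolding form_def
  by (rule graded_poly.intros; (rule rangeI | assumption))+

lemma form_cmult: "form d f \<Longrightarrow> form d (\<lambda>v. c * f v)"
  using form_mult[OF form_const, of d f c] by simp

lemma form_power: "form d f \<Longrightarrow> form (n * d) (\<lambda>v. f v ^ n)"
proof (induction n)
  case 0
  then show ?case using form_const[of 1] by simp
next
  case (Suc n)
  then show ?case using form_mult[of d f "n * d" "\<lambda>v. f v ^ n"] by simp
qed

lemma form2_const: "form2 0 (\<lambda>_. c)"
  and form2_coord: "form2 1 (\<lambda>(v, t, u). v $ i)"
  and form2_fst: "form2 0 (\<lambda>(v, t, u). t)"
  and form2_snd: "form2 0 (\<lambda>(v, t, u). u)"
  and form2_add: "form2 d f \<Longrightarrow> form2 d g \<Longrightarrow> form2 d (\<lambda>p. f p + g p)"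
  and form2_mult: "form2 d f \<Longrightarrow> form2 e g \<Longrightarrow> form2 (d + e) (\<lambda>p. f p * g p)"
  unfolding form2_def
  by (rule graded_poly.intros; (rule rangeI | assumption | simp))+

lemma form2_of_form:
  assumes "form d f" shows "form2 d (\<lambda>(v, t, u). f v)"
proof -
  have "form2 d (\<lambda>p. f (fst p))"
    using assms unfolding form_def
  proof (induction rule: graded_poly.induct)
    case (proj_coord l)
    then obtain i where "l = (\<lambda>v. v $ i)" by auto
    then show ?case using form2_coord[of i] by (simp add: case_prod_unfold)
  qed (auto intro: form2_const form2_add form2_mult)
  then show ?thesis by (simp add: case_prod_unfold)
qed

lemma form_of_form2:
  assumes "form2 d f" shows "form d (\<lambda>v. f (v, t, u))"
  using assms unfolding form2_def
proof (induction rule: graded_poly.induct)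
  case (proj_coord l)
  then obtain i where "l = (\<lambda>(v, t, u). v $ i)" by auto
  then show ?case using form_coord[of i] by simp
qed (auto intro: form_const form_add form_mult)

lemma form2_swap:
  assumes "form2 d f" shows "form2 d (\<lambda>(v, t, u). f (v, u, t))"
proof -
  have "form2 d (\<lambda>p. f (fst p, snd (snd p), fst (snd p)))"
    using assms[unfolded form2_def]
  proof (induction rule: graded_poly.induct)
    case (proj_coord l)
    then obtain i where "l = (\<lambda>(v, t, u). v $ i)" by auto
    then show ?case using form2_coord[of i] by (simp add: case_prod_unfold)
  next
    case (affine_coord a)
    then show ?case using form2_fst form2_snd by (auto simp: case_prod_unfold)
  qed (auto intro: form2_const form2_add form2_mult)
  then show ?thesis by (simp add: case_prod_unfold)
qed

text \<open>For \<open>F = near Y P\<close> this says that \<open>\<Psi>\<close> is regular at \<open>P\<close>, for \<open>F = cofin Y\<close> that it is rational; \<open>t\<close>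
  and \<open>u\<close> are the coordinates on the fibres of two charts.\<close>

definition rg :: "('k::field, 'n::finite) point filter \<Rightarrow> (('k, 'n) point \<Rightarrow> 'k \<Rightarrow> 'k \<Rightarrow> 'k) \<Rightarrow> bool" where
  "rg F \<Psi> \<longleftrightarrow> (\<exists>d f g. form2 d f \<and> form d g \<and>
     (\<forall>\<^sub>F Q in F. \<forall>v\<in>Q. g v \<noteq> 0 \<and> (\<forall>t u. \<Psi> Q t u = f (v, t, u) / g v)))"

abbreviation rf :: "('k::field, 'n::finite) point filter \<Rightarrow> (('k, 'n) point \<Rightarrow> 'k) \<Rightarrow> bool" where
  "rf F \<phi> \<equiv> rg F (\<lambda>Q _ _. \<phi> Q)"

lemma rgI:
  assumes "form2 d f" "form d g"
    "\<forall>\<^sub>F Q in F. \<forall>v\<in>Q. g v \<noteq> 0 \<and> (\<forall>t u. \<Psi> Q t u = f (v, t, u) / g v)"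
  shows "rg F \<Psi>"
  using assms unfolding rg_def by blast

lemma rg_mono: "rg F \<Psi> \<Longrightarrow> F' \<le> F \<Longrightarrow> rg F' \<Psi>"
  unfolding rg_def using filter_leD by blast

lemma rg_cong:
  assumes "rg F \<Psi>" "\<forall>\<^sub>F Q in F. \<forall>t u. \<Psi>' Q t u = \<Psi> Q t u" shows "rg F \<Psi>'"
proof -
  obtain d f g where *: "form2 d f" "form d g"
    "\<forall>\<^sub>F Q in F. \<forall>v\<in>Q. g v \<noteq> 0 \<and> (\<forall>t u. \<Psi> Q t u = f (v, t, u) / g v)"
    using assms(1) unfolding rg_def by blast
  show ?thesis
    by (rule rgI[OF *(1,2)], use *(3) assms(2) in eventually_elim) simp
qed

lemma rg_const: "rg F (\<lambda>_ _ _. c)"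
  by (rule rgI[OF form2_const[of c] form_const[of 1]]) simp

lemma rg_fst: "rg F (\<lambda>_ t _. t)"
  by (rule rgI[OF form2_fst form_const[of 1]]) simp

lemma rg_snd: "rg F (\<lambda>_ _ u. u)"
  by (rule rgI[OF form2_snd form_const[of 1]]) simp

lemma rg_add:
  assumes "rg F \<Psi>" "rg F \<Psi>'" shows "rg F (\<lambda>Q t u. \<Psi> Q t u + \<Psi>' Q t u)"
proof -
  obtain d f g where *: "form2 d f" "form d g"
    "\<forall>\<^sub>F Q in F. \<forall>v\<in>Q. g v \<noteq> 0 \<and> (\<forall>t u. \<Psi> Q t u = f (v, t, u) / g v)"
    using assms(1) unfolding rg_def by blast
  obtain d' f' g' where **: "form2 d' f'" "form d' g'"
    "\<forall>\<^sub>F Q in F. \<forall>v\<in>Q. g' v \<noteq> 0 \<and> (\<forall>t u. \<Psi>' Q t u = f' (v, t, u) / g' v)"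
    using assms(2) unfolding rg_def by blast
  have 1: "form2 (d + d') (\<lambda>p. f p * (\<lambda>(v, t, u). g' v) p)"
    by (intro form2_mult form2_of_form * **)
  have 2: "form2 (d' + d) (\<lambda>p. f' p * (\<lambda>(v, t, u). g v) p)"
    by (intro form2_mult form2_of_form * **)
  show ?thesis
  proof (rule rgI)
    show "form2 (d + d') (\<lambda>p. f p * (\<lambda>(v, t, u). g' v) p + f' p * (\<lambda>(v, t, u). g v) p)"
      using form2_add[OF 1] 2 by (simp add: add.commute)
    show "form (d + d') (\<lambda>v. g v * g' v)" by (intro form_mult * **)
    show "\<forall>\<^sub>F Q in F. \<forall>v\<in>Q. g v * g' v \<noteq> 0 \<and> (\<forall>t u. \<Psi> Q t u + \<Psi>' Q t u =
       (f (v, t, u) * (\<lambda>(v, t, u). g' v) (v, t, u) + f' (v, t, u) * (\<lambda>(v, t, u). g v) (v, t, u)) / (g v * g' v))"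
      using *(3) **(3) by eventually_elim (simp add: add_divide_eq_iff divide_add_eq_iff field_simps)
  qed
qed

lemma rg_mult:
  assumes "rg F \<Psi>" "rg F \<Psi>'" shows "rg F (\<lambda>Q t u. \<Psi> Q t u * \<Psi>' Q t u)"
proof -
  obtain d f g where *: "form2 d f" "form d g"
    "\<forall>\<^sub>F Q in F. \<forall>v\<in>Q. g v \<noteq> 0 \<and> (\<forall>t u. \<Psi> Q t u = f (v, t, u) / g v)"
    using assms(1) unfolding rg_def by blast
  obtain d' f' g' where **: "form2 d' f'" "form d' g'"
    "\<forall>\<^sub>F Q in F. \<forall>v\<in>Q. g' v \<noteq> 0 \<and> (\<forall>t u. \<Psi>' Q t u = f' (v, t, u) / g' v)"
    using assms(2) unfolding rg_def by blast
  show ?thesis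
  proof (rule rgI[OF form2_mult[OF *(1) **(1)] form_mult[OF *(2) **(2)]])
    show "\<forall>\<^sub>F Q in F. \<forall>v\<in>Q. g v * g' v \<noteq> 0 \<and>
       (\<forall>t u. \<Psi> Q t u * \<Psi>' Q t u = f (v, t, u) * f' (v, t, u) / (g v * g' v))"
      using *(3) **(3) by eventually_elim simp
  qed
qed

lemma rg_uminus: "rg F \<Psi> \<Longrightarrow> rg F (\<lambda>Q t u. - \<Psi> Q t u)"
  using rg_mult[OF rg_const[of F "-1"], of \<Psi>] by simp

lemma rg_diff: "rg F \<Psi> \<Longrightarrow> rg F \<Psi>' \<Longrightarrow> rg F (\<lambda>Q t u. \<Psi> Q t u - \<Psi>' Q t u)"
  using rg_add[OF _ rg_uminus, of F \<Psi> \<Psi>'] by simp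

lemma rg_power: "rg F \<Psi> \<Longrightarrow> rg F (\<lambda>Q t u. \<Psi> Q t u ^ n)"
  by (induction n) (auto intro: rg_const rg_mult)

lemma rg_sum: "(\<And>i. i \<in> I \<Longrightarrow> rg F (\<Psi> i)) \<Longrightarrow> rg F (\<lambda>Q t u. \<Sum>i\<in>I. \<Psi> i Q t u)"
  by (induction I rule: infinite_finite_induct) (auto intro: rg_const rg_add)

lemma rg_prod: "(\<And>i. i \<in> I \<Longrightarrow> rg F (\<Psi> i)) \<Longrightarrow> rg F (\<lambda>Q t u. \<Prod>i\<in>I. \<Psi> i Q t u)"
  by (induction I rule: infinite_finite_induct) (auto intro: rg_const rg_mult)

lemma rg_swap:
  assumes "rg F \<Psi>" shows "rg F (\<lambda>Q t u. \<Psi> Q u t)"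
proof -
  obtain d f g where *: "form2 d f" "form d g"
    "\<forall>\<^sub>F Q in F. \<forall>v\<in>Q. g v \<noteq> 0 \<and> (\<forall>t u. \<Psi> Q t u = f (v, t, u) / g v)"
    using assms(1) unfolding rg_def by blast
  show ?thesis
    by (rule rgI[OF form2_swap[OF *(1)] *(2)], use *(3) in eventually_elim) simp
qed

lemma rf_rg:
  assumes "rg F \<Psi>" shows "rf F (\<lambda>Q. \<Psi> Q t u)"
proof -
  obtain d f g where *: "form2 d f" "form d g"
    "\<forall>\<^sub>F Q in F. \<forall>v\<in>Q. g v \<noteq> 0 \<and> (\<forall>t u. \<Psi> Q t u = f (v, t, u) / g v)"
    using assms(1) unfolding rg_def by blast
  show ?thesis
    by (rule rgI[OF form2_of_form[OF form_of_form2[OF *(1), of t u]] *(2)], use *(3) in eventually_elim) simp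
qed

lemma rfE:
  assumes "rf F \<phi>"
  obtains d f g where "form d f" "form d g" "\<forall>\<^sub>F Q in F. \<forall>v\<in>Q. g v \<noteq> 0 \<and> \<phi> Q = f v / g v"
proof -
  obtain d f g where *: "form2 d f" "form d g"
    "\<forall>\<^sub>F Q in F. \<forall>v\<in>Q. g v \<noteq> 0 \<and> (\<forall>t u. \<phi> Q = f (v, t, u) / g v)"
    using assms(1) unfolding rg_def by blast
  from *(3) have "\<forall>\<^sub>F Q in F. \<forall>v\<in>Q. g v \<noteq> 0 \<and> \<phi> Q = f (v, 0, 0) / g v" by eventually_elim blast
  with form_of_form2[OF *(1)] *(2) show ?thesis by (rule that)
qed

lemma rfI:
  assumes "form d f" "form d g" "\<forall>\<^sub>F Q in F. \<forall>v\<in>Q. g v \<noteq> 0 \<and> \<phi> Q = f v / g v"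
  shows "rf F \<phi>"
  by (rule rgI[OF form2_of_form[OF assms(1)] assms(2)], use assms(3) in eventually_elim) simp

lemma rf_inverse:
  assumes "rf F \<phi>" "\<forall>\<^sub>F Q in F. \<phi> Q \<noteq> 0" shows "rf F (\<lambda>Q. inverse (\<phi> Q))"
proof -
  obtain d f g where *: "form d f" "form d g" "\<forall>\<^sub>F Q in F. \<forall>v\<in>Q. g v \<noteq> 0 \<and> \<phi> Q = f v / g v"
    using rfE[OF assms(1)] .
  show ?thesis
  proof (rule rfI[OF *(2,1)])
    show "\<forall>\<^sub>F Q in F. \<forall>v\<in>Q. f v \<noteq> 0 \<and> inverse (\<phi> Q) = g v / f v"
      using *(3) assms(2) by eventually_elim auto
  qed
qed

lemma rg_divide:
  assumes "rg F \<Psi>" "rf F \<phi>" "\<forall>\<^sub>F Q in F. \<phi> Q \<noteq> 0"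
  shows "rg F (\<lambda>Q t u. \<Psi> Q t u / \<phi> Q)"
  using rg_mult[OF assms(1) rf_inverse[OF assms(2,3)]] by (simp add: divide_inverse)

lemma rf_power_int:
  assumes "rf F \<phi>" "\<forall>\<^sub>F Q in F. \<phi> Q \<noteq> 0" shows "rf F (\<lambda>Q. \<phi> Q powi n)"
  by (cases "n \<ge> 0") (auto simp: power_int_def intro!: rg_power rf_inverse assms)

lemma rf_of_poly: "rg F \<Psi> \<Longrightarrow> rg F (\<lambda>Q t u. poly p (\<Psi> Q t u))"
  by (induction p) (auto intro: rg_const rg_add rg_mult)

text \<open>A rational function is regular off a finite set: the quotient of forms that represents
  it generically also represents it at each point where the identity holds.\<close>

lemma rf_cofin_near:
  assumes "rf (cofin Y) \<phi>" shows "\<forall>\<^sub>F P in cofin Y. rf (near Y P) \<phi>"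
proof -
  obtain d f g where *: "form d f" "form d g" "\<forall>\<^sub>F Q in cofin Y. \<forall>v\<in>Q. g v \<noteq> 0 \<and> \<phi> Q = f v / g v"
    using rfE[OF assms(1)] .
  from eventually_cofin_near[OF *(3)] show ?thesis
    by eventually_elim (rule rfI[OF *(1,2)])
qed

section \<open>The curve and its affine charts\<close>

text \<open>Euclid's argument: the product of all X - a, increased by 1, would have positive degree
  and no root.\<close>

lemma infinite_UNIV_alg_closed: "infinite (UNIV :: 'k::alg_closed_field set)"
proof
  assume fin: "finite (UNIV :: 'k set)"
  define p where "p = (\<Prod>a\<in>UNIV. [:-a, 1 :: 'k:]) + 1"
  have "degree (\<Prod>a\<in>UNIV. [:-a, 1 :: 'k:]) = card (UNIV :: 'k set)"
    by (subst degree_prod_eq_sum_degree) auto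
  then have "degree p = card (UNIV :: 'k set)"
    using fin by (simp add: p_def degree_add_eq_left card_gt_0_iff)
  then have "degree p > 0" using fin by (simp add: card_gt_0_iff)
  then obtain x where "poly p x = 0" using alg_closed_imp_poly_has_root by blast
  moreover have "poly p x = 1"
    using fin by (auto simp: p_def poly_prod)
  ultimately show False by simp
qed

lemma UNIV_3_shift: "UNIV = {i, i + 1, i + 2 :: 3}"
  using exhaust_3[of i] unfolding UNIV_3 by auto

lemma shift_3_neq: "i + 1 \<noteq> (i :: 3)" "i + 2 \<noteq> (i :: 3)" "i + 1 \<noteq> (i + 2 :: 3)"
    "(i :: 3) \<noteq> i + 1" "(i :: 3) \<noteq> i + 2" "(i + 2 :: 3) \<noteq> i + 1"
  using exhaust_3[of i] by auto

lemma exhaust_3_shift: "k = i \<or> k = i + 1 \<or> k = (i + 2 :: 3)"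
  using UNIV_3_shift[of i] by auto

lemma sum_3_shift: "(\<Sum>k\<in>UNIV. f k) = f i + f (i + 1) + f (i + 2 :: 3)"
  by (subst UNIV_3_shift[of i]) (use shift_3_neq[of i] in \<open>simp add: ac_simps\<close>)

lemma prod_3_shift: "(\<Prod>k\<in>UNIV. f k) = f i * f (i + 1) * f (i + 2 :: 3)"
  by (subst UNIV_3_shift[of i]) (use shift_3_neq[of i] in \<open>simp add: ac_simps\<close>)

text \<open>Invertibility of 2 recovers two coordinates from their sum and difference; invertibility
  of 3 makes 1 - 4 \<epsilon> u^3 separable, which gives uniformizers at the branch points.\<close>

locale cubic_curve =
  fixes \<epsilon> :: "'k::alg_closed_field"
  assumes eps: "\<epsilon> \<noteq> 0" and two: "(2::'k) \<noteq> 0" and three: "(3::'k) \<noteq> 0"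
begin

abbreviation Y :: "('k, 3 option) point set" where "Y \<equiv> proj_curve \<epsilon>"

text \<open>Where \<open>x\<^sub>i \<noteq> 0\<close> the curve has the affine coordinates \<open>u = z / x\<^sub>i\<close> and
  \<open>y = (x\<^bsub>i+1\<^esub> - x\<^bsub>i+2\<^esub>) / x\<^sub>i\<close> with equation \<open>y\<^sup>2 = 1 - 4 \<epsilon> u\<^sup>3\<close>; exchanging \<open>x\<^bsub>i+1\<^esub>\<close> and \<open>x\<^bsub>i+2\<^esub>\<close>
  maps \<open>y\<close> to \<open>-y\<close>.\<close>

definition cvec :: "3 \<Rightarrow> 'k \<Rightarrow> 'k \<Rightarrow> 'k^(3 option)" where
  "cvec i u y = (\<chi> j. case j of None \<Rightarrow> 2 * u
     | Some k \<Rightarrow> if k = i then 2 else if k = i + 1 then -1 + y else -1 - y)"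

definition cpt :: "3 \<Rightarrow> 'k \<Rightarrow> 'k \<Rightarrow> ('k, 3 option) point" where
  "cpt i u y = {c *s cvec i u y | c. c \<noteq> 0}"

definition rep :: "('k, 3 option) point \<Rightarrow> 'k^(3 option)" where
  "rep P = (SOME v. v \<in> P)"

text \<open>It depends on the chosen representative, so it is meaningful only through its vanishing
  and inside quotients of total degree 0.\<close>

definition xc :: "3 \<Rightarrow> ('k, 3 option) point \<Rightarrow> 'k" where
  "xc i P = rep P $ Some i"

definition uc :: "3 \<Rightarrow> ('k, 3 option) point \<Rightarrow> 'k" where
  "uc i P = rep P $ None / rep P $ Some i"

definition yc :: "3 \<Rightarrow> ('k, 3 option) point \<Rightarrow> 'k" where
  "yc i P = (rep P $ Some (i + 1) - rep P $ Some (i + 2)) / rep P $ Some i"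

lemma cvec_simps [simp]:
  "cvec i u y $ None = 2 * u" "cvec i u y $ Some i = 2"
  "cvec i u y $ Some (i + 1) = -1 + y" "cvec i u y $ Some (i + 2) = -1 - y"
  using shift_3_neq[of i] by (auto simp: cvec_def)

lemma Y_line:
  assumes "P \<in> Y" "v \<in> P"
  shows "v \<noteq> 0" "P = {c *s v | c. c \<noteq> 0}" "(\<Sum>i\<in>UNIV. v $ Some i) = 0"
    "(\<Prod>i\<in>UNIV. v $ Some i) = \<epsilon> * (v $ None) ^ 3"
proof -
  obtain w where w: "w \<noteq> 0" "P = {c *s w | c. c \<noteq> 0}" "(\<Sum>i\<in>UNIV. w $ Some i) = 0"
    "(\<Prod>i\<in>UNIV. w $ Some i) = \<epsilon> * (w $ None) ^ 3"
    using assms(1) unfolding proj_curve_def proj_points_def by blast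
  obtain c where c: "c \<noteq> 0" "v = c *s w" using assms(2) w by auto
  show "v \<noteq> 0" using c w by simp
  show "P = {c *s v | c. c \<noteq> 0}"
  proof (intro equalityI subsetI)
    fix x assume "x \<in> P"
    then obtain b where "b \<noteq> 0" "x = b *s w" using w by auto
    then have "x = (b / c) *s v" "b / c \<noteq> 0" using c by (simp_all add: vector_smult_assoc)
    then show "x \<in> {c *s v | c. c \<noteq> 0}" by blast
  next
    fix x assume "x \<in> {c *s v | c. c \<noteq> 0}"
    then obtain b where "b \<noteq> 0" "x = b *s v" by auto
    then have "x = (b * c) *s w" "b * c \<noteq> 0" using c by (simp_all add: vector_smult_assoc)
    then show "x \<in> P" using w by blast
  qed
  show "(\<Sum>i\<in>UNIV. v $ Some i) = 0" using w c by (simp add: sum_distrib_left[symmetric])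
  show "(\<Prod>i\<in>UNIV. v $ Some i) = \<epsilon> * (v $ None) ^ 3"
    using w c by (simp add: prod.distrib power_mult_distrib)
qed

lemma rep_in: "P \<in> Y \<Longrightarrow> rep P \<in> P"
proof -
  assume "P \<in> Y"
  then obtain w where "P = {c *s w | c. c \<noteq> 0}"
    unfolding proj_curve_def proj_points_def by blast
  then have "1 *s w \<in> P" using one_neq_zero by blast
  then show ?thesis unfolding rep_def by (rule someI)
qed

lemma Y_points: "P \<in> Y \<Longrightarrow> v \<in> P \<Longrightarrow> \<exists>c. c \<noteq> 0 \<and> v = c *s rep P"
  using Y_line(2)[OF _ rep_in, of P] by blast

lemma Y_eqI:
  assumes "P \<in> Y" "Q \<in> Y" "v \<in> P" "v \<in> Q" shows "P = Q"
  using Y_line(2)[OF assms(1,3)] Y_line(2)[OF assms(2,4)] by simp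

lemma cpt_in_Y:
  assumes "y\<^sup>2 = 1 - 4 * \<epsilon> * u ^ 3" shows "cpt i u y \<in> Y"
proof -
  have "cvec i u y \<noteq> 0" using two cvec_simps(2)[of i u y] by (metis zero_index)
  moreover have "(\<Sum>k\<in>UNIV. cvec i u y $ Some k) = 0"
    by (simp add: sum_3_shift[of _ i])
  moreover have "(\<Prod>k\<in>UNIV. cvec i u y $ Some k) = \<epsilon> * (cvec i u y $ None) ^ 3"
  proof -
    have "2 * (-1 + y) * (-1 - y) = 2 * (1 - y\<^sup>2)" by (simp add: algebra_simps power2_eq_square)
    also have "\<dots> = \<epsilon> * (2 * u) ^ 3" using assms by (simp add: power_mult_distrib)
    finally show ?thesis by (simp add: prod_3_shift[of _ i])
  qed
  ultimately show ?thesis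
    unfolding proj_curve_def proj_points_def cpt_def by blast
qed

lemma cvec_in_cpt: "cvec i u y \<in> cpt i u y"
  unfolding cpt_def by (auto intro: exI[of _ 1])

text \<open>With a, b, c the coordinates i, i+1, i+2, the relation b + c = -a turns (b - c)^2 = (b +
  c)^2 - 4bc into the affine equation, and b, c are recovered from their sum and difference.\<close>

lemma chart_coords:
  assumes "P \<in> Y" "v \<in> P" "v $ Some i \<noteq> 0"
  defines "u \<equiv> v $ None / v $ Some i" and "y \<equiv> (v $ Some (i + 1) - v $ Some (i + 2)) / v $ Some i"
  shows "y\<^sup>2 = 1 - 4 * \<epsilon> * u ^ 3" "v = (v $ Some i / 2) *s cvec i u y" "P = cpt i u y"
proof -
  define a b c z where "a = v $ Some i" and "b = v $ Some (i + 1)" and "c = v $ Some (i + 2)"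
    and "z = v $ None"
  note d = a_def[symmetric] b_def[symmetric] c_def[symmetric] z_def[symmetric]
  have s: "a + b + c = 0" using Y_line(3)[OF assms(1,2)] by (simp add: sum_3_shift[of _ i] d)
  have p: "a * b * c = \<epsilon> * z ^ 3" using Y_line(4)[OF assms(1,2)] by (simp add: prod_3_shift[of _ i] d)
  have a: "a \<noteq> 0" using assms(3) by (simp add: d)
  have u: "u = z / a" and y: "y = (b - c) / a" by (simp_all add: u_def y_def d)
  have "a * (b - c)\<^sup>2 = a * (b + c)\<^sup>2 - 4 * (a * b * c)" by (simp add: power2_eq_square algebra_simps)
  also have "b + c = - a" using s by (simp add: algebra_simps eq_neg_iff_add_eq_0)
  finally have "a * (b - c)\<^sup>2 = a ^ 3 - 4 * \<epsilon> * z ^ 3"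
    unfolding p by (simp add: power2_eq_square power3_eq_cube)
  moreover have "y\<^sup>2 = a * (b - c)\<^sup>2 / a ^ 3" "1 - 4 * \<epsilon> * u ^ 3 = (a ^ 3 - 4 * \<epsilon> * z ^ 3) / a ^ 3"
    unfolding u y using a
    by (simp add: power_divide power2_eq_square power3_eq_cube)
      (simp add: a power_divide diff_divide_distrib)
  ultimately show 1: "y\<^sup>2 = 1 - 4 * \<epsilon> * u ^ 3" by simp
  have b: "b = a / 2 * (-1 + y)" and c: "c = a / 2 * (-1 - y)"
  proof -
    have "2 * b = - a + (b - c)" "2 * c = - a - (b - c)"
      using s by (simp_all add: eq_neg_iff_add_eq_0 algebra_simps)
    moreover have "b - c = a * y" using a by (simp add: y)
    ultimately have "2 * b = a * (-1 + y)" "2 * c = a * (-1 - y)" by (simp_all add: algebra_simps)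
    then show "b = a / 2 * (-1 + y)" "c = a / 2 * (-1 - y)" using two by (simp_all add: field_simps)
  qed
  have "v $ j = ((v $ Some i / 2) *s cvec i u y) $ j" for j
  proof (cases j)
    case None
    then show ?thesis using a two by (simp add: u d)
  next
    case (Some k)
    then show ?thesis using exhaust_3_shift[of k i] b c a two by (auto simp: d)
  qed
  then show 2: "v = (v $ Some i / 2) *s cvec i u y" unfolding vec_eq_iff by blast
  have "v \<in> cpt i u y" unfolding cpt_def using 2 assms(3) two
    by (intro CollectI exI[of _ "v $ Some i / 2"]) simp
  then show "P = cpt i u y" using Y_eqI[OF assms(1) cpt_in_Y[OF 1] assms(2)] by blast
qed

lemma xc_nonzero_iff: "P \<in> Y \<Longrightarrow> v \<in> P \<Longrightarrow> v $ Some i \<noteq> 0 \<longleftrightarrow> xc i P \<noteq> 0"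
  unfolding xc_def using Y_points[of P v] by auto

lemma uc_eq: "P \<in> Y \<Longrightarrow> v \<in> P \<Longrightarrow> uc i P = v $ None / v $ Some i"
  unfolding uc_def using Y_points[of P v] by auto

lemma yc_eq:
  assumes "P \<in> Y" "v \<in> P" shows "yc i P = (v $ Some (i + 1) - v $ Some (i + 2)) / v $ Some i"
proof -
  obtain c where "c \<noteq> 0" "v = c *s rep P" using Y_points[OF assms] by blast
  then show ?thesis unfolding yc_def
    by (simp add: right_diff_distrib[symmetric])
qed

lemma chart_point:
  assumes "P \<in> Y" "xc i P \<noteq> 0"
  shows "(yc i P)\<^sup>2 = 1 - 4 * \<epsilon> * uc i P ^ 3" "P = cpt i (uc i P) (yc i P)"
  using chart_coords[OF assms(1) rep_in[OF assms(1)]] assms(2) by (simp_all add: uc_def yc_def xc_def)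

lemma cpt_coords:
  assumes "y\<^sup>2 = 1 - 4 * \<epsilon> * u ^ 3"
  shows "xc i (cpt i u y) \<noteq> 0" "uc i (cpt i u y) = u" "yc i (cpt i u y) = y"
  using xc_nonzero_iff[OF cpt_in_Y[OF assms] cvec_in_cpt, of i i] two
    uc_eq[OF cpt_in_Y[OF assms] cvec_in_cpt, of i i] yc_eq[OF cpt_in_Y[OF assms] cvec_in_cpt, of i i]
  by simp_all

lemma ex_chart:
  assumes "P \<in> Y" obtains i where "xc i P \<noteq> 0"
proof -
  let ?v = "rep P"
  note Y = Y_line[OF assms rep_in[OF assms]]
  have "\<exists>i. ?v $ Some i \<noteq> 0"
  proof (rule ccontr)
    assume *: "\<nexists>i. ?v $ Some i \<noteq> 0"
    then have "?v $ None = 0" using Y(4) eps by simp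
    with * have "?v $ j = 0" for j by (cases j) auto
    with Y(1) show False by (simp add: vec_eq_iff)
  qed
  then show ?thesis using that by (auto simp: xc_def)
qed

text \<open>The square of y as a polynomial in u: the affine curve is the double cover y^2 =
  \<open>Dpol\<close> of the u-line.\<close>

definition Dpol :: "'k poly" where "Dpol = [:1, 0, 0, - 4 * \<epsilon>:]"

lemma poly_Dpol: "poly Dpol u = 1 - 4 * \<epsilon> * u ^ 3"
  by (simp add: Dpol_def power3_eq_cube algebra_simps)

lemma four: "(4::'k) \<noteq> 0"
  using two by (metis mult_2_right mult_eq_0_iff numeral_Bit0 one_add_one)

lemma degree_Dpol: "degree Dpol = 3"
  using eps four by (simp add: Dpol_def)

text \<open>The expression is the norm of a + b y down to the u-line. It cannot vanish because a^2
  has even degree, while b^2 \<open>Dpol\<close> has odd degree.\<close>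

lemma norm_nonzero:
  assumes "a \<noteq> 0 \<or> b \<noteq> 0" shows "a\<^sup>2 - b\<^sup>2 * Dpol \<noteq> 0"
proof
  assume 0: "a\<^sup>2 - b\<^sup>2 * Dpol = 0"
  then have eq: "a\<^sup>2 = b\<^sup>2 * Dpol" by simp
  have D: "Dpol \<noteq> 0" using degree_Dpol by auto
  from eq assms D have "a \<noteq> 0" "b \<noteq> 0" by auto
  then have "2 * degree a = 2 * degree b + 3"
    using arg_cong[OF eq, of degree] D by (simp add: degree_power_eq degree_mult_eq degree_Dpol)
  then show False by presburger
qed

text \<open>Every power of y beyond the first is removed by y^2 = \<open>Dpol\<close>, so the
  coordinate ring of the chart is free over the polynomials in u with basis 1, y.\<close>

lemma form_on_chart:
  assumes "form d f"
  obtains a b where "\<And>u y. y\<^sup>2 = 1 - 4 * \<epsilon> * u ^ 3 \<Longrightarrow> f (cvec i u y) = poly a u + poly b u * y"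
proof -
  have "\<exists>a b. \<forall>u y. y\<^sup>2 = 1 - 4 * \<epsilon> * u ^ 3 \<longrightarrow> f (cvec i u y) = poly a u + poly b u * y"
    using assms unfolding form_def
  proof (induction rule: graded_poly.induct)
    case (const c)
    show ?case by (rule exI[of _ "[:c:]"], rule exI[of _ 0]) simp
  next
    case (proj_coord l)
    then obtain j where l: "l = (\<lambda>v. v $ j)" by auto
    show ?case
    proof (cases j)
      case None
      then show ?thesis unfolding l by (intro exI[of _ "[:0, 2:]"] exI[of _ 0]) simp
    next
      case (Some k)
      consider "k = i" | "k = i + 1" | "k = i + 2" using exhaust_3_shift[of k i] by blast
      then show ?thesis unfolding l Some
        by cases (intro exI[of _ "[:2:]"] exI[of _ 0], simp,
          intro exI[of _ "[:-1:]"] exI[of _ 1], simp, intro exI[of _ "[:-1:]"] exI[of _ "[:-1:]"], simp)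
    qed
  next
    case (affine_coord a)
    then show ?case by simp
  next
    case (add d f g)
    then obtain a b a' b' where
      *: "\<forall>u y. y\<^sup>2 = 1 - 4 * \<epsilon> * u ^ 3 \<longrightarrow> f (cvec i u y) = poly a u + poly b u * y"
        "\<forall>u y. y\<^sup>2 = 1 - 4 * \<epsilon> * u ^ 3 \<longrightarrow> g (cvec i u y) = poly a' u + poly b' u * y" by blast
    show ?case
      by (rule exI[of _ "a + a'"], rule exI[of _ "b + b'"]) (use * in \<open>auto simp: algebra_simps\<close>)
  next
    case (mult d f e g)
    then obtain a b a' b' where
      *: "\<forall>u y. y\<^sup>2 = 1 - 4 * \<epsilon> * u ^ 3 \<longrightarrow> f (cvec i u y) = poly a u + poly b u * y"
        "\<forall>u y. y\<^sup>2 = 1 - 4 * \<epsilon> * u ^ 3 \<longrightarrow> g (cvec i u y) = poly a' u + poly b' u * y" by blast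
    show ?case
    proof (rule exI[of _ "a * a' + b * b' * Dpol"], rule exI[of _ "a * b' + a' * b"], intro allI impI)
      fix u y assume y: "y\<^sup>2 = 1 - 4 * \<epsilon> * u ^ 3"
      have "(poly a u + poly b u * y) * (poly a' u + poly b' u * y) =
        poly a u * poly a' u + poly b u * poly b' u * y\<^sup>2 + (poly a u * poly b' u + poly a' u * poly b u) * y"
        by (simp add: algebra_simps power2_eq_square)
      then show "f (cvec i u y) * g (cvec i u y) =
        poly (a * a' + b * b' * Dpol) u + poly (a * b' + a' * b) u * y"
        using * y by (simp add: poly_Dpol)
    qed
  qed
  then show ?thesis using that by blast
qed

text \<open>At most one point is missed: x_i = 0 forces z = 0 and makes the other two coordinates
  opposite, which determines the line.\<close>

lemma finite_off_chart: "finite {P\<in>Y. xc i P = 0}"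
proof -
  have "P = Q" if PQ: "P \<in> Y" "xc i P = 0" "Q \<in> Y" "xc i Q = 0" for P Q
  proof -
    have *: "rep P $ None = 0 \<and> rep P $ Some (i+2) = - rep P $ Some (i+1) \<and> rep P $ Some (i+1) \<noteq> 0"
      if "P \<in> Y" "xc i P = 0" for P
    proof -
      note Y = Y_line[OF that(1) rep_in[OF that(1)]]
      have x: "rep P $ Some i = 0" using that(2) by (simp add: xc_def)
      then have 1: "rep P $ None = 0" using Y(4) eps by (simp add: prod_3_shift[of _ i])
      have 2: "rep P $ Some (i+2) = - rep P $ Some (i+1)"
        using Y(3) x by (simp add: sum_3_shift[of _ i] eq_neg_iff_add_eq_0 add.commute)
      have "rep P $ Some (i+1) \<noteq> 0"
      proof
        assume 0: "rep P $ Some (i+1) = 0"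
        have "rep P $ j = 0" for j
        proof (cases j)
          case (Some k)
          then show ?thesis using exhaust_3_shift[of k i] 0 2 x by auto
        qed (simp add: 1)
        with Y(1) show False by (simp add: vec_eq_iff)
      qed
      with 1 2 show ?thesis by blast
    qed
    note p = *[OF PQ(1,2)] and q = *[OF PQ(3,4)]
    let ?c = "rep P $ Some (i+1) / rep Q $ Some (i+1)"
    have "rep P $ j = (?c *s rep Q) $ j" for j
    proof (cases j)
      case None
      then show ?thesis using p q by simp
    next
      case (Some k)
      then show ?thesis using exhaust_3_shift[of k i] p q PQ(2,4) by (auto simp: xc_def)
    qed
    then have "rep P = ?c *s rep Q" unfolding vec_eq_iff by blast
    moreover have "?c \<noteq> 0" using p q by simp
    ultimately have "rep P \<in> Q" using Y_line(2)[OF PQ(3) rep_in[OF PQ(3)]] by blast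
    with Y_eqI[OF PQ(1,3) rep_in[OF PQ(1)]] show ?thesis by blast
  qed
  then have *: "{P\<in>Y. xc i P = 0} \<subseteq> {P}" if "P \<in> {P\<in>Y. xc i P = 0}" for P
    using that by blast
  show ?thesis
  proof (cases "{P\<in>Y. xc i P = 0} = {}")
    case False
    then obtain P where "P \<in> {P\<in>Y. xc i P = 0}" by blast
    from finite_subset[OF *[OF this]] show ?thesis by simp
  qed (simp only: finite.emptyI)
qed

lemma eventually_chart: "\<forall>\<^sub>F P in cofin Y. xc i P \<noteq> 0"
  using finite_off_chart[of i] by (simp add: eventually_cofin)

lemma finite_u_fibre:
  assumes "finite U" shows "finite {P\<in>Y. xc i P \<noteq> 0 \<and> uc i P \<in> U}"
proof -
  have "{P\<in>Y. xc i P \<noteq> 0 \<and> uc i P \<in> U} \<subseteq> (\<lambda>(u, y). cpt i u y) ` (SIGMA u:U. {y. y\<^sup>2 = 1 - 4 * \<epsilon> * u ^ 3})"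
    (is "_ \<subseteq> ?f ` ?S")
  proof
    fix P assume P: "P \<in> {P\<in>Y. xc i P \<noteq> 0 \<and> uc i P \<in> U}"
    then have "P = ?f (uc i P, yc i P)" "(uc i P, yc i P) \<in> ?S" using chart_point[of P i] by auto
    then show "P \<in> ?f ` ?S" by blast
  qed
  moreover have "finite {y. y\<^sup>2 = c}" for c :: 'k
  proof -
    have "{y. y\<^sup>2 = c} = {y. poly [:-c, 0, 1:] y = 0}" by (auto simp: power2_eq_square)
    then show ?thesis using poly_roots_finite[of "[:-c, 0, 1:]"] by simp
  qed
  ultimately show ?thesis using assms by (meson finite_SigmaI finite_imageI finite_subset)
qed

text \<open>This is the irreducibility of the curve in the form used everywhere. On a chart the form
  is a + b y with nonzero norm, its zeros lie above the roots of the norm, and only finitely many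
  points lie above each u or outside the chart.\<close>

lemma form_finite_zeros:
  assumes f: "form d f" and P: "P \<in> Y" "v \<in> P" "f v \<noteq> 0"
  shows "\<forall>\<^sub>F Q in cofin Y. \<forall>v\<in>Q. f v \<noteq> 0"
proof -
  obtain i where i: "xc i P \<noteq> 0" using ex_chart[OF P(1)] .
  obtain a b where ab: "\<And>u y. y\<^sup>2 = 1 - 4 * \<epsilon> * u ^ 3 \<Longrightarrow> f (cvec i u y) = poly a u + poly b u * y"
    using form_on_chart[OF f] by blast
  have scale: "f v \<noteq> 0 \<longleftrightarrow> poly a (uc i Q) + poly b (uc i Q) * yc i Q \<noteq> 0"
    if "Q \<in> Y" "xc i Q \<noteq> 0" "v \<in> Q" for Q v
  proof -
    note q = chart_coords[OF that(1,3), of i, folded uc_eq[OF that(1,3)] yc_eq[OF that(1,3)]]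
    have v: "v $ Some i \<noteq> 0" using xc_nonzero_iff[OF that(1,3)] that(2) by simp
    have "f v = (v $ Some i / 2) ^ d * f (cvec i (uc i Q) (yc i Q))"
      using q(2)[OF v] form_scale[OF f] by metis
    then show ?thesis using ab[OF q(1)[OF v]] v two by simp
  qed
  have "a \<noteq> 0 \<or> b \<noteq> 0" using scale[OF P(1) i P(2)] P(3) by auto
  then have N: "a\<^sup>2 - b\<^sup>2 * Dpol \<noteq> 0" by (rule norm_nonzero)
  have "{Q\<in>Y. \<not> (\<forall>v\<in>Q. f v \<noteq> 0)} \<subseteq> {P\<in>Y. xc i P = 0} \<union>
     {P\<in>Y. xc i P \<noteq> 0 \<and> uc i P \<in> {u. poly (a\<^sup>2 - b\<^sup>2 * Dpol) u = 0}}"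
  proof
    fix Q assume Q: "Q \<in> {Q\<in>Y. \<not> (\<forall>v\<in>Q. f v \<noteq> 0)}"
    show "Q \<in> {P\<in>Y. xc i P = 0} \<union> {P\<in>Y. xc i P \<noteq> 0 \<and> uc i P \<in> {u. poly (a\<^sup>2 - b\<^sup>2 * Dpol) u = 0}}"
    proof (cases "xc i Q = 0")
      case False
      with Q scale have "poly a (uc i Q) + poly b (uc i Q) * yc i Q = 0" by blast
      then have "(poly a (uc i Q))\<^sup>2 = (poly b (uc i Q))\<^sup>2 * (yc i Q)\<^sup>2"
        by (metis add_eq_0_iff power2_minus power_mult_distrib)
      then show ?thesis using Q False chart_point(1)[of Q i] by (simp add: poly_Dpol)
    qed (use Q in simp)
  qed
  moreover have "finite {u. poly (a\<^sup>2 - b\<^sup>2 * Dpol) u = 0}" using N poly_roots_finite by blast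
  ultimately show ?thesis unfolding eventually_cofin
    using finite_off_chart finite_u_fibre by (meson finite_UnI finite_subset)
qed

lemma infinite_Y: "infinite Y"
proof
  assume "finite Y"
  then have "finite (uc 1 ` Y)" by simp
  moreover have "u \<in> uc 1 ` Y" for u
  proof -
    obtain y where "y\<^sup>2 = 1 - 4 * \<epsilon> * u ^ 3" using nth_root_exists[of 2 "1 - 4 * \<epsilon> * u ^ 3"] by auto
    from cpt_coords(2)[OF this, of 1] cpt_in_Y[OF this, of 1] show ?thesis by (metis image_eqI)
  qed
  ultimately show False using infinite_UNIV_alg_closed by (metis finite_subset subsetI)
qed

lemma cofin_neq_bot: "cofin Y \<noteq> bot"
  using infinite_Y by (simp add: trivial_limit_def eventually_cofin)

lemma eventually_cofin_const [simp]: "(\<forall>\<^sub>F Q in cofin Y. c) \<longleftrightarrow> c"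
  using cofin_neq_bot by (simp add: eventually_const_iff)

lemma eventually_cofin_ex: "eventually \<Phi> (cofin Y) \<Longrightarrow> \<exists>P\<in>Y. \<Phi> P"
  using eventually_happens[OF eventually_conj[OF eventually_cofin_mem, of \<Phi> Y]] cofin_neq_bot by auto

text \<open>The numerator of a representing quotient does not vanish at \<open>P\<close>, hence
  almost nowhere.\<close>

lemma rf_near_nonzero:
  assumes "P \<in> Y" "rf (near Y P) \<phi>" "\<phi> P \<noteq> 0"
  shows "\<forall>\<^sub>F Q in near Y P. \<phi> Q \<noteq> 0"
proof -
  obtain d f g where *: "form d f" "form d g" "\<forall>\<^sub>F Q in near Y P. \<forall>v\<in>Q. g v \<noteq> 0 \<and> \<phi> Q = f v / g v"
    using rfE[OF assms(2)] .
  have "f (rep P) \<noteq> 0" using *(3) rep_in[OF assms(1)] assms(3) by (auto simp: eventually_near)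
  from form_finite_zeros[OF *(1) assms(1) rep_in[OF assms(1)] this]
  have "\<forall>\<^sub>F Q in cofin Y. \<phi> Q \<noteq> 0"
    using *(3)[unfolded eventually_near, THEN conjunct1] eventually_cofin_mem
    by eventually_elim (metis divide_eq_0_iff rep_in)
  then show ?thesis using assms(3) by (simp add: eventually_near)
qed

text \<open>Generic identities extend to points of regularity: a nonzero value at \<open>P\<close>
  would persist generically, and the filter \<open>cofin Y\<close> is proper.\<close>

lemma rf_near_zero:
  assumes "P \<in> Y" "rf (near Y P) \<phi>" "\<forall>\<^sub>F Q in cofin Y. \<phi> Q = 0" shows "\<phi> P = 0"
proof (rule ccontr)
  assume "\<phi> P \<noteq> 0"
  from rf_near_nonzero[OF assms(1,2) this] have "\<forall>\<^sub>F Q in cofin Y. \<phi> Q \<noteq> 0" by (simp add: eventually_near)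
  with assms(3) have "\<forall>\<^sub>F Q in cofin Y. False" by eventually_elim simp
  then show False by simp
qed

lemma rf_near_eq:
  assumes "P \<in> Y" "rf (near Y P) \<phi>" "rf (near Y P) \<psi>" "\<forall>\<^sub>F Q in cofin Y. \<phi> Q = \<psi> Q" shows "\<phi> P = \<psi> P"
  using rf_near_zero[OF assms(1) rg_diff[OF assms(2,3)]] assms(4) by simp

lemma rf_cofin_dichotomy:
  assumes "rf (cofin Y) \<phi>"
  shows "(\<forall>\<^sub>F Q in cofin Y. \<phi> Q = 0) \<or> (\<forall>\<^sub>F Q in cofin Y. \<phi> Q \<noteq> 0)"
proof (rule disjCI)
  assume *: "\<not> (\<forall>\<^sub>F Q in cofin Y. \<phi> Q \<noteq> 0)"
  obtain d f g where fg: "form d f" "form d g" "\<forall>\<^sub>F Q in cofin Y. \<forall>v\<in>Q. g v \<noteq> 0 \<and> \<phi> Q = f v / g v"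
    using rfE[OF assms] .
  have "f v = 0" if "P \<in> Y" "v \<in> P" for P v
  proof (rule ccontr)
    assume "f v \<noteq> 0"
    from form_finite_zeros[OF fg(1) that this]
    have "\<forall>\<^sub>F Q in cofin Y. \<phi> Q \<noteq> 0" using fg(3) eventually_cofin_mem
      by eventually_elim (metis divide_eq_0_iff rep_in)
    with * show False by contradiction
  qed
  note * = this
  show "\<forall>\<^sub>F Q in cofin Y. \<phi> Q = 0" using fg(3) eventually_cofin_mem
  proof eventually_elim
    case (elim Q)
    then show ?case using *[OF elim(2) rep_in[OF elim(2)]] rep_in[OF elim(2)] by auto
  qed
qed

end

section \<open>Uniformizers\<close>

context cubic_curve begin

lemma near_chart:
  assumes "P \<in> Y" "xc i P \<noteq> 0" shows "\<forall>\<^sub>F Q in near Y P. Q \<in> Y \<and> xc i Q \<noteq> 0"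
  using eventually_conj[OF eventually_cofin_mem eventually_chart[of i]] assms by (simp add: eventually_near)

lemma rf_uc:
  assumes "\<forall>\<^sub>F Q in F. Q \<in> Y \<and> xc i Q \<noteq> 0" shows "rf F (uc i)"
  by (rule rfI[OF form_coord[of None] form_coord[of "Some i"]], use assms in eventually_elim)
     (metis uc_eq xc_nonzero_iff)

lemma rf_yc:
  assumes "\<forall>\<^sub>F Q in F. Q \<in> Y \<and> xc i Q \<noteq> 0" shows "rf F (yc i)"
proof (rule rfI[OF _ form_coord[of "Some i"]])
  show "form 1 (\<lambda>v. v $ Some (i + 1) + (-1) * v $ Some (i + 2))"
    by (intro form_add form_cmult form_coord)
  show "\<forall>\<^sub>F Q in F. \<forall>v\<in>Q. v $ Some i \<noteq> 0 \<and> yc i Q = (v $ Some (i + 1) + (-1) * v $ Some (i + 2)) / v $ Some i"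
    using assms by eventually_elim (auto simp: yc_eq dest: xc_nonzero_iff[of _ _ i])
qed

lemma rf_chart:
  assumes F: "\<forall>\<^sub>F Q in F. Q \<in> Y \<and> xc i Q \<noteq> 0" and "rf F \<phi>"
  obtains a b a' b' where
    "\<forall>\<^sub>F Q in F. poly a' (uc i Q) + poly b' (uc i Q) * yc i Q \<noteq> 0 \<and>
       \<phi> Q = (poly a (uc i Q) + poly b (uc i Q) * yc i Q) / (poly a' (uc i Q) + poly b' (uc i Q) * yc i Q)"
proof -
  obtain d f g where fg: "form d f" "form d g" "\<forall>\<^sub>F Q in F. \<forall>v\<in>Q. g v \<noteq> 0 \<and> \<phi> Q = f v / g v"
    using rfE[OF assms(2)] .
  obtain a b where ab: "\<And>u y. y\<^sup>2 = 1 - 4 * \<epsilon> * u ^ 3 \<Longrightarrow> f (cvec i u y) = poly a u + poly b u * y"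
    using form_on_chart[OF fg(1)] by blast
  obtain a' b' where ab': "\<And>u y. y\<^sup>2 = 1 - 4 * \<epsilon> * u ^ 3 \<Longrightarrow> g (cvec i u y) = poly a' u + poly b' u * y"
    using form_on_chart[OF fg(2)] by blast
  have "\<forall>\<^sub>F Q in F. poly a' (uc i Q) + poly b' (uc i Q) * yc i Q \<noteq> 0 \<and>
       \<phi> Q = (poly a (uc i Q) + poly b (uc i Q) * yc i Q) / (poly a' (uc i Q) + poly b' (uc i Q) * yc i Q)"
    using fg(3) F
  proof eventually_elim
    case (elim Q)
    note q = chart_point[of Q i]
    have "cvec i (uc i Q) (yc i Q) \<in> Q" using q(2) elim cvec_in_cpt by metis
    with elim ab[OF q(1)] ab'[OF q(1)] show ?case by auto
  qed
  then show ?thesis using that by blast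
qed

text \<open>A uniformizer expressed without a local ring: every germ vanishing at \<open>P\<close>
  is a multiple of \<pi>, and every regular germ that is generically nonzero is a power of \<pi>
  times a unit. The factorizations hold along \<open>near Y P\<close>, hence at \<open>P\<close>
  itself as well.\<close>

definition unif :: "('k, 3 option) point \<Rightarrow> (('k, 3 option) point \<Rightarrow> 'k) \<Rightarrow> bool" where
  "unif P \<pi> \<longleftrightarrow> rf (near Y P) \<pi> \<and> \<pi> P = 0 \<and> (\<forall>\<^sub>F Q in cofin Y. \<pi> Q \<noteq> 0) \<and>
     (\<forall>\<phi>. rf (near Y P) \<phi> \<and> \<phi> P = 0 \<longrightarrow> (\<exists>\<psi>. rf (near Y P) \<psi> \<and> (\<forall>\<^sub>F Q in near Y P. \<phi> Q = \<pi> Q * \<psi> Q))) \<and>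
     (\<forall>\<phi>. rf (near Y P) \<phi> \<and> (\<forall>\<^sub>F Q in cofin Y. \<phi> Q \<noteq> 0) \<longrightarrow>
        (\<exists>n \<psi>. rf (near Y P) \<psi> \<and> \<psi> P \<noteq> 0 \<and> (\<forall>\<^sub>F Q in near Y P. \<phi> Q = \<pi> Q ^ n * \<psi> Q)))"

text \<open>Division by \<pi> has to stop. A multiple of \<phi> equals \<pi>^k times a unit, each
  division lowers k by one, and at k = 0 the germ is itself a unit.\<close>

lemma finite_order:
  assumes P: "P \<in> Y" and \<pi>: "rf (near Y P) \<pi>" "\<forall>\<^sub>F Q in cofin Y. \<pi> Q \<noteq> 0"
    and div: "\<And>\<phi>. rf (near Y P) \<phi> \<Longrightarrow> \<phi> P = 0 \<Longrightarrow>
      \<exists>\<psi>. rf (near Y P) \<psi> \<and> (\<forall>\<^sub>F Q in near Y P. \<phi> Q = \<pi> Q * \<psi> Q)"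
  shows "rf (near Y P) \<phi> \<Longrightarrow> rf (near Y P) \<theta> \<Longrightarrow> rf (near Y P) \<eta> \<Longrightarrow> \<eta> P \<noteq> 0 \<Longrightarrow>
    \<forall>\<^sub>F Q in cofin Y. \<phi> Q * \<theta> Q = \<pi> Q ^ k * \<eta> Q \<Longrightarrow>
    \<exists>n \<psi>. rf (near Y P) \<psi> \<and> \<psi> P \<noteq> 0 \<and> (\<forall>\<^sub>F Q in near Y P. \<phi> Q = \<pi> Q ^ n * \<psi> Q)"
proof (induction k arbitrary: \<phi>)
  case (0 \<phi>)
  have "\<phi> P * \<theta> P = \<eta> P"
    by (rule rf_near_eq[OF P rg_mult[OF 0(1,2)] 0(3)]) (use 0(5) in simp)
  then have "\<phi> P \<noteq> 0" using 0(4) by auto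
  then show ?case using 0(1) by (intro exI[of _ 0] exI[of _ \<phi>]) simp
next
  case (Suc k \<phi>)
  show ?case
  proof (cases "\<phi> P = 0")
    case False
    then show ?thesis using Suc.prems(1) by (intro exI[of _ 0] exI[of _ \<phi>]) simp
  next
    case True
    obtain \<psi> where \<psi>: "rf (near Y P) \<psi>" "\<forall>\<^sub>F Q in near Y P. \<phi> Q = \<pi> Q * \<psi> Q"
      using div[OF Suc.prems(1) True] by blast
    have "\<forall>\<^sub>F Q in cofin Y. \<psi> Q * \<theta> Q = \<pi> Q ^ k * \<eta> Q"
      using Suc.prems(5) \<psi>(2)[unfolded eventually_near, THEN conjunct1] \<pi>(2)
      by eventually_elim simp
    from Suc.IH[OF \<psi>(1) Suc.prems(2-4) this] obtain n \<psi>' where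
      "rf (near Y P) \<psi>'" "\<psi>' P \<noteq> 0" "\<forall>\<^sub>F Q in near Y P. \<psi> Q = \<pi> Q ^ n * \<psi>' Q" by blast
    moreover from this(3) \<psi>(2) have "\<forall>\<^sub>F Q in near Y P. \<phi> Q = \<pi> Q ^ Suc n * \<psi>' Q"
      by eventually_elim simp
    ultimately show ?thesis by blast
  qed
qed

lemma Dpol_factor:
  "poly Dpol u - poly Dpol u0 = (u - u0) * poly (Polynomial.smult (- 4 * \<epsilon>) [:u0\<^sup>2, u0, 1:]) u"
  unfolding poly_Dpol by (simp add: algebra_simps power2_eq_square power3_eq_cube)

text \<open>Away from the branch points u - u0 is a uniformizer, since y - y0 = (u - u0) D1 / (y +
  y0). At a branch point y is one, since u - u0 = y^2 / D1. Here D1 is the difference quotient of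
  \<open>Dpol\<close>; its value at u0 is the derivative there, nonzero at a branch point because
  the roots of \<open>Dpol\<close> are simple.\<close>

lemma unif_chart:
  assumes P: "P \<in> Y" "xc i P \<noteq> 0"
  shows "unif P (if yc i P = 0 then yc i else (\<lambda>Q. uc i Q - uc i P))"
proof -
  define u0 y0 where "u0 = uc i P" and "y0 = yc i P"
  define \<pi> where "\<pi> = (if y0 = 0 then yc i else (\<lambda>Q. uc i Q - u0))"
  define D1 where "D1 = Polynomial.smult (- 4 * \<epsilon>) [:u0\<^sup>2, u0, 1:]"
  let ?N = "near Y P"
  note near = near_chart[OF P]
  note rf_u = rf_uc[OF near] and rf_y = rf_yc[OF near]
  have curve: "y0\<^sup>2 = poly Dpol u0" using chart_point(1)[OF P] by (simp add: poly_Dpol u0_def y0_def)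
  have D1: "(yc i Q)\<^sup>2 - y0\<^sup>2 = (uc i Q - u0) * poly D1 (uc i Q)" if "Q \<in> Y" "xc i Q \<noteq> 0" for Q
    using chart_point(1)[OF that] Dpol_factor[of "uc i Q" u0] curve by (simp add: poly_Dpol D1_def)
  have D10: "poly D1 u0 \<noteq> 0" if "y0 = 0"
  proof -
    have "u0 \<noteq> 0" using curve that by (auto simp: poly_Dpol)
    moreover have "poly D1 u0 = - 4 * \<epsilon> * (3 * u0\<^sup>2)" by (simp add: D1_def power2_eq_square algebra_simps)
    moreover have "(12::'k) \<noteq> 0" using three four mult_eq_0_iff[of "3::'k" 4] by simp
    ultimately show ?thesis using eps by simp
  qed
  have rD1: "rf ?N (\<lambda>Q. poly D1 (uc i Q))" by (rule rf_of_poly[OF rf_u])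
  have D1near: "\<forall>\<^sub>F Q in ?N. poly D1 (uc i Q) \<noteq> 0" if "y0 = 0"
    by (rule rf_near_nonzero[OF P(1) rD1]) (use D10[OF that] in \<open>simp add: u0_def\<close>)
  have ry: "rf ?N (\<lambda>Q. yc i Q + y0)" by (intro rg_add rf_y rg_const)
  have ynear: "\<forall>\<^sub>F Q in ?N. yc i Q + y0 \<noteq> 0" if "y0 \<noteq> 0"
    by (rule rf_near_nonzero[OF P(1) ry])
       (use that two in \<open>metis y0_def mult_2 mult_eq_0_iff\<close>)
  have 1: "rf ?N \<pi>" unfolding \<pi>_def using rf_y rg_diff[OF rf_u rg_const] by simp
  have 2: "\<pi> P = 0" by (simp add: \<pi>_def u0_def y0_def)
  have fin: "\<forall>\<^sub>F Q in cofin Y. uc i Q \<noteq> c" for c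
  proof -
    have "finite ({P\<in>Y. xc i P \<noteq> 0 \<and> uc i P \<in> {c}} \<union> {P\<in>Y. xc i P = 0})"
      using finite_u_fibre[of "{c}"] finite_off_chart by blast
    then show ?thesis unfolding eventually_cofin by (rule finite_subset[rotated]) auto
  qed
  have 3: "\<forall>\<^sub>F Q in cofin Y. \<pi> Q \<noteq> 0"
  proof (cases "y0 = 0")
    case True
    have "\<forall>\<^sub>F Q in cofin Y. yc i Q \<noteq> 0"
      using D1near[OF True, unfolded eventually_near, THEN conjunct1] fin[of u0]
        near[unfolded eventually_near, THEN conjunct1]
    proof eventually_elim
      case (elim Q)
      then show ?case using D1[of Q] True by auto
    qed
    then show ?thesis using True by (simp add: \<pi>_def)
  next
    case False
    then show ?thesis using fin[of u0] by (simp add: \<pi>_def)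
  qed
  have 4: "\<exists>\<psi>. rf ?N \<psi> \<and> (\<forall>\<^sub>F Q in ?N. \<phi> Q = \<pi> Q * \<psi> Q)" if \<phi>: "rf ?N \<phi>" "\<phi> P = 0" for \<phi>
  proof -
    obtain a b a' b' where ab:
      "\<forall>\<^sub>F Q in ?N. poly a' (uc i Q) + poly b' (uc i Q) * yc i Q \<noteq> 0 \<and>
       \<phi> Q = (poly a (uc i Q) + poly b (uc i Q) * yc i Q) / (poly a' (uc i Q) + poly b' (uc i Q) * yc i Q)"
      by (rule rf_chart[OF near \<phi>(1)])
    define den where "den = (\<lambda>Q. poly a' (uc i Q) + poly b' (uc i Q) * yc i Q)"
    have "rf ?N den" unfolding den_def
      by (rule rg_add[OF rf_of_poly[OF rf_u] rg_mult[OF rf_of_poly[OF rf_u] rf_y]])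
    moreover have "\<forall>\<^sub>F Q in ?N. den Q \<noteq> 0" unfolding den_def using ab by eventually_elim (rule conjunct1)
    ultimately have den: "rf ?N den" "\<forall>\<^sub>F Q in ?N. den Q \<noteq> 0" .
    have "den P \<noteq> 0" using den(2) by (simp add: eventually_near)
    then have 0: "poly a u0 + poly b u0 * y0 = 0"
      using ab[unfolded eventually_near, THEN conjunct2] \<phi>(2) by (auto simp: u0_def y0_def den_def)
    \<comment> \<open>The numerator a + b y vanishes at \<open>P\<close>, so a + y0 b has the root
      u0 and a = (u - u0) c - y0 b.\<close>
    then have "poly (a + Polynomial.smult y0 b) u0 = 0" by (simp add: mult.commute)
    then obtain c where "a + Polynomial.smult y0 b = [:-u0, 1:] * c" by (metis poly_eq_0_iff_dvd dvdE)
    then have "poly (a + Polynomial.smult y0 b) u = poly ([:-u0, 1:] * c) u" for u by simp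
    then have c: "poly a u = (u - u0) * poly c u - y0 * poly b u" for u by (simp add: algebra_simps eq_diff_eq)
    show ?thesis
    proof (cases "y0 = 0")
      case True
      \<comment> \<open>For y0 = 0 the numerator is (u - u0) c + b y = y (y c / D1 + b).\<close>
      let ?\<psi> = "\<lambda>Q. (yc i Q * poly c (uc i Q) / poly D1 (uc i Q) + poly b (uc i Q)) / den Q"
      have "rf ?N ?\<psi>"
        by (intro rg_divide rg_add rg_mult rf_of_poly rf_u rf_y den rD1 D1near[OF True])
      moreover have "\<forall>\<^sub>F Q in ?N. \<phi> Q = \<pi> Q * ?\<psi> Q"
        using ab D1near[OF True] near
      proof eventually_elim
        case (elim Q)
        have "(yc i Q)\<^sup>2 / poly D1 (uc i Q) = uc i Q - u0" using D1[of Q] elim True by (simp add: field_simps)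
        moreover have "yc i Q * (yc i Q * poly c (uc i Q) / poly D1 (uc i Q) + poly b (uc i Q)) =
          (yc i Q)\<^sup>2 / poly D1 (uc i Q) * poly c (uc i Q) + poly b (uc i Q) * yc i Q"
          by (simp add: algebra_simps power2_eq_square)
        ultimately have "yc i Q * (yc i Q * poly c (uc i Q) / poly D1 (uc i Q) + poly b (uc i Q)) =
          poly a (uc i Q) + poly b (uc i Q) * yc i Q"
          using True c[of "uc i Q"] by simp
        then show ?case using elim True by (simp add: \<pi>_def den_def)
      qed
      ultimately show ?thesis by (intro exI[of _ ?\<psi>] conjI)
    next
      case False
      \<comment> \<open>The numerator is (u - u0) c + b (y - y0), and y - y0 contains the factor u -
        u0 with cofactor D1 / (y + y0).\<close>
      let ?\<psi> = "\<lambda>Q. (poly c (uc i Q) + poly b (uc i Q) * poly D1 (uc i Q) / (yc i Q + y0)) / den Q"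
      have "rf ?N ?\<psi>"
        by (intro rg_divide rg_add rg_mult rf_of_poly rf_u rf_y rg_const den rD1 ynear[OF False])
      moreover have "\<forall>\<^sub>F Q in ?N. \<phi> Q = \<pi> Q * ?\<psi> Q"
        using ab ynear[OF False] near
      proof eventually_elim
        case (elim Q)
        have "(uc i Q - u0) * poly D1 (uc i Q) = (yc i Q - y0) * (yc i Q + y0)"
          using D1[of Q] elim by (simp add: algebra_simps power2_eq_square)
        then have "(uc i Q - u0) * poly D1 (uc i Q) / (yc i Q + y0) = yc i Q - y0"
          using elim by simp
        moreover have "(uc i Q - u0) * (poly c (uc i Q) + poly b (uc i Q) * poly D1 (uc i Q) / (yc i Q + y0)) =
          (uc i Q - u0) * poly c (uc i Q) + poly b (uc i Q) * ((uc i Q - u0) * poly D1 (uc i Q) / (yc i Q + y0))"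
          by (simp only: distrib_left times_divide_eq_right mult.left_commute)
        ultimately have "(uc i Q - u0) * (poly c (uc i Q) + poly b (uc i Q) * poly D1 (uc i Q) / (yc i Q + y0)) =
          (uc i Q - u0) * poly c (uc i Q) + poly b (uc i Q) * (yc i Q - y0)" by simp
        also have "\<dots> = poly a (uc i Q) + poly b (uc i Q) * yc i Q"
          using c[of "uc i Q"] by (simp add: algebra_simps)
        finally show ?case using elim False by (simp add: \<pi>_def den_def)
      qed
      ultimately show ?thesis by (intro exI[of _ ?\<psi>] conjI)
    qed
  qed
  have 5: "\<exists>n \<psi>. rf ?N \<psi> \<and> \<psi> P \<noteq> 0 \<and> (\<forall>\<^sub>F Q in ?N. \<phi> Q = \<pi> Q ^ n * \<psi> Q)"
    if \<phi>: "rf ?N \<phi>" "\<forall>\<^sub>F Q in cofin Y. \<phi> Q \<noteq> 0" for \<phi>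
  proof -
    obtain a b a' b' where ab:
      "\<forall>\<^sub>F Q in ?N. poly a' (uc i Q) + poly b' (uc i Q) * yc i Q \<noteq> 0 \<and>
       \<phi> Q = (poly a (uc i Q) + poly b (uc i Q) * yc i Q) / (poly a' (uc i Q) + poly b' (uc i Q) * yc i Q)"
      by (rule rf_chart[OF near \<phi>(1)])
    have "a \<noteq> 0 \<or> b \<noteq> 0"
    proof (rule ccontr)
      assume ab0: "\<not> (a \<noteq> 0 \<or> b \<noteq> 0)"
      have "\<forall>\<^sub>F Q in cofin Y. False"
        using ab[unfolded eventually_near, THEN conjunct1] \<phi>(2) by eventually_elim (use ab0 in simp)
      then show False by simp
    qed
    then have "a\<^sup>2 - b\<^sup>2 * Dpol \<noteq> 0" by (rule norm_nonzero)
    from order_decomp[OF this, of u0] obtain N1 where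
      N1: "a\<^sup>2 - b\<^sup>2 * Dpol = [:-u0, 1:] ^ order u0 (a\<^sup>2 - b\<^sup>2 * Dpol) * N1" "\<not> [:-u0, 1:] dvd N1"
      by blast
    define k where "k = order u0 (a\<^sup>2 - b\<^sup>2 * Dpol)"
    have N10: "poly N1 u0 \<noteq> 0" using N1(2) by (simp add: poly_eq_0_iff_dvd)
    \<comment> \<open>The conjugate of the numerator times the denominator, so that \<phi> \<theta>
      is the norm of the numerator, a polynomial in u whose order at u0 is k.\<close>
    define \<theta> where "\<theta> = (\<lambda>Q. (poly a (uc i Q) - poly b (uc i Q) * yc i Q) *
       (poly a' (uc i Q) + poly b' (uc i Q) * yc i Q))"
    have \<theta>: "rf ?N \<theta>" unfolding \<theta>_def by (intro rg_add rg_diff rg_mult rf_of_poly rf_u rf_y)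
    have prod: "\<forall>\<^sub>F Q in cofin Y. \<phi> Q * \<theta> Q = (uc i Q - u0) ^ k * poly N1 (uc i Q)"
      using ab[unfolded eventually_near, THEN conjunct1] near[unfolded eventually_near, THEN conjunct1]
    proof eventually_elim
      case (elim Q)
      have "\<phi> Q * \<theta> Q = (poly a (uc i Q) + poly b (uc i Q) * yc i Q) * (poly a (uc i Q) - poly b (uc i Q) * yc i Q)"
        using elim by (simp add: \<theta>_def)
      also have "\<dots> = (poly a (uc i Q))\<^sup>2 - (poly b (uc i Q))\<^sup>2 * (yc i Q)\<^sup>2"
        by (simp add: power2_eq_square algebra_simps)
      also have "\<dots> = poly (a\<^sup>2 - b\<^sup>2 * Dpol) (uc i Q)"
        using chart_point(1)[of Q i] elim by (simp add: poly_Dpol)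
      also have "\<dots> = (uc i Q - u0) ^ k * poly N1 (uc i Q)" by (subst N1(1)) (simp add: k_def)
      finally show ?case .
    qed
    have rN1: "rf ?N (\<lambda>Q. poly N1 (uc i Q))" by (rule rf_of_poly[OF rf_u])
    show ?thesis
    proof (cases "y0 = 0")
      case True
      \<comment> \<open>The exponent doubles because u - u0 has order 2 at a branch point.\<close>
      have "\<forall>\<^sub>F Q in cofin Y. \<phi> Q * \<theta> Q = \<pi> Q ^ (2 * k) * (poly N1 (uc i Q) / poly D1 (uc i Q) ^ k)"
        using prod D1near[OF True, unfolded eventually_near, THEN conjunct1]
          near[unfolded eventually_near, THEN conjunct1]
      proof eventually_elim
        case (elim Q)
        have "(yc i Q)\<^sup>2 / poly D1 (uc i Q) = uc i Q - u0" using D1[of Q] elim True by (simp add: field_simps)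
        then have "(uc i Q - u0) ^ k = \<pi> Q ^ (2 * k) / poly D1 (uc i Q) ^ k"
          using True by (metis \<pi>_def power_divide power_mult)
        then show ?case using elim by simp
      qed
      moreover have "rf ?N (\<lambda>Q. poly N1 (uc i Q) / poly D1 (uc i Q) ^ k)"
        by (intro rg_divide rN1 rg_power rD1, use D1near[OF True] in eventually_elim) simp
      ultimately show ?thesis
        using finite_order[OF P(1) 1 3 4 \<phi>(1) \<theta>, of "\<lambda>Q. poly N1 (uc i Q) / poly D1 (uc i Q) ^ k" "2 * k"]
          N10 D10[OF True] by (simp add: u0_def)
    next
      case False
      then have "\<forall>\<^sub>F Q in cofin Y. \<phi> Q * \<theta> Q = \<pi> Q ^ k * poly N1 (uc i Q)"
        using prod by (simp add: \<pi>_def)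
      then show ?thesis
        using finite_order[OF P(1) 1 3 4 \<phi>(1) \<theta> rN1, of k] N10 by (simp add: u0_def)
    qed
  qed
  from 1 2 3 4 5 have "unif P \<pi>" unfolding unif_def by blast
  then show ?thesis by (simp only: \<pi>_def u0_def y0_def)
qed

lemma unif_exists: assumes "P \<in> Y" obtains \<pi> where "unif P \<pi>"
  using ex_chart[OF assms] unif_chart[OF assms] that by metis

lemma unifD:
  assumes "unif P \<pi>"
  shows "rf (near Y P) \<pi>" "\<pi> P = 0" "\<forall>\<^sub>F Q in cofin Y. \<pi> Q \<noteq> 0"
  using assms by (simp_all add: unif_def)

lemma unif_dvd:
  assumes "unif P \<pi>" "rf (near Y P) \<phi>" "\<phi> P = 0"
  obtains \<psi> where "rf (near Y P) \<psi>" "\<forall>\<^sub>F Q in near Y P. \<phi> Q = \<pi> Q * \<psi> Q"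
  using assms unfolding unif_def by blast

text \<open>A quotient of two forms becomes a quotient of two germs regular at \<open>P\<close>
  after both are divided by a power of a coordinate that does not vanish there; the order is the
  difference of theirs.\<close>

lemma unif_order:
  assumes "P \<in> Y" "unif P \<pi>" "rf (cofin Y) \<phi>" "\<forall>\<^sub>F Q in cofin Y. \<phi> Q \<noteq> 0"
  obtains n \<psi> where "rf (near Y P) \<psi>" "\<psi> P \<noteq> 0" "\<forall>\<^sub>F Q in cofin Y. \<phi> Q = \<pi> Q powi n * \<psi> Q"
proof -
  obtain i where i: "xc i P \<noteq> 0" using ex_chart[OF assms(1)] .
  obtain d f g where fg: "form d f" "form d g" "\<forall>\<^sub>F Q in cofin Y. \<forall>v\<in>Q. g v \<noteq> 0 \<and> \<phi> Q = f v / g v"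
    using rfE[OF assms(3)] .
  have *: "\<exists>n \<psi>. rf (near Y P) \<psi> \<and> \<psi> P \<noteq> 0 \<and> (\<forall>\<^sub>F Q in cofin Y. f (rep Q) / xc i Q ^ d = \<pi> Q ^ n * \<psi> Q)"
    if f: "form d f" "\<forall>\<^sub>F Q in cofin Y. f (rep Q) \<noteq> 0" for f
  proof -
    have "form d (\<lambda>v. (v $ Some i) ^ d)" using form_power[OF form_coord[of "Some i"], of d] by simp
    then have "rf (near Y P) (\<lambda>Q. f (rep Q) / xc i Q ^ d)"
    proof (rule rfI[OF f(1)])
      show "\<forall>\<^sub>F Q in near Y P. \<forall>v\<in>Q. (v $ Some i) ^ d \<noteq> 0 \<and> f (rep Q) / xc i Q ^ d = f v / (v $ Some i) ^ d"
        using near_chart[OF assms(1) i]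
      proof eventually_elim
        case (elim Q)
        show ?case
        proof
          fix v assume v: "v \<in> Q"
          obtain c where c: "c \<noteq> 0" "v = c *s rep Q" using Y_points[of Q v] elim v by blast
          show "(v $ Some i) ^ d \<noteq> 0 \<and> f (rep Q) / xc i Q ^ d = f v / (v $ Some i) ^ d"
            using elim c form_scale[OF f(1), of c "rep Q"] by (simp add: xc_def power_mult_distrib)
        qed
      qed
    qed
    moreover have "\<forall>\<^sub>F Q in cofin Y. f (rep Q) / xc i Q ^ d \<noteq> 0"
      using f(2) eventually_chart[of i] by eventually_elim simp
    ultimately show ?thesis using assms(2) unfolding unif_def eventually_near by meson
  qed
  have "\<forall>\<^sub>F Q in cofin Y. f (rep Q) \<noteq> 0" "\<forall>\<^sub>F Q in cofin Y. g (rep Q) \<noteq> 0"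
    using fg(3) assms(4) eventually_cofin_mem by (eventually_elim, metis divide_eq_0_iff rep_in)+
  then obtain n \<psi> n' \<psi>' where
    1: "rf (near Y P) \<psi>" "\<psi> P \<noteq> 0" "\<forall>\<^sub>F Q in cofin Y. f (rep Q) / xc i Q ^ d = \<pi> Q ^ n * \<psi> Q" and
    2: "rf (near Y P) \<psi>'" "\<psi>' P \<noteq> 0" "\<forall>\<^sub>F Q in cofin Y. g (rep Q) / xc i Q ^ d = \<pi> Q ^ n' * \<psi>' Q"
    using *[OF fg(1)] *[OF fg(2)] by blast
  show ?thesis
  proof (rule that)
    show "rf (near Y P) (\<lambda>Q. \<psi> Q / \<psi>' Q)"
      by (intro rg_divide 1 2 rf_near_nonzero[OF assms(1) 2(1,2)])
    show "\<psi> P / \<psi>' P \<noteq> 0" using 1 2 by simp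
    show "\<forall>\<^sub>F Q in cofin Y. \<phi> Q = \<pi> Q powi (int n - int n') * (\<psi> Q / \<psi>' Q)"
      using 1(3) 2(3) fg(3) eventually_cofin_mem eventually_chart[of i] unifD(3)[OF assms(2)]
    proof eventually_elim
      case (elim Q)
      have "\<phi> Q = (f (rep Q) / xc i Q ^ d) / (g (rep Q) / xc i Q ^ d)"
        using elim(3,5) rep_in[OF elim(4)] by simp
      also have "\<dots> = (\<pi> Q ^ n * \<psi> Q) / (\<pi> Q ^ n' * \<psi>' Q)" using elim(1,2) by simp
      also have "\<dots> = \<pi> Q powi (int n - int n') * (\<psi> Q / \<psi>' Q)"
        using elim(6) by (simp add: power_int_diff)
      finally show ?case .
    qed
  qed
qed

text \<open>If n < n', cancelling \<pi>^n presents \<psi> generically as a positive power of \<pi>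
  times a regular germ, and so \<psi> vanishes at \<open>P\<close>.\<close>

lemma unif_order_unique:
  assumes P: "P \<in> Y" and \<pi>: "unif P \<pi>" and "rf (near Y P) \<psi>" "\<psi> P \<noteq> 0" "rf (near Y P) \<psi>'" "\<psi>' P \<noteq> 0"
    and eq: "\<forall>\<^sub>F Q in cofin Y. \<pi> Q powi n * \<psi> Q = \<pi> Q powi n' * \<psi>' Q"
  shows "n = n'"
proof -
  have *: False if "n < n'" "rf (near Y P) \<psi>" "\<psi> P \<noteq> 0" "rf (near Y P) \<psi>'"
    "\<forall>\<^sub>F Q in cofin Y. \<pi> Q powi n * \<psi> Q = \<pi> Q powi n' * \<psi>' Q" for n n' \<psi> \<psi>'
  proof -
    have "\<forall>\<^sub>F Q in cofin Y. \<psi> Q = \<pi> Q ^ nat (n' - n) * \<psi>' Q"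
      using that(5) unifD(3)[OF \<pi>]
    proof eventually_elim
      case (elim Q)
      have "\<pi> Q powi n' = \<pi> Q powi n * \<pi> Q ^ nat (n' - n)"
        using elim(2) that(1) power_int_add[of "\<pi> Q" n "n' - n"] by (simp add: power_int_def)
      then show ?case using elim by simp
    qed
    from rf_near_eq[OF P that(2) rg_mult[OF rg_power[OF unifD(1)[OF \<pi>]] that(4)] this]
    show False using unifD(2)[OF \<pi>] that(1,3) by simp
  qed
  have eq': "\<forall>\<^sub>F Q in cofin Y. \<pi> Q powi n' * \<psi>' Q = \<pi> Q powi n * \<psi> Q"
    using eq by eventually_elim simp
  from *[OF _ assms(3,4,5) eq] *[OF _ assms(5,6,3) eq'] show ?thesis by (meson linorder_neqE)
qed

end

section \<open>Families of polynomials and openness of etale maps\<close>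

text \<open>Polynomials in a new variable whose coefficients are regular or rational in
  \<open>Q\<close>, \<open>t\<close>, \<open>u\<close>. The uniform degree bound makes evaluation
  and products finite sums of germs.\<close>

definition rpp :: "('k::field, 'n::finite) point filter \<Rightarrow> (('k, 'n) point \<Rightarrow> 'k \<Rightarrow> 'k \<Rightarrow> 'k poly) \<Rightarrow> bool" where
  "rpp F p \<longleftrightarrow> (\<exists>D. \<forall>\<^sub>F Q in F. \<forall>t u. degree (p Q t u) \<le> D) \<and> (\<forall>l. rg F (\<lambda>Q t u. coeff (p Q t u) l))"

lemma rpp_coeff: "rpp F p \<Longrightarrow> rg F (\<lambda>Q t u. coeff (p Q t u) l)"
  by (simp add: rpp_def)

lemma rpp_mono: "rpp F p \<Longrightarrow> F' \<le> F \<Longrightarrow> rpp F' p"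
  unfolding rpp_def using filter_leD rg_mono by meson

lemma rpp_const: "rpp F (\<lambda>_ _ _. p)"
  unfolding rpp_def by (auto intro: rg_const intro!: exI[of _ "degree p"])

lemma rpp_add:
  assumes "rpp F p" "rpp F q" shows "rpp F (\<lambda>Q t u. p Q t u + q Q t u)"
proof -
  obtain D D' where D: "\<forall>\<^sub>F Q in F. \<forall>t u. degree (p Q t u) \<le> D" "\<forall>\<^sub>F Q in F. \<forall>t u. degree (q Q t u) \<le> D'"
    using assms unfolding rpp_def by blast
  from D have "\<forall>\<^sub>F Q in F. \<forall>t u. degree (p Q t u + q Q t u) \<le> max D D'"
    by eventually_elim (meson degree_add_le_max le_max_iff_disj max.mono order_trans)
  then show ?thesis using assms unfolding rpp_def by (auto intro: rg_add)
qed

lemma rpp_mult: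
  assumes "rpp F p" "rpp F q" shows "rpp F (\<lambda>Q t u. p Q t u * q Q t u)"
proof -
  obtain D D' where D: "\<forall>\<^sub>F Q in F. \<forall>t u. degree (p Q t u) \<le> D" "\<forall>\<^sub>F Q in F. \<forall>t u. degree (q Q t u) \<le> D'"
    using assms unfolding rpp_def by blast
  from D have "\<forall>\<^sub>F Q in F. \<forall>t u. degree (p Q t u * q Q t u) \<le> D + D'"
    by eventually_elim (meson add_mono degree_mult_le order_trans)
  moreover have "rg F (\<lambda>Q t u. coeff (p Q t u * q Q t u) l)" for l
    unfolding coeff_mult by (intro rg_sum rg_mult rpp_coeff[OF assms(1)] rpp_coeff[OF assms(2)])
  ultimately show ?thesis unfolding rpp_def by blast
qed

lemma rpp_power: "rpp F p \<Longrightarrow> rpp F (\<lambda>Q t u. p Q t u ^ n)"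
  by (induction n) (auto intro: rpp_const rpp_mult)

lemma rpp_monom: "rg F \<Psi> \<Longrightarrow> rpp F (\<lambda>Q t u. monom (\<Psi> Q t u) n)"
  unfolding rpp_def
proof (intro conjI allI)
  show "rg F (\<lambda>Q t u. coeff (monom (\<Psi> Q t u) n) l)" if "rg F \<Psi>" for l
    using that rg_const[of F 0] by (cases "l = n") auto
qed (auto simp: degree_monom_le intro!: exI[of _ n])

lemma rpp_smult: "rg F \<Psi> \<Longrightarrow> rpp F p \<Longrightarrow> rpp F (\<lambda>Q t u. Polynomial.smult (\<Psi> Q t u) (p Q t u))"
  using rpp_mult[OF rpp_monom[of F \<Psi> 0], of p] by (simp add: monom_0)

lemma rpp_uminus: "rpp F p \<Longrightarrow> rpp F (\<lambda>Q t u. - p Q t u)"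
  using rpp_mult[OF rpp_const[of F "-1"], of p] by simp

lemma rpp_diff: "rpp F p \<Longrightarrow> rpp F q \<Longrightarrow> rpp F (\<lambda>Q t u. p Q t u - q Q t u)"
  using rpp_add[OF _ rpp_uminus, of F p q] by simp

lemma rpp_sum: "(\<And>i. i \<in> I \<Longrightarrow> rpp F (p i)) \<Longrightarrow> rpp F (\<lambda>Q t u. \<Sum>i\<in>I. p i Q t u)"
  by (induction I rule: infinite_finite_induct) (auto intro: rpp_const rpp_add)

lemma rpp_swap:
  assumes "rpp F p" shows "rpp F (\<lambda>Q t u. p Q u t)"
proof -
  obtain D where D: "\<forall>\<^sub>F Q in F. \<forall>t u. degree (p Q t u) \<le> D" using assms(1) unfolding rpp_def by blast
  then have "\<forall>\<^sub>F Q in F. \<forall>t u. degree (p Q u t) \<le> D" by eventually_elim simp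
  then show ?thesis using assms unfolding rpp_def by (auto intro: rg_swap)
qed

lemma rg_poly:
  assumes "rpp F p" "rg F \<Psi>" shows "rg F (\<lambda>Q t u. poly (p Q t u) (\<Psi> Q t u))"
proof -
  obtain D where D: "\<forall>\<^sub>F Q in F. \<forall>t u. degree (p Q t u) \<le> D" using assms(1) unfolding rpp_def by blast
  have "rg F (\<lambda>Q t u. \<Sum>l\<le>D. coeff (p Q t u) l * \<Psi> Q t u ^ l)"
    by (intro rg_sum rg_mult rg_power assms rpp_coeff[OF assms(1)])
  then show ?thesis
    by (rule rg_cong, use D in eventually_elim) (auto simp: poly_altdef coeff_eq_0 intro!: sum.mono_neutral_left dest: le_degree)
qed

text \<open>Long division carried out uniformly in \<open>Q\<close>: along the filter the divisor
  has constant degree, hence an invertible leading coefficient. The induction runs over a bound N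
  for the nonzero coefficients, and each step removes the top one.\<close>

lemma rpp_divmod_aux:
  assumes E: "rpp F (\<lambda>Q _ _. E Q)" and d: "\<forall>\<^sub>F Q in F. degree (E Q) = d \<and> E Q \<noteq> 0"
  shows "rpp F p \<Longrightarrow> \<forall>\<^sub>F Q in F. \<forall>t u. \<forall>l\<ge>N. coeff (p Q t u) l = 0 \<Longrightarrow>
    \<exists>q r. rpp F q \<and> rpp F r \<and>
      (\<forall>\<^sub>F Q in F. \<forall>t u. p Q t u = q Q t u * E Q + r Q t u \<and> (r Q t u = 0 \<or> degree (r Q t u) < d))"
proof (induction N arbitrary: p)
  case 0
  have "\<forall>\<^sub>F Q in F. \<forall>t u. p Q t u = 0 * E Q + 0 \<and> ((0::'a poly) = 0 \<or> degree (0::'a poly) < d)"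
    using 0(2) by eventually_elim (simp add: poly_eq_iff)
  then show ?case using rpp_const[of F 0] by (intro exI[of _ "\<lambda>_ _ _. 0"]) blast
next
  case (Suc N p)
  show ?case
  proof (cases "N < d")
    case True
    have "\<forall>\<^sub>F Q in F. \<forall>t u. p Q t u = 0 * E Q + p Q t u \<and> (p Q t u = 0 \<or> degree (p Q t u) < d)"
      using Suc.prems(2)
    proof eventually_elim
      case (elim Q)
      have "degree (p Q t u) \<le> N" for t u
        by (rule degree_le) (use elim in auto)
      then show ?case using True by (auto intro: le_less_trans)
    qed
    then show ?thesis using rpp_const[of F 0] Suc.prems(1) by (intro exI[of _ "\<lambda>_ _ _. 0"] exI[of _ p]) blast
  next
    case False
    define c where "c = (\<lambda>Q t u. coeff (p Q t u) N / coeff (E Q) d)"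
    have c: "rg F c" unfolding c_def
      by (intro rg_divide rpp_coeff Suc.prems(1) E rpp_coeff[OF E], use d in eventually_elim) auto
    define p' where "p' = (\<lambda>Q t u. p Q t u - monom (c Q t u) (N - d) * E Q)"
    have p': "rpp F p'" unfolding p'_def by (intro rpp_diff rpp_mult rpp_monom c E Suc.prems(1))
    have "\<forall>\<^sub>F Q in F. \<forall>t u. \<forall>l\<ge>N. coeff (p' Q t u) l = 0"
      using Suc.prems(2) d
    proof eventually_elim
      case (elim Q)
      have "coeff (p' Q t u) l = 0" if "l \<ge> N" for t u l
      proof (cases "l = N")
        case True
        have "coeff (E Q) d \<noteq> 0" using elim(2) by auto
        then show ?thesis using True False by (simp add: p'_def coeff_monom_mult c_def)
      next
        case False
        then have "l > N" using that by simp
        then have "coeff (E Q) (l - (N - d)) = 0" using elim(2) \<open>\<not> N < d\<close> by (intro coeff_eq_0) auto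
        then show ?thesis using \<open>l > N\<close> elim(1) by (simp add: p'_def coeff_monom_mult)
      qed
      then show ?case by blast
    qed
    from Suc.IH[OF p' this] obtain q r where qr: "rpp F q" "rpp F r"
      "\<forall>\<^sub>F Q in F. \<forall>t u. p' Q t u = q Q t u * E Q + r Q t u \<and> (r Q t u = 0 \<or> degree (r Q t u) < d)" by blast
    have "rpp F (\<lambda>Q t u. q Q t u + monom (c Q t u) (N - d))" by (intro rpp_add qr rpp_monom c)
    moreover have "\<forall>\<^sub>F Q in F. \<forall>t u. p Q t u = (q Q t u + monom (c Q t u) (N - d)) * E Q + r Q t u \<and>
       (r Q t u = 0 \<or> degree (r Q t u) < d)"
      using qr(3) by eventually_elim (auto simp: p'_def algebra_simps diff_eq_eq)
    ultimately show ?thesis using qr(2)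
      by (intro exI[of _ "\<lambda>Q t u. q Q t u + monom (c Q t u) (N - d)"] exI[of _ r]) blast
  qed
qed

lemma rpp_divmod:
  assumes E: "rpp F (\<lambda>Q _ _. E Q)" and d: "\<forall>\<^sub>F Q in F. degree (E Q) = d \<and> E Q \<noteq> 0" and p: "rpp F p"
  obtains q r where "rpp F q" "rpp F r"
    "\<forall>\<^sub>F Q in F. \<forall>t u. p Q t u = q Q t u * E Q + r Q t u \<and> (r Q t u = 0 \<or> degree (r Q t u) < d)"
proof -
  obtain D where D: "\<forall>\<^sub>F Q in F. \<forall>t u. degree (p Q t u) \<le> D" using p unfolding rpp_def by blast
  then have "\<forall>\<^sub>F Q in F. \<forall>t u. \<forall>l\<ge>Suc D. coeff (p Q t u) l = 0"
    by eventually_elim (meson Suc_le_lessD coeff_eq_0 le_less_trans)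
  from rpp_divmod_aux[OF E d p this] show ?thesis using that by blast
qed

text \<open>E splits into \<open>degree E\<close> linear factors, each of which divides p.\<close>

lemma dvd_power_of_roots:
  fixes E p :: "'k::alg_closed_field poly"
  assumes "E \<noteq> 0" "\<And>x. poly E x = 0 \<Longrightarrow> poly p x = 0"
  shows "E dvd p ^ degree E"
proof -
  obtain A where A: "size A = degree E" "E = Polynomial.smult (lead_coeff E) (\<Prod>x\<in>#A. [:-x, 1:])"
    using alg_closed_imp_factorization[OF assms(1)] by blast
  have "[:-x, 1:] dvd p" if "x \<in># A" for x
  proof -
    have "poly E x = 0"
      by (subst A(2)) (use that in \<open>auto simp: poly_prod_mset prod_mset_zero_iff\<close>)
    then show ?thesis using assms(2) by (simp add: poly_eq_0_iff_dvd)
  qed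
  then have "(\<Prod>x\<in>#A. [:-x, 1:]) dvd p ^ size A"
  proof (induction A)
    case (add x A)
    then have "[:-x, 1:] * (\<Prod>x\<in>#A. [:-x, 1:]) dvd p * p ^ size A" by (intro mult_dvd_mono) auto
    then show ?case by (simp del: mult_pCons_left)
  qed simp
  then show ?thesis using A assms(1) by (metis leading_coeff_0_iff smult_dvd)
qed

text \<open>Sorting by powers of the second fibre coordinate; all coefficients are again forms of
  the same degree d in the projective coordinates.\<close>

lemma form2_as_poly:
  fixes f :: "('a::comm_ring_1^'b) \<times> 'a \<times> 'a \<Rightarrow> 'a"
  assumes "form2 d f"
  obtains p D where "\<And>v t u. f (v, t, u) = poly (p v t) u" "\<And>v t. degree (p v t) \<le> D"
    "\<And>l. form2 d (\<lambda>(v, t, u). coeff (p v t) l)"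
proof -
  have "\<exists>p D. (\<forall>v t u. f (v, t, u) = poly (p v t) u) \<and> (\<forall>v t. degree (p v t) \<le> D) \<and>
     (\<forall>l. form2 d (\<lambda>(v, t, u). coeff (p v t) l))"
    using assms[unfolded form2_def]
  proof (induction rule: graded_poly.induct)
    case (const c)
    show ?case by (intro exI[of _ "\<lambda>_ _. [:c:]"] exI[of _ 0]) (simp add: case_prod_unfold form2_const)
  next
    case (proj_coord l)
    then obtain i where l: "l = (\<lambda>(v, t, u). v $ i)" by auto
    have "form2 1 (\<lambda>(v :: 'a^'b, t, u). coeff [:v $ i:] n)" for n
      using form2_coord[of i] form2_mult[OF form2_const[of 0] form2_coord[of i]]
      by (cases n) (auto simp: case_prod_unfold)
    then show ?case unfolding l
      by (intro exI[of _ "\<lambda>v _. [:v $ i:]"] exI[of _ 0]) (simp add: case_prod_unfold)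
  next
    case (affine_coord a)
    then consider "a = (\<lambda>(v, t, u). t)" | "a = (\<lambda>(v, t, u). u)" by blast
    then show ?case
    proof cases
      case 1
      have "form2 0 (\<lambda>(v :: 'a^'b, t, u). coeff [:t:] n)" for n
        using form2_fst form2_const[of 0] by (cases n) (auto simp: case_prod_unfold)
      then show ?thesis unfolding 1
        by (intro exI[of _ "\<lambda>_ t. [:t:]"] exI[of _ 0]) (simp add: case_prod_unfold)
    next
      case 2
      show ?thesis unfolding 2
        by (rule exI[of _ "\<lambda>_ _. [:0, 1:]"], rule exI[of _ 1]) (auto simp: case_prod_unfold intro: form2_const)
    qed
  next
    case (add d f g)
    then obtain p D p' D' where *: "\<forall>v t u. f (v, t, u) = poly (p v t) u" "\<forall>v t. degree (p v t) \<le> D"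
      "\<forall>l. form2 d (\<lambda>(v, t, u). coeff (p v t) l)"
      "\<forall>v t u. g (v, t, u) = poly (p' v t) u" "\<forall>v t. degree (p' v t) \<le> D'"
      "\<forall>l. form2 d (\<lambda>(v, t, u). coeff (p' v t) l)" by blast
    have "degree (p v t + p' v t) \<le> max D D'" for v t
      using *(2,5) by (meson degree_add_le_max le_max_iff_disj max.mono order_trans)
    moreover have "form2 d (\<lambda>(v, t, u). coeff (p v t + p' v t) l)" for l
      using form2_add[OF *(3)[rule_format, of l] *(6)[rule_format, of l]] by (simp add: case_prod_unfold)
    ultimately show ?case using *(1,4)
      by (intro exI[of _ "\<lambda>v t. p v t + p' v t"] exI[of _ "max D D'"]) simp
  next
    case (mult d f e g)
    then obtain p D p' D' where *: "\<forall>v t u. f (v, t, u) = poly (p v t) u" "\<forall>v t. degree (p v t) \<le> D"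
      "\<forall>l. form2 d (\<lambda>(v, t, u). coeff (p v t) l)"
      "\<forall>v t u. g (v, t, u) = poly (p' v t) u" "\<forall>v t. degree (p' v t) \<le> D'"
      "\<forall>l. form2 e (\<lambda>(v, t, u). coeff (p' v t) l)" by blast
    have "degree (p v t * p' v t) \<le> D + D'" for v t
      using *(2,5) by (meson add_mono degree_mult_le order_trans)
    moreover have "form2 (d + e) (\<lambda>(v, t, u). coeff (p v t * p' v t) l)" for l
    proof -
      have sum: "form2 n (\<lambda>x. \<Sum>i\<le>m. h i x)" if "\<And>i. form2 n (h i)"
        for n m :: nat and h :: "nat \<Rightarrow> ('a^'b) \<times> 'a \<times> 'a \<Rightarrow> 'a"
        by (induction m) (use that in \<open>auto intro: form2_add\<close>)
      have "form2 (d + e) (\<lambda>(v, t, u). coeff (p v t) i * coeff (p' v t) j)" for i j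
        using form2_mult[OF *(3)[rule_format, of i] *(6)[rule_format, of j]] by (simp add: case_prod_unfold)
      then show ?thesis unfolding coeff_mult case_prod_unfold by (intro sum) simp
    qed
    ultimately show ?case using *(1,4)
      by (intro exI[of _ "\<lambda>v t. p v t * p' v t"] exI[of _ "D + D'"]) simp
  qed
  then show ?thesis using that by blast
qed

section \<open>Openness and the identity principle for etale charts over the curve\<close>

context cubic_curve begin

text \<open>The coefficients are read off at the representative \<open>rep Q\<close>; numerator and
  denominator scale by the same power of c, so the quotient is valid on the whole line.\<close>

lemma rg_as_poly:
  assumes F: "\<forall>\<^sub>F Q in F. Q \<in> Y" and "rg F \<Psi>"
  obtains p where "rpp F (\<lambda>Q t u. p Q t)" "\<forall>\<^sub>F Q in F. \<forall>t u. \<Psi> Q t u = poly (p Q t) u"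
proof -
  obtain d f g where fg: "form2 d f" "form d g"
    "\<forall>\<^sub>F Q in F. \<forall>v\<in>Q. g v \<noteq> 0 \<and> (\<forall>t u. \<Psi> Q t u = f (v, t, u) / g v)"
    using assms(2) unfolding rg_def by blast
  obtain p D where p: "\<And>v t u. f (v, t, u) = poly (p v t) u" "\<And>v t. degree (p v t) \<le> D"
    "\<And>l. form2 d (\<lambda>(v, t, u). coeff (p v t) l)" using form2_as_poly[OF fg(1)] by blast
  define q where "q = (\<lambda>Q t. Polynomial.smult (inverse (g (rep Q))) (p (rep Q) t))"
  have "rg F (\<lambda>Q t u. coeff (q Q t) l)" for l
  proof (rule rgI[OF p(3)[of l] fg(2)])
    show "\<forall>\<^sub>F Q in F. \<forall>v\<in>Q. g v \<noteq> 0 \<and>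
      (\<forall>t u. coeff (q Q t) l = (case (v, t, u) of (v, t, u) \<Rightarrow> coeff (p v t) l) / g v)"
      using fg(3) F
    proof eventually_elim
      case (elim Q)
      show ?case
      proof (intro ballI conjI allI)
        fix v t u assume v: "v \<in> Q"
        then show "g v \<noteq> 0" using elim by blast
        obtain c where c: "c \<noteq> 0" "v = c *s rep Q" using Y_points[of Q v] elim v by blast
        have "coeff (p v t) l = c ^ d * coeff (p (rep Q) t) l"
          using form2_scale[OF p(3)[of l], of c "rep Q" t u] c by simp
        moreover have "g v = c ^ d * g (rep Q)" using form_scale[OF fg(2)] c by simp
        ultimately show "coeff (q Q t) l = (case (v, t, u) of (v, t, u) \<Rightarrow> coeff (p v t) l) / g v"
          using c by (simp add: q_def field_simps)
      qed
    qed
  qed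
  moreover have "degree (q Q t) \<le> D" for Q t unfolding q_def using p(2) degree_smult_le order_trans by blast
  ultimately have "rpp F (\<lambda>Q t u. q Q t)" unfolding rpp_def by (auto intro!: exI[of _ D])
  moreover have "\<forall>\<^sub>F Q in F. \<forall>t u. \<Psi> Q t u = poly (q Q t) u" using fg(3) F
  proof eventually_elim
    case (elim Q)
    then show ?case using rep_in[OF elim(2)] by (simp add: q_def p(1) divide_inverse mult.commute)
  qed
  ultimately show ?thesis using that by blast
qed

text \<open>Images of open sets under a finite map, made explicit. If p vanished at all roots of E
  then E would divide p^d with d the degree of E, so a nonzero coefficient of the remainder of p^d
  modulo E certifies a root where p does not vanish. At \<open>P\<close> some coefficient is nonzero
  because p is nonzero at the root x0.\<close>

lemma root_openness:
  assumes E: "rpp (near Y P) (\<lambda>Q _ _. E Q)" and d: "\<forall>\<^sub>F Q in near Y P. degree (E Q) = d \<and> E Q \<noteq> 0"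
    and p: "rpp (near Y P) p" and x0: "poly (E P) x0 = 0" "poly (p P t0 u0) x0 \<noteq> 0"
  obtains \<Psi> where "rg (near Y P) \<Psi>" "\<Psi> P t0 u0 \<noteq> 0"
    "\<forall>\<^sub>F Q in near Y P. \<forall>t u. \<Psi> Q t u \<noteq> 0 \<longrightarrow> (\<exists>x. poly (E Q) x = 0 \<and> poly (p Q t u) x \<noteq> 0)"
proof -
  obtain q r where qr: "rpp (near Y P) q" "rpp (near Y P) r"
    "\<forall>\<^sub>F Q in near Y P. \<forall>t u. p Q t u ^ d = q Q t u * E Q + r Q t u \<and> (r Q t u = 0 \<or> degree (r Q t u) < d)"
    using rpp_divmod[OF E d rpp_power[OF p]] by blast
  have "p P t0 u0 ^ d = q P t0 u0 * E P + r P t0 u0" using qr(3) by (simp add: eventually_near)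
  then have "poly (p P t0 u0 ^ d) x0 = poly (q P t0 u0 * E P + r P t0 u0) x0" by simp
  then have "poly (r P t0 u0) x0 \<noteq> 0" using x0 by auto
  then have "r P t0 u0 \<noteq> 0" by auto
  then obtain l where l: "coeff (r P t0 u0) l \<noteq> 0" by (auto simp: poly_eq_iff)
  show ?thesis
  proof (rule that[OF rpp_coeff[OF qr(2), of l] l])
    show "\<forall>\<^sub>F Q in near Y P. \<forall>t u. coeff (r Q t u) l \<noteq> 0 \<longrightarrow> (\<exists>x. poly (E Q) x = 0 \<and> poly (p Q t u) x \<noteq> 0)"
      using qr(3) d
    proof eventually_elim
      case (elim Q)
      show ?case
      proof (intro allI impI, rule ccontr)
        fix t u assume l: "coeff (r Q t u) l \<noteq> 0" and "\<nexists>x. poly (E Q) x = 0 \<and> poly (p Q t u) x \<noteq> 0"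
        then have "E Q dvd p Q t u ^ d" using dvd_power_of_roots[of "E Q" "p Q t u"] elim(2) by auto
        then have "E Q dvd r Q t u" using elim(1) by (metis dvd_add_right_iff dvd_triv_right)
        moreover have "r Q t u \<noteq> 0" using l by auto
        ultimately show False using elim dvd_imp_degree_le[of "E Q" "r Q t u"] by fastforce
      qed
    qed
  qed
qed

lemma zariski_open_near:
  assumes "zariski_open_in Y V" "P \<in> V" shows "\<forall>\<^sub>F Q in near Y P. Q \<in> V"
proof -
  obtain d f where f: "form d f" "\<forall>v\<in>P. f v \<noteq> 0" "\<forall>Q\<in>Y. (\<forall>v\<in>Q. f v \<noteq> 0) \<longrightarrow> Q \<in> V"
    using assms unfolding zariski_open_in_def by blast
  have P: "P \<in> Y" using assms unfolding zariski_open_in_def by blast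
  have "\<forall>\<^sub>F Q in cofin Y. Q \<in> V"
    using form_finite_zeros[OF f(1) P rep_in[OF P]] f(2) rep_in[OF P] eventually_cofin_mem[of Y]
    by (auto elim: eventually_elim2 simp: f(3))
  then show ?thesis using assms(2) by (simp add: eventually_near)
qed

lemma regular_on_rf:
  assumes "zariski_open_in Y V" "P \<in> V" "regular_on V \<phi>" shows "rf (near Y P) \<phi>"
proof -
  obtain d f g where fg: "form d f" "form d g" "\<forall>v\<in>P. g v \<noteq> 0"
    "\<forall>Q\<in>V. \<forall>v\<in>Q. g v \<noteq> 0 \<longrightarrow> \<phi> Q = f v / g v"
    using bspec[OF assms(3)[unfolded regular_on_def] assms(2)] by blast
  have P: "P \<in> Y" using assms unfolding zariski_open_in_def by blast
  have "\<forall>\<^sub>F Q in near Y P. \<forall>v\<in>Q. g v \<noteq> 0"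
    using form_finite_zeros[OF fg(2) P rep_in[OF P]] fg(3) rep_in[OF P] by (simp add: eventually_near)
  then have "\<forall>\<^sub>F Q in near Y P. \<forall>v\<in>Q. g v \<noteq> 0 \<and> \<phi> Q = f v / g v"
    using zariski_open_near[OF assms(1,2)] by eventually_elim (use fg(4) in auto)
  then show ?thesis by (rule rfI[OF fg(1,2)])
qed

lemma chart_near:
  assumes c: "standard_etale Y c" "P \<in> base c"
  obtains d where "\<forall>\<^sub>F Q in near Y P. Q \<in> base c" "rpp (near Y P) (\<lambda>Q _ _. eqn c Q)"
    "rpp (near Y P) (\<lambda>Q _ _. loc c Q)" "\<forall>\<^sub>F Q in near Y P. degree (eqn c Q) = d \<and> lead_coeff (eqn c Q) = 1"
proof -
  obtain d d' where *: "zariski_open_in Y (base c)"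
    "\<forall>P\<in>base c. degree (eqn c P) = d \<and> lead_coeff (eqn c P) = 1" "\<forall>P\<in>base c. degree (loc c P) \<le> d'"
    "\<forall>i. regular_on (base c) (\<lambda>P. coeff (eqn c P) i)" "\<forall>i. regular_on (base c) (\<lambda>P. coeff (loc c P) i)"
    using c(1) unfolding standard_etale_def by blast
  note near = zariski_open_near[OF *(1) c(2)]
  show ?thesis
  proof (rule that[OF near])
    have "\<forall>\<^sub>F Q in near Y P. degree (eqn c Q) \<le> d" using near by eventually_elim (use * in auto)
    then show "rpp (near Y P) (\<lambda>Q _ _. eqn c Q)" unfolding rpp_def
      using regular_on_rf[OF *(1) c(2)] *(4) by auto
    have "\<forall>\<^sub>F Q in near Y P. degree (loc c Q) \<le> d'" using near by eventually_elim (use * in auto)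
    then show "rpp (near Y P) (\<lambda>Q _ _. loc c Q)" unfolding rpp_def
      using regular_on_rf[OF *(1) c(2)] *(5) by auto
    show "\<forall>\<^sub>F Q in near Y P. degree (eqn c Q) = d \<and> lead_coeff (eqn c Q) = 1"
      using near by eventually_elim (use * in auto)
  qed
qed

text \<open>Multiplying p by \<open>loc\<close> restricts the roots found to those that lie in the
  chart.\<close>

lemma chart_openness:
  assumes c: "standard_etale Y c" and x0: "x0 \<in> chart_fibre c P"
    and p: "rpp (near Y P) p" "poly (p P t0 u0) x0 \<noteq> 0"
  obtains \<Psi> where "rg (near Y P) \<Psi>" "\<Psi> P t0 u0 \<noteq> 0"
    "\<forall>\<^sub>F Q in near Y P. \<forall>t u. \<Psi> Q t u \<noteq> 0 \<longrightarrow> (\<exists>x\<in>chart_fibre c Q. poly (p Q t u) x \<noteq> 0)"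
proof -
  have P: "P \<in> base c" using x0 by (simp add: chart_fibre_def)
  obtain d where d: "\<forall>\<^sub>F Q in near Y P. Q \<in> base c" "rpp (near Y P) (\<lambda>Q _ _. eqn c Q)"
    "rpp (near Y P) (\<lambda>Q _ _. loc c Q)" "\<forall>\<^sub>F Q in near Y P. degree (eqn c Q) = d \<and> lead_coeff (eqn c Q) = 1"
    by (rule chart_near[OF c P])
  have *: "\<forall>\<^sub>F Q in near Y P. degree (eqn c Q) = d \<and> eqn c Q \<noteq> 0" using d(4) by eventually_elim auto
  have x: "poly (eqn c P) x0 = 0" "poly (p P t0 u0 * loc c P) x0 \<noteq> 0"
    using x0 p(2) by (simp_all add: chart_fibre_def)
  obtain \<Psi> where \<Psi>: "rg (near Y P) \<Psi>" "\<Psi> P t0 u0 \<noteq> 0"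
    "\<forall>\<^sub>F Q in near Y P. \<forall>t u. \<Psi> Q t u \<noteq> 0 \<longrightarrow> (\<exists>x. poly (eqn c Q) x = 0 \<and> poly (p Q t u * loc c Q) x \<noteq> 0)"
    by (rule root_openness[OF d(2) * rpp_mult[OF p(1) d(3)] x])
  from \<Psi>(3) d(1)
  have "\<forall>\<^sub>F Q in near Y P. \<forall>t u. \<Psi> Q t u \<noteq> 0 \<longrightarrow> (\<exists>x\<in>chart_fibre c Q. poly (p Q t u) x \<noteq> 0)"
    by eventually_elim (simp add: chart_fibre_def, metis)
  with \<Psi>(1,2) show ?thesis by (rule that)
qed

text \<open>Two applications of openness eliminate the fibre coordinates one after the other: u in
  favour of a germ in t, and then t in favour of a germ on the curve, which is generically
  nonzero.\<close>

lemma fibre_density: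
  assumes c: "standard_etale Y c" "t0 \<in> chart_fibre c P" and c': "standard_etale Y c'" "u0 \<in> chart_fibre c' P"
    and P: "P \<in> Y" and \<Psi>: "rg (near Y P) \<Psi>" "\<Psi> P t0 u0 \<noteq> 0"
  shows "\<forall>\<^sub>F Q in cofin Y. \<exists>t\<in>chart_fibre c Q. \<exists>u\<in>chart_fibre c' Q. \<Psi> Q t u \<noteq> 0"
proof -
  note near = eventually_near_mem[OF P]
  obtain p where p: "rpp (near Y P) (\<lambda>Q t u. p Q t)" "\<forall>\<^sub>F Q in near Y P. \<forall>t u. \<Psi> Q t u = poly (p Q t) u"
    by (rule rg_as_poly[OF near \<Psi>(1)])
  have *: "poly (p P t0) u0 \<noteq> 0" using p(2) \<Psi>(2) by (simp add: eventually_near)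
  \<comment> \<open>The family p Q t does not involve the second coordinate, which therefore is a
    dummy argument of \<Theta> and stays fixed at u0 below.\<close>
  obtain \<Theta> where \<Theta>: "rg (near Y P) \<Theta>" "\<Theta> P t0 u0 \<noteq> 0"
    "\<forall>\<^sub>F Q in near Y P. \<forall>t u. \<Theta> Q t u \<noteq> 0 \<longrightarrow> (\<exists>x\<in>chart_fibre c' Q. poly (p Q t) x \<noteq> 0)"
    by (rule chart_openness[OF c' p(1), of t0 u0, OF *])
  obtain q where q: "rpp (near Y P) (\<lambda>Q t u. q Q t)" "\<forall>\<^sub>F Q in near Y P. \<forall>t u. \<Theta> Q u t = poly (q Q t) u"
    by (rule rg_as_poly[OF near rg_swap[OF \<Theta>(1)]])
  have *: "poly (q P u0) t0 \<noteq> 0" using q(2) \<Theta>(2) by (simp add: eventually_near)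
  obtain \<Xi> where \<Xi>: "rg (near Y P) \<Xi>" "\<Xi> P u0 0 \<noteq> 0"
    "\<forall>\<^sub>F Q in near Y P. \<forall>t u. \<Xi> Q t u \<noteq> 0 \<longrightarrow> (\<exists>x\<in>chart_fibre c Q. poly (q Q t) x \<noteq> 0)"
    by (rule chart_openness[OF c q(1), of u0 0, OF *])
  have "\<forall>\<^sub>F Q in near Y P. \<Xi> Q u0 0 \<noteq> 0"
    by (rule rf_near_nonzero[OF P rf_rg[OF \<Xi>(1)] \<Xi>(2)])
  then have "\<forall>\<^sub>F Q in near Y P. \<exists>t\<in>chart_fibre c Q. \<exists>u\<in>chart_fibre c' Q. \<Psi> Q t u \<noteq> 0"
    using p(2) \<Theta>(3) q(2) \<Xi>(3) by eventually_elim metis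
  then show ?thesis by (simp add: eventually_near)
qed

text \<open>The identity principle on a fibre product of charts: a regular function that is zero on
  almost all fibres is zero at every point. It carries generic identities to the points where the
  generic formulas break down.\<close>

lemma fibre_vanishing:
  assumes "standard_etale Y c" "t0 \<in> chart_fibre c P" "standard_etale Y c'" "u0 \<in> chart_fibre c' P"
    "P \<in> Y" "rg (near Y P) \<Psi>"
    and "\<forall>\<^sub>F Q in cofin Y. \<forall>t\<in>chart_fibre c Q. \<forall>u\<in>chart_fibre c' Q. \<Psi> Q t u = 0"
  shows "\<Psi> P t0 u0 = 0"
proof (rule ccontr)
  assume "\<Psi> P t0 u0 \<noteq> 0"
  from fibre_density[OF assms(1-6) this] assms(7) have "\<forall>\<^sub>F Q in cofin Y. False"
    by eventually_elim blast
  then show False by simp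
qed

end

section \<open>Cech classes\<close>

context cubic_curve begin

text \<open>Representatives of distinct points are not proportional, so some 2 by 2 minor is
  nonzero; expanding that minor along the second vector gives the linear form.\<close>

lemma separating_form:
  assumes "P \<in> Y" "Q \<in> Y" "P \<noteq> Q"
  obtains d f where "form d f" "\<forall>v\<in>P. f v \<noteq> 0" "\<forall>v\<in>Q. f v = 0"
proof -
  let ?p = "rep P" and ?q = "rep Q"
  have "\<exists>j l. ?p $ j * ?q $ l - ?p $ l * ?q $ j \<noteq> 0"
  proof (rule ccontr)
    assume "\<nexists>j l. ?p $ j * ?q $ l - ?p $ l * ?q $ j \<noteq> 0"
    then have eq: "?p $ j * ?q $ l = ?p $ l * ?q $ j" for j l by auto
    obtain l where l: "?q $ l \<noteq> 0"
      using Y_line(1)[OF assms(2) rep_in[OF assms(2)]] by (auto simp: vec_eq_iff)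
    obtain l' where l': "?p $ l' \<noteq> 0"
      using Y_line(1)[OF assms(1) rep_in[OF assms(1)]] by (auto simp: vec_eq_iff)
    have "?p $ l \<noteq> 0" using eq[of l' l] l l' by auto
    moreover have "?p $ j = (?p $ l / ?q $ l) * ?q $ j" for j using eq[of j l] l by (simp add: field_simps)
    then have "?p = (?p $ l / ?q $ l) *s ?q" unfolding vec_eq_iff vector_smult_component by blast
    ultimately have "?p \<in> Q" using Y_line(2)[OF assms(2) rep_in[OF assms(2)]] l
      by (metis (mono_tags, lifting) divide_eq_0_iff mem_Collect_eq)
    then show False using Y_eqI[OF assms(1,2) rep_in[OF assms(1)]] assms(3) by blast
  qed
  then obtain j l where jl: "?p $ j * ?q $ l - ?p $ l * ?q $ j \<noteq> 0" by blast
  let ?f = "\<lambda>v. ?q $ l * v $ j + (- ?q $ j) * v $ l"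
  show ?thesis
  proof (rule that)
    show "form 1 ?f" by (intro form_add form_cmult form_coord)
    show "\<forall>v\<in>P. ?f v \<noteq> 0"
    proof
      fix v assume "v \<in> P"
      then obtain c where "c \<noteq> 0" "v = c *s ?p" using Y_points[OF assms(1)] by blast
      moreover have "?f (c *s ?p) = c * (?p $ j * ?q $ l - ?p $ l * ?q $ j)" by (simp add: algebra_simps)
      ultimately show "?f v \<noteq> 0" using jl by simp
    qed
    show "\<forall>v\<in>Q. ?f v = 0"
    proof
      fix v assume "v \<in> Q"
      then obtain c where "v = c *s ?q" using Y_points[OF assms(2)] by blast
      then show "?f v = 0" by simp
    qed
  qed
qed

lemma separating_form_finite:
  assumes "finite B" "B \<subseteq> Y" "P \<in> Y" "P \<notin> B"
  obtains d f where "form d f" "\<forall>v\<in>P. f v \<noteq> 0" "\<forall>Q\<in>B. \<forall>v\<in>Q. f v = 0"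
proof -
  have "\<exists>d f. form d f \<and> (\<forall>v\<in>P. f v \<noteq> 0) \<and> (\<forall>Q\<in>B. \<forall>v\<in>Q. f v = 0)"
    using assms
  proof (induction B)
    case empty
    show ?case using form_const[of 1] by (intro exI[of _ 0] exI[of _ "\<lambda>_. 1"]) simp
  next
    case (insert Q B)
    then obtain d f where f: "form d f" "\<forall>v\<in>P. f v \<noteq> 0" "\<forall>Q\<in>B. \<forall>v\<in>Q. f v = 0" by auto
    obtain e g where g: "form e g" "\<forall>v\<in>P. g v \<noteq> 0" "\<forall>v\<in>Q. g v = 0"
      using separating_form[of P Q] insert.prems by auto
    show ?case using form_mult[OF f(1) g(1)] f g
      by (intro exI[of _ "d + e"] exI[of _ "\<lambda>v. f v * g v"]) auto
  qed
  then show ?thesis using that by blast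
qed

text \<open>Dividing by the d-th power of a coordinate that is nonzero at \<open>P\<close> turns a
  form into a germ with the same zeros nearby.\<close>

lemma rg_of_form2:
  assumes "form2 d f" "P \<in> Y"
  obtains \<Psi> where "rg (near Y P) \<Psi>"
    "\<forall>\<^sub>F Q in near Y P. \<forall>t u. \<Psi> Q t u \<noteq> 0 \<longleftrightarrow> (\<forall>v\<in>Q. f (v, t, u) \<noteq> 0)"
proof -
  obtain i where i: "xc i P \<noteq> 0" using ex_chart[OF assms(2)] .
  have g: "form d (\<lambda>v. (v $ Some i) ^ d)" using form_power[OF form_coord[of "Some i"], of d] by simp
  note near = near_chart[OF assms(2) i]
  show ?thesis
  proof (rule that)
    show "rg (near Y P) (\<lambda>Q t u. f (rep Q, t, u) / xc i Q ^ d)"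
    proof (rule rgI[OF assms(1) g])
      show "\<forall>\<^sub>F Q in near Y P. \<forall>v\<in>Q. (v $ Some i) ^ d \<noteq> 0 \<and>
         (\<forall>t u. f (rep Q, t, u) / xc i Q ^ d = f (v, t, u) / (v $ Some i) ^ d)"
        using near
      proof eventually_elim
        case (elim Q)
        show ?case
        proof
          fix v assume v: "v \<in> Q"
          obtain c where c: "c \<noteq> 0" "v = c *s rep Q" using Y_points[of Q v] elim v by blast
          show "(v $ Some i) ^ d \<noteq> 0 \<and> (\<forall>t u. f (rep Q, t, u) / xc i Q ^ d = f (v, t, u) / (v $ Some i) ^ d)"
            using elim c form2_scale[OF assms(1), of c "rep Q"] by (simp add: xc_def power_mult_distrib)
        qed
      qed
    qed
    show "\<forall>\<^sub>F Q in near Y P. \<forall>t u. f (rep Q, t, u) / xc i Q ^ d \<noteq> 0 \<longleftrightarrow> (\<forall>v\<in>Q. f (v, t, u) \<noteq> 0)"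
      using near
    proof eventually_elim
      case (elim Q)
      have eq: "f (v, t, u) \<noteq> 0 \<longleftrightarrow> f (rep Q, t, u) \<noteq> 0" if v: "v \<in> Q" for v t u
      proof -
        obtain c where c: "c \<noteq> 0" "v = c *s rep Q" using Y_points[of Q v] elim v by blast
        have "f (v, t, u) = c ^ d * f (rep Q, t, u)" using form2_scale[OF assms(1), of c "rep Q"] c(2) by metis
        then show ?thesis using c(1) by simp
      qed
      have "rep Q \<in> Q" using elim rep_in by blast
      then have "(\<forall>v\<in>Q. f (v, t, u) \<noteq> 0) \<longleftrightarrow> f (rep Q, t, u) \<noteq> 0" for t u using eq by blast
      then show ?case using elim by simp
    qed
  qed
qed

text \<open>Back from germs to forms: the numerator is multiplied by a form that vanishes on the
  finitely many points where the representation or \<Phi> fails, so its nonvanishing certifies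
  both.\<close>

lemma form2_of_rg:
  assumes "P \<in> Y" "rg (near Y P) \<Psi>" "eventually \<Phi> (near Y P)" "\<Psi> P t0 u0 \<noteq> 0"
  obtains d f where "form2 d f" "\<forall>v\<in>P. f (v, t0, u0) \<noteq> 0"
    "\<And>Q t u. Q \<in> Y \<Longrightarrow> \<forall>v\<in>Q. f (v, t, u) \<noteq> 0 \<Longrightarrow> \<Phi> Q \<and> \<Psi> Q t u \<noteq> 0"
proof -
  obtain d f g where fg: "form2 d f" "form d g"
    "\<forall>\<^sub>F Q in near Y P. \<forall>v\<in>Q. g v \<noteq> 0 \<and> (\<forall>t u. \<Psi> Q t u = f (v, t, u) / g v)"
    using assms(2) unfolding rg_def by blast
  define G where "G = (\<lambda>Q. \<Phi> Q \<and> (\<forall>v\<in>Q. g v \<noteq> 0 \<and> (\<forall>t u. \<Psi> Q t u = f (v, t, u) / g v)))"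
  have G: "eventually G (near Y P)" unfolding G_def using assms(3) fg(3) by eventually_elim blast
  define B where "B = {Q\<in>Y. \<not> G Q}"
  have B: "finite B" "B \<subseteq> Y" "P \<notin> B" using G by (auto simp: B_def eventually_near eventually_cofin)
  obtain e h where h: "form e h" "\<forall>v\<in>P. h v \<noteq> 0" "\<forall>Q\<in>B. \<forall>v\<in>Q. h v = 0"
    using separating_form_finite[OF B(1,2) assms(1) B(3)] by blast
  show ?thesis
  proof (rule that)
    show "form2 (d + e) (\<lambda>p. f p * (\<lambda>(v, t, u). h v) p)" by (intro form2_mult form2_of_form fg h)
    show "\<forall>v\<in>P. f (v, t0, u0) * (\<lambda>(v, t, u). h v) (v, t0, u0) \<noteq> 0"
      using h(2) fg(3) assms(4) by (auto simp: eventually_near)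
    fix Q t u assume Q: "Q \<in> Y" "\<forall>v\<in>Q. f (v, t, u) * (\<lambda>(v, t, u). h v) (v, t, u) \<noteq> 0"
    have r: "rep Q \<in> Q" using rep_in[OF Q(1)] .
    then have "Q \<notin> B" using h(3) Q(2) by auto
    then have "G Q" using Q(1) by (simp add: B_def)
    then show "\<Phi> Q \<and> \<Psi> Q t u \<noteq> 0" using r Q(2) unfolding G_def by auto
  qed
qed

lemma fibre_in_Y:
  assumes "\<forall>c\<in>set cs. standard_etale Y c" "x \<in> fibre cs P" shows "P \<in> Y"
proof -
  obtain i t where "i < length cs" "t \<in> chart_fibre (cs ! i) P" using assms(2) by (auto simp: fibre_def)
  then have "P \<in> base (cs ! i)" "standard_etale Y (cs ! i)" using assms(1) by (auto simp: chart_fibre_def)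
  then show ?thesis unfolding standard_etale_def zariski_open_in_def by blast
qed

text \<open>Local constancy tested on germs: a Zariski neighbourhood in the fibre product may be
  given by a regular \<Psi> and any property that holds along \<open>near Y P\<close>.\<close>

lemma const_sectionI:
  assumes cs: "\<forall>c\<in>set cs. standard_etale Y c"
    and *: "\<And>P i t j u. (i, t) \<in> fibre cs P \<Longrightarrow> (j, u) \<in> fibre cs' P \<Longrightarrow>
      \<exists>\<Psi>. rg (near Y P) \<Psi> \<and> \<Psi> P t u \<noteq> 0 \<and> (\<forall>\<^sub>F Q in near Y P. \<forall>t' u'.
         (i, t') \<in> fibre cs Q \<and> (j, u') \<in> fibre cs' Q \<and> \<Psi> Q t' u' \<noteq> 0 \<longrightarrow>
           [w Q (i, t') (j, u') = w P (i, t) (j, u)] (mod int m))"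
  shows "const_section m cs cs' w"
  unfolding const_section_def
proof (intro allI impI)
  fix P i t j u assume fib: "(i, t) \<in> fibre cs P \<and> (j, u) \<in> fibre cs' P"
  then have P: "P \<in> Y" using fibre_in_Y[OF cs] by blast
  obtain \<Psi> where \<Psi>: "rg (near Y P) \<Psi>" "\<Psi> P t u \<noteq> 0" "\<forall>\<^sub>F Q in near Y P. \<forall>t' u'.
         (i, t') \<in> fibre cs Q \<and> (j, u') \<in> fibre cs' Q \<and> \<Psi> Q t' u' \<noteq> 0 \<longrightarrow>
           [w Q (i, t') (j, u') = w P (i, t) (j, u)] (mod int m)" using * fib by blast
  obtain d f where f: "form2 d f" "\<forall>v\<in>P. f (v, t, u) \<noteq> 0"
    "\<And>Q t' u'. Q \<in> Y \<Longrightarrow> \<forall>v\<in>Q. f (v, t', u') \<noteq> 0 \<Longrightarrow> (\<forall>t' u'.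
         (i, t') \<in> fibre cs Q \<and> (j, u') \<in> fibre cs' Q \<and> \<Psi> Q t' u' \<noteq> 0 \<longrightarrow>
           [w Q (i, t') (j, u') = w P (i, t) (j, u)] (mod int m)) \<and> \<Psi> Q t' u' \<noteq> 0"
    by (rule form2_of_rg[OF P \<Psi>(1,3,2)]) blast
  show "\<exists>d f. form2 d f \<and> (\<forall>v\<in>P. f (v, t, u) \<noteq> 0) \<and>
     (\<forall>Q t' u'. (i, t') \<in> fibre cs Q \<and> (j, u') \<in> fibre cs' Q \<and> (\<forall>v\<in>Q. f (v, t', u') \<noteq> 0) \<longrightarrow>
        [w Q (i, t') (j, u') = w P (i, t) (j, u)] (mod int m))"
    using f(1,2)
  proof (intro exI conjI allI impI; assumption?)
    fix Q t' u' assume q: "(i, t') \<in> fibre cs Q \<and> (j, u') \<in> fibre cs' Q \<and> (\<forall>v\<in>Q. f (v, t', u') \<noteq> 0)"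
    then have "Q \<in> Y" using fibre_in_Y[OF cs] by blast
    from f(3)[OF this] q show "[w Q (i, t') (j, u') = w P (i, t) (j, u)] (mod int m)" by blast
  qed
qed

lemma const_sectionD:
  assumes "const_section m cs cs' w" "P \<in> Y" "(i, t) \<in> fibre cs P" "(j, u) \<in> fibre cs' P"
  obtains \<Psi> where "rg (near Y P) \<Psi>" "\<Psi> P t u \<noteq> 0" "\<forall>\<^sub>F Q in near Y P. \<forall>t' u'.
         (i, t') \<in> fibre cs Q \<and> (j, u') \<in> fibre cs' Q \<and> \<Psi> Q t' u' \<noteq> 0 \<longrightarrow>
           [w Q (i, t') (j, u') = w P (i, t) (j, u)] (mod int m)"
proof -
  obtain d f where f: "form2 d f" "\<forall>v\<in>P. f (v, t, u) \<noteq> 0"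
    "\<forall>Q t' u'. (i, t') \<in> fibre cs Q \<and> (j, u') \<in> fibre cs' Q \<and> (\<forall>v\<in>Q. f (v, t', u') \<noteq> 0) \<longrightarrow>
        [w Q (i, t') (j, u') = w P (i, t) (j, u)] (mod int m)"
    using assms(1)[unfolded const_section_def, rule_format, OF conjI[OF assms(3,4)]] by blast
  obtain \<Psi> where \<Psi>: "rg (near Y P) \<Psi>"
    "\<forall>\<^sub>F Q in near Y P. \<forall>t u. \<Psi> Q t u \<noteq> 0 \<longleftrightarrow> (\<forall>v\<in>Q. f (v, t, u) \<noteq> 0)"
    by (rule rg_of_form2[OF f(1) assms(2)])
  show ?thesis
  proof (rule that[OF \<Psi>(1)])
    show "\<Psi> P t u \<noteq> 0" using \<Psi>(2) f(2) by (simp add: eventually_near)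
    show "\<forall>\<^sub>F Q in near Y P. \<forall>t' u'.
         (i, t') \<in> fibre cs Q \<and> (j, u') \<in> fibre cs' Q \<and> \<Psi> Q t' u' \<noteq> 0 \<longrightarrow>
           [w Q (i, t') (j, u') = w P (i, t) (j, u)] (mod int m)"
      using \<Psi>(2) by eventually_elim (use f(3) in blast)
  qed
qed

lemma cech_cocycleD:
  assumes "cech_cocycle Y m (cs, g)"
  shows "\<forall>c\<in>set cs. standard_etale Y c" "\<And>P. P \<in> Y \<Longrightarrow> fibre cs P \<noteq> {}" "const_section m cs cs g"
    "\<And>P u v w. u \<in> fibre cs P \<Longrightarrow> v \<in> fibre cs P \<Longrightarrow> w \<in> fibre cs P \<Longrightarrow>
       [g P u v + g P v w = g P u w] (mod int m)"
  using assms unfolding cech_cocycle_def etale_covering_def by auto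

lemma const_section_swap:
  assumes "const_section m cs cs' w" shows "const_section m cs' cs (\<lambda>P u u'. - w P u' u)"
  unfolding const_section_def
proof (intro allI impI)
  fix P i t j u assume fib: "(i, t) \<in> fibre cs' P \<and> (j, u) \<in> fibre cs P"
  then obtain d f where f: "form2 d f" "\<forall>v\<in>P. f (v, u, t) \<noteq> 0"
    "\<forall>Q t' u'. (j, t') \<in> fibre cs Q \<and> (i, u') \<in> fibre cs' Q \<and> (\<forall>v\<in>Q. f (v, t', u') \<noteq> 0) \<longrightarrow>
        [w Q (j, t') (i, u') = w P (j, u) (i, t)] (mod int m)"
    using assms unfolding const_section_def by blast
  show "\<exists>d f. form2 d f \<and> (\<forall>v\<in>P. f (v, t, u) \<noteq> 0) \<and>
     (\<forall>Q t' u'. (i, t') \<in> fibre cs' Q \<and> (j, u') \<in> fibre cs Q \<and> (\<forall>v\<in>Q. f (v, t', u') \<noteq> 0) \<longrightarrow>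
        [- w Q (j, u') (i, t') = - w P (j, u) (i, t)] (mod int m))"
    using form2_swap[OF f(1)] f(2,3)
    by (intro exI[of _ d] exI[of _ "\<lambda>(v, t, u). f (v, u, t)"]) (auto simp: cong_minus_minus_iff)
qed

lemma cohomologous_sym:
  assumes "(a, b) \<in> cohomologous Y m" shows "(b, a) \<in> cohomologous Y m"
proof -
  obtain cs g cs' g' where ab: "a = (cs, g)" "b = (cs', g')" by fastforce
  obtain w where w: "cech_cocycle Y m (cs, g)" "cech_cocycle Y m (cs', g')" "const_section m cs cs' w"
    "\<And>P u v u' v'. u\<in>fibre cs P \<Longrightarrow> v\<in>fibre cs P \<Longrightarrow> u'\<in>fibre cs' P \<Longrightarrow> v'\<in>fibre cs' P \<Longrightarrow>
          [g P u v - g' P u' v' = w P u u' - w P v v'] (mod int m)"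
    using assms unfolding ab cohomologous_def by blast
  have "[g' P u' v' - g P u v = - w P u u' - - w P v v'] (mod int m)"
    if "u\<in>fibre cs P" "v\<in>fibre cs P" "u'\<in>fibre cs' P" "v'\<in>fibre cs' P" for P u v u' v'
    using w(4)[OF that] by (metis (no_types, opaque_lifting) cong_minus_minus_iff minus_diff_eq minus_diff_minus)
  then show ?thesis unfolding ab cohomologous_def
    using w(1,2) const_section_swap[OF w(3)] by blast
qed

text \<open>The sum over an intermediate covering is locally constant although an intermediate point
  cannot be chosen continuously. Near a fixed point x0 of the middle fibre both summands are
  constant on open sets, and openness of the middle chart yields over every nearby pair some x in
  both of them.\<close>

lemma const_section_compose:
  assumes c: "cech_cocycle Y m (cs, g)" "cech_cocycle Y m (cs', g')"
    and w: "const_section m cs cs' w1" "const_section m cs' cs'' w2"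
    and eq: "\<And>P u u' u''. u \<in> fibre cs P \<Longrightarrow> u' \<in> fibre cs' P \<Longrightarrow> u'' \<in> fibre cs'' P \<Longrightarrow>
       [w P u u'' = w1 P u u' + w2 P u' u''] (mod int m)"
  shows "const_section m cs cs'' w"
proof (rule const_sectionI[OF cech_cocycleD(1)[OF c(1)]])
  fix P i t j u assume fib: "(i, t) \<in> fibre cs P" "(j, u) \<in> fibre cs'' P"
  then have P: "P \<in> Y" using fibre_in_Y[OF cech_cocycleD(1)[OF c(1)]] by blast
  note near = eventually_near_mem[OF P]
  obtain k x0 where x: "(k, x0) \<in> fibre cs' P" using cech_cocycleD(2)[OF c(2) P] by auto
  obtain \<Psi>1 where \<Psi>1: "rg (near Y P) \<Psi>1" "\<Psi>1 P t x0 \<noteq> 0" "\<forall>\<^sub>F Q in near Y P. \<forall>t' u'.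
         (i, t') \<in> fibre cs Q \<and> (k, u') \<in> fibre cs' Q \<and> \<Psi>1 Q t' u' \<noteq> 0 \<longrightarrow>
           [w1 Q (i, t') (k, u') = w1 P (i, t) (k, x0)] (mod int m)"
    by (rule const_sectionD[OF w(1) P fib(1) x])
  obtain \<Psi>2 where \<Psi>2: "rg (near Y P) \<Psi>2" "\<Psi>2 P x0 u \<noteq> 0" "\<forall>\<^sub>F Q in near Y P. \<forall>t' u'.
         (k, t') \<in> fibre cs' Q \<and> (j, u') \<in> fibre cs'' Q \<and> \<Psi>2 Q t' u' \<noteq> 0 \<longrightarrow>
           [w2 Q (k, t') (j, u') = w2 P (k, x0) (j, u)] (mod int m)"
    by (rule const_sectionD[OF w(2) P x fib(2)])
  obtain p1 where p1: "rpp (near Y P) (\<lambda>Q t u. p1 Q t)" "\<forall>\<^sub>F Q in near Y P. \<forall>t u. \<Psi>1 Q t u = poly (p1 Q t) u"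
    by (rule rg_as_poly[OF near \<Psi>1(1)])
  obtain p2 where p2: "rpp (near Y P) (\<lambda>Q t u. p2 Q t)" "\<forall>\<^sub>F Q in near Y P. \<forall>t u. \<Psi>2 Q u t = poly (p2 Q t) u"
    by (rule rg_as_poly[OF near rg_swap[OF \<Psi>2(1)]])
  have kx: "k < length cs'" "x0 \<in> chart_fibre (cs' ! k) P" using x by (auto simp: fibre_def)
  then have se: "standard_etale Y (cs' ! k)" using cech_cocycleD(1)[OF c(2)] by simp
  \<comment> \<open>A root of the middle chart at which this product is nonzero satisfies both
    neighbourhood conditions at once.\<close>
  have rp: "rpp (near Y P) (\<lambda>Q t u. p1 Q t * p2 Q u)" by (intro rpp_mult p1(1) rpp_swap[OF p2(1)])
  have nz: "poly (p1 P t * p2 P u) x0 \<noteq> 0"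
    using p1(2) p2(2) \<Psi>1(2) \<Psi>2(2) by (simp add: eventually_near)
  obtain \<Psi> where \<Psi>: "rg (near Y P) \<Psi>" "\<Psi> P t u \<noteq> 0"
    "\<forall>\<^sub>F Q in near Y P. \<forall>t u. \<Psi> Q t u \<noteq> 0 \<longrightarrow> (\<exists>x\<in>chart_fibre (cs' ! k) Q. poly (p1 Q t * p2 Q u) x \<noteq> 0)"
    by (rule chart_openness[OF se kx(2) rp, of t u, OF nz])
  have "\<forall>\<^sub>F Q in near Y P. \<forall>t' u'.
         (i, t') \<in> fibre cs Q \<and> (j, u') \<in> fibre cs'' Q \<and> \<Psi> Q t' u' \<noteq> 0 \<longrightarrow>
           [w Q (i, t') (j, u') = w P (i, t) (j, u)] (mod int m)"
    using \<Psi>(3) p1(2) p2(2) \<Psi>1(3) \<Psi>2(3)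
  proof eventually_elim
    case (elim Q)
    show ?case
    proof (intro allI impI)
      fix t' u' assume h: "(i, t') \<in> fibre cs Q \<and> (j, u') \<in> fibre cs'' Q \<and> \<Psi> Q t' u' \<noteq> 0"
      then obtain x where x': "x \<in> chart_fibre (cs' ! k) Q" "poly (p1 Q t' * p2 Q u') x \<noteq> 0"
        using elim(1) by blast
      then have xf: "(k, x) \<in> fibre cs' Q" using kx(1) by (simp add: fibre_def)
      have nz: "\<Psi>1 Q t' x \<noteq> 0" "\<Psi>2 Q x u' \<noteq> 0" using x'(2) elim(2,3) by auto
      have "[w Q (i, t') (j, u') = w1 Q (i, t') (k, x) + w2 Q (k, x) (j, u')] (mod int m)"
        using eq h xf by blast
      also have "[w1 Q (i, t') (k, x) + w2 Q (k, x) (j, u') = w1 P (i, t) (k, x0) + w2 P (k, x0) (j, u)] (mod int m)"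
        using elim(4,5) h xf nz by (intro cong_add) auto
      also have "[w1 P (i, t) (k, x0) + w2 P (k, x0) (j, u) = w P (i, t) (j, u)] (mod int m)"
        using eq[OF fib(1) x fib(2)] by (rule cong_sym)
      finally show "[w Q (i, t') (j, u') = w P (i, t) (j, u)] (mod int m)" .
    qed
  qed
  with \<Psi>(1,2) show "\<exists>\<Psi>. rg (near Y P) \<Psi> \<and> \<Psi> P t u \<noteq> 0 \<and> (\<forall>\<^sub>F Q in near Y P. \<forall>t' u'.
         (i, t') \<in> fibre cs Q \<and> (j, u') \<in> fibre cs'' Q \<and> \<Psi> Q t' u' \<noteq> 0 \<longrightarrow>
           [w Q (i, t') (j, u') = w P (i, t) (j, u)] (mod int m))" by blast
qed

text \<open>On the triple fibre product \<open>w1\<close> + \<open>w2\<close> is the required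
  cochain. By the two coboundary relations its residue does not depend on the middle point, so it
  descends to the product of the outer coverings.\<close>

lemma cohomologous_trans:
  assumes "(a, b) \<in> cohomologous Y m" "(b, c) \<in> cohomologous Y m" shows "(a, c) \<in> cohomologous Y m"
proof -
  obtain cs g cs' g' cs'' g'' where abc: "a = (cs, g)" "b = (cs', g')" "c = (cs'', g'')" by (metis surj_pair)
  obtain w1 where w1: "cech_cocycle Y m (cs, g)" "cech_cocycle Y m (cs', g')" "const_section m cs cs' w1"
    "\<And>P u v u' v'. u\<in>fibre cs P \<Longrightarrow> v\<in>fibre cs P \<Longrightarrow> u'\<in>fibre cs' P \<Longrightarrow> v'\<in>fibre cs' P \<Longrightarrow>
          [g P u v - g' P u' v' = w1 P u u' - w1 P v v'] (mod int m)"
    using assms(1) unfolding abc cohomologous_def by blast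
  obtain w2 where w2: "cech_cocycle Y m (cs'', g'')" "const_section m cs' cs'' w2"
    "\<And>P u v u' v'. u\<in>fibre cs' P \<Longrightarrow> v\<in>fibre cs' P \<Longrightarrow> u'\<in>fibre cs'' P \<Longrightarrow> v'\<in>fibre cs'' P \<Longrightarrow>
          [g' P u v - g'' P u' v' = w2 P u u' - w2 P v v'] (mod int m)"
    using assms(2) unfolding abc cohomologous_def by blast
  have zero: "[g P u u = 0] (mod int m)" if "cech_cocycle Y m (cs, g)" "u \<in> fibre cs P" for cs g P u
    using cech_cocycleD(4)[OF that(1) that(2) that(2) that(2)] by (simp only: cong_add_lcancel_0)
  \<comment> \<open>Any middle point serves, since the choice only changes the value by a multiple
    of m.\<close>
  define w where "w = (\<lambda>P u u''. w1 P u (SOME x. x \<in> fibre cs' P) + w2 P (SOME x. x \<in> fibre cs' P) u'')"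
  have w: "[w P u u'' = w1 P u u' + w2 P u' u''] (mod int m)"
    if u: "u \<in> fibre cs P" "u' \<in> fibre cs' P" "u'' \<in> fibre cs'' P" for P u u' u''
  proof -
    define x where "x = (SOME x. x \<in> fibre cs' P)"
    have x: "x \<in> fibre cs' P" unfolding x_def using u(2) by (rule someI)
    \<comment> \<open>The relations are taken with equal outer points; the terms in g' cancel, and
      diagonal values of a cocycle are 0 modulo m.\<close>
    have "[g P u u - g' P x u' + (g' P x u' - g'' P u'' u'') =
      w1 P u x - w1 P u u' + (w2 P x u'' - w2 P u' u'')] (mod int m)"
      by (intro cong_add w1(4) w2(3) u x)
    moreover have "[g P u u - g'' P u'' u'' = 0 - 0] (mod int m)"
      by (intro cong_diff zero[OF w1(1)] zero[OF w2(1)] u)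
    ultimately have "[w1 P u x - w1 P u u' + (w2 P x u'' - w2 P u' u'') = 0] (mod int m)"
      by (simp add: cong_def)
    moreover have "w1 P u x - w1 P u u' + (w2 P x u'' - w2 P u' u'') = w P u u'' - (w1 P u u' + w2 P u' u'')"
      by (simp add: w_def x_def)
    ultimately show ?thesis by (simp add: cong_diff_iff_cong_0)
  qed
  have "const_section m cs cs'' w" by (rule const_section_compose[OF w1(1,2,3) w2(2) w])
  moreover have "[g P u v - g'' P u' v' = w P u u' - w P v v'] (mod int m)"
    if u: "u\<in>fibre cs P" "v\<in>fibre cs P" "u'\<in>fibre cs'' P" "v'\<in>fibre cs'' P" for P u v u' v'
  proof -
    obtain x where x: "x \<in> fibre cs' P"
      using cech_cocycleD(2)[OF w1(2) fibre_in_Y[OF cech_cocycleD(1)[OF w1(1)] u(1)]] by blast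
    have "[w P u u' - w P v v' = (w1 P u x + w2 P x u') - (w1 P v x + w2 P x v')] (mod int m)"
      by (intro cong_diff w u x)
    also have "(w1 P u x + w2 P x u') - (w1 P v x + w2 P x v') = (w1 P u x - w1 P v x) + (w2 P x u' - w2 P x v')"
      by simp
    also have "[\<dots> = (g P u v - g' P x x) + (g' P x x - g'' P u' v')] (mod int m)"
      by (intro cong_add cong_sym[OF w1(4)] cong_sym[OF w2(3)] u x)
    finally show ?thesis by (simp add: cong_sym)
  qed
  ultimately show ?thesis unfolding abc cohomologous_def using w1(1) w2(1) by blast
qed

end

section \<open>Pullback along permutations of the coordinates\<close>

lemma perm3_cases:
  assumes "bij (\<sigma> :: 3 \<Rightarrow> 3)"
  obtains (id) "\<sigma> = id"
  | (transp) i where "\<sigma> = Transposition.transpose (i + 1) (i + 2)"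
  | (cycle) "\<sigma> = (\<lambda>k. k + 1)" | (cycle2) "\<sigma> = (\<lambda>k. k + 2)"
proof -
  have ext: "\<sigma> = f" if "\<sigma> 1 = f 1" "\<sigma> 2 = f 2" "\<sigma> 3 = f 3" for f
    using that by (intro ext) (metis exhaust_3)
  have inj: "\<sigma> 1 \<noteq> \<sigma> 2" "\<sigma> 2 \<noteq> \<sigma> 3" "\<sigma> 1 \<noteq> \<sigma> 3"
    using assms by (auto simp: bij_def inj_def dest!: spec)
  consider "\<sigma> 1 = 1" "\<sigma> 2 = 2" "\<sigma> 3 = 3" | "\<sigma> 1 = 1" "\<sigma> 2 = 3" "\<sigma> 3 = 2"
    | "\<sigma> 1 = 2" "\<sigma> 2 = 1" "\<sigma> 3 = 3" | "\<sigma> 1 = 2" "\<sigma> 2 = 3" "\<sigma> 3 = 1"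
    | "\<sigma> 1 = 3" "\<sigma> 2 = 1" "\<sigma> 3 = 2" | "\<sigma> 1 = 3" "\<sigma> 2 = 2" "\<sigma> 3 = 1"
    using inj exhaust_3[of "\<sigma> 1"] exhaust_3[of "\<sigma> 2"] exhaust_3[of "\<sigma> 3"] by metis
  then show ?thesis
  proof cases
    case 1 then show ?thesis by (intro that(1) ext) auto
  next
    case 2 then show ?thesis by (intro that(2)[of 1] ext) (auto simp: Transposition.transpose_def)
  next
    case 3 then show ?thesis by (intro that(2)[of 0] ext) (auto simp: Transposition.transpose_def)
  next
    case 4 then show ?thesis by (intro that(3) ext) auto
  next
    case 5 then show ?thesis by (intro that(4) ext) auto
  next
    case 6 then show ?thesis by (intro that(2)[of 2] ext) (auto simp: Transposition.transpose_def)
  qed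
qed

lemma cycle3_transpose:
  "(\<lambda>k::3. k + 1) = Transposition.transpose (0 + 1) (0 + 2) \<circ> Transposition.transpose (1 + 1) (1 + 2)"
  "(\<lambda>k::3. k + 2) = Transposition.transpose (1 + 1) (1 + 2) \<circ> Transposition.transpose (0 + 1) (0 + 2)"
proof -
  have ext: "f = g" if "f 1 = g 1" "f 2 = g 2" "f 3 = g 3" for f g :: "3 \<Rightarrow> 3"
    using that by (intro ext) (metis exhaust_3)
  show "(\<lambda>k::3. k + 1) = Transposition.transpose (0 + 1) (0 + 2) \<circ> Transposition.transpose (1 + 1) (1 + 2)"
    by (rule ext) (simp_all add: Transposition.transpose_def)
  show "(\<lambda>k::3. k + 2) = Transposition.transpose (1 + 1) (1 + 2) \<circ> Transposition.transpose (0 + 1) (0 + 2)"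
    by (rule ext) (simp_all add: Transposition.transpose_def)
qed

lemma sign_perm3:
  "sign (Transposition.transpose (i + 1) (i + 2 :: 3)) = -1"
  "sign (\<lambda>k::3. k + 1) = 1" "sign (\<lambda>k::3. k + 2) = 1"
proof -
  show *: "sign (Transposition.transpose (i + 1) (i + 2 :: 3)) = -1" for i
    using shift_3_neq[of i] by (simp add: sign_swap_id)
  have p: "permutation (Transposition.transpose a (b::3))" for a b by (rule permutation_swap_id)
  show "sign (\<lambda>k::3. k + 1) = 1" "sign (\<lambda>k::3. k + 2) = 1"
    unfolding cycle3_transpose by (subst sign_compose[OF p p], subst (1 2) *, simp)+
qed

definition pvec :: "(3 \<Rightarrow> 3) \<Rightarrow> 'k^(3 option) \<Rightarrow> 'k^(3 option)" where
  "pvec \<sigma> v = (\<chi> j. v $ map_option (inv_into UNIV \<sigma>) j)"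

lemma perm_point_pvec: "perm_point \<sigma> P = pvec \<sigma> ` P"
  by (simp add: perm_point_def pvec_def[abs_def])

lemma pvec_smult: "pvec \<sigma> (c *s v) = c *s pvec \<sigma> (v :: 'k::field^(3 option))"
  by (simp add: pvec_def vec_eq_iff)

lemma pvec_compose:
  assumes "bij \<sigma>" "bij \<tau>" shows "pvec \<sigma> (pvec \<tau> v) = pvec (\<sigma> \<circ> \<tau>) v"
  using assms by (simp add: pvec_def vec_eq_iff option.map_comp o_inv_distrib)

lemma perm_point_compose:
  assumes "bij \<sigma>" "bij \<tau>" shows "perm_point \<sigma> (perm_point \<tau> P) = perm_point (\<sigma> \<circ> \<tau>) P"
  unfolding perm_point_pvec image_image pvec_compose[OF assms] ..

lemma form_pvec:
  assumes "form d f" shows "form d (\<lambda>v. f (pvec \<sigma> v))"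
  using assms unfolding form_def
proof (induction rule: graded_poly.induct)
  case (proj_coord l)
  then obtain j where "l = (\<lambda>v. v $ j)" by auto
  then show ?case using form_coord[of "map_option (inv_into UNIV \<sigma>) j"] by (simp add: pvec_def form_def)
qed (auto intro: graded_poly.intros)

lemma form2_pvec:
  assumes "form2 d f" shows "form2 d (\<lambda>(v, t, u). f (pvec \<sigma> v, t, u))"
proof -
  have "form2 d (\<lambda>p. f (pvec \<sigma> (fst p), snd p))"
    using assms[unfolded form2_def]
  proof (induction rule: graded_poly.induct)
    case (proj_coord l)
    then obtain j where "l = (\<lambda>(v, t, u). v $ j)" by auto
    then show ?case using form2_coord[of "map_option (inv_into UNIV \<sigma>) j"] by (simp add: pvec_def case_prod_unfold)
  next
    case (affine_coord a)
    then show ?case using form2_fst form2_snd by (auto simp: case_prod_unfold)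
  qed (auto intro: form2_const form2_add form2_mult)
  then show ?thesis by (simp add: case_prod_unfold)
qed

section \<open>Action of coordinate permutations on cocycles and reduction to reflections\<close>

context cubic_curve begin

lemma perm_point_in_Y:
  assumes "bij \<sigma>" "P \<in> Y" shows "perm_point \<sigma> P \<in> Y"
proof -
  let ?v = "rep P"
  note v = Y_line[OF assms(2) rep_in[OF assms(2)]]
  have b: "bij (inv_into UNIV \<sigma>)" using assms(1) by (rule bij_imp_bij_inv)
  have "(\<Sum>i\<in>UNIV. pvec \<sigma> ?v $ Some i) = (\<Sum>i\<in>UNIV. ?v $ Some i)"
    using sum.reindex_bij_betw[OF b, of "\<lambda>i. ?v $ Some i"] by (simp add: pvec_def)
  moreover have "(\<Prod>i\<in>UNIV. pvec \<sigma> ?v $ Some i) = (\<Prod>i\<in>UNIV. ?v $ Some i)"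
    using prod.reindex_bij_betw[OF b, of "\<lambda>i. ?v $ Some i"] by (simp add: pvec_def)
  moreover have "pvec \<sigma> ?v \<noteq> 0"
  proof
    assume 0: "pvec \<sigma> ?v = 0"
    have "?v $ j = 0" for j
    proof -
      have "j = map_option (inv_into UNIV \<sigma>) (map_option \<sigma> j)"
        using assms(1) by (simp add: option.map_comp bij_is_inj option.map_id)
      then have "?v $ j = pvec \<sigma> ?v $ map_option \<sigma> j" by (simp add: pvec_def)
      then show ?thesis using 0 by simp
    qed
    then show False using v(1) by (simp add: vec_eq_iff)
  qed
  moreover have "perm_point \<sigma> P = {c *s pvec \<sigma> ?v | c. c \<noteq> 0}"
  proof -
    have "pvec \<sigma> ` {c *s ?v | c. c \<noteq> 0} = {c *s pvec \<sigma> ?v | c. c \<noteq> 0}"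
    proof (intro equalityI subsetI)
      fix x assume "x \<in> {c *s pvec \<sigma> ?v | c. c \<noteq> 0}"
      then obtain c where "c \<noteq> 0" "x = pvec \<sigma> (c *s ?v)" by (auto simp: pvec_smult)
      then show "x \<in> pvec \<sigma> ` {c *s ?v | c. c \<noteq> 0}" by blast
    qed (auto simp: pvec_smult)
    then show ?thesis unfolding perm_point_pvec using v(2) by simp
  qed
  ultimately show ?thesis using v(3,4)
    unfolding proj_curve_def proj_points_def by (auto simp: pvec_def)
qed

lemma zariski_open_pullback:
  assumes "bij \<sigma>" "zariski_open_in Y V" shows "zariski_open_in Y {P\<in>Y. perm_point \<sigma> P \<in> V}"
  unfolding zariski_open_in_def
proof (intro conjI ballI)
  fix P assume P: "P \<in> {P\<in>Y. perm_point \<sigma> P \<in> V}"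
  then obtain d f where f: "form d f" "\<forall>v\<in>perm_point \<sigma> P. f v \<noteq> 0"
    "\<forall>Q\<in>Y. (\<forall>v\<in>Q. f v \<noteq> 0) \<longrightarrow> Q \<in> V" using assms(2) unfolding zariski_open_in_def by blast
  show "\<exists>d f. form d f \<and> (\<forall>v\<in>P. f v \<noteq> 0) \<and> (\<forall>Q\<in>Y. (\<forall>v\<in>Q. f v \<noteq> 0) \<longrightarrow> Q \<in> {P\<in>Y. perm_point \<sigma> P \<in> V})"
    using form_pvec[OF f(1), of \<sigma>] f(2,3) perm_point_in_Y[OF assms(1)]
    by (intro exI[of _ d] exI[of _ "\<lambda>v. f (pvec \<sigma> v)"]) (auto simp: perm_point_pvec)
qed auto

lemma regular_on_pullback:
  assumes "bij \<sigma>" "regular_on V \<phi>" shows "regular_on {P\<in>Y. perm_point \<sigma> P \<in> V} (\<lambda>P. \<phi> (perm_point \<sigma> P))"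
  unfolding regular_on_def
proof (intro ballI)
  fix P assume P: "P \<in> {P\<in>Y. perm_point \<sigma> P \<in> V}"
  then obtain d f g where fg: "form d f" "form d g" "\<forall>v\<in>perm_point \<sigma> P. g v \<noteq> 0"
    "\<forall>Q\<in>V. \<forall>v\<in>Q. g v \<noteq> 0 \<longrightarrow> \<phi> Q = f v / g v"
    using bspec[OF assms(2)[unfolded regular_on_def], of "perm_point \<sigma> P"] by blast
  show "\<exists>d f g. form d f \<and> form d g \<and> (\<forall>v\<in>P. g v \<noteq> 0) \<and>
    (\<forall>Q\<in>{P\<in>Y. perm_point \<sigma> P \<in> V}. \<forall>v\<in>Q. g v \<noteq> 0 \<longrightarrow> \<phi> (perm_point \<sigma> Q) = f v / g v)"
    using form_pvec[OF fg(1), of \<sigma>] form_pvec[OF fg(2), of \<sigma>] fg(3,4)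
    by (intro exI[of _ d] exI[of _ "\<lambda>v. f (pvec \<sigma> v)"] exI[of _ "\<lambda>v. g (pvec \<sigma> v)"])
       (auto simp: perm_point_pvec)
qed

lemma chart_fibre_pullback:
  "chart_fibre (chart_pullback Y s c) P = (if P \<in> Y then chart_fibre c (s P) else {})"
  by (auto simp: chart_fibre_def chart_pullback_def)

lemma fibre_pullback:
  "fibre (map (chart_pullback Y s) cs) P = (if P \<in> Y then fibre cs (s P) else {})"
  by (auto simp: fibre_def chart_fibre_pullback)

lemma standard_etale_pullback:
  assumes "bij \<sigma>" "standard_etale Y c" shows "standard_etale Y (chart_pullback Y (perm_point \<sigma>) c)"
proof -
  obtain d d' where *: "zariski_open_in Y (base c)"
    "\<forall>P\<in>base c. degree (eqn c P) = d \<and> lead_coeff (eqn c P) = 1" "\<forall>P\<in>base c. degree (loc c P) \<le> d'"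
    "\<forall>i. regular_on (base c) (\<lambda>P. coeff (eqn c P) i)" "\<forall>i. regular_on (base c) (\<lambda>P. coeff (loc c P) i)"
    "\<forall>P. \<forall>t\<in>chart_fibre c P. poly (pderiv (eqn c P)) t \<noteq> 0"
    using assms(2) unfolding standard_etale_def by blast
  show ?thesis unfolding standard_etale_def
  proof (intro conjI allI ballI)
    fix i
    show "zariski_open_in Y (base (chart_pullback Y (perm_point \<sigma>) c))"
      using zariski_open_pullback[OF assms(1) *(1)] by (simp add: chart_pullback_def)
    show "\<exists>d. \<forall>P\<in>base (chart_pullback Y (perm_point \<sigma>) c).
       degree (eqn (chart_pullback Y (perm_point \<sigma>) c) P) = d \<and> lead_coeff (eqn (chart_pullback Y (perm_point \<sigma>) c) P) = 1"
      using *(2) by (auto simp: chart_pullback_def)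
    show "\<exists>d. \<forall>P\<in>base (chart_pullback Y (perm_point \<sigma>) c). degree (loc (chart_pullback Y (perm_point \<sigma>) c) P) \<le> d"
      using *(3) by (auto simp: chart_pullback_def)
    show "regular_on (base (chart_pullback Y (perm_point \<sigma>) c)) (\<lambda>P. coeff (eqn (chart_pullback Y (perm_point \<sigma>) c) P) i)"
      using regular_on_pullback[OF assms(1) spec[OF *(4), of i]] by (simp add: chart_pullback_def)
    show "regular_on (base (chart_pullback Y (perm_point \<sigma>) c)) (\<lambda>P. coeff (loc (chart_pullback Y (perm_point \<sigma>) c) P) i)"
      using regular_on_pullback[OF assms(1) spec[OF *(5), of i]] by (simp add: chart_pullback_def)
  next
    fix P t assume "t \<in> chart_fibre (chart_pullback Y (perm_point \<sigma>) c) P"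
    then have "t \<in> chart_fibre c (perm_point \<sigma> P)" by (simp add: chart_fibre_pullback split: if_splits)
    then show "poly (pderiv (eqn (chart_pullback Y (perm_point \<sigma>) c) P)) t \<noteq> 0"
      using *(6) by (simp add: chart_pullback_def)
  qed
qed

lemma const_section_pullback:
  assumes "bij \<sigma>" "const_section m cs cs' w"
  shows "const_section m (map (chart_pullback Y (perm_point \<sigma>)) cs) (map (chart_pullback Y (perm_point \<sigma>)) cs')
    (\<lambda>P. w (perm_point \<sigma> P))"
  unfolding const_section_def
proof (intro allI impI)
  fix P i t j u
  assume "(i, t) \<in> fibre (map (chart_pullback Y (perm_point \<sigma>)) cs) P \<and> (j, u) \<in> fibre (map (chart_pullback Y (perm_point \<sigma>)) cs') P"
  then have fib: "P \<in> Y" "(i, t) \<in> fibre cs (perm_point \<sigma> P)" "(j, u) \<in> fibre cs' (perm_point \<sigma> P)"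
    by (auto simp: fibre_pullback split: if_splits)
  then obtain d f where f: "form2 d f" "\<forall>v\<in>perm_point \<sigma> P. f (v, t, u) \<noteq> 0"
    "\<forall>Q t' u'. (i, t') \<in> fibre cs Q \<and> (j, u') \<in> fibre cs' Q \<and> (\<forall>v\<in>Q. f (v, t', u') \<noteq> 0) \<longrightarrow>
        [w Q (i, t') (j, u') = w (perm_point \<sigma> P) (i, t) (j, u)] (mod int m)"
    using assms(2) unfolding const_section_def by blast
  show "\<exists>d f. form2 d f \<and> (\<forall>v\<in>P. f (v, t, u) \<noteq> 0) \<and>
     (\<forall>Q t' u'. (i, t') \<in> fibre (map (chart_pullback Y (perm_point \<sigma>)) cs) Q \<and>
        (j, u') \<in> fibre (map (chart_pullback Y (perm_point \<sigma>)) cs') Q \<and> (\<forall>v\<in>Q. f (v, t', u') \<noteq> 0) \<longrightarrow>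
        [w (perm_point \<sigma> Q) (i, t') (j, u') = w (perm_point \<sigma> P) (i, t) (j, u)] (mod int m))"
  proof (intro exI conjI allI impI)
    show "form2 d (\<lambda>(v, t, u). f (pvec \<sigma> v, t, u))" by (rule form2_pvec[OF f(1)])
    show "\<forall>v\<in>P. (case (v, t, u) of (v, t, u) \<Rightarrow> f (pvec \<sigma> v, t, u)) \<noteq> 0"
      using f(2) by (simp add: perm_point_pvec)
    fix Q t' u' assume "(i, t') \<in> fibre (map (chart_pullback Y (perm_point \<sigma>)) cs) Q \<and>
        (j, u') \<in> fibre (map (chart_pullback Y (perm_point \<sigma>)) cs') Q \<and>
        (\<forall>v\<in>Q. (case (v, t', u') of (v, t, u) \<Rightarrow> f (pvec \<sigma> v, t, u)) \<noteq> 0)"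
    then have "(i, t') \<in> fibre cs (perm_point \<sigma> Q)" "(j, u') \<in> fibre cs' (perm_point \<sigma> Q)"
      "\<forall>v\<in>perm_point \<sigma> Q. f (v, t', u') \<noteq> 0"
      by (auto simp: fibre_pullback perm_point_pvec split: if_splits)
    then show "[w (perm_point \<sigma> Q) (i, t') (j, u') = w (perm_point \<sigma> P) (i, t) (j, u)] (mod int m)"
      using f(3) by blast
  qed
qed

lemma cech_cocycle_pullback:
  assumes "bij \<sigma>" "cech_cocycle Y m (cs, g)"
  shows "cech_cocycle Y m (map (chart_pullback Y (perm_point \<sigma>)) cs, \<lambda>P. g (perm_point \<sigma> P))"
proof -
  note c = cech_cocycleD[OF assms(2)]
  show ?thesis
    unfolding cech_cocycle_def etale_covering_def prod.case
  proof (intro conjI allI ballI)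
    fix c' assume "c' \<in> set (map (chart_pullback Y (perm_point \<sigma>)) cs)"
    then show "standard_etale Y c'" using standard_etale_pullback[OF assms(1)] c(1) by auto
  next
    fix P assume "P \<in> Y"
    then show "fibre (map (chart_pullback Y (perm_point \<sigma>)) cs) P \<noteq> {}"
      using c(2)[OF perm_point_in_Y[OF assms(1)]] by (simp add: fibre_pullback)
  next
    fix P u v w
    assume "u \<in> fibre (map (chart_pullback Y (perm_point \<sigma>)) cs) P"
      "v \<in> fibre (map (chart_pullback Y (perm_point \<sigma>)) cs) P" "w \<in> fibre (map (chart_pullback Y (perm_point \<sigma>)) cs) P"
    then show "[g (perm_point \<sigma> P) u v + g (perm_point \<sigma> P) v w = g (perm_point \<sigma> P) u w] (mod int m)"
      by (intro c(4)) (auto simp: fibre_pullback split: if_splits)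
  qed (rule const_section_pullback[OF assms(1) c(3)])
qed

lemma const_section_cmult:
  assumes "const_section m cs cs' w" shows "const_section m cs cs' (\<lambda>P u v. z * w P u v)"
  unfolding const_section_def
proof (intro allI impI)
  fix P i t j u assume "(i, t) \<in> fibre cs P \<and> (j, u) \<in> fibre cs' P"
  then obtain d f where "form2 d f" "\<forall>v\<in>P. f (v, t, u) \<noteq> 0"
    "\<forall>Q t' u'. (i, t') \<in> fibre cs Q \<and> (j, u') \<in> fibre cs' Q \<and> (\<forall>v\<in>Q. f (v, t', u') \<noteq> 0) \<longrightarrow>
        [w Q (i, t') (j, u') = w P (i, t) (j, u)] (mod int m)"
    using assms unfolding const_section_def by blast
  then show "\<exists>d f. form2 d f \<and> (\<forall>v\<in>P. f (v, t, u) \<noteq> 0) \<and>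
     (\<forall>Q t' u'. (i, t') \<in> fibre cs Q \<and> (j, u') \<in> fibre cs' Q \<and> (\<forall>v\<in>Q. f (v, t', u') \<noteq> 0) \<longrightarrow>
        [z * w Q (i, t') (j, u') = z * w P (i, t) (j, u)] (mod int m))"
    by (intro exI[of _ d] exI[of _ f]) (simp add: cong_scalar_left)
qed

lemma cech_cocycle_cmult:
  assumes "cech_cocycle Y m (cs, g)" shows "cech_cocycle Y m (cs, \<lambda>P u v. z * g P u v)"
proof -
  have "[z * g P u v + z * g P v w = z * g P u w] (mod int m)"
    if "u \<in> fibre cs P" "v \<in> fibre cs P" "w \<in> fibre cs P" for P u v w
    using cong_scalar_left[OF cech_cocycleD(4)[OF assms that], of z] by (simp add: distrib_left)
  then show ?thesis using assms const_section_cmult[of m cs cs g z] unfolding cech_cocycle_def by simp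
qed

lemma cohomologous_cmult:
  assumes "((cs, g), (cs', g')) \<in> cohomologous Y m"
  shows "((cs, \<lambda>P u v. z * g P u v), (cs', \<lambda>P u v. z * g' P u v)) \<in> cohomologous Y m"
proof -
  obtain w where w: "cech_cocycle Y m (cs, g)" "cech_cocycle Y m (cs', g')" "const_section m cs cs' w"
    "\<And>P u v u' v'. u\<in>fibre cs P \<Longrightarrow> v\<in>fibre cs P \<Longrightarrow> u'\<in>fibre cs' P \<Longrightarrow> v'\<in>fibre cs' P \<Longrightarrow>
          [g P u v - g' P u' v' = w P u u' - w P v v'] (mod int m)"
    using assms unfolding cohomologous_def by blast
  have "[z * g P u v - z * g' P u' v' = z * w P u u' - z * w P v v'] (mod int m)"
    if "u\<in>fibre cs P" "v\<in>fibre cs P" "u'\<in>fibre cs' P" "v'\<in>fibre cs' P" for P u v u' v'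
    using cong_scalar_left[OF w(4)[OF that], of z] by (simp add: right_diff_distrib)
  then show ?thesis unfolding cohomologous_def
    using cech_cocycle_cmult[OF w(1), of z] cech_cocycle_cmult[OF w(2), of z] const_section_cmult[OF w(3), of z]
    by (auto intro!: exI[of _ "\<lambda>P u v. z * w P u v"])
qed

text \<open>The sign action on cocycles modulo m. Stated before passing to classes, it is compatible
  with composition of permutations and gives the action on the limit and its localization
  levelwise.\<close>

definition sign_acts :: "nat \<Rightarrow> (3 \<Rightarrow> 3) \<Rightarrow> bool" where
  "sign_acts m \<sigma> \<longleftrightarrow> (\<forall>cs g. cech_cocycle Y m (cs, g) \<longrightarrow>
     ((map (chart_pullback Y (perm_point \<sigma>)) cs, \<lambda>P. g (perm_point \<sigma> P)), (cs, \<lambda>P u v. sign \<sigma> * g P u v))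
       \<in> cohomologous Y m)"

text \<open>Pullback reverses composition: \<tau> acts on the cocycle already pulled back along
  \<sigma>, and the relation for \<sigma> is then scaled by the sign of \<tau>.\<close>

lemma sign_acts_compose:
  assumes "bij \<sigma>" "bij \<tau>" "sign_acts m \<sigma>" "sign_acts m \<tau>" shows "sign_acts m (\<sigma> \<circ> \<tau>)"
  unfolding sign_acts_def
proof (intro allI impI)
  fix cs g assume c: "cech_cocycle Y m (cs, g)"
  let ?s = "perm_point \<sigma>" and ?t = "perm_point \<tau>"
  have p: "permutation \<sigma>" "permutation \<tau>"
    using assms(1,2) by (simp_all add: permutation)
  have eq: "chart_pullback Y (perm_point (\<sigma> \<circ> \<tau>)) c = chart_pullback Y ?t (chart_pullback Y ?s c)" for c
    unfolding chart_pullback_def perm_point_compose[OF assms(1,2), symmetric]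
    using perm_point_in_Y[OF assms(2)] by auto
  have 1: "((map (chart_pullback Y ?t) (map (chart_pullback Y ?s) cs), \<lambda>P. g (?s (?t P))),
     (map (chart_pullback Y ?s) cs, \<lambda>P u v. sign \<tau> * g (?s P) u v)) \<in> cohomologous Y m"
    using assms(4) cech_cocycle_pullback[OF assms(1) c] unfolding sign_acts_def by blast
  have e: "map (chart_pullback Y (perm_point (\<sigma> \<circ> \<tau>))) cs = map (chart_pullback Y ?t) (map (chart_pullback Y ?s) cs)"
    "(\<lambda>P. g (perm_point (\<sigma> \<circ> \<tau>) P)) = (\<lambda>P. g (?s (?t P)))"
    "(\<lambda>P u v. sign (\<sigma> \<circ> \<tau>) * g P u v) = (\<lambda>P u v. sign \<tau> * (sign \<sigma> * g P u v))"
    by (simp_all add: eq perm_point_compose[OF assms(1,2)] sign_compose[OF p] mult.assoc mult.left_commute)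
  have 2: "((map (chart_pullback Y ?s) cs, \<lambda>P u v. sign \<tau> * g (?s P) u v),
      (cs, \<lambda>P u v. sign \<tau> * (sign \<sigma> * g P u v))) \<in> cohomologous Y m"
    using cohomologous_cmult[OF assms(3)[unfolded sign_acts_def, rule_format, OF c], of "sign \<tau>"] .
  have "((map (chart_pullback Y ?t) (map (chart_pullback Y ?s) cs), \<lambda>P. g (?s (?t P))),
     (cs, \<lambda>P u v. sign \<tau> * (sign \<sigma> * g P u v))) \<in> cohomologous Y m"
    by (rule cohomologous_trans[OF 1 2])
  then show "((map (chart_pullback Y (perm_point (\<sigma> \<circ> \<tau>))) cs, \<lambda>P. g (perm_point (\<sigma> \<circ> \<tau>) P)),
     (cs, \<lambda>P u v. sign (\<sigma> \<circ> \<tau>) * g P u v)) \<in> cohomologous Y m"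
    unfolding e by simp
qed

text \<open>Reflections generate S_3; the identity is obtained as the square of one.\<close>

lemma sign_acts_all:
  assumes "\<And>i. sign_acts m (Transposition.transpose (i + 1) (i + 2))" "bij \<sigma>" shows "sign_acts m \<sigma>"
  using assms(2)
proof (cases rule: perm3_cases)
  case id
  have "sign_acts m (Transposition.transpose (1 + 1) (1 + 2) \<circ> Transposition.transpose (1 + 1) (1 + 2))"
    by (intro sign_acts_compose assms(1)) simp_all
  then show ?thesis unfolding id by (simp add: comp_def id_def)
next
  case cycle
  show ?thesis unfolding cycle cycle3_transpose(1) by (intro sign_acts_compose assms(1)) simp_all
next
  case cycle2
  show ?thesis unfolding cycle2 cycle3_transpose(2) by (intro sign_acts_compose assms(1)) simp_all
qed (use assms(1) in simp)

text \<open>Both sides are saturations of images of the same class, and corresponding elements are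
  cohomologous.\<close>

lemma H1_pullback_sign:
  assumes "sign_acts m \<sigma>" "a \<in> H1 Y m"
  shows "H1_pullback Y m (perm_point \<sigma>) a = H1_smult Y m (sign \<sigma>) a"
proof -
  have c: "cech_cocycle Y m x" if "x \<in> a" for x
    using assms(2) that unfolding H1_def quotient_def cohomologous_def by auto
  let ?p = "\<lambda>(cs, g). (map (chart_pullback Y (perm_point \<sigma>)) cs, \<lambda>P. g (perm_point \<sigma> P))"
  let ?q = "\<lambda>(cs, g). (cs, \<lambda>P u v. sign \<sigma> * g P u v)"
  have *: "(?p x, ?q x) \<in> cohomologous Y m" if "x \<in> a" for x
    using assms(1) c[OF that] unfolding sign_acts_def by (cases x) auto
  have "cohomologous Y m `` (?p ` a) = cohomologous Y m `` (?q ` a)"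
    using * cohomologous_sym cohomologous_trans by blast
  then show ?thesis unfolding H1_pullback_def H1_smult_def .
qed

lemma H1_rational_pullback_sign:
  assumes "\<And>n. sign_acts (r ^ n) \<sigma>" "\<xi> \<in> H1_rational Y r"
  shows "H1_rational_pullback Y r (perm_point \<sigma>) \<xi> = H1_rational_smult Y r (sign \<sigma>) \<xi>"
proof -
  have "\<alpha> \<in> H1_adic Y r" if "(\<alpha>, k) \<in> \<xi>" for \<alpha> k
    using assms(2) that unfolding H1_rational_def quotient_def H1_frac_rel_def by auto
  then have "\<alpha> n \<in> H1 Y (r ^ n)" if "(\<alpha>, k) \<in> \<xi>" for \<alpha> k n
    using that unfolding H1_adic_def by blast
  then have "(\<lambda>(\<alpha>, k). (\<lambda>n. H1_pullback Y (r ^ n) (perm_point \<sigma>) (\<alpha> n), k)) ` \<xi> =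
    (\<lambda>(\<alpha>, k). (\<lambda>n. H1_smult Y (r ^ n) (sign \<sigma>) (\<alpha> n), k)) ` \<xi>"
    by (intro image_cong refl) (auto simp: H1_pullback_sign[OF assms(1)])
  then show ?thesis unfolding H1_rational_pullback_def H1_rational_smult_def by simp
qed

end

section \<open>Rational families: linear systems, gcd, interpolation\<close>

text \<open>Splitting off a root x leaves a quotient that is nonzero at x and whose roots are still
  simple, by the product rule.\<close>

lemma card_simple_roots:
  fixes p :: "'k::alg_closed_field poly"
  assumes "p \<noteq> 0" "\<And>x. poly p x = 0 \<Longrightarrow> poly (pderiv p) x \<noteq> 0"
  shows "card {x. poly p x = 0} = degree p"
  using assms
proof (induction "degree p" arbitrary: p)
  case 0
  then obtain c where "p = [:c:]" by (metis degree_eq_zeroE)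
  then show ?case using 0 by simp
next
  case (Suc n)
  obtain x where x: "poly p x = 0" using alg_closed_imp_poly_has_root[of p] Suc.hyps(2) by auto
  then obtain q where q: "p = [:-x, 1:] * q" by (metis poly_eq_0_iff_dvd dvdE)
  have q0: "q \<noteq> 0" using Suc.prems(1) q by auto
  have dq: "degree p = Suc (degree q)" unfolding q using q0 by (subst degree_mult_eq) auto
  have pp: "pderiv p = [:-x, 1:] * pderiv q + q * pderiv [:-x, 1:]" unfolding q by (rule pderiv_mult)
  have pd: "poly (pderiv p) z = poly q z + (z - x) * poly (pderiv q) z" for z
    unfolding pp by (simp add: pderiv_pCons algebra_simps)
  have qx: "poly q x \<noteq> 0" using pd[of x] Suc.prems(2)[OF x] by simp
  have "poly (pderiv q) z \<noteq> 0" if "poly q z = 0" for z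
    using Suc.prems(2)[of z] pd[of z] that by (auto simp: q)
  from Suc.hyps(1)[of q, OF _ q0 this] Suc.hyps(2) dq have "card {x. poly q x = 0} = degree q" by simp
  moreover have "{z. poly p z = 0} = insert x {z. poly q z = 0}" by (auto simp: q)
  moreover have "finite {z. poly q z = 0}" using q0 by (rule poly_roots_finite)
  ultimately show ?case using qx dq by simp
qed

text \<open>Newton interpolation: a new node is accommodated by adding a multiple of the product
  over the old nodes.\<close>

lemma ex_interpolation:
  fixes f :: "'k::field \<Rightarrow> 'k"
  assumes "finite S" shows "\<exists>c. \<forall>t\<in>S. f t = (\<Sum>i<card S. c i * t ^ i)"
proof -
  have "\<exists>p. (\<forall>i\<ge>card S. coeff p i = 0) \<and> (\<forall>t\<in>S. f t = poly p t)"
    using assms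
  proof (induction S)
    case (insert a S)
    then obtain p where p: "\<forall>i\<ge>card S. coeff p i = 0" "\<forall>t\<in>S. f t = poly p t" by blast
    define w where "w = (\<Prod>b\<in>S. [:-b, 1:])"
    have w: "degree w = card S" "poly w a \<noteq> 0" "\<forall>t\<in>S. poly w t = 0"
      using insert.hyps by (auto simp: w_def poly_prod degree_prod_eq_sum_degree)
    let ?q = "p + Polynomial.smult ((f a - poly p a) / poly w a) w"
    have "coeff ?q i = 0" if "i \<ge> card (insert a S)" for i
      using that insert.hyps p(1) w(1) by (simp add: coeff_eq_0)
    moreover have "f t = poly ?q t" if "t \<in> insert a S" for t using that p(2) w by auto
    ultimately show ?case by blast
  qed (auto intro: exI[of _ 0])
  then obtain p where p: "\<forall>i\<ge>card S. coeff p i = 0" "\<forall>t\<in>S. f t = poly p t" by blast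
  have "poly p t = (\<Sum>i<card S. coeff p i * t ^ i)" for t
    unfolding poly_altdef using p(1)
    by (intro sum.mono_neutral_cong) (auto simp: coeff_eq_0 not_le not_less)
  then show ?thesis using p(2) by (intro exI[of _ "coeff p"]) auto
qed

lemma interpolation_unique:
  fixes c :: "nat \<Rightarrow> 'k::field"
  assumes "finite S" "\<And>t. t \<in> S \<Longrightarrow> (\<Sum>i<card S. c i * t ^ i) = 0" "i < card S" shows "c i = 0"
proof -
  define p where "p = (\<Sum>i<card S. monom (c i) i)"
  have "poly p t = 0" if "t \<in> S" for t using assms(2)[OF that] by (simp add: p_def poly_sum poly_monom)
  then have sub: "S \<subseteq> {t. poly p t = 0}" by auto
  have "p = 0"
  proof (rule ccontr)
    assume "p \<noteq> 0"
    then have "card S \<le> degree p"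
      using sub poly_roots_finite[of p] card_poly_roots_bound[of p] card_mono[of "{t. poly p t = 0}" S] by linarith
    moreover have "degree p < card S" unfolding p_def
      using assms(3) by (intro le_less_trans[OF degree_sum_le[of _ _ "card S - 1"]])
        (auto intro: order.trans[OF degree_monom_le])
    ultimately show False by simp
  qed
  moreover have "coeff p i = c i" using assms(3) by (simp add: p_def coeff_sum)
  ultimately show ?thesis by simp
qed

lemma ex_interpolation2:
  fixes f :: "'k::field \<Rightarrow> 'k \<Rightarrow> 'k"
  assumes "finite S" "finite S'"
  shows "\<exists>c. \<forall>t\<in>S. \<forall>u\<in>S'. f t u = (\<Sum>i<card S. \<Sum>j<card S'. c i j * t ^ i * u ^ j)"
proof -
  obtain b where b: "\<And>t. \<forall>u\<in>S'. f t u = (\<Sum>j<card S'. b t j * u ^ j)"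
  proof -
    have "\<forall>t. \<exists>b. \<forall>u\<in>S'. f t u = (\<Sum>j<card S'. b j * u ^ j)" by (intro allI ex_interpolation[OF assms(2)])
    from choice[OF this] show ?thesis using that by blast
  qed
  obtain c where c: "\<And>j. \<forall>t\<in>S. b t j = (\<Sum>i<card S. c j i * t ^ i)"
  proof -
    have "\<forall>j. \<exists>c. \<forall>t\<in>S. b t j = (\<Sum>i<card S. c i * t ^ i)" by (intro allI ex_interpolation[OF assms(1)])
    from choice[OF this] show ?thesis using that by blast
  qed
  have "f t u = (\<Sum>i<card S. \<Sum>j<card S'. c j i * t ^ i * u ^ j)" if "t \<in> S" "u \<in> S'" for t u
  proof -
    have "f t u = (\<Sum>j<card S'. (\<Sum>i<card S. c j i * t ^ i) * u ^ j)" using b c that by simp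
    also have "\<dots> = (\<Sum>i<card S. \<Sum>j<card S'. c j i * t ^ i * u ^ j)"
      unfolding sum_distrib_right by (rule sum.swap)
    finally show ?thesis .
  qed
  then show ?thesis by (intro exI[of _ "\<lambda>i j. c j i"]) blast
qed

lemma interpolation2_unique:
  fixes c :: "nat \<Rightarrow> nat \<Rightarrow> 'k::field"
  assumes "finite S" "finite S'"
    "\<And>t u. t \<in> S \<Longrightarrow> u \<in> S' \<Longrightarrow> (\<Sum>i<card S. \<Sum>j<card S'. c i j * t ^ i * u ^ j) = 0" "i < card S" "j < card S'"
  shows "c i j = 0"
proof (rule interpolation_unique[OF assms(1) _ assms(4)])
  fix t assume t: "t \<in> S"
  show "(\<Sum>i<card S. c i j * t ^ i) = 0"
  proof (rule interpolation_unique[OF assms(2) _ assms(5)])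
    fix u assume u: "u \<in> S'"
    have "(\<Sum>j<card S'. (\<Sum>i<card S. c i j * t ^ i) * u ^ j) = (\<Sum>i<card S. \<Sum>j<card S'. c i j * t ^ i * u ^ j)"
      unfolding sum_distrib_right by (rule sum.swap)
    then show "(\<Sum>j<card S'. (\<Sum>i<card S. c i j * t ^ i) * u ^ j) = 0" using assms(3)[OF t u] by simp
  qed
qed

lemma rpp_fix: "rpp F p \<Longrightarrow> rpp F (\<lambda>Q _ _. p Q t u)"
proof -
  assume p: "rpp F p"
  then obtain D where "\<forall>\<^sub>F Q in F. \<forall>t u. degree (p Q t u) \<le> D" unfolding rpp_def by blast
  then have "\<forall>\<^sub>F Q in F. \<forall>_ _. degree (p Q t u) \<le> D" by eventually_elim simp
  moreover have "rf F (\<lambda>Q. coeff (p Q t u) l)" for l by (rule rf_rg[OF rpp_coeff[OF p]])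
  ultimately show ?thesis unfolding rpp_def by blast
qed

section \<open>Linear systems over a local ring, generic gcd, equations of generic fibres\<close>

context cubic_curve begin

text \<open>The unknowns are arbitrary functions of the point, and the conclusion is that they are
  generically given by germs regular at \<open>P\<close>. The system may be overdetermined;
  injectivity of its specialization at \<open>P\<close> makes Gaussian elimination with pivots that
  are units at \<open>P\<close> possible.\<close>

lemma rf_solve:
  fixes T :: "'i \<Rightarrow> 'j \<Rightarrow> ('k, 3 option) point \<Rightarrow> 'k"
  assumes P: "P \<in> Y" and J: "finite J"
  shows "(\<And>i j. i \<in> I \<Longrightarrow> j \<in> J \<Longrightarrow> rf (near Y P) (T i j)) \<Longrightarrow> (\<And>i. i \<in> I \<Longrightarrow> rf (near Y P) (b i)) \<Longrightarrow>
    (\<And>x. (\<And>i. i \<in> I \<Longrightarrow> (\<Sum>j\<in>J. T i j P * x j) = 0) \<Longrightarrow> \<forall>j\<in>J. x j = 0) \<Longrightarrow>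
    \<forall>\<^sub>F Q in cofin Y. \<forall>i\<in>I. (\<Sum>j\<in>J. T i j Q * x j Q) = b i Q \<Longrightarrow>
    \<forall>j\<in>J. \<exists>\<psi>. rf (near Y P) \<psi> \<and> (\<forall>\<^sub>F Q in cofin Y. x j Q = \<psi> Q)"
  using J
proof (induction J arbitrary: T b)
  case empty
  then show ?case by simp
next
  case (insert j0 J T b)
  \<comment> \<open>Without a pivot in column j0 the corresponding unit vector would lie in the
    kernel at \<open>P\<close>.\<close>
  have "\<exists>i0\<in>I. T i0 j0 P \<noteq> 0"
  proof (rule ccontr)
    assume "\<not> (\<exists>i0\<in>I. T i0 j0 P \<noteq> 0)"
    then have "(\<Sum>j\<in>insert j0 J. T i j P * (if j = j0 then 1 else 0)) = 0" if "i \<in> I" for i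
      using that by (auto intro: sum.neutral)
    from insert.prems(3)[OF this] show False by auto
  qed
  then obtain i0 where i0: "i0 \<in> I" "T i0 j0 P \<noteq> 0" by blast
  let ?c = "T i0 j0"
  have c: "rf (near Y P) ?c" using insert.prems(1) i0 by blast
  have cn: "\<forall>\<^sub>F Q in near Y P. ?c Q \<noteq> 0" by (rule rf_near_nonzero[OF P c i0(2)])
  define T' where "T' = (\<lambda>i j Q. T i j Q - T i j0 Q / ?c Q * T i0 j Q)"
  define b' where "b' = (\<lambda>i Q. b i Q - T i j0 Q / ?c Q * b i0 Q)"
  have 1: "rf (near Y P) (T' i j)" if "i \<in> I" "j \<in> J" for i j
    unfolding T'_def using that i0 by (intro rg_diff rg_mult rg_divide c cn insert.prems(1)) auto
  have 2: "rf (near Y P) (b' i)" if "i \<in> I" for i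
    unfolding b'_def using that i0 by (intro rg_diff rg_mult rg_divide c cn insert.prems(1,2)) auto
  have red: "(\<Sum>j\<in>J. T' i j Q * y j) = (\<Sum>j\<in>J. T i j Q * y j) - T i j0 Q / ?c Q * (\<Sum>j\<in>J. T i0 j Q * y j)" for i Q y
    by (simp add: T'_def left_diff_distrib sum_subtractf sum_distrib_left mult.assoc)
  have 3: "\<forall>j\<in>J. y j = 0" if y: "\<And>i. i \<in> I \<Longrightarrow> (\<Sum>j\<in>J. T' i j P * y j) = 0" for y
  proof -
    \<comment> \<open>A kernel vector of the reduced system is completed by solving the pivot
      equation at \<open>P\<close> for its coordinate j0.\<close>
    define z where "z = y(j0 := - (\<Sum>j\<in>J. T i0 j P * y j) / ?c P)"
    have zJ: "(\<Sum>j\<in>J. T i j P * z j) = (\<Sum>j\<in>J. T i j P * y j)" for i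
      using insert.hyps by (intro sum.cong) (auto simp: z_def)
    have "(\<Sum>j\<in>insert j0 J. T i j P * z j) = 0" if "i \<in> I" for i
    proof -
      have "(\<Sum>j\<in>insert j0 J. T i j P * z j) = T i j0 P * z j0 + (\<Sum>j\<in>J. T i j P * y j)"
        using insert.hyps zJ by simp
      also have "\<dots> = (\<Sum>j\<in>J. T' i j P * y j)" unfolding red by (simp add: z_def)
      finally show ?thesis using y[OF that] by simp
    qed
    from insert.prems(3)[OF this] have "\<forall>j\<in>J. z j = 0" by blast
    then show ?thesis using insert.hyps by (metis fun_upd_other z_def)
  qed
  have 4: "\<forall>\<^sub>F Q in cofin Y. \<forall>i\<in>I. (\<Sum>j\<in>J. T' i j Q * x j Q) = b' i Q"
    using insert.prems(4) cn[unfolded eventually_near, THEN conjunct1]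
  proof eventually_elim
    case (elim Q)
    show ?case
    proof
      fix i assume i: "i \<in> I"
      have e: "(\<Sum>j\<in>J. T i j Q * x j Q) = b i Q - T i j0 Q * x j0 Q" if "i \<in> I" for i
        using elim(1) that insert.hyps by (auto simp: algebra_simps)
      show "(\<Sum>j\<in>J. T' i j Q * x j Q) = b' i Q"
        unfolding red e[OF i] e[OF i0(1)] b'_def using elim(2) by (simp add: field_simps)
    qed
  qed
  have IH: "\<forall>j\<in>J. \<exists>\<psi>. rf (near Y P) \<psi> \<and> (\<forall>\<^sub>F Q in cofin Y. x j Q = \<psi> Q)"
    by (rule insert.IH[OF 1 2 3 4])
  from bchoice[OF this] obtain \<psi> where \<psi>: "\<And>j. j \<in> J \<Longrightarrow> rf (near Y P) (\<psi> j)" "\<And>j. j \<in> J \<Longrightarrow> \<forall>\<^sub>F Q in cofin Y. x j Q = \<psi> j Q"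
    by blast
  have all: "\<forall>\<^sub>F Q in cofin Y. \<forall>j\<in>J. x j Q = \<psi> j Q"
    by (rule eventually_ball_finite[OF insert.hyps(1)]) (use \<psi>(2) in blast)
  let ?\<psi> = "\<lambda>Q. (b i0 Q - (\<Sum>j\<in>J. T i0 j Q * \<psi> j Q)) / ?c Q"
  have "rf (near Y P) ?\<psi>"
    using i0(1) by (intro rg_divide rg_diff rg_sum rg_mult c cn insert.prems(1,2) \<psi>(1)) auto
  moreover have "\<forall>\<^sub>F Q in cofin Y. x j0 Q = ?\<psi> Q"
    using insert.prems(4) all cn[unfolded eventually_near, THEN conjunct1]
  proof eventually_elim
    case (elim Q)
    have "(\<Sum>j\<in>J. T i0 j Q * x j Q) = (\<Sum>j\<in>J. T i0 j Q * \<psi> j Q)" using elim(2) by (intro sum.cong) auto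
    moreover have "?c Q * x j0 Q + (\<Sum>j\<in>J. T i0 j Q * x j Q) = b i0 Q" using elim(1) i0(1) insert.hyps by auto
    ultimately show ?case using elim(3) by (simp add: field_simps)
  qed
  ultimately have "\<exists>\<psi>. rf (near Y P) \<psi> \<and> (\<forall>\<^sub>F Q in cofin Y. x j0 Q = \<psi> Q)" by (intro exI[of _ ?\<psi>] conjI)
  with IH show ?case by blast
qed

text \<open>Each coefficient is generically zero or generically nonzero, and only finitely many
  occur, so the degree is generically constant.\<close>

lemma rpp_degree:
  assumes "rpp (cofin Y) (\<lambda>Q _ _. A Q)"
  shows "(\<forall>\<^sub>F Q in cofin Y. A Q = 0) \<or> (\<exists>d. \<forall>\<^sub>F Q in cofin Y. degree (A Q) = d \<and> A Q \<noteq> 0)"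
proof -
  obtain D where D: "\<forall>\<^sub>F Q in cofin Y. degree (A Q) \<le> D" using assms unfolding rpp_def by auto
  have co: "rf (cofin Y) (\<lambda>Q. coeff (A Q) l)" for l using rpp_coeff[OF assms] .
  define S where "S = {l. l \<le> D \<and> \<not> (\<forall>\<^sub>F Q in cofin Y. coeff (A Q) l = 0)}"
  have fS: "finite S" unfolding S_def by simp
  show ?thesis
  proof (cases "S = {}")
    case True
    then have "\<forall>l\<in>{..D}. \<forall>\<^sub>F Q in cofin Y. coeff (A Q) l = 0" by (auto simp: S_def)
    then have "\<forall>\<^sub>F Q in cofin Y. \<forall>l\<in>{..D}. coeff (A Q) l = 0" by (intro eventually_ball_finite) auto
    with D have "\<forall>\<^sub>F Q in cofin Y. A Q = 0"
      by eventually_elim (metis atMost_iff leading_coeff_0_iff)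
    then show ?thesis ..
  next
    case False
    define d where "d = Max S"
    have dS: "d \<in> S" using fS False by (simp add: d_def)
    have 1: "\<forall>\<^sub>F Q in cofin Y. coeff (A Q) d \<noteq> 0" using rf_cofin_dichotomy[OF co] dS by (auto simp: S_def)
    have "\<forall>l\<in>{d<..D}. \<forall>\<^sub>F Q in cofin Y. coeff (A Q) l = 0"
      using Max_ge[OF fS] by (fastforce simp: S_def d_def)
    then have 2: "\<forall>\<^sub>F Q in cofin Y. \<forall>l\<in>{d<..D}. coeff (A Q) l = 0" by (intro eventually_ball_finite) auto
    have "\<forall>\<^sub>F Q in cofin Y. degree (A Q) = d \<and> A Q \<noteq> 0" using D 1 2
    proof eventually_elim
      case (elim Q)
      have nz: "A Q \<noteq> 0" using elim(2) by auto
      moreover have "degree (A Q) \<ge> d" using elim(2) by (rule le_degree)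
      moreover have "\<not> degree (A Q) > d" using elim(1,3) nz by (metis greaterThanAtMost_iff leading_coeff_0_iff)
      ultimately show ?case by simp
    qed
    then show ?thesis by blast
  qed
qed

text \<open>Euclid's algorithm run simultaneously over almost all points; the degrees stay
  generically constant at every stage. Only the gcd is recorded as a rational family, the cofactors
  are mere functions.\<close>

lemma rpp_bezout_aux:
  "rpp (cofin Y) (\<lambda>Q _ _. A Q) \<Longrightarrow> rpp (cofin Y) (\<lambda>Q _ _. B Q) \<Longrightarrow>
   \<forall>\<^sub>F Q in cofin Y. B Q = 0 \<or> degree (B Q) < n \<Longrightarrow>
   \<exists>D X1 Z. rpp (cofin Y) (\<lambda>Q _ _. D Q) \<and> (\<forall>\<^sub>F Q in cofin Y. D Q dvd A Q \<and> D Q dvd B Q \<and> D Q = X1 Q * A Q + Z Q * B Q)"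
proof (induction n arbitrary: A B)
  case 0
  then have "\<forall>\<^sub>F Q in cofin Y. A Q dvd A Q \<and> A Q dvd B Q \<and> A Q = 1 * A Q + 0 * B Q"
    by (auto elim!: eventually_mono)
  then show ?case using 0(1) by (intro exI[of _ A] exI[of _ "\<lambda>_. 1"] exI[of _ "\<lambda>_. 0"]) blast
next
  case (Suc n A B)
  from rpp_degree[OF Suc.prems(2)] show ?case
  proof
    assume "\<forall>\<^sub>F Q in cofin Y. B Q = 0"
    then have "\<forall>\<^sub>F Q in cofin Y. A Q dvd A Q \<and> A Q dvd B Q \<and> A Q = 1 * A Q + 0 * B Q"
      by (auto elim!: eventually_mono)
    then show ?case using Suc.prems(1) by (intro exI[of _ A] exI[of _ "\<lambda>_. 1"] exI[of _ "\<lambda>_. 0"]) blast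
  next
    assume "\<exists>d. \<forall>\<^sub>F Q in cofin Y. degree (B Q) = d \<and> B Q \<noteq> 0"
    then obtain d where d: "\<forall>\<^sub>F Q in cofin Y. degree (B Q) = d \<and> B Q \<noteq> 0" by blast
    obtain q r where qr: "rpp (cofin Y) q" "rpp (cofin Y) r"
      "\<forall>\<^sub>F Q in cofin Y. \<forall>t u. A Q = q Q t u * B Q + r Q t u \<and> (r Q t u = 0 \<or> degree (r Q t u) < d)"
      by (rule rpp_divmod[OF Suc.prems(2) d Suc.prems(1)])
    define q' r' where "q' = (\<lambda>Q. q Q 0 0)" and "r' = (\<lambda>Q. r Q 0 0)"
    have r': "rpp (cofin Y) (\<lambda>Q _ _. r' Q)" unfolding r'_def by (rule rpp_fix[OF qr(2)])
    have eq: "\<forall>\<^sub>F Q in cofin Y. A Q = q' Q * B Q + r' Q" using qr(3) by eventually_elim (simp add: q'_def r'_def)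
    have "\<forall>\<^sub>F Q in cofin Y. r' Q = 0 \<or> degree (r' Q) < n"
      using qr(3) d Suc.prems(3)
    proof eventually_elim
      case (elim Q)
      have "r' Q = 0 \<or> degree (r' Q) < d" using elim(1) unfolding r'_def by blast
      moreover have "d \<le> n" using elim(2,3) by auto
      ultimately show ?case by auto
    qed
    from Suc.IH[OF Suc.prems(2) r' this] obtain D X1 Z where D: "rpp (cofin Y) (\<lambda>Q _ _. D Q)"
      "\<forall>\<^sub>F Q in cofin Y. D Q dvd B Q \<and> D Q dvd r' Q \<and> D Q = X1 Q * B Q + Z Q * r' Q" by blast
    from D(2) eq have "\<forall>\<^sub>F Q in cofin Y. D Q dvd A Q \<and> D Q dvd B Q \<and>
       D Q = Z Q * A Q + (X1 Q - Z Q * q' Q) * B Q"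
      by eventually_elim (auto simp: algebra_simps)
    then show ?case using D(1) by (intro exI[of _ D] exI[of _ Z] exI[of _ "\<lambda>Q. X1 Q - Z Q * q' Q"]) blast
  qed
qed

lemma rpp_bezout:
  assumes "rpp (cofin Y) (\<lambda>Q _ _. A Q)" "rpp (cofin Y) (\<lambda>Q _ _. B Q)"
  obtains D X1 Z where "rpp (cofin Y) (\<lambda>Q _ _. D Q)"
    "\<forall>\<^sub>F Q in cofin Y. D Q dvd A Q \<and> D Q dvd B Q \<and> D Q = X1 Q * A Q + Z Q * B Q"
proof -
  obtain n where "\<forall>\<^sub>F Q in cofin Y. degree (B Q) \<le> n" using assms(2) unfolding rpp_def by auto
  then have "\<forall>\<^sub>F Q in cofin Y. B Q = 0 \<or> degree (B Q) < Suc n" by eventually_elim auto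
  from rpp_bezout_aux[OF assms this] show ?thesis using that by blast
qed

text \<open>The chart fibre consists of the roots of \<open>eqn\<close> at which \<open>loc\<close>
  is nonzero. Dividing \<open>eqn\<close> by its gcd with a high power of \<open>loc\<close> removes
  the other roots; the remaining ones are simple because the chart is etale, so their number is the
  generic degree.\<close>

lemma fibre_poly:
  assumes c: "standard_etale Y c" "base c \<noteq> {}"
  obtains M s where "rpp (cofin Y) (\<lambda>Q _ _. M Q)" "\<forall>\<^sub>F Q in cofin Y. degree (M Q) = s \<and> lead_coeff (M Q) = 1 \<and>
    {t. poly (M Q) t = 0} = chart_fibre c Q \<and> finite (chart_fibre c Q) \<and> card (chart_fibre c Q) = s"
proof -
  let ?F = "cofin Y"
  obtain P where P: "P \<in> base c" using c(2) by blast
  obtain d where d0: "\<forall>\<^sub>F Q in near Y P. Q \<in> base c" "rpp (near Y P) (\<lambda>Q _ _. eqn c Q)"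
    "rpp (near Y P) (\<lambda>Q _ _. loc c Q)" "\<forall>\<^sub>F Q in near Y P. degree (eqn c Q) = d \<and> lead_coeff (eqn c Q) = 1"
    by (rule chart_near[OF c(1) P])
  note d = filter_leD[OF cofin_le_near d0(1)] rpp_mono[OF d0(2) cofin_le_near]
    rpp_mono[OF d0(3) cofin_le_near] filter_leD[OF cofin_le_near d0(4)]
  have et: "\<forall>Q. \<forall>t\<in>chart_fibre c Q. poly (pderiv (eqn c Q)) t \<noteq> 0" using c(1) unfolding standard_etale_def by blast
  \<comment> \<open>Roots of \<open>eqn\<close> on which \<open>loc\<close> vanishes may be
    multiple, but their multiplicity is at most d, so the d-th power of \<open>loc\<close> absorbs
    them completely.\<close>
  obtain D X1 Z where D: "rpp ?F (\<lambda>Q _ _. D Q)"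
    "\<forall>\<^sub>F Q in ?F. D Q dvd eqn c Q \<and> D Q dvd loc c Q ^ d \<and> D Q = X1 Q * eqn c Q + Z Q * loc c Q ^ d"
    by (rule rpp_bezout[OF d(2) rpp_power[OF d(3), of d]])
  have "\<forall>\<^sub>F Q in ?F. D Q \<noteq> 0" using D(2) d(4) by eventually_elim auto
  moreover from this have "\<not> (\<forall>\<^sub>F Q in ?F. D Q = 0)"
    using eventually_conj[of "\<lambda>Q. D Q \<noteq> 0" ?F "\<lambda>Q. D Q = 0"] by auto
  ultimately obtain e where e: "\<forall>\<^sub>F Q in ?F. degree (D Q) = e \<and> D Q \<noteq> 0" using rpp_degree[OF D(1)] by blast
  obtain q r where qr: "rpp ?F q" "rpp ?F r"
    "\<forall>\<^sub>F Q in ?F. \<forall>t u. eqn c Q = q Q t u * D Q + r Q t u \<and> (r Q t u = 0 \<or> degree (r Q t u) < e)"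
    by (rule rpp_divmod[OF D(1) e d(2)])
  define lc where "lc = (\<lambda>Q. coeff (D Q) e)"
  \<comment> \<open>Scaling by the leading coefficient of D makes the quotient monic.\<close>
  define M where "M = (\<lambda>Q. Polynomial.smult (lc Q) (q Q 0 0))"
  have lc: "rf ?F lc" unfolding lc_def by (rule rpp_coeff[OF D(1)])
  have M: "rpp ?F (\<lambda>Q _ _. M Q)" unfolding M_def by (rule rpp_smult[OF lc rpp_fix[OF qr(1)]])
  have fac: "\<forall>\<^sub>F Q in ?F. Polynomial.smult (lc Q) (eqn c Q) = M Q * D Q"
    using qr(3) D(2) e
  proof eventually_elim
    case (elim Q)
    have "r Q 0 0 = 0"
    proof (rule ccontr)
      assume nz: "r Q 0 0 \<noteq> 0"
      have "D Q dvd r Q 0 0" using elim(1,2) by (metis dvd_add_right_iff dvd_triv_right)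
      then show False using dvd_imp_degree_le[of "D Q" "r Q 0 0"] nz elim by fastforce
    qed
    then show ?case using elim(1)[rule_format, of 0 0] by (simp add: M_def)
  qed
  have "\<forall>\<^sub>F Q in ?F. degree (M Q) = d - e \<and> lead_coeff (M Q) = 1 \<and>
    {t. poly (M Q) t = 0} = chart_fibre c Q \<and> finite (chart_fibre c Q) \<and> card (chart_fibre c Q) = d - e"
    using fac D(2) e d(1,4)
  proof eventually_elim
    case (elim Q)
    have lc0: "lc Q \<noteq> 0" using elim(3) by (auto simp: lc_def)
    have E0: "eqn c Q \<noteq> 0" using elim(5) by auto
    have M0: "M Q \<noteq> 0" using elim(1) lc0 E0 by auto
    have "degree (M Q) + e = d" using arg_cong[OF elim(1), of degree] lc0 M0 elim(3,5) by (simp add: degree_mult_eq)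
    then have deg: "degree (M Q) = d - e" by simp
    have lead: "lead_coeff (M Q) = 1"
    proof -
      have "lc Q = lead_coeff (M Q) * lc Q"
        using arg_cong[OF elim(1), of lead_coeff] elim(3,5) lc0 by (auto simp: lead_coeff_mult lc_def)
      then show ?thesis using lc0 by simp
    qed
    have ME: "lc Q * poly (eqn c Q) t = poly (M Q) t * poly (D Q) t" for t
      using arg_cong[OF elim(1), of "\<lambda>p. poly p t"] by simp
    have roots: "{t. poly (M Q) t = 0} = chart_fibre c Q"
    proof (intro equalityI subsetI)
      fix t assume t: "t \<in> {t. poly (M Q) t = 0}"
      have Et: "poly (eqn c Q) t = 0" using ME[of t] t lc0 by simp
      have "poly (loc c Q) t \<noteq> 0"
      proof
        assume L: "poly (loc c Q) t = 0"
        define k where "k = order t (eqn c Q)"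
        have k: "[:-t, 1:] ^ k dvd eqn c Q" "\<not> [:-t, 1:] ^ Suc k dvd eqn c Q"
          using order_1[of t "eqn c Q"] order_2[OF E0, of t] by (auto simp: k_def)
        have "k \<le> d" using order_degree[OF E0, of t] elim(5) by (simp add: k_def)
        have "[:-t, 1:] ^ k dvd loc c Q ^ k" using L by (intro dvd_power_same) (simp add: poly_eq_0_iff_dvd)
        also have "loc c Q ^ k dvd loc c Q ^ d" using \<open>k \<le> d\<close> by (rule le_imp_power_dvd)
        finally have "[:-t, 1:] ^ k dvd loc c Q ^ d" .
        with k(1) elim(2) have "[:-t, 1:] ^ k dvd D Q" by (metis dvd_add dvd_mult)
        moreover have "[:-t, 1:] dvd M Q" using t by (simp add: poly_eq_0_iff_dvd)
        ultimately have "[:-t, 1:] * [:-t, 1:] ^ k dvd M Q * D Q" by (intro mult_dvd_mono)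
        then have "[:-t, 1:] ^ Suc k dvd Polynomial.smult (lc Q) (eqn c Q)" using elim(1) by simp
        then have "[:-t, 1:] ^ Suc k dvd eqn c Q" by (rule dvd_smult_cancel[OF _ lc0])
        then show False using k(2) by blast
      qed
      then show "t \<in> chart_fibre c Q" using Et elim(4) by (simp add: chart_fibre_def)
    next
      fix t assume t: "t \<in> chart_fibre c Q"
      have "poly (D Q) t \<noteq> 0"
      proof
        assume "poly (D Q) t = 0"
        then have "poly (loc c Q ^ d) t = 0" using elim(2) by (metis poly_eq_0_iff_dvd dvd_trans)
        then show False using t by (auto simp: chart_fibre_def)
      qed
      then show "t \<in> {t. poly (M Q) t = 0}" using ME[of t] t by (auto simp: chart_fibre_def)
    qed
    have "poly (pderiv (M Q)) t \<noteq> 0" if "poly (M Q) t = 0" for t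
    proof
      assume "poly (pderiv (M Q)) t = 0"
      then have "poly (pderiv (Polynomial.smult (lc Q) (eqn c Q))) t = 0"
        using that unfolding elim(1) by (simp add: pderiv_mult)
      then have "poly (pderiv (eqn c Q)) t = 0" using lc0 by (simp add: pderiv_smult)
      then show False using et roots that by blast
    qed
    then have "card {t. poly (M Q) t = 0} = d - e" using card_simple_roots[OF M0] deg by simp
    then show ?case using deg lead roots poly_roots_finite[OF M0] by simp
  qed
  with M show ?thesis by (rule that)
qed

text \<open>On the roots of M the function agrees with its remainder modulo M, which has degree
  below s in the last coordinate.\<close>

lemma rg_reduce:
  assumes F: "\<forall>\<^sub>F Q in F. Q \<in> Y" and M: "rpp F (\<lambda>Q _ _. M Q)" "\<forall>\<^sub>F Q in F. degree (M Q) = s \<and> M Q \<noteq> 0"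
    and \<Psi>: "rg F \<Psi>"
  obtains r where "\<And>j. rg F (\<lambda>Q t u. r j Q t)"
    "\<forall>\<^sub>F Q in F. \<forall>t u. poly (M Q) u = 0 \<longrightarrow> \<Psi> Q t u = (\<Sum>j<s. r j Q t * u ^ j)"
proof -
  obtain p where p: "rpp F (\<lambda>Q t u. p Q t)" "\<forall>\<^sub>F Q in F. \<forall>t u. \<Psi> Q t u = poly (p Q t) u"
    by (rule rg_as_poly[OF F \<Psi>])
  obtain q r where qr: "rpp F q" "rpp F r"
    "\<forall>\<^sub>F Q in F. \<forall>t u. p Q t = q Q t u * M Q + r Q t u \<and> (r Q t u = 0 \<or> degree (r Q t u) < s)"
    by (rule rpp_divmod[OF M p(1)])
  show ?thesis
  proof (rule that)
    show "rg F (\<lambda>Q t u. coeff (r Q t 0) j)" for j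
    proof -
      \<comment> \<open>Uniform division leaves a formal dependence on the last coordinate; it is
        removed by setting that coordinate to 0, that is, by taking the constant term of its
        expansion.\<close>
      obtain p' where p': "rpp F (\<lambda>Q t u. p' Q t)" "\<forall>\<^sub>F Q in F. \<forall>t u. coeff (r Q t u) j = poly (p' Q t) u"
        by (rule rg_as_poly[OF F rpp_coeff[OF qr(2), of j]])
      show ?thesis
        by (rule rg_cong[OF rpp_coeff[OF p'(1), of 0]], use p'(2) in eventually_elim) (simp add: poly_0_coeff_0)
    qed
    show "\<forall>\<^sub>F Q in F. \<forall>t u. poly (M Q) u = 0 \<longrightarrow> \<Psi> Q t u = (\<Sum>j<s. coeff (r Q t 0) j * u ^ j)"
      using p(2) qr(3)
    proof eventually_elim
      case (elim Q)
      show ?case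
      proof (intro allI impI)
        fix t u assume u: "poly (M Q) u = 0"
        have "p Q t = q Q t 0 * M Q + r Q t 0" using elim(2) by blast
        then have "\<Psi> Q t u = poly (r Q t 0) u" using elim(1) u by (metis add_0 mult_zero_right poly_add poly_mult)
        also have "\<dots> = (\<Sum>j<s. coeff (r Q t 0) j * u ^ j)"
        proof -
          have z: "coeff (r Q t 0) j = 0" if "j \<ge> s" for j
            using elim(2)[rule_format, of t 0] that by (auto intro: coeff_eq_0)
          show ?thesis unfolding poly_altdef
            by (intro sum.mono_neutral_cong) (auto simp: coeff_eq_0 not_le not_less intro: z)
        qed
        finally show "\<Psi> Q t u = (\<Sum>j<s. coeff (r Q t 0) j * u ^ j)" .
      qed
    qed
  qed
qed

lemma rg_reduce2:
  assumes F: "\<forall>\<^sub>F Q in F. Q \<in> Y" and M: "rpp F (\<lambda>Q _ _. M Q)" "\<forall>\<^sub>F Q in F. degree (M Q) = s \<and> M Q \<noteq> 0"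
    and M': "rpp F (\<lambda>Q _ _. M' Q)" "\<forall>\<^sub>F Q in F. degree (M' Q) = s' \<and> M' Q \<noteq> 0" and \<Psi>: "rg F \<Psi>"
  obtains r where "\<And>i j. rf F (r i j)"
    "\<forall>\<^sub>F Q in F. \<forall>t u. poly (M Q) t = 0 \<and> poly (M' Q) u = 0 \<longrightarrow>
       \<Psi> Q t u = (\<Sum>i<s. \<Sum>j<s'. r i j Q * t ^ i * u ^ j)"
proof -
  obtain a where a: "\<And>j. rg F (\<lambda>Q t u. a j Q t)"
    "\<forall>\<^sub>F Q in F. \<forall>t u. poly (M' Q) u = 0 \<longrightarrow> \<Psi> Q t u = (\<Sum>j<s'. a j Q t * u ^ j)"
    by (rule rg_reduce[OF F M' \<Psi>]) blast
  have "\<exists>b. (\<forall>i. rg F (\<lambda>Q t u. b i Q t)) \<and> (\<forall>\<^sub>F Q in F. \<forall>t u. poly (M Q) u = 0 \<longrightarrow> a j Q u = (\<Sum>i<s. b i Q t * u ^ i))" for j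
  proof -
    obtain b where "\<And>i. rg F (\<lambda>Q t u. b i Q t)"
      "\<forall>\<^sub>F Q in F. \<forall>t u. poly (M Q) u = 0 \<longrightarrow> a j Q u = (\<Sum>i<s. b i Q t * u ^ i)"
      by (rule rg_reduce[OF F M rg_swap[OF a(1)[of j]]]) blast
    then show ?thesis by blast
  qed
  then have "\<forall>j. \<exists>b. (\<forall>i. rg F (\<lambda>Q t u. b i Q t)) \<and> (\<forall>\<^sub>F Q in F. \<forall>t u. poly (M Q) u = 0 \<longrightarrow> a j Q u = (\<Sum>i<s. b i Q t * u ^ i))"
    by blast
  from choice[OF this] obtain b where b: "\<And>i j. rg F (\<lambda>Q t u. b j i Q t)"
    "\<And>j. \<forall>\<^sub>F Q in F. \<forall>t u. poly (M Q) u = 0 \<longrightarrow> a j Q u = (\<Sum>i<s. b j i Q t * u ^ i)" by blast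
  show ?thesis
  proof (rule that)
    show "rf F (\<lambda>Q. b j i Q 0)" for i j by (rule rf_rg[OF b(1)])
    have "\<forall>\<^sub>F Q in F. \<forall>j\<in>{..<s'}. \<forall>t u. poly (M Q) u = 0 \<longrightarrow> a j Q u = (\<Sum>i<s. b j i Q t * u ^ i)"
      by (rule eventually_ball_finite) (use b(2) in auto)
    with a(2) show "\<forall>\<^sub>F Q in F. \<forall>t u. poly (M Q) t = 0 \<and> poly (M' Q) u = 0 \<longrightarrow>
       \<Psi> Q t u = (\<Sum>i<s. \<Sum>j<s'. b j i Q 0 * t ^ i * u ^ j)"
    proof eventually_elim
      case (elim Q)
      show ?case
      proof (intro allI impI)
        fix t u assume tu: "poly (M Q) t = 0 \<and> poly (M' Q) u = 0"
        have "\<Psi> Q t u = (\<Sum>j<s'. (\<Sum>i<s. b j i Q 0 * t ^ i) * u ^ j)"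
          using elim(1) tu by (simp add: elim(2)[rule_format, where t = 0])
        also have "\<dots> = (\<Sum>i<s. \<Sum>j<s'. b j i Q 0 * t ^ i * u ^ j)"
          unfolding sum_distrib_right by (rule sum.swap)
        finally show "\<Psi> Q t u = (\<Sum>i<s. \<Sum>j<s'. b j i Q 0 * t ^ i * u ^ j)" .
      qed
    qed
  qed
qed

end

section \<open>Generic trivialization of a cocycle with values in roots of unity\<close>

lemma power_int_cong:
  fixes \<zeta> :: "'k::field"
  assumes "\<zeta> ^ m = 1" "\<zeta> \<noteq> 0" "[a = b] (mod int m)" shows "\<zeta> powi a = \<zeta> powi b"
proof -
  obtain k where k: "a = b + int m * k" using assms(3) by (metis cong_iff_lin cong_sym)
  have "\<zeta> powi (int m * k) = (\<zeta> powi int m) powi k" by (rule power_int_mult)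
  then show ?thesis using assms(1,2) by (simp add: k power_int_add)
qed

text \<open>With exponents below s and s' these monomials are a basis of the functions on a product
  of two fibres of sizes s and s'.\<close>

definition bimon :: "nat \<times> nat \<Rightarrow> 'k::comm_ring_1 \<Rightarrow> 'k \<Rightarrow> 'k" where
  "bimon p t u = t ^ fst p * u ^ snd p"

lemma double_sum_bimon:
  "(\<Sum>i<s. \<Sum>j<s'. c i j * t ^ i * u ^ j) = (\<Sum>p\<in>{..<s}\<times>{..<s'}. c (fst p) (snd p) * bimon p t u)"
  by (simp add: sum.cartesian_product case_prod_unfold bimon_def mult.assoc)

lemma bimon_unique:
  fixes c :: "nat \<times> nat \<Rightarrow> 'k::field"
  assumes "finite S" "finite S'"
    "\<And>t u. t \<in> S \<Longrightarrow> u \<in> S' \<Longrightarrow> (\<Sum>p\<in>{..<card S}\<times>{..<card S'}. c p * bimon p t u) = 0"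
    "p \<in> {..<card S} \<times> {..<card S'}"
  shows "c p = 0"
  using interpolation2_unique[OF assms(1,2), of "\<lambda>i j. c (i, j)" "fst p" "snd p"] assms(3,4)
  by (auto simp: double_sum_bimon)

text \<open>T is the matrix of multiplication by \<Psi> in the monomial basis, and the left side is
  the matrix applied to the coefficients x.\<close>

lemma sum_bimon_mult:
  fixes \<Psi> :: "'k::field"
  assumes "\<And>p. p \<in> J \<Longrightarrow> \<Psi> * bimon p t u = (\<Sum>q\<in>J. T p q * bimon q t u)"
  shows "(\<Sum>q\<in>J. (\<Sum>p\<in>J. T p q * x p) * bimon q t u) = \<Psi> * (\<Sum>p\<in>J. x p * bimon p t u)"
proof -
  have "(\<Sum>q\<in>J. (\<Sum>p\<in>J. T p q * x p) * bimon q t u) = (\<Sum>p\<in>J. \<Sum>q\<in>J. T p q * x p * bimon q t u)"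
    unfolding sum_distrib_right by (rule sum.swap)
  also have "\<dots> = (\<Sum>p\<in>J. x p * (\<Sum>q\<in>J. T p q * bimon q t u))"
    by (simp add: sum_distrib_left mult_ac)
  also have "\<dots> = (\<Sum>p\<in>J. x p * (\<Psi> * bimon p t u))" using assms by (intro sum.cong) auto
  finally show ?thesis by (simp add: sum_distrib_left mult_ac)
qed

lemma rpp_cofin_near:
  assumes M: "rpp (cofin Y) (\<lambda>Q _ _. M Q)" shows "\<forall>\<^sub>F P in cofin Y. rpp (near Y P) (\<lambda>Q _ _. M Q)"
proof -
  obtain D where D: "\<forall>\<^sub>F Q in cofin Y. degree (M Q) \<le> D" using M unfolding rpp_def by auto
  have "\<forall>\<^sub>F P in cofin Y. \<forall>l\<in>{..D}. rf (near Y P) (\<lambda>Q. coeff (M Q) l)"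
    by (intro eventually_ball_finite ballI rf_cofin_near rpp_coeff[OF M]) simp
  then show ?thesis using eventually_cofin_near[OF D]
  proof eventually_elim
    case (elim P)
    have "rf (near Y P) (\<lambda>Q. coeff (M Q) l)" for l
    proof (cases "l \<le> D")
      case False
      show ?thesis
        by (rule rg_cong[OF rg_const[of _ 0]], use elim(2) in eventually_elim)
           (use False in \<open>auto intro: coeff_eq_0\<close>)
    qed (use elim(1) in simp)
    then show ?case using elim(2) unfolding rpp_def by auto
  qed
qed

context cubic_curve begin

text \<open>Local constancy only says that on an open set around each point a of one fibre the
  function equals a constant. With \<Psi> cutting out that open set, \<Psi> times the function
  equals \<Psi> times the constant everywhere, a linear condition on the interpolation coefficients
  of the function. Over all points a of the fibre these conditions determine the coefficients, which
  are therefore rational.\<close>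

lemma rational_root_of_unity_section:
  assumes c: "cech_cocycle Y m (cs, g)" and \<zeta>: "\<zeta> ^ m = 1" "\<zeta> \<noteq> 0"
    and M: "rpp (cofin Y) (\<lambda>Q _ _. M Q)" "\<forall>\<^sub>F Q in cofin Y. degree (M Q) = s \<and> lead_coeff (M Q) = 1 \<and>
    {t. poly (M Q) t = 0} = chart_fibre (cs ! i0) Q \<and> finite (chart_fibre (cs ! i0) Q) \<and> card (chart_fibre (cs ! i0) Q) = s"
    and M': "rpp (cofin Y) (\<lambda>Q _ _. M' Q)" "\<forall>\<^sub>F Q in cofin Y. degree (M' Q) = s' \<and> lead_coeff (M' Q) = 1 \<and>
    {t. poly (M' Q) t = 0} = chart_fibre (cs ! i1) Q \<and> finite (chart_fibre (cs ! i1) Q) \<and> card (chart_fibre (cs ! i1) Q) = s'"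
    and i: "i0 < length cs" "i1 < length cs"
  obtains G where "\<And>p. p \<in> {..<s} \<times> {..<s'} \<Longrightarrow> rf (cofin Y) (G p)"
    "\<forall>\<^sub>F Q in cofin Y. \<forall>t\<in>chart_fibre (cs ! i0) Q. \<forall>u\<in>chart_fibre (cs ! i1) Q.
       \<zeta> powi g Q (i0, t) (i1, u) = (\<Sum>p\<in>{..<s} \<times> {..<s'}. G p Q * bimon p t u)"
proof -
  let ?S = "\<lambda>Q. chart_fibre (cs ! i0) Q" and ?S' = "\<lambda>Q. chart_fibre (cs ! i1) Q"
  define J where "J = {..<s} \<times> {..<s'}"
  have finJ: "finite J" by (simp add: J_def)
  define good where "good = (\<lambda>Q. Q \<in> Y \<and> (degree (M Q) = s \<and> M Q \<noteq> 0) \<and> (degree (M' Q) = s' \<and> M' Q \<noteq> 0) \<and>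
    {t. poly (M Q) t = 0} = ?S Q \<and> finite (?S Q) \<and> card (?S Q) = s \<and>
    {t. poly (M' Q) t = 0} = ?S' Q \<and> finite (?S' Q) \<and> card (?S' Q) = s')"
  have good: "\<forall>\<^sub>F Q in cofin Y. good Q" using M(2) M'(2) eventually_cofin_mem
    by eventually_elim (auto simp: good_def)
  \<comment> \<open>The conclusion is generic, so a single point suffices; it is taken where the
    fibres have their generic sizes and their equations are regular.\<close>
  from good eventually_cofin_near[OF good] rpp_cofin_near[OF M(1)] rpp_cofin_near[OF M'(1)]
  have "\<forall>\<^sub>F P in cofin Y. good P \<and> eventually good (near Y P) \<and> rpp (near Y P) (\<lambda>Q _ _. M Q) \<and> rpp (near Y P) (\<lambda>Q _ _. M' Q)"
    by eventually_elim blast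
  from eventually_cofin_ex[OF this] obtain P where P: "P \<in> Y" "good P" "eventually good (near Y P)"
    "rpp (near Y P) (\<lambda>Q _ _. M Q)" "rpp (near Y P) (\<lambda>Q _ _. M' Q)" by blast
  note nearY = eventually_near_mem[OF P(1)]
  have Md: "\<forall>\<^sub>F Q in near Y P. degree (M Q) = s \<and> M Q \<noteq> 0" "\<forall>\<^sub>F Q in near Y P. degree (M' Q) = s' \<and> M' Q \<noteq> 0"
    using P(3) by (eventually_elim, simp add: good_def)+
  define A where "A = ?S P \<times> ?S' P"
  have finA: "finite A" using P(2) by (simp add: A_def good_def)
  have "\<exists>\<Psi>. rg (near Y P) \<Psi> \<and> \<Psi> P (fst a) (snd a) \<noteq> 0 \<and> (\<forall>\<^sub>F Q in near Y P. \<forall>t' u'.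
         (i0, t') \<in> fibre cs Q \<and> (i1, u') \<in> fibre cs Q \<and> \<Psi> Q t' u' \<noteq> 0 \<longrightarrow>
           [g Q (i0, t') (i1, u') = g P (i0, fst a) (i1, snd a)] (mod int m))" if "a \<in> A" for a
  proof -
    have "(i0, fst a) \<in> fibre cs P" "(i1, snd a) \<in> fibre cs P" using that i by (auto simp: A_def fibre_def)
    from const_sectionD[OF cech_cocycleD(3)[OF c] P(1) this] show ?thesis by blast
  qed
  then have "\<forall>a\<in>A. \<exists>\<Psi>. rg (near Y P) \<Psi> \<and> \<Psi> P (fst a) (snd a) \<noteq> 0 \<and> (\<forall>\<^sub>F Q in near Y P. \<forall>t' u'.
         (i0, t') \<in> fibre cs Q \<and> (i1, u') \<in> fibre cs Q \<and> \<Psi> Q t' u' \<noteq> 0 \<longrightarrow>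
           [g Q (i0, t') (i1, u') = g P (i0, fst a) (i1, snd a)] (mod int m))" by blast
  from bchoice[OF this] obtain \<Psi> where \<Psi>: "\<And>a. a \<in> A \<Longrightarrow> rg (near Y P) (\<Psi> a)"
    "\<And>a. a \<in> A \<Longrightarrow> \<Psi> a P (fst a) (snd a) \<noteq> 0"
    "\<And>a. a \<in> A \<Longrightarrow> \<forall>\<^sub>F Q in near Y P. \<forall>t' u'.
         (i0, t') \<in> fibre cs Q \<and> (i1, u') \<in> fibre cs Q \<and> \<Psi> a Q t' u' \<noteq> 0 \<longrightarrow>
           [g Q (i0, t') (i1, u') = g P (i0, fst a) (i1, snd a)] (mod int m)" by blast
  have expand: "\<exists>r. (\<forall>q. rf (near Y P) (r q)) \<and> (\<forall>\<^sub>F Q in near Y P. \<forall>t\<in>?S Q. \<forall>u\<in>?S' Q.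
       \<Theta> Q t u = (\<Sum>q\<in>J. r q Q * bimon q t u))" if \<Theta>: "rg (near Y P) \<Theta>" for \<Theta>
  proof -
    obtain r where r: "\<And>i j. rf (near Y P) (r i j)"
      "\<forall>\<^sub>F Q in near Y P. \<forall>t u. poly (M Q) t = 0 \<and> poly (M' Q) u = 0 \<longrightarrow>
         \<Theta> Q t u = (\<Sum>i<s. \<Sum>j<s'. r i j Q * t ^ i * u ^ j)"
      by (rule rg_reduce2[OF nearY P(4) Md(1) P(5) Md(2) \<Theta>]) blast
    have "\<forall>\<^sub>F Q in near Y P. \<forall>t\<in>?S Q. \<forall>u\<in>?S' Q. \<Theta> Q t u = (\<Sum>q\<in>J. r (fst q) (snd q) Q * bimon q t u)"
      using r(2) P(3)
    proof eventually_elim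
      case (elim Q)
      show ?case
      proof (intro ballI)
        fix t u assume "t \<in> ?S Q" "u \<in> ?S' Q"
        then have "poly (M Q) t = 0 \<and> poly (M' Q) u = 0" using elim(2) unfolding good_def by blast
        then show "\<Theta> Q t u = (\<Sum>q\<in>J. r (fst q) (snd q) Q * bimon q t u)"
          using elim(1) by (simp add: double_sum_bimon J_def)
      qed
    qed
    then show ?thesis using r(1) by (intro exI[of _ "\<lambda>q. r (fst q) (snd q)"]) blast
  qed
  have scaled: "rg (near Y P) (\<lambda>Q t u. \<Psi> a Q t u * bimon p t u)" if "a \<in> A" for a p
    unfolding bimon_def by (intro rg_mult rg_power rg_fst rg_snd \<Psi>(1)[OF that])
  \<comment> \<open>The expansions of \<Psi> times each monomial supply the columns of its
    multiplication matrix, with entries regular at \<open>P\<close>.\<close>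
  have "\<forall>x\<in>A \<times> J. \<exists>r. (\<forall>q. rf (near Y P) (r q)) \<and> (\<forall>\<^sub>F Q in near Y P. \<forall>t\<in>?S Q. \<forall>u\<in>?S' Q.
       \<Psi> (fst x) Q t u * bimon (snd x) t u = (\<Sum>q\<in>J. r q Q * bimon q t u))"
  proof (intro ballI)
    fix x assume "x \<in> A \<times> J"
    then have "fst x \<in> A" by auto
    from expand[OF scaled[OF this]] show "\<exists>r. (\<forall>q. rf (near Y P) (r q)) \<and> (\<forall>\<^sub>F Q in near Y P. \<forall>t\<in>?S Q. \<forall>u\<in>?S' Q.
       \<Psi> (fst x) Q t u * bimon (snd x) t u = (\<Sum>q\<in>J. r q Q * bimon q t u))" .
  qed
  from bchoice[OF this] obtain T where TT: "\<forall>x\<in>A \<times> J. (\<forall>q. rf (near Y P) (T x q)) \<and> (\<forall>\<^sub>F Q in near Y P. \<forall>t\<in>?S Q. \<forall>u\<in>?S' Q.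
       \<Psi> (fst x) Q t u * bimon (snd x) t u = (\<Sum>q\<in>J. T x q Q * bimon q t u))" ..
  have T: "rf (near Y P) (T x q)"
    "\<forall>\<^sub>F Q in near Y P. \<forall>t\<in>?S Q. \<forall>u\<in>?S' Q.
       \<Psi> (fst x) Q t u * bimon (snd x) t u = (\<Sum>q\<in>J. T x q Q * bimon q t u)" if "x \<in> A \<times> J" for x q
    using bspec[OF TT that] by (blast, rule conjunct2)
  have "\<forall>a\<in>A. \<exists>r. (\<forall>q. rf (near Y P) (r q)) \<and> (\<forall>\<^sub>F Q in near Y P. \<forall>t\<in>?S Q. \<forall>u\<in>?S' Q.
       \<Psi> a Q t u = (\<Sum>q\<in>J. r q Q * bimon q t u))"
    by (intro ballI expand \<Psi>(1))
  from bchoice[OF this] obtain B where BB: "\<forall>a\<in>A. (\<forall>q. rf (near Y P) (B a q)) \<and> (\<forall>\<^sub>F Q in near Y P. \<forall>t\<in>?S Q. \<forall>u\<in>?S' Q.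
       \<Psi> a Q t u = (\<Sum>q\<in>J. B a q Q * bimon q t u))" ..
  have B: "rf (near Y P) (B a q)"
    "\<forall>\<^sub>F Q in near Y P. \<forall>t\<in>?S Q. \<forall>u\<in>?S' Q. \<Psi> a Q t u = (\<Sum>q\<in>J. B a q Q * bimon q t u)" if "a \<in> A" for a q
    using bspec[OF BB that] by (blast, rule conjunct2)
  have T2: "\<forall>\<^sub>F Q in near Y P. \<forall>x\<in>A \<times> J. \<forall>t\<in>?S Q. \<forall>u\<in>?S' Q.
       \<Psi> (fst x) Q t u * bimon (snd x) t u = (\<Sum>q\<in>J. T x q Q * bimon q t u)"
    by (rule eventually_ball_finite) (rule finite_cartesian_product[OF finA finJ], intro ballI, rule T(2))
  have B2: "\<forall>\<^sub>F Q in near Y P. \<forall>a\<in>A. \<forall>t\<in>?S Q. \<forall>u\<in>?S' Q. \<Psi> a Q t u = (\<Sum>q\<in>J. B a q Q * bimon q t u)"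
    by (rule eventually_ball_finite) (rule finA, intro ballI, rule B(2))
  have L2: "\<forall>\<^sub>F Q in near Y P. \<forall>a\<in>A. \<forall>t' u'.
         (i0, t') \<in> fibre cs Q \<and> (i1, u') \<in> fibre cs Q \<and> \<Psi> a Q t' u' \<noteq> 0 \<longrightarrow>
           [g Q (i0, t') (i1, u') = g P (i0, fst a) (i1, snd a)] (mod int m)"
    by (rule eventually_ball_finite) (rule finA, intro ballI, rule \<Psi>(3))
  \<comment> \<open>Pointwise interpolation gives coefficients x with no regularity in
    \<open>Q\<close>; regularity is what the linear system adds.\<close>
  have "\<exists>x. good Q \<longrightarrow> (\<forall>t\<in>?S Q. \<forall>u\<in>?S' Q. \<zeta> powi g Q (i0, t) (i1, u) = (\<Sum>p\<in>J. x p * bimon p t u))" for Q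
  proof (cases "good Q")
    case True
    then obtain c where "\<forall>t\<in>?S Q. \<forall>u\<in>?S' Q. \<zeta> powi g Q (i0, t) (i1, u) = (\<Sum>i<s. \<Sum>j<s'. c i j * t ^ i * u ^ j)"
      using ex_interpolation2[of "?S Q" "?S' Q" "\<lambda>t u. \<zeta> powi g Q (i0, t) (i1, u)"] by (auto simp: good_def)
    then show ?thesis by (intro exI[of _ "\<lambda>p. c (fst p) (snd p)"]) (simp add: double_sum_bimon J_def)
  qed simp
  then obtain x where x: "\<And>Q t u. good Q \<Longrightarrow> t \<in> ?S Q \<Longrightarrow> u \<in> ?S' Q \<Longrightarrow>
     \<zeta> powi g Q (i0, t) (i1, u) = (\<Sum>p\<in>J. x Q p * bimon p t u)"
    using choice[of "\<lambda>Q x. good Q \<longrightarrow> (\<forall>t\<in>?S Q. \<forall>u\<in>?S' Q. \<zeta> powi g Q (i0, t) (i1, u) = (\<Sum>p\<in>J. x p * bimon p t u))"]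
    by blast
  define b where "b = (\<lambda>(a, q) Q. \<zeta> powi g P (i0, fst a) (i1, snd a) * B a q Q)"
  \<comment> \<open>Where \<Psi> vanishes both sides are zero, elsewhere the exponent has the
    residue it has at a; uniqueness of interpolation turns the equality of functions into one
    equation for each monomial.\<close>
  have sys: "\<forall>\<^sub>F Q in cofin Y. \<forall>i\<in>A \<times> J. (\<Sum>p\<in>J. T (fst i, p) (snd i) Q * x Q p) = b i Q"
    using good filter_leD[OF cofin_le_near T2] filter_leD[OF cofin_le_near B2] filter_leD[OF cofin_le_near L2]
  proof eventually_elim
    case (elim Q)
    have cards: "finite (?S Q)" "finite (?S' Q)" "card (?S Q) = s" "card (?S' Q) = s'" using elim(1) by (auto simp: good_def)
    have "(\<Sum>p\<in>J. T (a, p) q Q * x Q p) - \<zeta> powi g P (i0, fst a) (i1, snd a) * B a q Q = 0"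
      if a: "a \<in> A" and q: "q \<in> J" for a q
    proof (rule bimon_unique[OF cards(1,2), of "\<lambda>q. (\<Sum>p\<in>J. T (a, p) q Q * x Q p) - \<zeta> powi g P (i0, fst a) (i1, snd a) * B a q Q"])
      show "q \<in> {..<card (?S Q)} \<times> {..<card (?S' Q)}" using q cards by (simp add: J_def)
      fix t u assume tu: "t \<in> ?S Q" "u \<in> ?S' Q"
      have "(\<Sum>q\<in>J. (\<Sum>p\<in>J. T (a, p) q Q * x Q p) * bimon q t u) = \<Psi> a Q t u * (\<Sum>p\<in>J. x Q p * bimon p t u)"
        by (rule sum_bimon_mult) (use elim(2) a tu in force)
      also have "\<dots> = \<Psi> a Q t u * \<zeta> powi g Q (i0, t) (i1, u)" using x[OF elim(1) tu] by simp
      also have "\<dots> = \<Psi> a Q t u * \<zeta> powi g P (i0, fst a) (i1, snd a)"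
      proof (cases "\<Psi> a Q t u = 0")
        case False
        then have "[g Q (i0, t) (i1, u) = g P (i0, fst a) (i1, snd a)] (mod int m)"
          using elim(4) a tu i by (auto simp: fibre_def)
        then show ?thesis using power_int_cong[OF \<zeta>] by simp
      qed simp
      also have "\<dots> = (\<Sum>q\<in>J. \<zeta> powi g P (i0, fst a) (i1, snd a) * B a q Q * bimon q t u)"
        using elim(3) a tu by (simp add: sum_distrib_left sum_distrib_right mult_ac)
      finally show "(\<Sum>q\<in>{..<card (?S Q)} \<times> {..<card (?S' Q)}.
        ((\<Sum>p\<in>J. T (a, p) q Q * x Q p) - \<zeta> powi g P (i0, fst a) (i1, snd a) * B a q Q) * bimon q t u) = 0"
        using cards by (simp add: J_def[symmetric] left_diff_distrib sum_subtractf)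
    qed
    then show ?case by (auto simp: b_def)
  qed
  \<comment> \<open>At \<open>P\<close> itself the system for a says that \<Psi> times the
    interpolated function is zero; as \<Psi> is nonzero at a, the function vanishes at every point
    of the fibre.\<close>
  have ker: "\<forall>p\<in>J. y p = 0" if y: "\<And>i. i \<in> A \<times> J \<Longrightarrow> (\<Sum>p\<in>J. T (fst i, p) (snd i) P * y p) = 0" for y
  proof
    fix p assume p: "p \<in> J"
    have cards: "finite (?S P)" "finite (?S' P)" "card (?S P) = s" "card (?S' P) = s'" using P(2) by (auto simp: good_def)
    show "y p = 0"
    proof (rule bimon_unique[OF cards(1,2)])
      show "p \<in> {..<card (?S P)} \<times> {..<card (?S' P)}" using p cards by (simp add: J_def)
      fix t u assume tu: "t \<in> ?S P" "u \<in> ?S' P"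
      then have a: "(t, u) \<in> A" by (simp add: A_def)
      have "(\<Sum>q\<in>J. (\<Sum>p\<in>J. T ((t, u), p) q P * y p) * bimon q t u) = \<Psi> (t, u) P t u * (\<Sum>p\<in>J. y p * bimon p t u)"
        by (rule sum_bimon_mult) (use T2[unfolded eventually_near, THEN conjunct2] a tu in force)
      moreover have "(\<Sum>q\<in>J. (\<Sum>p\<in>J. T ((t, u), p) q P * y p) * bimon q t u) = 0"
        using y[of "((t, u), _)"] a by (intro sum.neutral) auto
      ultimately have "(\<Sum>p\<in>J. y p * bimon p t u) = 0" using \<Psi>(2)[OF a] by simp
      then show "(\<Sum>p\<in>{..<card (?S P)} \<times> {..<card (?S' P)}. y p * bimon p t u) = 0" using cards by (simp add: J_def)
    qed
  qed
  have "\<forall>p\<in>J. \<exists>\<psi>. rf (near Y P) \<psi> \<and> (\<forall>\<^sub>F Q in cofin Y. x Q p = \<psi> Q)"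
    by (rule rf_solve[OF P(1) finJ, of "A \<times> J" "\<lambda>i p. T (fst i, p) (snd i)" b, OF _ _ ker sys])
       (auto simp: b_def intro!: T(1) B(1) rg_mult rg_const)
  note sol = this
  have "rf (cofin Y) (\<lambda>Q. x Q p)" if p: "p \<in> J" for p
  proof -
    obtain \<psi> where \<psi>: "rf (near Y P) \<psi>" "\<forall>\<^sub>F Q in cofin Y. x Q p = \<psi> Q" using bspec[OF sol p] by blast
    show ?thesis by (rule rg_cong[OF rg_mono[OF \<psi>(1) cofin_le_near]], use \<psi>(2) in eventually_elim) simp
  qed
  moreover have "\<forall>\<^sub>F Q in cofin Y. \<forall>t\<in>?S Q. \<forall>u\<in>?S' Q. \<zeta> powi g Q (i0, t) (i1, u) = (\<Sum>p\<in>J. x Q p * bimon p t u)"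
    using good by eventually_elim (use x in blast)
  ultimately show ?thesis unfolding J_def by (intro that[of "\<lambda>p Q. x Q p"])
qed

text \<open>Hilbert 90 made explicit. One chart k is fixed and \<zeta>^g(x, (k, u)) is expanded in
  powers of u. By the cocycle relation each coefficient, as a function of x, transforms by \<zeta>^g
  and is thus a candidate for the trivializing function; not all of them can vanish.\<close>

lemma generic_trivialization:
  assumes c: "cech_cocycle Y m (cs, g)" and \<zeta>: "\<zeta> ^ m = 1" "\<zeta> \<noteq> 0"
  obtains H F where "\<And>i. i < length cs \<Longrightarrow> rpp (cofin Y) (\<lambda>Q _ _. H i Q)" "rf (cofin Y) F"
    "\<forall>\<^sub>F Q in cofin Y. F Q \<noteq> 0"
    "\<forall>\<^sub>F Q in cofin Y. \<forall>i t. (i, t) \<in> fibre cs Q \<longrightarrow> poly (H i Q) t ^ m = F Q"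
    "\<forall>\<^sub>F Q in cofin Y. \<forall>i t j u. (i, t) \<in> fibre cs Q \<and> (j, u) \<in> fibre cs Q \<longrightarrow>
       poly (H i Q) t = \<zeta> powi g Q (i, t) (j, u) * poly (H j Q) u"
proof -
  let ?n = "length cs"
  let ?S = "\<lambda>i Q. chart_fibre (cs ! i) Q"
  note se = cech_cocycleD(1)[OF c]
  have "\<exists>Ms. base (cs ! i) \<noteq> {} \<longrightarrow> rpp (cofin Y) (\<lambda>Q _ _. fst Ms Q) \<and> (\<forall>\<^sub>F Q in cofin Y. degree (fst Ms Q) = snd Ms \<and> lead_coeff (fst Ms Q) = 1 \<and>
    {t. poly (fst Ms Q) t = 0} = ?S i Q \<and> finite (?S i Q) \<and> card (?S i Q) = snd Ms)" if i: "i < ?n" for i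
  proof (cases "base (cs ! i) = {}")
    case False
    have "standard_etale Y (cs ! i)" using se i by simp
    then obtain M s where "rpp (cofin Y) (\<lambda>Q _ _. M Q)" "\<forall>\<^sub>F Q in cofin Y. degree (M Q) = s \<and> lead_coeff (M Q) = 1 \<and>
      {t. poly (M Q) t = 0} = ?S i Q \<and> finite (?S i Q) \<and> card (?S i Q) = s"
      by (rule fibre_poly[OF _ False])
    then show ?thesis by (intro exI[of _ "(M, s)"]) simp
  qed simp
  then have "\<forall>i\<in>{..<?n}. \<exists>Ms. base (cs ! i) \<noteq> {} \<longrightarrow> rpp (cofin Y) (\<lambda>Q _ _. fst Ms Q) \<and> (\<forall>\<^sub>F Q in cofin Y. degree (fst Ms Q) = snd Ms \<and> lead_coeff (fst Ms Q) = 1 \<and>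
    {t. poly (fst Ms Q) t = 0} = ?S i Q \<and> finite (?S i Q) \<and> card (?S i Q) = snd Ms)"
    by blast
  from bchoice[OF this] obtain Ms where Ms: "\<And>i. i < ?n \<Longrightarrow> base (cs ! i) \<noteq> {} \<Longrightarrow> rpp (cofin Y) (\<lambda>Q _ _. fst (Ms i) Q) \<and> (\<forall>\<^sub>F Q in cofin Y. degree (fst (Ms i) Q) = snd (Ms i) \<and> lead_coeff (fst (Ms i) Q) = 1 \<and>
    {t. poly (fst (Ms i) Q) t = 0} = ?S i Q \<and> finite (?S i Q) \<and> card (?S i Q) = snd (Ms i))"
    by auto
  define M s where "M = (\<lambda>i. fst (Ms i))" and "s = (\<lambda>i. snd (Ms i))"
  have M: "rpp (cofin Y) (\<lambda>Q _ _. M i Q)"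
    "\<forall>\<^sub>F Q in cofin Y. degree (M i Q) = s i \<and> lead_coeff (M i Q) = 1 \<and>
    {t. poly (M i Q) t = 0} = ?S i Q \<and> finite (?S i Q) \<and> card (?S i Q) = s i" if "i < ?n" "base (cs ! i) \<noteq> {}" for i
    using Ms[OF that] by (simp_all add: M_def s_def)
  obtain P0 where P0: "P0 \<in> Y" using infinite_Y by (metis finite.emptyI ex_in_conv)
  obtain k x0 where k: "(k, x0) \<in> fibre cs P0" using cech_cocycleD(2)[OF c P0] by auto
  then have kn: "k < ?n" "x0 \<in> ?S k P0" by (auto simp: fibre_def)
  then have kb: "base (cs ! k) \<noteq> {}" by (auto simp: chart_fibre_def)
  \<comment> \<open>The constant function 1 in the density statement shows that almost all fibres of
    the chosen chart are nonempty.\<close>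
  have ne: "\<forall>\<^sub>F Q in cofin Y. ?S k Q \<noteq> {}"
  proof -
    have "standard_etale Y (cs ! k)" using se kn by simp
    from fibre_density[OF this kn(2) this kn(2) P0 rg_const[of _ 1]] show ?thesis by (auto elim!: eventually_mono)
  qed
  define J where "J = (\<lambda>i. {..<s i} \<times> {..<s k})"
  have "\<exists>G. base (cs ! i) \<noteq> {} \<longrightarrow> (\<forall>p\<in>J i. rf (cofin Y) (G p)) \<and>
    (\<forall>\<^sub>F Q in cofin Y. \<forall>t\<in>?S i Q. \<forall>u\<in>?S k Q. \<zeta> powi g Q (i, t) (k, u) = (\<Sum>p\<in>J i. G p Q * bimon p t u))"
    if i: "i < ?n" for i
  proof (cases "base (cs ! i) = {}")
    case False
    obtain G where "\<And>p. p \<in> J i \<Longrightarrow> rf (cofin Y) (G p)"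
      "\<forall>\<^sub>F Q in cofin Y. \<forall>t\<in>?S i Q. \<forall>u\<in>?S k Q. \<zeta> powi g Q (i, t) (k, u) = (\<Sum>p\<in>J i. G p Q * bimon p t u)"
      unfolding J_def
      by (rule rational_root_of_unity_section[OF c \<zeta> M[OF i False] M[OF kn(1) kb] i kn(1)]) blast
    then show ?thesis by blast
  qed simp
  then have "\<forall>i\<in>{..<?n}. \<exists>G. base (cs ! i) \<noteq> {} \<longrightarrow> (\<forall>p\<in>J i. rf (cofin Y) (G p)) \<and>
    (\<forall>\<^sub>F Q in cofin Y. \<forall>t\<in>?S i Q. \<forall>u\<in>?S k Q. \<zeta> powi g Q (i, t) (k, u) = (\<Sum>p\<in>J i. G p Q * bimon p t u))"
    by blast
  from bchoice[OF this] obtain G where G: "\<And>i p. i < ?n \<Longrightarrow> base (cs ! i) \<noteq> {} \<Longrightarrow> p \<in> J i \<Longrightarrow> rf (cofin Y) (G i p)"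
    "\<And>i. i < ?n \<Longrightarrow> base (cs ! i) \<noteq> {} \<Longrightarrow> \<forall>\<^sub>F Q in cofin Y. \<forall>t\<in>?S i Q. \<forall>u\<in>?S k Q. \<zeta> powi g Q (i, t) (k, u) = (\<Sum>p\<in>J i. G i p Q * bimon p t u)"
    by (auto simp: Ball_def)
  \<comment> \<open>H j i is the coefficient of u^j on chart i, a polynomial in the coordinate t of
    that chart. The value 0 on a chart with empty base is never evaluated at a point.\<close>
  define H where "H = (\<lambda>j i Q. if base (cs ! i) = {} then 0 else \<Sum>l<s i. monom (G i (l, j) Q) l)"
  have H: "rpp (cofin Y) (\<lambda>Q _ _. H j i Q)" if "i < ?n" "j < s k" for i j
  proof (cases "base (cs ! i) = {}")
    case False
    have "rpp (cofin Y) (\<lambda>Q _ _. \<Sum>l<s i. monom (G i (l, j) Q) l)"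
      by (intro rpp_sum rpp_monom G(1)[OF that(1) False]) (use that in \<open>auto simp: J_def\<close>)
    then show ?thesis using False by (simp add: H_def)
  qed (simp add: H_def rpp_const)
  have "\<forall>\<^sub>F Q in cofin Y. \<forall>i\<in>{i. i < ?n \<and> base (cs ! i) \<noteq> {}}. \<forall>t\<in>?S i Q. \<forall>u\<in>?S k Q.
     \<zeta> powi g Q (i, t) (k, u) = (\<Sum>p\<in>J i. G i p Q * bimon p t u)"
    by (rule eventually_ball_finite) (use G(2) in auto)
  then have HG: "\<forall>\<^sub>F Q in cofin Y. \<forall>i t u. (i, t) \<in> fibre cs Q \<and> u \<in> ?S k Q \<longrightarrow>
     \<zeta> powi g Q (i, t) (k, u) = (\<Sum>j<s k. poly (H j i Q) t * u ^ j)"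
  proof eventually_elim
    case (elim Q)
    show ?case
    proof (intro allI impI)
      fix i t u assume a: "(i, t) \<in> fibre cs Q \<and> u \<in> ?S k Q"
      then have i: "i < ?n" "t \<in> ?S i Q" "base (cs ! i) \<noteq> {}" by (auto simp: fibre_def chart_fibre_def)
      then have "\<zeta> powi g Q (i, t) (k, u) = (\<Sum>p\<in>J i. G i p Q * bimon p t u)" using elim a by blast
      also have "\<dots> = (\<Sum>l<s i. \<Sum>j<s k. G i (l, j) Q * t ^ l * u ^ j)"
        by (simp add: double_sum_bimon J_def)
      also have "\<dots> = (\<Sum>j<s k. \<Sum>l<s i. G i (l, j) Q * t ^ l * u ^ j)" by (rule sum.swap)
      also have "\<dots> = (\<Sum>j<s k. poly (H j i Q) t * u ^ j)"
        using i(3) by (simp add: H_def poly_sum poly_monom sum_distrib_right)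
      finally show "\<zeta> powi g Q (i, t) (k, u) = (\<Sum>j<s k. poly (H j i Q) t * u ^ j)" .
    qed
  qed
  \<comment> \<open>Both sides are polynomials in u of degree below s k that agree on the s k points
    of the fibre, so their coefficients agree.\<close>
  have equi: "\<forall>\<^sub>F Q in cofin Y. \<forall>j<s k. \<forall>i t i' t'. (i, t) \<in> fibre cs Q \<and> (i', t') \<in> fibre cs Q \<longrightarrow>
       poly (H j i Q) t = \<zeta> powi g Q (i, t) (i', t') * poly (H j i' Q) t'"
    using HG M(2)[OF kn(1) kb]
  proof eventually_elim
    case (elim Q)
    show ?case
    proof (intro allI impI)
      fix j i t i' t' assume j: "j < s k" and f: "(i, t) \<in> fibre cs Q \<and> (i', t') \<in> fibre cs Q"
      have fin: "finite (?S k Q)" "card (?S k Q) = s k" using elim(2) by auto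
      have "poly (H j i Q) t - \<zeta> powi g Q (i, t) (i', t') * poly (H j i' Q) t' = 0"
      proof (rule interpolation_unique[OF fin(1), of "\<lambda>j. poly (H j i Q) t - \<zeta> powi g Q (i, t) (i', t') * poly (H j i' Q) t'"])
        show "j < card (?S k Q)" using j fin by simp
        fix u assume u: "u \<in> ?S k Q"
        then have ku: "(k, u) \<in> fibre cs Q" using kn(1) by (simp add: fibre_def)
        have "\<zeta> powi g Q (i, t) (k, u) = \<zeta> powi (g Q (i, t) (i', t') + g Q (i', t') (k, u))"
          using power_int_cong[OF \<zeta> cong_sym[OF cech_cocycleD(4)[OF c]]] f ku by blast
        also have "\<dots> = \<zeta> powi g Q (i, t) (i', t') * \<zeta> powi g Q (i', t') (k, u)"
          using \<zeta>(2) by (simp add: power_int_add)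
        finally have zz: "\<zeta> powi g Q (i, t) (k, u) = \<zeta> powi g Q (i, t) (i', t') * \<zeta> powi g Q (i', t') (k, u)" .
        have e1: "\<zeta> powi g Q (i, t) (k, u) = (\<Sum>j<s k. poly (H j i Q) t * u ^ j)"
          and e2: "\<zeta> powi g Q (i', t') (k, u) = (\<Sum>j<s k. poly (H j i' Q) t' * u ^ j)"
          using elim(1) f u by blast+
        have "(\<Sum>j<s k. poly (H j i Q) t * u ^ j) = \<zeta> powi g Q (i, t) (i', t') * (\<Sum>j<s k. poly (H j i' Q) t' * u ^ j)"
          using zz unfolding e1 e2 .
        then show "(\<Sum>j<card (?S k Q). (poly (H j i Q) t - \<zeta> powi g Q (i, t) (i', t') * poly (H j i' Q) t') * u ^ j) = 0"
          using fin by (simp add: left_diff_distrib sum_subtractf sum_distrib_left mult.assoc)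
      qed
      then show "poly (H j i Q) t = \<zeta> powi g Q (i, t) (i', t') * poly (H j i' Q) t'" by simp
    qed
  qed
  have zm: "(\<zeta> powi a) ^ m = 1" for a
  proof -
    have "(\<zeta> powi a) ^ m = \<zeta> powi (a * int m)" by (simp add: power_int_mult)
    also have "\<dots> = \<zeta> powi 0" by (rule power_int_cong[OF \<zeta>]) (simp add: cong_0_iff)
    finally show ?thesis by simp
  qed
  have Mk: "\<forall>\<^sub>F Q in cofin Y. degree (M k Q) = s k \<and> M k Q \<noteq> 0" using M(2)[OF kn(1) kb] by eventually_elim auto
  \<comment> \<open>The m-th power is constant along each fibre because values of \<zeta>^g have
    m-th power 1. Hence its remainder modulo the fibre equation is a constant, and the constant
    coefficient \<open>r 0\<close> presents it as a rational function on the curve.\<close>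
  have "\<exists>F. rf (cofin Y) F \<and> (\<forall>\<^sub>F Q in cofin Y. \<forall>i t. (i, t) \<in> fibre cs Q \<longrightarrow> poly (H j i Q) t ^ m = F Q)"
    if j: "j < s k" for j
  proof -
    have "rg (cofin Y) (\<lambda>Q t u. poly (H j k Q) u ^ m)" by (intro rg_power rg_poly[OF H[OF kn(1) j]] rg_snd)
    then obtain r where r: "\<And>l. rg (cofin Y) (\<lambda>Q t u. r l Q t)"
      "\<forall>\<^sub>F Q in cofin Y. \<forall>t u. poly (M k Q) u = 0 \<longrightarrow> poly (H j k Q) u ^ m = (\<Sum>l<s k. r l Q t * u ^ l)"
      by (rule rg_reduce[OF eventually_cofin_mem M(1)[OF kn(1) kb] Mk]) blast
    have "\<forall>\<^sub>F Q in cofin Y. \<forall>i t. (i, t) \<in> fibre cs Q \<longrightarrow> poly (H j i Q) t ^ m = r 0 Q 0"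
      using r(2) equi M(2)[OF kn(1) kb] ne
    proof eventually_elim
      case (elim Q)
      obtain u0 where u0: "u0 \<in> ?S k Q" using elim(4) by blast
      have fin: "finite (?S k Q)" "card (?S k Q) = s k" using elim(3) by auto
      have pos: "0 < s k" using fin u0 by (metis card_gt_0_iff empty_iff)
      have f: "(k, u) \<in> fibre cs Q" if "u \<in> ?S k Q" for u using that kn(1) by (simp add: fibre_def)
      have same: "poly (H j i Q) t ^ m = poly (H j k Q) u0 ^ m" if "(i, t) \<in> fibre cs Q" for i t
        using elim(2)[rule_format, OF j, of i t k u0] that f[OF u0] zm by (simp add: power_mult_distrib)
      define v where "v = poly (H j k Q) u0 ^ m"
      have "r 0 Q 0 - v = 0"
      proof -
        let ?c = "\<lambda>l. r l Q 0 - (if l = 0 then v else 0)"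
        have "?c 0 = 0"
        proof (rule interpolation_unique[OF fin(1), of ?c])
          show "0 < card (?S k Q)" using pos fin by simp
          fix u assume u: "u \<in> ?S k Q"
          then have "poly (M k Q) u = 0" using elim(3) by blast
          then have "poly (H j k Q) u ^ m = (\<Sum>l<s k. r l Q 0 * u ^ l)" using elim(1) by blast
          then have "v = (\<Sum>l<s k. r l Q 0 * u ^ l)" using same[OF f[OF u]] by (simp add: v_def)
          moreover have "(\<Sum>l<s k. (if l = 0 then v else 0) * u ^ l) = v"
            using pos by (subst sum.remove[of _ 0]) (auto intro!: sum.neutral)
          ultimately show "(\<Sum>l<card (?S k Q). ?c l * u ^ l) = 0"
            using fin by (simp add: left_diff_distrib sum_subtractf)
        qed
        then show ?thesis by simp
      qed
      then show ?case using same by (simp add: v_def)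
    qed
    then show ?thesis using rf_rg[OF r(1)[of 0], of 0] by (intro exI[of _ "\<lambda>Q. r 0 Q 0"]) simp
  qed
  then have "\<forall>j\<in>{..<s k}. \<exists>F. rf (cofin Y) F \<and> (\<forall>\<^sub>F Q in cofin Y. \<forall>i t. (i, t) \<in> fibre cs Q \<longrightarrow> poly (H j i Q) t ^ m = F Q)"
    by blast
  from bchoice[OF this] obtain F where F: "\<And>j. j < s k \<Longrightarrow> rf (cofin Y) (F j)"
    "\<And>j. j < s k \<Longrightarrow> \<forall>\<^sub>F Q in cofin Y. \<forall>i t. (i, t) \<in> fibre cs Q \<longrightarrow> poly (H j i Q) t ^ m = F j Q" by auto
  \<comment> \<open>If all coefficients vanished generically, then so would \<zeta>^g.\<close>
  have "\<exists>j<s k. \<forall>\<^sub>F Q in cofin Y. F j Q \<noteq> 0"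
  proof (rule ccontr)
    assume "\<not> (\<exists>j<s k. \<forall>\<^sub>F Q in cofin Y. F j Q \<noteq> 0)"
    then have "\<forall>\<^sub>F Q in cofin Y. F j Q = 0" if "j < s k" for j using rf_cofin_dichotomy[OF F(1)[OF that]] that by blast
    then have "\<forall>\<^sub>F Q in cofin Y. \<forall>j\<in>{..<s k}. F j Q = 0" by (intro eventually_ball_finite) auto
    moreover have "\<forall>\<^sub>F Q in cofin Y. \<forall>j\<in>{..<s k}. \<forall>i t. (i, t) \<in> fibre cs Q \<longrightarrow> poly (H j i Q) t ^ m = F j Q"
      by (rule eventually_ball_finite) (use F(2) in auto)
    ultimately have "\<forall>\<^sub>F Q in cofin Y. False" using HG ne
    proof eventually_elim
      case (elim Q)
      obtain u where u: "u \<in> ?S k Q" using elim(4) by blast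
      have f: "(k, u) \<in> fibre cs Q" using u kn(1) by (simp add: fibre_def)
      have "poly (H j k Q) u = 0" if "j < s k" for j
        using elim(1,2) that f by (metis lessThan_iff power_eq_0_iff)
      then have "\<zeta> powi g Q (k, u) (k, u) = 0" using elim(3) f u by simp
      then show False using \<zeta>(2) by simp
    qed
    then show False by simp
  qed
  then obtain j where j: "j < s k" "\<forall>\<^sub>F Q in cofin Y. F j Q \<noteq> 0" by blast
  show ?thesis
  proof (rule that[of "H j" "F j"])
    show "\<forall>\<^sub>F Q in cofin Y. \<forall>i t i' u. (i, t) \<in> fibre cs Q \<and> (i', u) \<in> fibre cs Q \<longrightarrow>
       poly (H j i Q) t = \<zeta> powi g Q (i, t) (i', u) * poly (H j i' Q) u"
      using equi by eventually_elim (use j(1) in blast)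
  qed (use j F H in auto)
qed

end

section \<open>Local normal form and the norm to the projective line\<close>

context cubic_curve begin

lemma rpp_unif_dvd:
  assumes \<pi>: "unif P \<pi>" and B: "rpp (near Y P) (\<lambda>Q _ _. B Q)" "B P = 0"
  obtains A where "rpp (near Y P) (\<lambda>Q _ _. A Q)" "\<forall>\<^sub>F Q in near Y P. B Q = Polynomial.smult (\<pi> Q) (A Q)"
proof -
  obtain D where D: "\<forall>\<^sub>F Q in near Y P. degree (B Q) \<le> D" using B(1) unfolding rpp_def by auto
  have "\<exists>\<psi>. rf (near Y P) \<psi> \<and> (\<forall>\<^sub>F Q in near Y P. coeff (B Q) l = \<pi> Q * \<psi> Q)" for l
    by (rule unif_dvd[OF \<pi> rpp_coeff[OF B(1), of l]]) (use B(2) in auto)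
  then have "\<forall>l. \<exists>\<psi>. rf (near Y P) \<psi> \<and> (\<forall>\<^sub>F Q in near Y P. coeff (B Q) l = \<pi> Q * \<psi> Q)" by blast
  from choice[OF this] obtain \<psi> where \<psi>: "\<forall>l. rf (near Y P) (\<psi> l) \<and> (\<forall>\<^sub>F Q in near Y P. coeff (B Q) l = \<pi> Q * \<psi> l Q)" ..
  have ev: "\<forall>\<^sub>F Q in near Y P. \<forall>l\<in>{..D}. coeff (B Q) l = \<pi> Q * \<psi> l Q"
    by (rule eventually_ball_finite) (use \<psi> in auto)
  show ?thesis
  proof (rule that)
    show "rpp (near Y P) (\<lambda>Q _ _. \<Sum>l\<le>D. monom (\<psi> l Q) l)" by (intro rpp_sum rpp_monom) (use \<psi> in blast)
    show "\<forall>\<^sub>F Q in near Y P. B Q = Polynomial.smult (\<pi> Q) (\<Sum>l\<le>D. monom (\<psi> l Q) l)"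
      using D ev
    proof eventually_elim
      case (elim Q)
      have "coeff (B Q) l = coeff (Polynomial.smult (\<pi> Q) (\<Sum>l\<le>D. monom (\<psi> l Q) l)) l" for l
        using elim by (cases "l \<le> D") (auto simp: coeff_sum coeff_eq_0)
      then show ?case by (simp add: poly_eq_iff)
    qed
  qed
qed

text \<open>A common pole bound for the finitely many coefficients. Each coefficient admits all
  sufficiently large exponents N, which also covers those that are generically zero and have no
  order.\<close>

lemma rpp_denominator:
  assumes P: "P \<in> Y" and \<pi>: "unif P \<pi>" and H: "rpp (cofin Y) (\<lambda>Q _ _. H Q)"
  obtains N A where "rpp (near Y P) (\<lambda>Q _ _. A Q)"
    "\<forall>\<^sub>F Q in cofin Y. H Q = Polynomial.smult (\<pi> Q powi (- int N)) (A Q)"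
proof -
  obtain D where D: "\<forall>\<^sub>F Q in cofin Y. degree (H Q) \<le> D" using H unfolding rpp_def by auto
  have "\<exists>N0. \<forall>N\<ge>N0. \<exists>a. rf (near Y P) a \<and> (\<forall>\<^sub>F Q in cofin Y. coeff (H Q) l = \<pi> Q powi (- int N) * a Q)" for l
  proof -
    have co: "rf (cofin Y) (\<lambda>Q. coeff (H Q) l)" by (rule rpp_coeff[OF H])
    from rf_cofin_dichotomy[OF co] show ?thesis
    proof
      assume "\<forall>\<^sub>F Q in cofin Y. coeff (H Q) l = 0"
      then show ?thesis by (intro exI[of _ 0] allI impI exI[of _ "\<lambda>_. 0"]) (simp add: rg_const)
    next
      assume nz: "\<forall>\<^sub>F Q in cofin Y. coeff (H Q) l \<noteq> 0"
      obtain n \<psi> where \<psi>: "rf (near Y P) \<psi>" "\<forall>\<^sub>F Q in cofin Y. coeff (H Q) l = \<pi> Q powi n * \<psi> Q"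
        by (rule unif_order[OF P \<pi> co nz])
      show ?thesis
      proof (intro exI[of _ "nat (- n)"] allI impI)
        fix N assume N: "N \<ge> nat (- n)"
        have "rf (near Y P) (\<lambda>Q. \<pi> Q ^ nat (n + int N) * \<psi> Q)" by (intro rg_mult rg_power unifD(1)[OF \<pi>] \<psi>(1))
        moreover have "\<forall>\<^sub>F Q in cofin Y. coeff (H Q) l = \<pi> Q powi (- int N) * (\<pi> Q ^ nat (n + int N) * \<psi> Q)"
          using \<psi>(2) unifD(3)[OF \<pi>]
        proof eventually_elim
          case (elim Q)
          have "\<pi> Q powi (- int N) * \<pi> Q powi (n + int N) = \<pi> Q powi n"
            using elim(2) by (simp add: power_int_add[symmetric])
          moreover have "\<pi> Q powi (n + int N) = \<pi> Q ^ nat (n + int N)" using N by (simp add: power_int_def)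
          ultimately show ?case using elim(1) by (simp add: mult.assoc[symmetric])
        qed
        ultimately show "\<exists>a. rf (near Y P) a \<and> (\<forall>\<^sub>F Q in cofin Y. coeff (H Q) l = \<pi> Q powi (- int N) * a Q)"
          by (intro exI[of _ "\<lambda>Q. \<pi> Q ^ nat (n + int N) * \<psi> Q"] conjI)
      qed
    qed
  qed
  then have "\<forall>l. \<exists>N0. \<forall>N\<ge>N0. \<exists>a. rf (near Y P) a \<and> (\<forall>\<^sub>F Q in cofin Y. coeff (H Q) l = \<pi> Q powi (- int N) * a Q)" by blast
  from choice[OF this] obtain N0 where N0: "\<forall>l. \<forall>N\<ge>N0 l. \<exists>a. rf (near Y P) a \<and> (\<forall>\<^sub>F Q in cofin Y. coeff (H Q) l = \<pi> Q powi (- int N) * a Q)" ..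
  define N where "N = Max (N0 ` {..D})"
  have "\<forall>l\<in>{..D}. \<exists>a. rf (near Y P) a \<and> (\<forall>\<^sub>F Q in cofin Y. coeff (H Q) l = \<pi> Q powi (- int N) * a Q)"
  proof
    fix l assume "l \<in> {..D}"
    then have "N \<ge> N0 l" unfolding N_def by (intro Max_ge) auto
    then show "\<exists>a. rf (near Y P) a \<and> (\<forall>\<^sub>F Q in cofin Y. coeff (H Q) l = \<pi> Q powi (- int N) * a Q)" using N0 by blast
  qed
  from bchoice[OF this] obtain a where a: "\<forall>l\<in>{..D}. rf (near Y P) (a l) \<and> (\<forall>\<^sub>F Q in cofin Y. coeff (H Q) l = \<pi> Q powi (- int N) * a l Q)" ..
  have ev: "\<forall>\<^sub>F Q in cofin Y. \<forall>l\<in>{..D}. coeff (H Q) l = \<pi> Q powi (- int N) * a l Q"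
    by (rule eventually_ball_finite) (use a in auto)
  show ?thesis
  proof (rule that)
    show "rpp (near Y P) (\<lambda>Q _ _. \<Sum>l\<le>D. monom (a l Q) l)" by (intro rpp_sum rpp_monom) (use a in blast)
    show "\<forall>\<^sub>F Q in cofin Y. H Q = Polynomial.smult (\<pi> Q powi (- int N)) (\<Sum>l\<le>D. monom (a l Q) l)"
      using D ev
    proof eventually_elim
      case (elim Q)
      have "coeff (H Q) l = coeff (Polynomial.smult (\<pi> Q powi (- int N)) (\<Sum>l\<le>D. monom (a l Q) l)) l" for l
        using elim by (cases "l \<le> D") (auto simp: coeff_sum coeff_eq_0)
      then show ?case by (simp add: poly_eq_iff)
    qed
  qed
qed

text \<open>A uniformizer downstairs remains one upstairs. At \<open>P\<close> both A and
  \<open>eqn\<close> contain X - t0, with cofactors a and e, and e(t0) is nonzero because the root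
  is simple. The combination A e - a \<open>eqn\<close> vanishes identically at \<open>P\<close>,
  hence is divisible by \<pi>, and on the fibre it equals A e.\<close>

lemma local_form_step:
  assumes P: "P \<in> Y" and \<pi>: "unif P \<pi>" and c: "standard_etale Y c" "t0 \<in> chart_fibre c P"
    and A: "rpp (near Y P) (\<lambda>Q _ _. A Q)" "poly (A P) t0 = 0"
  obtains e A' where "poly e t0 \<noteq> 0" "rpp (near Y P) (\<lambda>Q _ _. A' Q)"
    "\<forall>\<^sub>F Q in cofin Y. \<forall>t\<in>chart_fibre c Q. poly (A Q) t * poly e t = \<pi> Q * poly (A' Q) t"
proof -
  have Pb: "P \<in> base c" using c(2) by (simp add: chart_fibre_def)
  obtain d where d: "rpp (near Y P) (\<lambda>Q _ _. eqn c Q)" by (rule chart_near[OF c(1) Pb])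
  have "poly (eqn c P) t0 = 0" using c(2) by (simp add: chart_fibre_def)
  then obtain e where e: "eqn c P = [:-t0, 1:] * e" by (metis poly_eq_0_iff_dvd dvdE)
  obtain a where a: "A P = [:-t0, 1:] * a" using A(2) by (metis poly_eq_0_iff_dvd dvdE)
  have "poly (pderiv (eqn c P)) t0 \<noteq> 0" using c unfolding standard_etale_def by blast
  moreover have "pderiv (eqn c P) = [:-t0, 1:] * pderiv e + e * pderiv [:-t0, 1:]" unfolding e by (rule pderiv_mult)
  ultimately have e0: "poly e t0 \<noteq> 0" by (simp add: pderiv_pCons)
  have B: "rpp (near Y P) (\<lambda>Q _ _. A Q * e - a * eqn c Q)" by (intro rpp_diff rpp_mult A(1) d rpp_const)
  have B0: "A P * e - a * eqn c P = 0" unfolding e a by (simp add: mult_ac del: mult_pCons_left mult_pCons_right)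
  obtain A' where A': "rpp (near Y P) (\<lambda>Q _ _. A' Q)"
    "\<forall>\<^sub>F Q in near Y P. A Q * e - a * eqn c Q = Polynomial.smult (\<pi> Q) (A' Q)"
    by (rule rpp_unif_dvd[OF \<pi> B B0])
  have "\<forall>\<^sub>F Q in cofin Y. \<forall>t\<in>chart_fibre c Q. poly (A Q) t * poly e t = \<pi> Q * poly (A' Q) t"
    using A'(2)[unfolded eventually_near, THEN conjunct1]
  proof eventually_elim
    case (elim Q)
    show ?case
    proof
      fix t assume "t \<in> chart_fibre c Q"
      then show "poly (A Q) t * poly e t = \<pi> Q * poly (A' Q) t"
        using arg_cong[OF elim, of "\<lambda>p. poly p t"] by (simp add: chart_fibre_def)
    qed
  qed
  with e0 A'(1) show ?thesis by (rule that)
qed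

text \<open>At a point of the covering the function given by H is \<pi>^n times a unit, written as a
  quotient A / q of families that are nonzero there. Comparison of m-th powers shows that the order
  of F at \<open>P\<close> is n m.\<close>

lemma local_form:
  assumes P: "P \<in> Y" and \<pi>: "unif P \<pi>" and c: "standard_etale Y c" "t0 \<in> chart_fibre c P"
    and H: "rpp (cofin Y) (\<lambda>Q _ _. H Q)" and F: "rf (cofin Y) F" "\<forall>\<^sub>F Q in cofin Y. F Q \<noteq> 0"
    and HF: "\<forall>\<^sub>F Q in cofin Y. \<forall>t\<in>chart_fibre c Q. poly (H Q) t ^ m = F Q" and m: "m > 0"
  obtains n A q \<phi> where "rpp (near Y P) (\<lambda>Q _ _. A Q)" "rpp (near Y P) (\<lambda>Q _ _. q Q)"
    "poly (A P) t0 \<noteq> 0" "poly (q P) t0 \<noteq> 0" "rf (near Y P) \<phi>" "\<phi> P \<noteq> 0"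
    "\<forall>\<^sub>F Q in cofin Y. F Q = \<pi> Q powi (n * int m) * \<phi> Q"
    "\<forall>\<^sub>F Q in cofin Y. \<forall>t\<in>chart_fibre c Q. poly (H Q) t * poly (q Q) t = \<pi> Q powi n * poly (A Q) t"
    "poly (A P) t0 ^ m = \<phi> P * poly (q P) t0 ^ m"
proof -
  obtain l \<phi> where \<phi>: "rf (near Y P) \<phi>" "\<phi> P \<noteq> 0" "\<forall>\<^sub>F Q in cofin Y. F Q = \<pi> Q powi l * \<phi> Q"
    by (rule unif_order[OF P \<pi> F])
  have vanish: "\<Psi> P t0 = 0" if "rg (near Y P) (\<lambda>Q t u. \<Psi> Q t)" "\<forall>\<^sub>F Q in cofin Y. \<forall>t\<in>chart_fibre c Q. \<Psi> Q t = 0" for \<Psi>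
  proof -
    have "\<forall>\<^sub>F Q in cofin Y. \<forall>t\<in>chart_fibre c Q. \<forall>u\<in>chart_fibre c Q. \<Psi> Q t = 0"
      using that(2) by eventually_elim blast
    from fibre_vanishing[OF c c P that(1) this] show ?thesis .
  qed
  have rel: "\<forall>\<^sub>F Q in cofin Y. \<forall>t\<in>chart_fibre c Q. \<pi> Q powi l * \<phi> Q * poly (q Q) t ^ m = \<pi> Q powi (n * int m) * poly (A Q) t ^ m"
    if "\<forall>\<^sub>F Q in cofin Y. \<forall>t\<in>chart_fibre c Q. poly (H Q) t * poly (q Q) t = \<pi> Q powi n * poly (A Q) t" for n q A
    using that HF \<phi>(3)
  proof eventually_elim
    case (elim Q)
    show ?case
    proof
      fix t assume t: "t \<in> chart_fibre c Q"
      have "(poly (H Q) t * poly (q Q) t) ^ m = (\<pi> Q powi n * poly (A Q) t) ^ m" using elim(1) t by simp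
      then show "\<pi> Q powi l * \<phi> Q * poly (q Q) t ^ m = \<pi> Q powi (n * int m) * poly (A Q) t ^ m"
        using elim(2,3) t by (simp add: power_mult_distrib power_int_mult)
    qed
  qed
  have rgA: "rg (near Y P) (\<lambda>Q t u. poly (A Q) t ^ m)" if "rpp (near Y P) (\<lambda>Q _ _. A Q)" for A
    by (intro rg_power rg_poly[OF that] rg_fst)
  have "\<exists>A q. rpp (near Y P) (\<lambda>Q _ _. A Q) \<and> rpp (near Y P) (\<lambda>Q _ _. q Q) \<and>
    poly (A P) t0 \<noteq> 0 \<and> poly (q P) t0 \<noteq> 0 \<and> (\<exists>n. l = n * int m \<and>
    (\<forall>\<^sub>F Q in cofin Y. \<forall>t\<in>chart_fibre c Q. poly (H Q) t * poly (q Q) t = \<pi> Q powi n * poly (A Q) t)) \<and>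
    poly (A P) t0 ^ m = \<phi> P * poly (q P) t0 ^ m"
    if "rpp (near Y P) (\<lambda>Q _ _. A Q)" "rpp (near Y P) (\<lambda>Q _ _. q Q)" "poly (q P) t0 \<noteq> 0"
      "\<forall>\<^sub>F Q in cofin Y. \<forall>t\<in>chart_fibre c Q. poly (H Q) t * poly (q Q) t = \<pi> Q powi n * poly (A Q) t" for A q n
    using that
  proof (induction "nat (l - n * int m)" arbitrary: A q n rule: less_induct)
    case (less n A q)
    note rel' = rel[OF less.prems(4)]
    \<comment> \<open>As long as n m < l the family A vanishes at t0, so one more factor \<pi> is
      split off; n m > l would force the unit \<phi> q^m to vanish at the point.\<close>
    consider "l < n * int m" | "l = n * int m" | "l > n * int m" by linarith
    then show ?case
    proof cases
      case 1
      have "\<forall>\<^sub>F Q in cofin Y. \<forall>t\<in>chart_fibre c Q. \<phi> Q * poly (q Q) t ^ m - \<pi> Q ^ nat (n * int m - l) * poly (A Q) t ^ m = 0"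
        using rel' unifD(3)[OF \<pi>]
      proof eventually_elim
        case (elim Q)
        have "\<pi> Q powi (n * int m) = \<pi> Q powi l * \<pi> Q ^ nat (n * int m - l)"
          using elim(2) 1 power_int_add[of "\<pi> Q" l "n * int m - l"] by (simp add: power_int_def)
        then show ?case using elim by simp
      qed
      moreover have "rg (near Y P) (\<lambda>Q t u. \<phi> Q * poly (q Q) t ^ m - \<pi> Q ^ nat (n * int m - l) * poly (A Q) t ^ m)"
        by (intro rg_diff rg_mult \<phi>(1) rgA less.prems(1,2)) (rule rg_power[OF unifD(1)[OF \<pi>]])
      ultimately have "\<phi> P * poly (q P) t0 ^ m - \<pi> P ^ nat (n * int m - l) * poly (A P) t0 ^ m = 0"
        by (intro vanish)
      moreover have "nat (n * int m - l) \<noteq> 0" using 1 by simp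
      ultimately have "\<phi> P * poly (q P) t0 ^ m = 0" using unifD(2)[OF \<pi>] by (simp add: power_0_left)
      then show ?thesis using \<phi>(2) less.prems(3) by simp
    next
      case 2
      have "\<forall>\<^sub>F Q in cofin Y. \<forall>t\<in>chart_fibre c Q. poly (A Q) t ^ m - \<phi> Q * poly (q Q) t ^ m = 0"
        using rel' unifD(3)[OF \<pi>] by eventually_elim (simp add: 2)
      moreover have "rg (near Y P) (\<lambda>Q t u. poly (A Q) t ^ m - \<phi> Q * poly (q Q) t ^ m)"
        by (intro rg_diff rg_mult \<phi>(1) rgA less.prems(1,2))
      ultimately have "poly (A P) t0 ^ m - \<phi> P * poly (q P) t0 ^ m = 0" by (intro vanish)
      then have eq: "poly (A P) t0 ^ m = \<phi> P * poly (q P) t0 ^ m" by simp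
      then have nz: "poly (A P) t0 \<noteq> 0" using \<phi>(2) less.prems(3) m by (auto simp: power_0_left)
      show ?thesis
        by (rule exI[of _ A], rule exI[of _ q], intro conjI exI[of _ n]) (fact less.prems 2 eq nz)+
    next
      case 3
      have "\<forall>\<^sub>F Q in cofin Y. \<forall>t\<in>chart_fibre c Q. poly (A Q) t ^ m - \<pi> Q ^ nat (l - n * int m) * (\<phi> Q * poly (q Q) t ^ m) = 0"
        using rel' unifD(3)[OF \<pi>]
      proof eventually_elim
        case (elim Q)
        have "\<pi> Q powi l = \<pi> Q powi (n * int m) * \<pi> Q ^ nat (l - n * int m)"
          using elim(2) 3 power_int_add[of "\<pi> Q" "n * int m" "l - n * int m"] by (simp add: power_int_def)
        then show ?case using elim by simp
      qed
      moreover have "rg (near Y P) (\<lambda>Q t u. poly (A Q) t ^ m - \<pi> Q ^ nat (l - n * int m) * (\<phi> Q * poly (q Q) t ^ m))"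
        by (intro rg_diff rg_mult \<phi>(1) rgA less.prems(1,2)) (rule rg_power[OF unifD(1)[OF \<pi>]])
      ultimately have "poly (A P) t0 ^ m - \<pi> P ^ nat (l - n * int m) * (\<phi> P * poly (q P) t0 ^ m) = 0"
        by (intro vanish)
      moreover have "nat (l - n * int m) \<noteq> 0" using 3 by simp
      ultimately have "poly (A P) t0 = 0" using unifD(2)[OF \<pi>] by (simp add: power_0_left)
      then obtain e A' where e: "poly e t0 \<noteq> 0" "rpp (near Y P) (\<lambda>Q _ _. A' Q)"
        "\<forall>\<^sub>F Q in cofin Y. \<forall>t\<in>chart_fibre c Q. poly (A Q) t * poly e t = \<pi> Q * poly (A' Q) t"
        by (rule local_form_step[OF P \<pi> c less.prems(1)])
      have "nat (l - (n + 1) * int m) < nat (l - n * int m)" using 3 m by (simp add: algebra_simps)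
      moreover have "rpp (near Y P) (\<lambda>Q _ _. q Q * e)" by (intro rpp_mult less.prems(2) rpp_const)
      moreover have "poly (q P * e) t0 \<noteq> 0" using less.prems(3) e(1) by simp
      moreover have "\<forall>\<^sub>F Q in cofin Y. \<forall>t\<in>chart_fibre c Q. poly (H Q) t * poly (q Q * e) t = \<pi> Q powi (n + 1) * poly (A' Q) t"
        using less.prems(4) e(3) unifD(3)[OF \<pi>]
      proof eventually_elim
        case (elim Q)
        show ?case
        proof
          fix t assume t: "t \<in> chart_fibre c Q"
          have "poly (H Q) t * poly (q Q * e) t = (poly (H Q) t * poly (q Q) t) * poly e t" by simp
          also have "\<dots> = \<pi> Q powi n * (poly (A Q) t * poly e t)" using elim(1) t by simp
          also have "\<dots> = \<pi> Q powi (n + 1) * poly (A' Q) t" using elim(2,3) t by (simp add: power_int_add)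
          finally show "poly (H Q) t * poly (q Q * e) t = \<pi> Q powi (n + 1) * poly (A' Q) t" .
        qed
      qed
      ultimately show ?thesis using less.hyps[of "n + 1" A' "\<lambda>Q. q Q * e"] e(2) by blast
    qed
  qed
  note step = this
  \<comment> \<open>Clearing the poles of the coefficients of H provides the initial exponent -N,
    with q = 1.\<close>
  obtain N A0 where A0: "rpp (near Y P) (\<lambda>Q _ _. A0 Q)"
    "\<forall>\<^sub>F Q in cofin Y. H Q = Polynomial.smult (\<pi> Q powi (- int N)) (A0 Q)" by (rule rpp_denominator[OF P \<pi> H])
  have "\<forall>\<^sub>F Q in cofin Y. \<forall>t\<in>chart_fibre c Q. poly (H Q) t * poly 1 t = \<pi> Q powi (- int N) * poly (A0 Q) t"
    using A0(2) by eventually_elim simp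
  from step[OF A0(1) rpp_const[of _ 1] _ this] obtain A q n where
    "rpp (near Y P) (\<lambda>Q _ _. A Q)" "rpp (near Y P) (\<lambda>Q _ _. q Q)"
    "poly (A P) t0 \<noteq> 0" "poly (q P) t0 \<noteq> 0" "l = n * int m"
    "\<forall>\<^sub>F Q in cofin Y. \<forall>t\<in>chart_fibre c Q. poly (H Q) t * poly (q Q) t = \<pi> Q powi n * poly (A Q) t"
    "poly (A P) t0 ^ m = \<phi> P * poly (q P) t0 ^ m" by auto
  with \<phi> show ?thesis by (intro that) simp_all
qed

lemma eventually_perm:
  assumes "bij \<sigma>" "eventually \<Phi> (cofin Y)" shows "\<forall>\<^sub>F Q in cofin Y. \<Phi> (perm_point \<sigma> Q)"
proof -
  have fin: "finite {P\<in>Y. \<not> \<Phi> P}" using assms(2) by (simp add: eventually_cofin)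
  have id: "perm_point (inv_into UNIV \<sigma>) (perm_point \<sigma> P) = P" for P :: "('k, 3 option) point"
    unfolding perm_point_compose[OF bij_imp_bij_inv[OF assms(1)] assms(1)]
    using assms(1) by (simp add: bij_is_inj perm_point_def option.map_id0 id_def[symmetric] option.map_id)
  have "{P\<in>Y. \<not> \<Phi> (perm_point \<sigma> P)} \<subseteq> perm_point (inv_into UNIV \<sigma>) ` {P\<in>Y. \<not> \<Phi> P}"
  proof
    fix Q assume "Q \<in> {P\<in>Y. \<not> \<Phi> (perm_point \<sigma> P)}"
    then show "Q \<in> perm_point (inv_into UNIV \<sigma>) ` {P\<in>Y. \<not> \<Phi> P}"
      using id[of Q] perm_point_in_Y[OF assms(1)] by (intro image_eqI[of _ _ "perm_point \<sigma> Q"]) auto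
  qed
  then show ?thesis using fin by (auto simp: eventually_cofin intro: finite_subset)
qed

lemma eventually_near_perm:
  assumes "bij \<sigma>" "eventually \<Phi> (near Y (perm_point \<sigma> P))" shows "\<forall>\<^sub>F Q in near Y P. \<Phi> (perm_point \<sigma> Q)"
  using assms eventually_perm[OF assms(1)] by (simp add: eventually_near)

lemma rg_perm:
  assumes "rg F' \<Psi>" "\<And>\<Phi>. eventually \<Phi> F' \<Longrightarrow> \<forall>\<^sub>F Q in F. \<Phi> (perm_point \<sigma> Q)"
  shows "rg F (\<lambda>Q. \<Psi> (perm_point \<sigma> Q))"
proof -
  obtain d f g where *: "form2 d f" "form d g"
    "\<forall>\<^sub>F Q in F'. \<forall>v\<in>Q. g v \<noteq> 0 \<and> (\<forall>t u. \<Psi> Q t u = f (v, t, u) / g v)"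
    using assms(1) unfolding rg_def by blast
  show ?thesis
    by (rule rgI[OF form2_pvec[OF *(1), of \<sigma>] form_pvec[OF *(2), of \<sigma>]], use assms(2)[OF *(3)] in eventually_elim)
       (auto simp: perm_point_pvec)
qed

lemma rg_cofin_perm:
  assumes "rg (cofin Y) \<Psi>" "bij \<sigma>" shows "rg (cofin Y) (\<lambda>Q. \<Psi> (perm_point \<sigma> Q))"
  by (rule rg_perm[OF assms(1)]) (rule eventually_perm[OF assms(2)])

lemma rg_near_perm:
  assumes "rg (near Y (perm_point \<sigma> P)) \<Psi>" "bij \<sigma>" shows "rg (near Y P) (\<lambda>Q. \<Psi> (perm_point \<sigma> Q))"
  by (rule rg_perm[OF assms(1)]) (rule eventually_near_perm[OF assms(2)])

lemma rpp_near_perm: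
  assumes "bij \<sigma>" "rpp (near Y (perm_point \<sigma> P)) p" shows "rpp (near Y P) (\<lambda>Q. p (perm_point \<sigma> Q))"
proof -
  obtain D where D: "\<forall>\<^sub>F Q in near Y (perm_point \<sigma> P). \<forall>t u. degree (p Q t u) \<le> D" using assms(2) unfolding rpp_def by blast
  from eventually_near_perm[OF assms(1) D] rg_near_perm[OF rpp_coeff[OF assms(2)] assms(1)]
  show ?thesis unfolding rpp_def by blast
qed

end

lemma poly_eq_prod_roots:
  fixes p :: "'k::alg_closed_field poly"
  assumes "p \<noteq> 0"
  obtains A where "\<And>x. poly p x = lead_coeff p * (\<Prod>a\<in>set_mset A. (x - a) ^ count A a)"
proof -
  obtain A where A: "p = Polynomial.smult (lead_coeff p) (\<Prod>x\<in>#A. [:-x, 1:])"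
    using alg_closed_imp_factorization[OF assms] by blast
  have "poly p x = lead_coeff p * (\<Prod>a\<in>set_mset A. (x - a) ^ count A a)" for x
  proof -
    have "poly p x = lead_coeff p * poly (\<Prod>a\<in>#A. [:-a, 1:]) x"
      using arg_cong[OF A, of "\<lambda>q. poly q x"] by (simp only: poly_smult)
    also have "poly (\<Prod>a\<in>#A. [:-a, 1:]) x = (\<Prod>a\<in>#A. (x - a))"
      by (simp add: poly_prod_mset image_mset.compositionality comp_def)
    also have "\<dots> = (\<Prod>a\<in>set_mset A. (x - a) ^ count A a)"
      by (rule image_prod_mset_multiplicity)
    finally show ?thesis .
  qed
  then show ?thesis using that by blast
qed

section \<open>Reflections and the norm to the u-line\<close>

context cubic_curve begin

text \<open>The involution y -> -y of the double cover by u, so that functions of u are its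
  invariants.\<close>

abbreviation refl_pt :: "3 \<Rightarrow> ('k, 3 option) point \<Rightarrow> ('k, 3 option) point" where
  "refl_pt i \<equiv> perm_point (Transposition.transpose (i + 1) (i + 2))"

lemma refl_coords:
  assumes "P \<in> Y"
  shows "refl_pt i P \<in> Y" "xc i (refl_pt i P) \<noteq> 0 \<longleftrightarrow> xc i P \<noteq> 0"
    "uc i (refl_pt i P) = uc i P" "yc i (refl_pt i P) = - yc i P"
proof -
  let ?\<sigma> = "Transposition.transpose (i + 1) (i + 2)"
  show Y: "refl_pt i P \<in> Y" by (rule perm_point_in_Y[OF _ assms]) simp
  have v: "pvec ?\<sigma> (rep P) \<in> refl_pt i P" unfolding perm_point_pvec using rep_in[OF assms] by (rule imageI)
  have s: "pvec ?\<sigma> w $ None = w $ None" "pvec ?\<sigma> w $ Some i = w $ Some i"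
    "pvec ?\<sigma> w $ Some (i + 1) = w $ Some (i + 2)" "pvec ?\<sigma> w $ Some (i + 2) = w $ Some (i + 1)" for w :: "'k^(3 option)"
    using shift_3_neq[of i] by (simp_all add: pvec_def Transposition.transpose_def)
  show "xc i (refl_pt i P) \<noteq> 0 \<longleftrightarrow> xc i P \<noteq> 0"
    using xc_nonzero_iff[OF Y v, of i] by (simp add: s xc_def)
  show "uc i (refl_pt i P) = uc i P" using uc_eq[OF Y v, of i] by (simp add: s uc_def)
  show "yc i (refl_pt i P) = - yc i P"
    using yc_eq[OF Y v, of i] by (simp only: s yc_def minus_divide_left minus_diff_eq)
qed

text \<open>The norm is a quotient of two polynomials in u, hence a constant times powers of the u -
  a. Its exponents are computed on the curve, where the orders of F are multiples of m; a constant
  has an m-th root because the field is algebraically closed.\<close>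

lemma norm_is_power:
  assumes F: "rf (cofin Y) F" "\<forall>\<^sub>F Q in cofin Y. F Q \<noteq> 0" and m: "m > 0"
    and loc: "\<And>P \<pi>. P \<in> Y \<Longrightarrow> unif P \<pi> \<Longrightarrow>
      \<exists>n \<phi>. rf (near Y P) \<phi> \<and> \<phi> P \<noteq> 0 \<and> (\<forall>\<^sub>F Q in cofin Y. F Q = \<pi> Q powi (n * int m) * \<phi> Q)"
  obtains R where "rf (cofin Y) R" "\<forall>\<^sub>F Q in cofin Y. R Q \<noteq> 0" "\<forall>\<^sub>F Q in cofin Y. F Q * F (refl_pt i Q) = R Q ^ m"
proof -
  let ?s = "refl_pt i"
  let ?b = "Transposition.transpose (i + 1) (i + 2)"
  have bij: "bij ?b" by simp
  have ch: "\<forall>\<^sub>F Q in cofin Y. Q \<in> Y \<and> xc i Q \<noteq> 0" using eventually_cofin_mem eventually_chart[of i] by eventually_elim simp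
  obtain a b a' b' where ab:
    "\<forall>\<^sub>F Q in cofin Y. poly a' (uc i Q) + poly b' (uc i Q) * yc i Q \<noteq> 0 \<and>
       F Q = (poly a (uc i Q) + poly b (uc i Q) * yc i Q) / (poly a' (uc i Q) + poly b' (uc i Q) * yc i Q)"
    by (rule rf_chart[OF ch F(1)])
  define n1 n2 where "n1 = a\<^sup>2 - b\<^sup>2 * Dpol" and "n2 = a'\<^sup>2 - b'\<^sup>2 * Dpol"
  have nonz: "n1 \<noteq> 0 \<and> n2 \<noteq> 0"
  proof -
    have "a \<noteq> 0 \<or> b \<noteq> 0"
    proof (rule ccontr)
      assume *: "\<not> (a \<noteq> 0 \<or> b \<noteq> 0)"
      have "\<forall>\<^sub>F Q in cofin Y. False" using ab F(2) by eventually_elim (use * in simp)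
      then show False by simp
    qed
    moreover have "a' \<noteq> 0 \<or> b' \<noteq> 0"
    proof (rule ccontr)
      assume *: "\<not> (a' \<noteq> 0 \<or> b' \<noteq> 0)"
      have "\<forall>\<^sub>F Q in cofin Y. False" using ab by eventually_elim (use * in simp)
      then show False by simp
    qed
    ultimately show ?thesis unfolding n1_def n2_def using norm_nonzero by blast
  qed
  have nrm: "(poly a u + poly b u * y) * (poly a u - poly b u * y) = poly (a\<^sup>2 - b\<^sup>2 * Dpol) u" if "y\<^sup>2 = 1 - 4 * \<epsilon> * u ^ 3" for a b u y
  proof -
    have "(poly a u + poly b u * y) * (poly a u - poly b u * y) = (poly a u)\<^sup>2 - (poly b u)\<^sup>2 * y\<^sup>2"
      by (simp add: power2_eq_square algebra_simps)
    then show ?thesis using that by (simp add: poly_Dpol)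
  qed
  have N: "\<forall>\<^sub>F Q in cofin Y. F Q * F (?s Q) = poly n1 (uc i Q) / poly n2 (uc i Q) \<and> poly n2 (uc i Q) \<noteq> 0"
    using ab eventually_perm[OF bij ab] ch
  proof eventually_elim
    case (elim Q)
    have Q: "Q \<in> Y" "(yc i Q)\<^sup>2 = 1 - 4 * \<epsilon> * uc i Q ^ 3" using elim(3) chart_point(1)[of Q i] by auto
    have e2: "poly a' (uc i Q) - poly b' (uc i Q) * yc i Q \<noteq> 0"
      "F (?s Q) = (poly a (uc i Q) - poly b (uc i Q) * yc i Q) / (poly a' (uc i Q) - poly b' (uc i Q) * yc i Q)"
      using elim(2) by (simp_all add: refl_coords[OF Q(1)])
    show ?case unfolding n1_def n2_def nrm[OF Q(2), symmetric] using e2 elim(1) by simp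
  qed
  obtain A1 where A1: "\<And>x. poly n1 x = lead_coeff n1 * (\<Prod>a\<in>set_mset A1. (x - a) ^ count A1 a)"
    using poly_eq_prod_roots nonz by blast
  obtain A2 where A2: "\<And>x. poly n2 x = lead_coeff n2 * (\<Prod>a\<in>set_mset A2. (x - a) ^ count A2 a)"
    using poly_eq_prod_roots nonz by blast
  define Z where "Z = set_mset A1 \<union> set_mset A2"
  have finZ: "finite Z" by (simp add: Z_def)
  define e where "e = (\<lambda>a. int (count A1 a) - int (count A2 a))"
  define \<kappa> where "\<kappa> = lead_coeff n1 / lead_coeff n2"
  have \<kappa>: "\<kappa> \<noteq> 0" using nonz by (simp add: \<kappa>_def)
  have notZ: "\<forall>\<^sub>F Q in cofin Y. uc i Q \<notin> Z"
  proof -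
    have "finite ({P\<in>Y. xc i P \<noteq> 0 \<and> uc i P \<in> Z} \<union> {P\<in>Y. xc i P = 0})"
      using finite_u_fibre[OF finZ] finite_off_chart by blast
    then show ?thesis unfolding eventually_cofin by (rule finite_subset[rotated]) auto
  qed
  have quot: "poly n1 x / poly n2 x = \<kappa> * (\<Prod>a\<in>Z. (x - a) powi e a)" if "x \<notin> Z" for x
  proof -
    have "(\<Prod>a\<in>set_mset A1. (x - a) ^ count A1 a) = (\<Prod>a\<in>Z. (x - a) ^ count A1 a)"
      "(\<Prod>a\<in>set_mset A2. (x - a) ^ count A2 a) = (\<Prod>a\<in>Z. (x - a) ^ count A2 a)"
      using finZ by (intro prod.mono_neutral_left; auto simp: Z_def not_in_iff)+
    then have "poly n1 x / poly n2 x = \<kappa> * (\<Prod>a\<in>Z. (x - a) ^ count A1 a / (x - a) ^ count A2 a)"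
      by (simp add: A1[of x] A2[of x] \<kappa>_def prod_dividef)
    also have "(\<Prod>a\<in>Z. (x - a) ^ count A1 a / (x - a) ^ count A2 a) = (\<Prod>a\<in>Z. (x - a) powi e a)"
    proof (rule prod.cong[OF refl])
      fix a assume "a \<in> Z"
      then have "x - a \<noteq> 0" using that by auto
      then show "(x - a) ^ count A1 a / (x - a) ^ count A2 a = (x - a) powi e a"
        by (simp add: e_def power_int_diff)
    qed
    finally show ?thesis .
  qed
  have N': "\<forall>\<^sub>F Q in cofin Y. F Q * F (?s Q) = \<kappa> * (\<Prod>a\<in>Z. (uc i Q - a) powi e a)"
    using N notZ by eventually_elim (use quot in simp)
  have dvd: "int m dvd e u0" if u0: "u0 \<in> Z" for u0
  proof -
    obtain y0 where y0: "y0\<^sup>2 = 1 - 4 * \<epsilon> * u0 ^ 3" using nth_root_exists[of 2 "1 - 4 * \<epsilon> * u0 ^ 3"] by auto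
    define P where "P = cpt i u0 y0"
    have P: "P \<in> Y" "xc i P \<noteq> 0" "uc i P = u0" "yc i P = y0"
      using cpt_in_Y[OF y0] cpt_coords[OF y0] by (auto simp: P_def)
    note sP = refl_coords[OF P(1), of i]
    \<comment> \<open>The same function is a uniformizer at \<open>P\<close> and at its mirror
      image, whose coordinates are u0 and -y0.\<close>
    define \<pi> where "\<pi> = (if y0 = 0 then yc i else (\<lambda>Q. uc i Q - u0))"
    have \<pi>: "unif P \<pi>" "unif (?s P) \<pi>"
      using unif_chart[OF P(1,2)] unif_chart[OF sP(1) sP(2)[THEN iffD2, OF P(2)]]
      unfolding sP(3,4) P(3,4) neg_equal_0_iff_equal \<pi>_def .
    obtain n \<phi> where n: "rf (near Y P) \<phi>" "\<phi> P \<noteq> 0" "\<forall>\<^sub>F Q in cofin Y. F Q = \<pi> Q powi (n * int m) * \<phi> Q"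
      using loc[OF P(1) \<pi>(1)] by blast
    obtain n' \<phi>' where n': "rf (near Y (?s P)) \<phi>'" "\<phi>' (?s P) \<noteq> 0" "\<forall>\<^sub>F Q in cofin Y. F Q = \<pi> Q powi (n' * int m) * \<phi>' Q"
      using loc[OF sP(1) \<pi>(2)] by blast
    have r\<phi>': "rf (near Y P) (\<lambda>Q. \<phi>' (?s Q))" by (rule rg_near_perm[OF n'(1) bij])
    note near = near_chart[OF P(1,2)]
    note rf_u = rf_uc[OF near]
    define h where "h = (\<lambda>Q. \<kappa> * (\<Prod>a\<in>Z - {u0}. (uc i Q - a) powi e a))"
    have h: "rf (near Y P) h" unfolding h_def
    proof (intro rg_mult rg_const rg_prod)
      fix a assume a: "a \<in> Z - {u0}"
      have rfd: "rf (near Y P) (\<lambda>Q. uc i Q - a)" by (intro rg_diff rf_u rg_const)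
      show "rf (near Y P) (\<lambda>Q. (uc i Q - a) powi e a)"
        by (rule rf_power_int[OF rfd rf_near_nonzero[OF P(1) rfd]]) (use a P(3) in auto)
    qed
    have h0: "h P \<noteq> 0" using \<kappa> finZ P(3) by (auto simp: h_def)
    have split: "\<forall>\<^sub>F Q in cofin Y. F Q * F (?s Q) = (uc i Q - u0) powi e u0 * h Q"
      using N' by eventually_elim (simp add: h_def prod.remove[OF finZ u0] mult.left_commute)
    show ?thesis
    proof (cases "y0 = 0")
      case False
      \<comment> \<open>Off the branch points u - u0 has order 1, and the reflected function has at
        \<open>P\<close> the order that F has at the mirror image; the two orders add up.\<close>
      have "\<forall>\<^sub>F Q in cofin Y. \<pi> Q powi e u0 * h Q = \<pi> Q powi ((n + n') * int m) * (\<phi> Q * \<phi>' (?s Q))"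
        using split n(3) eventually_perm[OF bij n'(3)] ch unifD(3)[OF \<pi>(1)]
      proof eventually_elim
        case (elim Q)
        have "\<pi> (?s Q) = \<pi> Q" using False refl_coords[of Q i] elim(4) by (simp add: \<pi>_def)
        then have "\<pi> Q powi e u0 * h Q = (\<pi> Q powi (n * int m) * \<pi> Q powi (n' * int m)) * (\<phi> Q * \<phi>' (?s Q))"
          using elim(1-3) False by (simp add: \<pi>_def mult_ac)
        also have "\<pi> Q powi (n * int m) * \<pi> Q powi (n' * int m) = \<pi> Q powi ((n + n') * int m)"
          using elim(5) by (simp add: power_int_add[symmetric] distrib_right)
        finally show ?case .
      qed
      from unif_order_unique[OF P(1) \<pi>(1) h h0 _ _ this] have "e u0 = (n + n') * int m"
        using rg_mult[OF n(1) r\<phi>'] n(2) n'(2) by simp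
      then show ?thesis by simp
    next
      case True
      have sPP: "?s P = P"
        using chart_point(2)[OF sP(1), of i] chart_point(2)[OF P(1,2)] sP P True by simp
      define D1 where "D1 = Polynomial.smult (- 4 * \<epsilon>) [:u0\<^sup>2, u0, 1:]"
      have rD: "rf (near Y P) (\<lambda>Q. poly D1 (uc i Q))" by (rule rf_of_poly[OF rf_u])
      have "u0 \<noteq> 0" using y0 True by auto
      moreover have "(12::'k) \<noteq> 0" using three four mult_eq_0_iff[of "3::'k" 4] by simp
      moreover have "poly D1 u0 = - 12 * \<epsilon> * u0\<^sup>2" by (simp add: D1_def power2_eq_square algebra_simps)
      ultimately have D10: "poly D1 (uc i P) \<noteq> 0" using eps P(3) by simp
      note Dn = rf_near_nonzero[OF P(1) rD D10]
      define \<psi> where "\<psi> = (\<lambda>Q. poly D1 (uc i Q) powi (- e u0) * h Q)"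
      have \<psi>: "rf (near Y P) \<psi>" unfolding \<psi>_def by (intro rg_mult rf_power_int rD Dn h)
      define \<phi>2 where "\<phi>2 = (\<lambda>Q. (-1) powi (n * int m) * (\<phi> Q * \<phi> (?s Q)))"
      have \<phi>2: "rf (near Y P) \<phi>2" unfolding \<phi>2_def
        using rg_near_perm[OF _ bij, of P "\<lambda>Q _ _. \<phi> Q"] n(1) unfolding sPP by (intro rg_mult rg_const) simp_all
      \<comment> \<open>At a branch point, which the reflection fixes, both sides double: u - u0 has
        order 2, and F and its reflection have equal order. The sign in \<phi>2 comes from \<pi>
        changing sign under the reflection.\<close>
      have "\<forall>\<^sub>F Q in cofin Y. \<pi> Q powi (2 * e u0) * \<psi> Q = \<pi> Q powi (2 * (n * int m)) * \<phi>2 Q"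
        using split n(3) eventually_perm[OF bij n(3)] ch unifD(3)[OF \<pi>(1)] Dn[unfolded eventually_near, THEN conjunct1]
      proof eventually_elim
        case (elim Q)
        have Q: "Q \<in> Y" "xc i Q \<noteq> 0" using elim(4) by auto
        have pi: "\<pi> Q = yc i Q" "\<pi> (?s Q) = - \<pi> Q" using True refl_coords[OF Q(1), of i] by (simp_all add: \<pi>_def)
        have "(\<pi> Q)\<^sup>2 = (uc i Q - u0) * poly D1 (uc i Q)"
          using chart_point(1)[OF Q] Dpol_factor[of "uc i Q" u0] y0 True by (simp add: poly_Dpol D1_def pi)
        then have "uc i Q - u0 = (\<pi> Q)\<^sup>2 * inverse (poly D1 (uc i Q))" using elim(6) by (simp add: field_simps)
        then have "(uc i Q - u0) powi e u0 = \<pi> Q powi (2 * e u0) * poly D1 (uc i Q) powi (- e u0)"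
          by (simp add: power_int_mult_distrib power_int_mult power_int_minus power_int_inverse)
        then have "\<pi> Q powi (2 * e u0) * \<psi> Q = F Q * F (?s Q)" using elim(1) by (simp add: \<psi>_def mult.assoc)
        also have "\<dots> = \<pi> Q powi (n * int m) * (- \<pi> Q) powi (n * int m) * (\<phi> Q * \<phi> (?s Q))"
          using elim(2,3) pi by (simp add: mult_ac)
        also have "(- \<pi> Q) powi (n * int m) = (-1) powi (n * int m) * \<pi> Q powi (n * int m)"
          by (metis mult_minus1 power_int_mult_distrib)
        also have "\<pi> Q powi (n * int m) * ((-1) powi (n * int m) * \<pi> Q powi (n * int m)) * (\<phi> Q * \<phi> (?s Q)) =
          (\<pi> Q powi (n * int m) * \<pi> Q powi (n * int m)) * \<phi>2 Q" by (simp add: \<phi>2_def mult_ac)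
        also have "\<pi> Q powi (n * int m) * \<pi> Q powi (n * int m) = \<pi> Q powi (2 * (n * int m))"
          using elim(5) by (simp add: power_int_add[symmetric])
        finally show ?case .
      qed
      from unif_order_unique[OF P(1) \<pi>(1) \<psi> _ \<phi>2 _ this] have "2 * e u0 = 2 * (n * int m)"
        using D10 h0 n(2) by (simp add: \<psi>_def \<phi>2_def sPP)
      then show ?thesis by simp
    qed
  qed
  obtain \<kappa>' where \<kappa>': "\<kappa>' ^ m = \<kappa>" using nth_root_exists[OF m] by blast
  have \<kappa>'0: "\<kappa>' \<noteq> 0" using \<kappa> \<kappa>' m by auto
  define R where "R = (\<lambda>Q. \<kappa>' * (\<Prod>a\<in>Z. (uc i Q - a) powi (e a div int m)))"
  show ?thesis
  proof (rule that)
    show "rf (cofin Y) R" unfolding R_def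
    proof (intro rg_mult rg_const rg_prod)
      fix a assume a: "a \<in> Z"
      have rfd: "rf (cofin Y) (\<lambda>Q. uc i Q - a)" by (intro rg_diff rf_uc[OF ch] rg_const)
      show "rf (cofin Y) (\<lambda>Q. (uc i Q - a) powi (e a div int m))"
        by (rule rf_power_int[OF rfd], use notZ in eventually_elim) (use a in auto)
    qed
    show "\<forall>\<^sub>F Q in cofin Y. R Q \<noteq> 0" using notZ
      by eventually_elim (use \<kappa>'0 finZ in \<open>auto simp: R_def\<close>)
    show "\<forall>\<^sub>F Q in cofin Y. F Q * F (refl_pt i Q) = R Q ^ m" using N'
    proof eventually_elim
      case (elim Q)
      have "R Q ^ m = \<kappa> * (\<Prod>a\<in>Z. ((uc i Q - a) powi (e a div int m)) ^ m)"
        by (simp add: R_def power_mult_distrib \<kappa>' prod_power_distrib)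
      also have "(\<Prod>a\<in>Z. ((uc i Q - a) powi (e a div int m)) ^ m) = (\<Prod>a\<in>Z. (uc i Q - a) powi e a)"
      proof (rule prod.cong[OF refl])
        fix a assume "a \<in> Z"
        then have "e a div int m * int m = e a" using dvd by simp
        then show "((uc i Q - a) powi (e a div int m)) ^ m = (uc i Q - a) powi e a"
          by (metis power_int_mult power_int_of_nat)
      qed
      finally show ?case using elim by simp
    qed
  qed
qed

end

section \<open>Reflections act by the sign\<close>

text \<open>As r is invertible, X^(r^n) - 1 is separable and has r^n roots. They cannot all satisfy
  the equation for r^(n-1), and a root that does not has exact order r^n, because the proper
  divisors of r^n divide r^(n-1).\<close>

lemma ex_primitive_root:
  fixes r n :: nat
  assumes r: "Factorial_Ring.prime r" "of_nat r \<noteq> (0 :: 'k::alg_closed_field)"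
  obtains \<zeta> :: "'k::alg_closed_field" where "\<zeta> ^ (r ^ n) = 1" "\<zeta> \<noteq> 0" "\<And>z. z ^ (r ^ n) = 1 \<Longrightarrow> \<exists>l<r ^ n. z = \<zeta> ^ l"
    "\<And>a b. \<zeta> powi a = \<zeta> powi b \<Longrightarrow> [a = b] (mod int (r ^ n))"
proof -
  define m where "m = r ^ n"
  have r0: "r > 1" using prime_gt_1_nat[OF r(1)] .
  have m0: "m > 0" using r0 by (simp add: m_def)
  have bound: "finite {z::'k. z ^ k = 1} \<and> card {z::'k. z ^ k = 1} \<le> k" if "k > 0" for k
  proof -
    let ?p = "monom 1 k - 1 :: 'k poly"
    have "coeff ?p k = 1" using that by (simp add: coeff_1)
    then have "?p \<noteq> 0" by (metis coeff_0 zero_neq_one)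
    moreover have "{z. z ^ k = 1} = {z. poly ?p z = 0}" by (auto simp: poly_monom)
    moreover have "degree ?p \<le> k" by (intro degree_diff_le) (auto simp: degree_monom_le)
    ultimately show ?thesis using poly_roots_finite[of ?p] card_poly_roots_bound[of ?p] by (auto intro: order_trans)
  qed
  have card: "card {z::'k. z ^ m = 1} = m"
  proof -
    let ?p = "monom 1 m - 1 :: 'k poly"
    have c: "coeff ?p m = 1" using m0 by (simp add: coeff_1)
    then have p0: "?p \<noteq> 0" by (metis coeff_0 zero_neq_one)
    have "degree ?p \<le> m" by (intro degree_diff_le) (auto simp: degree_monom_le)
    moreover have "degree ?p \<ge> m" using c by (intro le_degree) simp
    ultimately have "degree ?p = m" by simp
    moreover have "poly (pderiv ?p) z \<noteq> 0" if "poly ?p z = 0" for z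
    proof -
      have "z ^ m = 1" using that by (simp add: poly_monom)
      then have "z \<noteq> 0" using m0 by (auto simp: power_0_left)
      moreover have "of_nat m \<noteq> (0::'k)" using r(2) by (simp add: m_def)
      ultimately show ?thesis by (simp add: pderiv_diff pderiv_monom poly_monom)
    qed
    moreover have "{z. z ^ m = 1} = {z. poly ?p z = 0}" by (auto simp: poly_monom)
    ultimately show ?thesis using card_simple_roots[OF p0] by simp
  qed
  \<comment> \<open>For n = 0 the second condition is void and \<zeta> = 1 works.\<close>
  have "\<exists>\<zeta>::'k. \<zeta> ^ m = 1 \<and> (n > 0 \<longrightarrow> \<zeta> ^ (r ^ (n - 1)) \<noteq> 1)"
  proof (cases "n = 0")
    case False
    then have "r ^ (n - 1) < m" using r0 by (simp add: m_def)
    moreover have "r ^ (n - 1) > 0" using r0 by simp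
    ultimately have "\<not> {z::'k. z ^ m = 1} \<subseteq> {z. z ^ (r ^ (n - 1)) = 1}"
      using bound[of "r ^ (n - 1)"] card card_mono[of "{z::'k. z ^ (r ^ (n - 1)) = 1}" "{z. z ^ m = 1}"] by linarith
    then show ?thesis by auto
  qed (auto intro: exI[of _ 1])
  then obtain \<zeta> :: 'k where \<zeta>: "\<zeta> ^ m = 1" "n > 0 \<Longrightarrow> \<zeta> ^ (r ^ (n - 1)) \<noteq> 1" by blast
  have z0: "\<zeta> \<noteq> 0" using \<zeta>(1) m0 by (auto simp: power_0_left)
  have one: "int m dvd k" if "\<zeta> powi k = 1" for k
  proof -
    \<comment> \<open>Bezout replaces the exponent by its gcd with m, which is a power of r.\<close>
    obtain x y where xy: "x * k + y * int m = gcd k (int m)" using bezout_int by blast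
    have "\<zeta> powi (gcd k (int m)) = (\<zeta> powi k) powi x * (\<zeta> powi int m) powi y"
      unfolding xy[symmetric] using z0
      by (simp only: power_int_add disjI1 mult.commute[of x] mult.commute[of y] power_int_mult simp_thms)
    then have g1: "\<zeta> ^ nat (gcd k (int m)) = 1" using that \<zeta>(1) by (simp add: power_int_def)
    have "nat (gcd k (int m)) dvd r ^ n" by (metis gcd_dvd2 int_dvd_int_iff m_def nat_0_le gcd_ge_0_int)
    then obtain i where i: "i \<le> n" "nat (gcd k (int m)) = r ^ i" using divides_primepow_nat[OF r(1)] by blast
    have "i = n"
    proof (rule ccontr)
      assume "i \<noteq> n"
      then have "r ^ (n - 1) = r ^ i * r ^ (n - 1 - i)" "n > 0" using i(1) by (simp_all add: power_add[symmetric])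
      then have "\<zeta> ^ (r ^ (n - 1)) = 1" using g1 i(2) by (simp add: power_mult)
      then show False using \<zeta>(2) \<open>n > 0\<close> by blast
    qed
    then have "gcd k (int m) = int m" using i(2) m_def by (metis gcd_ge_0_int nat_0_le)
    then show ?thesis by (metis gcd_dvd1)
  qed
  have inj: "[a = b] (mod int m)" if "\<zeta> powi a = \<zeta> powi b" for a b
  proof -
    have "\<zeta> powi (a - b) = 1" using that z0 by (simp add: power_int_diff)
    from one[OF this] show ?thesis by (simp add: cong_iff_dvd_diff)
  qed
  have "inj_on (\<lambda>l. \<zeta> ^ l) {..<m}"
  proof (rule inj_onI)
    fix a b assume ab: "a \<in> {..<m}" "b \<in> {..<m}" "\<zeta> ^ a = \<zeta> ^ b"
    then have "[int a = int b] (mod int m)" using inj[of "int a" "int b"] by simp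
    then show "a = b" using ab by (simp add: cong_int_iff cong_less_modulus_unique_nat)
  qed
  then have "card ((\<lambda>l. \<zeta> ^ l) ` {..<m}) = m" by (simp add: card_image)
  moreover have "(\<lambda>l. \<zeta> ^ l) ` {..<m} \<subseteq> {z. z ^ m = 1}"
    using \<zeta>(1) by (auto simp: power_mult[symmetric] mult.commute[of _ m]) (simp add: power_mult)
  ultimately have "(\<lambda>l. \<zeta> ^ l) ` {..<m} = {z. z ^ m = 1}"
    using card bound[OF m0] by (intro card_subset_eq) auto
  then have "\<exists>l<m. z = \<zeta> ^ l" if "z ^ m = 1" for z using that by auto
  with \<zeta>(1) z0 inj show ?thesis unfolding m_def by (intro that) blast+
qed

section \<open>The root of unity on the covering and its logarithm\<close>

context cubic_curve begin

text \<open>One exponent n and one unit \<phi> serve all points over \<open>P\<close>, since F lives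
  on the curve. The values of A / q are therefore the unit parts of the trivializing function with
  respect to the same power of \<pi>, and their ratios are still \<zeta>^g, even where the function
  itself has a zero or a pole.\<close>

lemma local_trivialization:
  assumes c: "cech_cocycle Y m (cs, g)" and m: "m > 0" and \<zeta>: "\<zeta> ^ m = 1" "\<zeta> \<noteq> 0" and P: "P \<in> Y"
    and H: "\<And>i. i < length cs \<Longrightarrow> rpp (cofin Y) (\<lambda>Q _ _. H i Q)" and F: "rf (cofin Y) F" "\<forall>\<^sub>F Q in cofin Y. F Q \<noteq> 0"
    and HF: "\<forall>\<^sub>F Q in cofin Y. \<forall>i t. (i, t) \<in> fibre cs Q \<longrightarrow> poly (H i Q) t ^ m = F Q"
    and Hg: "\<forall>\<^sub>F Q in cofin Y. \<forall>i t j u. (i, t) \<in> fibre cs Q \<and> (j, u) \<in> fibre cs Q \<longrightarrow>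
       poly (H i Q) t = \<zeta> powi g Q (i, t) (j, u) * poly (H j Q) u"
    and \<pi>: "unif P \<pi>"
  obtains n \<phi> A q where "rf (near Y P) \<phi>" "\<phi> P \<noteq> 0" "\<forall>\<^sub>F Q in cofin Y. F Q = \<pi> Q powi (n * int m) * \<phi> Q"
    "\<And>x. x \<in> fibre cs P \<Longrightarrow> rpp (near Y P) (\<lambda>Q _ _. A x Q)" "\<And>x. x \<in> fibre cs P \<Longrightarrow> rpp (near Y P) (\<lambda>Q _ _. q x Q)"
    "\<And>x. x \<in> fibre cs P \<Longrightarrow> poly (A x P) (snd x) \<noteq> 0" "\<And>x. x \<in> fibre cs P \<Longrightarrow> poly (q x P) (snd x) \<noteq> 0"
    "\<And>x. x \<in> fibre cs P \<Longrightarrow> \<forall>\<^sub>F Q in cofin Y. \<forall>t\<in>chart_fibre (cs ! fst x) Q.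
       poly (H (fst x) Q) t * poly (q x Q) t = \<pi> Q powi n * poly (A x Q) t"
    "\<And>x. x \<in> fibre cs P \<Longrightarrow> poly (A x P) (snd x) ^ m = \<phi> P * poly (q x P) (snd x) ^ m"
    "\<And>x y. x \<in> fibre cs P \<Longrightarrow> y \<in> fibre cs P \<Longrightarrow>
       poly (A x P) (snd x) * poly (q y P) (snd y) = \<zeta> powi g P x y * (poly (A y P) (snd y) * poly (q x P) (snd x))"
proof -
  have fx: "fst x < length cs" "snd x \<in> chart_fibre (cs ! fst x) Q" "standard_etale Y (cs ! fst x)" if "x \<in> fibre cs Q" for x Q
    using that cech_cocycleD(1)[OF c] by (auto simp: fibre_def)
  have HFx: "\<forall>\<^sub>F Q in cofin Y. \<forall>t\<in>chart_fibre (cs ! i) Q. poly (H i Q) t ^ m = F Q" if "i < length cs" for i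
    using HF by eventually_elim (use that in \<open>simp add: fibre_def\<close>)
  obtain l \<phi> where \<phi>: "rf (near Y P) \<phi>" "\<phi> P \<noteq> 0" "\<forall>\<^sub>F Q in cofin Y. F Q = \<pi> Q powi l * \<phi> Q"
    by (rule unif_order[OF P \<pi> F])
  define n where "n = l div int m"
  have ex: "l = n * int m \<and> (\<exists>Aq. rpp (near Y P) (\<lambda>Q _ _. fst Aq Q) \<and> rpp (near Y P) (\<lambda>Q _ _. snd Aq Q) \<and>
     poly (fst Aq P) (snd x) \<noteq> 0 \<and> poly (snd Aq P) (snd x) \<noteq> 0 \<and>
     (\<forall>\<^sub>F Q in cofin Y. \<forall>t\<in>chart_fibre (cs ! fst x) Q. poly (H (fst x) Q) t * poly (snd Aq Q) t = \<pi> Q powi n * poly (fst Aq Q) t) \<and>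
     poly (fst Aq P) (snd x) ^ m = \<phi> P * poly (snd Aq P) (snd x) ^ m)" if x: "x \<in> fibre cs P" for x
  proof -
    note fx = fx[OF x]
    obtain n' A q \<phi>' where a: "rpp (near Y P) (\<lambda>Q _ _. A Q)" "rpp (near Y P) (\<lambda>Q _ _. q Q)"
      "poly (A P) (snd x) \<noteq> 0" "poly (q P) (snd x) \<noteq> 0" "rf (near Y P) \<phi>'" "\<phi>' P \<noteq> 0"
      "\<forall>\<^sub>F Q in cofin Y. F Q = \<pi> Q powi (n' * int m) * \<phi>' Q"
      "\<forall>\<^sub>F Q in cofin Y. \<forall>t\<in>chart_fibre (cs ! fst x) Q. poly (H (fst x) Q) t * poly (q Q) t = \<pi> Q powi n' * poly (A Q) t"
      "poly (A P) (snd x) ^ m = \<phi>' P * poly (q P) (snd x) ^ m"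
      by (rule local_form[OF P \<pi> fx(3,2) H[OF fx(1)] F HFx[OF fx(1)] m])
    have eq: "\<forall>\<^sub>F Q in cofin Y. \<pi> Q powi l * \<phi> Q = \<pi> Q powi (n' * int m) * \<phi>' Q"
      using \<phi>(3) a(7) by eventually_elim simp
    have l: "l = n' * int m" by (rule unif_order_unique[OF P \<pi> \<phi>(1,2) a(5,6) eq])
    then have n': "n' = n" using m by (simp add: n_def)
    have "\<phi> P = \<phi>' P"
      by (rule rf_near_eq[OF P \<phi>(1) a(5)], use eq unifD(3)[OF \<pi>] in eventually_elim) (simp add: l)
    then show ?thesis using a l n' by (intro conjI exI[of _ "(A, q)"]) simp_all
  qed
  then have "\<forall>x\<in>fibre cs P. \<exists>Aq. rpp (near Y P) (\<lambda>Q _ _. fst Aq Q) \<and> rpp (near Y P) (\<lambda>Q _ _. snd Aq Q) \<and>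
     poly (fst Aq P) (snd x) \<noteq> 0 \<and> poly (snd Aq P) (snd x) \<noteq> 0 \<and>
     (\<forall>\<^sub>F Q in cofin Y. \<forall>t\<in>chart_fibre (cs ! fst x) Q. poly (H (fst x) Q) t * poly (snd Aq Q) t = \<pi> Q powi n * poly (fst Aq Q) t) \<and>
     poly (fst Aq P) (snd x) ^ m = \<phi> P * poly (snd Aq P) (snd x) ^ m" by blast
  from bchoice[OF this] obtain Aq where Aq: "\<forall>x\<in>fibre cs P. rpp (near Y P) (\<lambda>Q _ _. fst (Aq x) Q) \<and> rpp (near Y P) (\<lambda>Q _ _. snd (Aq x) Q) \<and>
     poly (fst (Aq x) P) (snd x) \<noteq> 0 \<and> poly (snd (Aq x) P) (snd x) \<noteq> 0 \<and>
     (\<forall>\<^sub>F Q in cofin Y. \<forall>t\<in>chart_fibre (cs ! fst x) Q. poly (H (fst x) Q) t * poly (snd (Aq x) Q) t = \<pi> Q powi n * poly (fst (Aq x) Q) t) \<and>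
     poly (fst (Aq x) P) (snd x) ^ m = \<phi> P * poly (snd (Aq x) P) (snd x) ^ m" ..
  define A q where "A = (\<lambda>x. fst (Aq x))" and "q = (\<lambda>x. snd (Aq x))"
  have A: "rpp (near Y P) (\<lambda>Q _ _. A x Q)" "rpp (near Y P) (\<lambda>Q _ _. q x Q)" "poly (A x P) (snd x) \<noteq> 0" "poly (q x P) (snd x) \<noteq> 0"
    "\<forall>\<^sub>F Q in cofin Y. \<forall>t\<in>chart_fibre (cs ! fst x) Q. poly (H (fst x) Q) t * poly (q x Q) t = \<pi> Q powi n * poly (A x Q) t"
    "poly (A x P) (snd x) ^ m = \<phi> P * poly (q x P) (snd x) ^ m" if "x \<in> fibre cs P" for x
    using bspec[OF Aq that] unfolding A_def q_def by simp_all
  obtain x0 where "x0 \<in> fibre cs P" using cech_cocycleD(2)[OF c P] by blast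
  from ex[OF this] have l: "l = n * int m" by blast
  have equi: "poly (A x P) (snd x) * poly (q y P) (snd y) = \<zeta> powi g P x y * (poly (A y P) (snd y) * poly (q x P) (snd x))"
    if x: "x \<in> fibre cs P" and y: "y \<in> fibre cs P" for x y
  proof -
    obtain \<Theta> where \<Theta>: "rg (near Y P) \<Theta>" "\<Theta> P (snd x) (snd y) \<noteq> 0" "\<forall>\<^sub>F Q in near Y P. \<forall>t' u'.
         (fst x, t') \<in> fibre cs Q \<and> (fst y, u') \<in> fibre cs Q \<and> \<Theta> Q t' u' \<noteq> 0 \<longrightarrow>
           [g Q (fst x, t') (fst y, u') = g P (fst x, snd x) (fst y, snd y)] (mod int m)"
      by (rule const_sectionD[OF cech_cocycleD(3)[OF c] P, of "fst x" "snd x" "fst y" "snd y"]) (use x y in simp_all)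
    \<comment> \<open>The factor \<Theta> confines the identity to the open set where g has the
      residue it has at (x, y); it is nonzero at that pair and cancels there.\<close>
    define \<Psi> where "\<Psi> = (\<lambda>Q t u. \<Theta> Q t u * (poly (A x Q) t * poly (q y Q) u - \<zeta> powi g P x y * (poly (A y Q) u * poly (q x Q) t)))"
    have rg: "rg (near Y P) \<Psi>" unfolding \<Psi>_def
      by (intro rg_mult rg_diff rg_const \<Theta>(1) rg_poly[OF A(1)[OF x]] rg_poly[OF A(2)[OF y]] rg_poly[OF A(1)[OF y]]
          rg_poly[OF A(2)[OF x]] rg_fst rg_snd)
    have "\<forall>\<^sub>F Q in cofin Y. \<forall>t\<in>chart_fibre (cs ! fst x) Q. \<forall>u\<in>chart_fibre (cs ! fst y) Q. \<Psi> Q t u = 0"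
      using \<Theta>(3)[unfolded eventually_near, THEN conjunct1] A(5)[OF x] A(5)[OF y] Hg unifD(3)[OF \<pi>]
    proof eventually_elim
      case (elim Q)
      show ?case
      proof (intro ballI)
        fix t u assume tu: "t \<in> chart_fibre (cs ! fst x) Q" "u \<in> chart_fibre (cs ! fst y) Q"
        have f: "(fst x, t) \<in> fibre cs Q" "(fst y, u) \<in> fibre cs Q" using tu fx[OF x] fx[OF y] by (auto simp: fibre_def)
        show "\<Psi> Q t u = 0"
        proof (cases "\<Theta> Q t u = 0")
          case False
          then have "[g Q (fst x, t) (fst y, u) = g P x y] (mod int m)" using elim(1) f by simp
          then have z: "\<zeta> powi g Q (fst x, t) (fst y, u) = \<zeta> powi g P x y" by (rule power_int_cong[OF \<zeta>])
          have hh: "poly (H (fst x) Q) t = \<zeta> powi g P x y * poly (H (fst y) Q) u"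
            using elim(4) f unfolding z[symmetric] by blast
          have "\<pi> Q powi n * (poly (A x Q) t * poly (q y Q) u) = poly (H (fst x) Q) t * poly (q x Q) t * poly (q y Q) u"
            using elim(2) tu by simp
          also have "\<dots> = \<zeta> powi g P x y * (poly (H (fst y) Q) u * poly (q y Q) u) * poly (q x Q) t"
            unfolding hh by (simp add: mult_ac)
          also have "\<dots> = \<pi> Q powi n * (\<zeta> powi g P x y * (poly (A y Q) u * poly (q x Q) t))"
            using elim(3) tu by (simp add: mult_ac)
          finally show ?thesis using elim(5) by (simp add: \<Psi>_def)
        qed (simp add: \<Psi>_def)
      qed
    qed
    from fibre_vanishing[OF fx(3)[OF x] fx(2)[OF x] fx(3)[OF y] fx(2)[OF y] P rg this]
    show ?thesis using \<Theta>(2) by (simp add: \<Psi>_def)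
  qed
  show ?thesis
    by (rule that[of \<phi> n A q])
       (rule \<phi>(1) \<phi>(2) \<phi>(3)[unfolded l] | erule A(1) A(2) A(3) A(4) A(5) A(6) | erule (1) equi)+
qed

text \<open>The function h (h \<circ> s) / R takes values in the m-th roots of unity and transforms
  by \<zeta> to the power g \<circ> s + g. Its logarithm to base \<zeta> is the cochain w; the work
  lies in extending the function to the points where h or R is zero or infinite, and in the local
  constancy of w.\<close>

lemma reflection_acts:
  fixes \<zeta> :: 'k
  assumes m: "m > 0" and \<zeta>: "\<zeta> ^ m = 1" "\<zeta> \<noteq> 0" "\<And>z. z ^ m = 1 \<Longrightarrow> \<exists>l<m. z = \<zeta> ^ l"
    "\<And>a b. \<zeta> powi a = \<zeta> powi b \<Longrightarrow> [a = b] (mod int m)"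
  shows "sign_acts m (Transposition.transpose (i + 1) (i + 2))"
  unfolding sign_acts_def
proof (intro allI impI)
  fix cs g assume c: "cech_cocycle Y m (cs, g)"
  let ?\<sigma> = "Transposition.transpose (i + 1) (i + 2)"
  let ?s = "refl_pt i"
  have bij: "bij ?\<sigma>" by simp
  note se = cech_cocycleD(1)[OF c]
  obtain H F where H: "\<And>i. i < length cs \<Longrightarrow> rpp (cofin Y) (\<lambda>Q _ _. H i Q)" and F: "rf (cofin Y) F"
    "\<forall>\<^sub>F Q in cofin Y. F Q \<noteq> 0"
    and HF: "\<forall>\<^sub>F Q in cofin Y. \<forall>i t. (i, t) \<in> fibre cs Q \<longrightarrow> poly (H i Q) t ^ m = F Q"
    and Hg: "\<forall>\<^sub>F Q in cofin Y. \<forall>i t j u. (i, t) \<in> fibre cs Q \<and> (j, u) \<in> fibre cs Q \<longrightarrow>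
       poly (H i Q) t = \<zeta> powi g Q (i, t) (j, u) * poly (H j Q) u"
    by (rule generic_trivialization[OF c \<zeta>(1,2)]) blast
  note lt = local_trivialization[OF c m \<zeta>(1,2) _ H F HF Hg]
  have "\<exists>n \<phi>. rf (near Y P) \<phi> \<and> \<phi> P \<noteq> 0 \<and> (\<forall>\<^sub>F Q in cofin Y. F Q = \<pi> Q powi (n * int m) * \<phi> Q)"
    if P: "P \<in> Y" and \<pi>: "unif P \<pi>" for P \<pi>
    by (rule lt[OF P _ \<pi>]) blast+
  then obtain R where R: "rf (cofin Y) R" "\<forall>\<^sub>F Q in cofin Y. R Q \<noteq> 0" "\<forall>\<^sub>F Q in cofin Y. F Q * F (?s Q) = R Q ^ m"
    by (rule norm_is_power[OF F m])
  \<comment> \<open>The generic formula; it is meaningful only at the points collected in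
    \<open>good\<close>.\<close>
  define Wg where "Wg = (\<lambda>Q u u'. poly (H (fst u) (?s Q)) (snd u) * poly (H (fst u') Q) (snd u') / R Q)"
  define equi where "equi = (\<lambda>P W. \<forall>u\<in>fibre cs (?s P). \<forall>v\<in>fibre cs (?s P). \<forall>u'\<in>fibre cs P. \<forall>v'\<in>fibre cs P.
     W u u' = \<zeta> powi (g (?s P) u v + g P u' v') * (W v v' :: 'k))"
  define root where "root = (\<lambda>P W. \<forall>u\<in>fibre cs (?s P). \<forall>u'\<in>fibre cs P. (W u u' :: 'k) ^ m = 1)"
  \<comment> \<open>Near \<open>P\<close> the generic formula is a quotient X1 / Y1 of regular germs
    whose value at the pair over \<open>P\<close> is the prescribed one. Thus a value assigned at an
    exceptional point is tied to the generic values around it.\<close>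
  define locl where "locl = (\<lambda>P W. \<forall>u\<in>fibre cs (?s P). \<forall>u'\<in>fibre cs P. \<exists>X1 Y1. rg (near Y P) X1 \<and> rg (near Y P) Y1 \<and>
     Y1 P (snd u) (snd u') \<noteq> 0 \<and> X1 P (snd u) (snd u') = W u u' * Y1 P (snd u) (snd u') \<and>
     (\<forall>\<^sub>F Q in cofin Y. \<forall>t\<in>chart_fibre (cs ! fst u) (?s Q). \<forall>t'\<in>chart_fibre (cs ! fst u') Q.
        Wg Q (fst u, t) (fst u', t') * Y1 Q t t' = X1 Q t t'))"
  define good where "good = (\<lambda>Q. Q \<in> Y \<and> rf (near Y Q) R \<and> R Q \<noteq> 0 \<and>
    (\<forall>j<length cs. rpp (near Y Q) (\<lambda>Q _ _. H j Q)) \<and> (\<forall>j<length cs. rpp (near Y (?s Q)) (\<lambda>Q _ _. H j Q)) \<and>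
    equi Q (Wg Q) \<and> root Q (Wg Q))"
  have good: "eventually good (cofin Y)"
  proof -
    have rH: "\<forall>\<^sub>F Q in cofin Y. \<forall>j\<in>{..<length cs}. rpp (near Y Q) (\<lambda>Q _ _. H j Q)"
      by (rule eventually_ball_finite) (use rpp_cofin_near[OF H] in auto)
    from R(2,3) rf_cofin_near[OF R(1)] rH eventually_perm[OF bij rH] HF eventually_perm[OF bij HF]
      Hg eventually_perm[OF bij Hg] eventually_cofin_mem
    show ?thesis
    proof eventually_elim
      case (elim Q)
      have "root Q (Wg Q)" unfolding root_def
      proof (intro ballI)
        fix u u' assume u: "u \<in> fibre cs (?s Q)" "u' \<in> fibre cs Q"
        have "poly (H (fst u) (?s Q)) (snd u) ^ m = F (?s Q)" "poly (H (fst u') Q) (snd u') ^ m = F Q"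
          using elim(7)[rule_format, of "fst u" "snd u"] elim(6)[rule_format, of "fst u'" "snd u'"] u by simp_all
        then show "Wg Q u u' ^ m = 1"
          using elim(1,2) by (simp add: Wg_def power_mult_distrib power_divide mult.commute)
      qed
      moreover have "equi Q (Wg Q)" unfolding equi_def
      proof (intro ballI)
        fix u v u' v' assume u: "u \<in> fibre cs (?s Q)" "v \<in> fibre cs (?s Q)" "u' \<in> fibre cs Q" "v' \<in> fibre cs Q"
        have "poly (H (fst u) (?s Q)) (snd u) = \<zeta> powi g (?s Q) u v * poly (H (fst v) (?s Q)) (snd v)"
          "poly (H (fst u') Q) (snd u') = \<zeta> powi g Q u' v' * poly (H (fst v') Q) (snd v')"
          using elim(9)[rule_format, of "fst u" "snd u" "fst v" "snd v"] elim(8)[rule_format, of "fst u'" "snd u'" "fst v'" "snd v'"] u by simp_all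
        then show "Wg Q u u' = \<zeta> powi (g (?s Q) u v + g Q u' v') * Wg Q v v'"
          using \<zeta>(2) by (simp add: Wg_def power_int_add mult_ac)
      qed
      moreover have "\<forall>j<length cs. rpp (near Y Q) (\<lambda>Q _ _. H j Q)" "\<forall>j<length cs. rpp (near Y (?s Q)) (\<lambda>Q _ _. H j Q)"
        using elim(4,5) by auto
      ultimately show ?case unfolding good_def using elim(1,3,10) by blast
    qed
  qed
  have "\<exists>W. equi P W \<and> root P W \<and> locl P W \<and> (good P \<longrightarrow> W = Wg P)" if P: "P \<in> Y" for P
  proof (cases "good P")
    case True
    have "locl P (Wg P)" unfolding locl_def
    proof (intro ballI)
      fix u u' assume u: "u \<in> fibre cs (?s P)" "u' \<in> fibre cs P"
      have j: "fst u < length cs" "fst u' < length cs" using u by (auto simp: fibre_def)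
      have "rpp (near Y (?s P)) (\<lambda>Q _ _. H (fst u) Q)" using True j by (simp add: good_def)
      note r1 = rpp_near_perm[OF bij this]
      have r2: "rpp (near Y P) (\<lambda>Q _ _. H (fst u') Q)" using True j by (simp add: good_def)
      have RP: "rf (near Y P) R" "R P \<noteq> 0" using True by (auto simp: good_def)
      have "rg (near Y P) (\<lambda>Q t t'. poly (H (fst u) (?s Q)) t * poly (H (fst u') Q) t' / R Q)"
        by (intro rg_divide rg_mult rg_poly[OF r1] rg_poly[OF r2] rg_fst rg_snd RP(1) rf_near_nonzero[OF P RP])
      moreover have "rg (near Y P) (\<lambda>Q t t'. 1)" by (rule rg_const)
      ultimately show "\<exists>X1 Y1. rg (near Y P) X1 \<and> rg (near Y P) Y1 \<and>
         Y1 P (snd u) (snd u') \<noteq> 0 \<and> X1 P (snd u) (snd u') = Wg P u u' * Y1 P (snd u) (snd u') \<and>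
         (\<forall>\<^sub>F Q in cofin Y. \<forall>t\<in>chart_fibre (cs ! fst u) (?s Q). \<forall>t'\<in>chart_fibre (cs ! fst u') Q.
            Wg Q (fst u, t) (fst u', t') * Y1 Q t t' = X1 Q t t')"
        by (intro exI[of _ "\<lambda>Q t t'. poly (H (fst u) (?s Q)) t * poly (H (fst u') Q) t' / R Q"] exI[of _ "\<lambda>_ _ _. 1"])
           (simp add: Wg_def)
    qed
    then show ?thesis using True by (intro exI[of _ "Wg P"]) (simp add: good_def)
  next
    case False
    have sP: "?s P \<in> Y" using refl_coords(1)[OF P] .
    obtain \<pi> where \<pi>: "unif P \<pi>" by (rule unif_exists[OF P])
    obtain \<pi>' where \<pi>': "unif (?s P) \<pi>'" by (rule unif_exists[OF sP])
    obtain n \<phi> A q where a: "rf (near Y P) \<phi>" "\<phi> P \<noteq> 0" "\<forall>\<^sub>F Q in cofin Y. F Q = \<pi> Q powi (n * int m) * \<phi> Q"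
      "\<And>x. x \<in> fibre cs P \<Longrightarrow> rpp (near Y P) (\<lambda>Q _ _. A x Q)" "\<And>x. x \<in> fibre cs P \<Longrightarrow> rpp (near Y P) (\<lambda>Q _ _. q x Q)"
      "\<And>x. x \<in> fibre cs P \<Longrightarrow> poly (A x P) (snd x) \<noteq> 0" "\<And>x. x \<in> fibre cs P \<Longrightarrow> poly (q x P) (snd x) \<noteq> 0"
      "\<And>x. x \<in> fibre cs P \<Longrightarrow> \<forall>\<^sub>F Q in cofin Y. \<forall>t\<in>chart_fibre (cs ! fst x) Q.
         poly (H (fst x) Q) t * poly (q x Q) t = \<pi> Q powi n * poly (A x Q) t"
      "\<And>x. x \<in> fibre cs P \<Longrightarrow> poly (A x P) (snd x) ^ m = \<phi> P * poly (q x P) (snd x) ^ m"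
      "\<And>x y. x \<in> fibre cs P \<Longrightarrow> y \<in> fibre cs P \<Longrightarrow>
         poly (A x P) (snd x) * poly (q y P) (snd y) = \<zeta> powi g P x y * (poly (A y P) (snd y) * poly (q x P) (snd x))"
      by (rule lt[OF P _ \<pi>]) blast+
    obtain n' \<phi>' A' q' where b: "rf (near Y (?s P)) \<phi>'" "\<phi>' (?s P) \<noteq> 0" "\<forall>\<^sub>F Q in cofin Y. F Q = \<pi>' Q powi (n' * int m) * \<phi>' Q"
      "\<And>x. x \<in> fibre cs (?s P) \<Longrightarrow> rpp (near Y (?s P)) (\<lambda>Q _ _. A' x Q)" "\<And>x. x \<in> fibre cs (?s P) \<Longrightarrow> rpp (near Y (?s P)) (\<lambda>Q _ _. q' x Q)"
      "\<And>x. x \<in> fibre cs (?s P) \<Longrightarrow> poly (A' x (?s P)) (snd x) \<noteq> 0" "\<And>x. x \<in> fibre cs (?s P) \<Longrightarrow> poly (q' x (?s P)) (snd x) \<noteq> 0"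
      "\<And>x. x \<in> fibre cs (?s P) \<Longrightarrow> \<forall>\<^sub>F Q in cofin Y. \<forall>t\<in>chart_fibre (cs ! fst x) Q.
         poly (H (fst x) Q) t * poly (q' x Q) t = \<pi>' Q powi n' * poly (A' x Q) t"
      "\<And>x. x \<in> fibre cs (?s P) \<Longrightarrow> poly (A' x (?s P)) (snd x) ^ m = \<phi>' (?s P) * poly (q' x (?s P)) (snd x) ^ m"
      "\<And>x y. x \<in> fibre cs (?s P) \<Longrightarrow> y \<in> fibre cs (?s P) \<Longrightarrow>
         poly (A' x (?s P)) (snd x) * poly (q' y (?s P)) (snd y) = \<zeta> powi g (?s P) x y * (poly (A' y (?s P)) (snd y) * poly (q' x (?s P)) (snd x))"
      by (rule lt[OF sP _ \<pi>']) blast+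
    \<comment> \<open>The factor of h (h \<circ> s) / R that carries zeros and poles, once the unit
      parts at \<open>P\<close> and its mirror image are taken out.\<close>
    define \<rho> where "\<rho> = (\<lambda>Q. \<pi> Q powi n * \<pi>' (?s Q) powi n' / R Q)"
    note pi'nz = eventually_perm[OF bij unifD(3)[OF \<pi>']]
    have \<rho>: "rf (cofin Y) \<rho>" unfolding \<rho>_def
      by (intro rg_divide rg_mult rf_power_int unifD(3)[OF \<pi>] pi'nz R(1,2) rg_mono[OF unifD(1)[OF \<pi>] cofin_le_near]
         rg_cofin_perm[OF rg_mono[OF unifD(1)[OF \<pi>'] cofin_le_near] bij])
    have \<rho>0: "\<forall>\<^sub>F Q in cofin Y. \<rho> Q \<noteq> 0" using unifD(3)[OF \<pi>] pi'nz R(2) by eventually_elim (simp add: \<rho>_def)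
    have \<rho>m: "\<forall>\<^sub>F Q in cofin Y. \<rho> Q ^ m * (\<phi> Q * \<phi>' (?s Q)) = 1"
      using a(3) eventually_perm[OF bij b(3)] R(2,3)
    proof eventually_elim
      case (elim Q)
      have "\<rho> Q ^ m * (\<phi> Q * \<phi>' (?s Q)) = F Q * F (?s Q) / R Q ^ m"
        using elim(1,2) by (simp add: \<rho>_def power_mult_distrib power_divide power_int_mult mult_ac)
      then show ?case using elim(3,4) by simp
    qed
    obtain l \<psi> where \<psi>: "rf (near Y P) \<psi>" "\<psi> P \<noteq> 0" "\<forall>\<^sub>F Q in cofin Y. \<rho> Q = \<pi> Q powi l * \<psi> Q"
      by (rule unif_order[OF P \<pi> \<rho> \<rho>0])
    have r\<phi>': "rf (near Y P) (\<lambda>Q. \<phi>' (?s Q))" by (rule rg_near_perm[OF b(1) bij])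
    have prod: "rf (near Y P) (\<lambda>Q. \<psi> Q ^ m * (\<phi> Q * \<phi>' (?s Q)))" by (intro rg_mult rg_power \<psi>(1) a(1) r\<phi>')
    \<comment> \<open>The m-th power of \<rho> is the inverse of a unit, so \<rho> has order 0 and
      its value at \<open>P\<close> is that of \<psi>.\<close>
    have "\<forall>\<^sub>F Q in cofin Y. \<pi> Q powi (l * int m) * (\<psi> Q ^ m * (\<phi> Q * \<phi>' (?s Q))) = \<pi> Q powi 0 * 1"
      using \<rho>m \<psi>(3) by eventually_elim (simp add: power_mult_distrib power_int_mult mult_ac)
    from unif_order_unique[OF P \<pi> prod _ rg_const[of _ 1] _ this] have "l * int m = 0"
      using \<psi>(2) a(2) b(2) by simp
    then have l0: "l = 0" using m by simp
    have "\<psi> P ^ m * (\<phi> P * \<phi>' (?s P)) = 1"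
      by (rule rf_near_eq[OF P prod rg_const[of _ 1]], use \<rho>m \<psi>(3) in eventually_elim) (simp add: l0)
    note \<psi>m = this
    define h h' where "h = (\<lambda>x. poly (A x P) (snd x) / poly (q x P) (snd x))"
      and "h' = (\<lambda>x. poly (A' x (?s P)) (snd x) / poly (q' x (?s P)) (snd x))"
    \<comment> \<open>The value at the exceptional point: the two unit parts times the value of
      \<rho>.\<close>
    define W where "W = (\<lambda>u u'. h' u * h u' * \<psi> P)"
    have hm: "h x ^ m = \<phi> P" if "x \<in> fibre cs P" for x using a(7,9)[OF that] by (simp add: h_def power_divide)
    have hm': "h' x ^ m = \<phi>' (?s P)" if "x \<in> fibre cs (?s P)" for x using b(7,9)[OF that] by (simp add: h'_def power_divide)
    have hg: "h x = \<zeta> powi g P x y * h y" if "x \<in> fibre cs P" "y \<in> fibre cs P" for x y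
      using a(10)[OF that] a(7)[OF that(1)] a(7)[OF that(2)] by (simp add: h_def divide_eq_eq eq_divide_eq mult_ac)
    have hg': "h' x = \<zeta> powi g (?s P) x y * h' y" if "x \<in> fibre cs (?s P)" "y \<in> fibre cs (?s P)" for x y
      using b(10)[OF that] b(7)[OF that(1)] b(7)[OF that(2)] by (simp add: h'_def divide_eq_eq eq_divide_eq mult_ac)
    have "root P W" unfolding root_def
    proof (intro ballI)
      fix u u' assume u: "u \<in> fibre cs (?s P)" "u' \<in> fibre cs P"
      have "W u u' ^ m = \<psi> P ^ m * (\<phi> P * \<phi>' (?s P))" using hm[OF u(2)] hm'[OF u(1)] by (simp add: W_def power_mult_distrib mult_ac)
      then show "W u u' ^ m = 1" using \<psi>m by simp
    qed
    moreover have "equi P W" unfolding equi_def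
    proof (intro ballI)
      fix u v u' v' assume u: "u \<in> fibre cs (?s P)" "v \<in> fibre cs (?s P)" "u' \<in> fibre cs P" "v' \<in> fibre cs P"
      show "W u u' = \<zeta> powi (g (?s P) u v + g P u' v') * W v v'"
        unfolding W_def hg'[OF u(1,2)] hg[OF u(3,4)] using \<zeta>(2) by (simp add: power_int_add mult_ac)
    qed
    moreover have "locl P W" unfolding locl_def
    proof (intro ballI)
      fix u u' assume u: "u \<in> fibre cs (?s P)" "u' \<in> fibre cs P"
      note r1 = rpp_near_perm[OF bij b(4)[OF u(1)]] and r2 = rpp_near_perm[OF bij b(5)[OF u(1)]]
      let ?X = "\<lambda>Q t t'. poly (A' u (?s Q)) t * poly (A u' Q) t' * \<psi> Q"
      let ?Y = "\<lambda>Q t t'. poly (q' u (?s Q)) t * poly (q u' Q) t'"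
      have "rg (near Y P) ?X" by (intro rg_mult rg_poly[OF r1] rg_poly[OF a(4)[OF u(2)]] rg_fst rg_snd \<psi>(1))
      moreover have "rg (near Y P) ?Y" by (intro rg_mult rg_poly[OF r2] rg_poly[OF a(5)[OF u(2)]] rg_fst rg_snd)
      moreover have "?Y P (snd u) (snd u') \<noteq> 0" using a(7)[OF u(2)] b(7)[OF u(1)] by simp
      moreover have "?X P (snd u) (snd u') = W u u' * ?Y P (snd u) (snd u')"
        using a(7)[OF u(2)] b(7)[OF u(1)] by (simp add: W_def h_def h'_def)
      moreover have "\<forall>\<^sub>F Q in cofin Y. \<forall>t\<in>chart_fibre (cs ! fst u) (?s Q). \<forall>t'\<in>chart_fibre (cs ! fst u') Q.
            Wg Q (fst u, t) (fst u', t') * ?Y Q t t' = ?X Q t t'"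
        using a(8)[OF u(2)] eventually_perm[OF bij b(8)[OF u(1)]] \<psi>(3)
      proof eventually_elim
        case (elim Q)
        show ?case
        proof (intro ballI)
          fix t t' assume t: "t \<in> chart_fibre (cs ! fst u) (?s Q)" "t' \<in> chart_fibre (cs ! fst u') Q"
          have "Wg Q (fst u, t) (fst u', t') * ?Y Q t t' = (poly (H (fst u) (?s Q)) t * poly (q' u (?s Q)) t) *
             (poly (H (fst u') Q) t' * poly (q u' Q) t') / R Q" by (simp add: Wg_def mult_ac)
          also have "\<dots> = (\<pi>' (?s Q) powi n' * poly (A' u (?s Q)) t) * (\<pi> Q powi n * poly (A u' Q) t') / R Q"
            using elim(1,2) t by simp
          also have "\<dots> = poly (A' u (?s Q)) t * poly (A u' Q) t' * \<rho> Q" by (simp add: \<rho>_def mult_ac)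
          finally show "Wg Q (fst u, t) (fst u', t') * ?Y Q t t' = ?X Q t t'" using elim(3) l0 by simp
        qed
      qed
      ultimately show "\<exists>X1 Y1. rg (near Y P) X1 \<and> rg (near Y P) Y1 \<and>
         Y1 P (snd u) (snd u') \<noteq> 0 \<and> X1 P (snd u) (snd u') = W u u' * Y1 P (snd u) (snd u') \<and>
         (\<forall>\<^sub>F Q in cofin Y. \<forall>t\<in>chart_fibre (cs ! fst u) (?s Q). \<forall>t'\<in>chart_fibre (cs ! fst u') Q.
            Wg Q (fst u, t) (fst u', t') * Y1 Q t t' = X1 Q t t')"
        by (intro exI[of _ ?X] exI[of _ ?Y] conjI)
    qed
    ultimately show ?thesis using False by (intro exI[of _ W]) simp
  qed
  then have "\<forall>P\<in>Y. \<exists>W. equi P W \<and> root P W \<and> locl P W \<and> (good P \<longrightarrow> W = Wg P)" by blast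
  from bchoice[OF this] obtain W where W: "\<forall>P\<in>Y. equi P (W P) \<and> root P (W P) \<and> locl P (W P) \<and> (good P \<longrightarrow> W P = Wg P)" ..
  \<comment> \<open>Only the residue of the exponent modulo m is determined by W, and only the
    residue matters for a section.\<close>
  define w where "w = (\<lambda>P u u'. SOME a. \<zeta> powi a = W P u u')"
  have w: "\<zeta> powi w P u u' = W P u u'" if "P \<in> Y" "u \<in> fibre cs (?s P)" "u' \<in> fibre cs P" for P u u'
  proof -
    have "W P u u' ^ m = 1" using W that unfolding root_def by blast
    then obtain l where "W P u u' = \<zeta> ^ l" using \<zeta>(3) by blast
    then have "\<zeta> powi int l = W P u u'" by simp
    then show ?thesis unfolding w_def by (rule someI)
  qed
  define cs' where "cs' = map (chart_pullback Y ?s) cs"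
  have c': "cech_cocycle Y m (cs', \<lambda>P. g (?s P))" unfolding cs'_def by (rule cech_cocycle_pullback[OF bij c])
  have fib': "fibre cs' P = (if P \<in> Y then fibre cs (?s P) else {})" for P by (simp add: cs'_def fibre_pullback)
  have "const_section m cs' cs w"
  proof (rule const_sectionI[OF cech_cocycleD(1)[OF c']])
    fix P j t j' t' assume u: "(j, t) \<in> fibre cs' P" "(j', t') \<in> fibre cs P"
    then have P: "P \<in> Y" and us: "(j, t) \<in> fibre cs (?s P)" by (auto simp: fib' split: if_splits)
    have j: "j < length cs" "j' < length cs" "t \<in> chart_fibre (cs ! j) (?s P)" "t' \<in> chart_fibre (cs ! j') P"
      using us u(2) by (auto simp: fibre_def)
    have "locl P (W P)" using W P by blast
    then obtain X1 Y1 where xy: "rg (near Y P) X1" "rg (near Y P) Y1" "Y1 P t t' \<noteq> 0"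
      "X1 P t t' = W P (j, t) (j', t') * Y1 P t t'"
      "\<forall>\<^sub>F Q in cofin Y. \<forall>x\<in>chart_fibre (cs ! j) (?s Q). \<forall>x'\<in>chart_fibre (cs ! j') Q. Wg Q (j, x) (j', x') * Y1 Q x x' = X1 Q x x'"
      using us u(2) unfolding locl_def by fastforce
    have fin: "finite (chart_fibre (cs ! k) Q)" if "k < length cs" for k Q
    proof (cases "Q \<in> base (cs ! k)")
      case True
      have "standard_etale Y (cs ! k)" using se that by simp
      then have "eqn (cs ! k) Q \<noteq> 0" using True unfolding standard_etale_def by auto
      from poly_roots_finite[OF this] show ?thesis by (rule finite_subset[rotated]) (auto simp: chart_fibre_def)
    qed (simp add: chart_fibre_def)
    define L where "L = {l\<in>{..<m}. \<zeta> ^ l \<noteq> W P (j, t) (j', t')}"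
    define S where "S = chart_fibre (cs ! j) (?s P) - {t}"
    define S' where "S' = chart_fibre (cs ! j') P - {t'}"
    have finS: "finite S" "finite S'" "finite L" using fin j by (simp_all add: S_def S'_def L_def)
    \<comment> \<open>Generic pairs at which a factor with l in L is nonzero cannot have the value
      \<zeta>^l, so they have the value taken at \<open>P\<close>. The products over S and S'
      exclude the other pairs in the fibres over \<open>P\<close> itself.\<close>
    define \<Psi> where "\<Psi> = (\<lambda>Q x x'. Y1 Q x x' * (\<Prod>l\<in>L. X1 Q x x' - \<zeta> ^ l * Y1 Q x x') * ((\<Prod>a\<in>S. x - a) * (\<Prod>a\<in>S'. x' - a)))"
    have "rg (near Y P) \<Psi>" unfolding \<Psi>_def
      by (intro rg_mult rg_prod rg_diff xy(1,2) rg_const rg_fst rg_snd)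
    moreover have "\<Psi> P t t' \<noteq> 0"
    proof -
      have "X1 P t t' - \<zeta> ^ l * Y1 P t t' \<noteq> 0" if "l \<in> L" for l
        using that xy(3,4) by (auto simp: L_def)
      then show ?thesis using xy(3) finS by (auto simp: \<Psi>_def S_def S'_def)
    qed
    moreover have "\<forall>\<^sub>F Q in near Y P. \<forall>x x'. (j, x) \<in> fibre cs' Q \<and> (j', x') \<in> fibre cs Q \<and> \<Psi> Q x x' \<noteq> 0 \<longrightarrow>
           [w Q (j, x) (j', x') = w P (j, t) (j', t')] (mod int m)"
      unfolding eventually_near
    proof
      show "\<forall>\<^sub>F Q in cofin Y. \<forall>x x'. (j, x) \<in> fibre cs' Q \<and> (j', x') \<in> fibre cs Q \<and> \<Psi> Q x x' \<noteq> 0 \<longrightarrow>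
           [w Q (j, x) (j', x') = w P (j, t) (j', t')] (mod int m)"
        using good xy(5)
      proof eventually_elim
        case (elim Q)
        show ?case
        proof (intro allI impI)
          fix x x' assume h: "(j, x) \<in> fibre cs' Q \<and> (j', x') \<in> fibre cs Q \<and> \<Psi> Q x x' \<noteq> 0"
          have Q: "Q \<in> Y" using elim(1) by (simp add: good_def)
          have f: "(j, x) \<in> fibre cs (?s Q)" "(j', x') \<in> fibre cs Q" using h Q by (auto simp: fib')
          then have cf: "x \<in> chart_fibre (cs ! j) (?s Q)" "x' \<in> chart_fibre (cs ! j') Q" by (auto simp: fibre_def)
          have eq: "Wg Q (j, x) (j', x') * Y1 Q x x' = X1 Q x x'" using elim(2) cf by blast
          have WQ: "W Q = Wg Q" using W Q elim(1) by blast
          have "W Q (j, x) (j', x') ^ m = 1" using W Q f unfolding root_def by blast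
          then obtain l where l: "l < m" "W Q (j, x) (j', x') = \<zeta> ^ l" using \<zeta>(3) by blast
          have "l \<notin> L"
          proof
            assume "l \<in> L"
            then have "(\<Prod>l\<in>L. X1 Q x x' - \<zeta> ^ l * Y1 Q x x') = 0"
              using finS(3) eq l(2) WQ by (intro prod_zero bexI[of _ l]) auto
            then show False using h by (simp add: \<Psi>_def)
          qed
          then have "W Q (j, x) (j', x') = W P (j, t) (j', t')" using l by (simp add: L_def)
          then have "\<zeta> powi w Q (j, x) (j', x') = \<zeta> powi w P (j, t) (j', t')"
            using w[OF Q f] w[OF P us u(2)] by simp
          then show "[w Q (j, x) (j', x') = w P (j, t) (j', t')] (mod int m)" by (rule \<zeta>(4))
        qed
      qed
      show "\<forall>x x'. (j, x) \<in> fibre cs' P \<and> (j', x') \<in> fibre cs P \<and> \<Psi> P x x' \<noteq> 0 \<longrightarrow>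
           [w P (j, x) (j', x') = w P (j, t) (j', t')] (mod int m)"
      proof (intro allI impI)
        fix x x' assume h: "(j, x) \<in> fibre cs' P \<and> (j', x') \<in> fibre cs P \<and> \<Psi> P x x' \<noteq> 0"
        then have "(j, x) \<in> fibre cs (?s P)" "(j', x') \<in> fibre cs P" using P by (simp_all add: fib')
        then have cf: "x \<in> chart_fibre (cs ! j) (?s P)" "x' \<in> chart_fibre (cs ! j') P" by (simp_all add: fibre_def)
        have "(\<Prod>a\<in>S. x - a) \<noteq> 0" "(\<Prod>a\<in>S'. x' - a) \<noteq> 0" using h by (auto simp: \<Psi>_def)
        then have "x \<notin> S" "x' \<notin> S'" using finS by auto
        then have "x = t" "x' = t'" using cf by (auto simp: S_def S'_def)
        then show "[w P (j, x) (j', x') = w P (j, t) (j', t')] (mod int m)" by simp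
      qed
    qed
    ultimately show "\<exists>\<Psi>. rg (near Y P) \<Psi> \<and> \<Psi> P t t' \<noteq> 0 \<and> (\<forall>\<^sub>F Q in near Y P. \<forall>x x'.
         (j, x) \<in> fibre cs' Q \<and> (j', x') \<in> fibre cs Q \<and> \<Psi> Q x x' \<noteq> 0 \<longrightarrow>
           [w Q (j, x) (j', x') = w P (j, t) (j', t')] (mod int m))" by blast
  qed
  moreover have "[g (?s P) u v - sign ?\<sigma> * g P u' v' = w P u u' - w P v v'] (mod int m)"
    if "u \<in> fibre cs' P" "v \<in> fibre cs' P" "u' \<in> fibre cs P" "v' \<in> fibre cs P" for P u v u' v'
  proof -
    have P: "P \<in> Y" and us: "u \<in> fibre cs (?s P)" "v \<in> fibre cs (?s P)" using that by (auto simp: fib' split: if_splits)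
    have "W P u u' = \<zeta> powi (g (?s P) u v + g P u' v') * W P v v'"
      using W P us that(3,4) unfolding equi_def by blast
    then have "\<zeta> powi w P u u' = \<zeta> powi (g (?s P) u v + g P u' v' + w P v v')"
      using w[OF P us(1) that(3)] w[OF P us(2) that(4)] \<zeta>(2) by (simp add: power_int_add)
    from \<zeta>(4)[OF this] have "[w P u u' - w P v v' = g (?s P) u v + g P u' v' + w P v v' - w P v v'] (mod int m)"
      by (intro cong_diff cong_refl)
    \<comment> \<open>A reflection has sign -1, so subtracting the signed cocycle adds g.\<close>
    then show ?thesis unfolding sign_perm3 by (simp add: cong_sym)
  qed
  ultimately show "((map (chart_pullback Y ?s) cs, \<lambda>P. g (?s P)), (cs, \<lambda>P u v. sign ?\<sigma> * g P u v)) \<in> cohomologous Y m"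
    using c' cech_cocycle_cmult[OF c, of "sign ?\<sigma>"] unfolding cohomologous_def cs'_def by blast
qed

theorem sign_action:
  assumes "Factorial_Ring.prime r" "of_nat r \<noteq> (0::'k)" "bij \<sigma>" "\<xi> \<in> H1_rational Y r"
  shows "H1_rational_pullback Y r (perm_point \<sigma>) \<xi> = H1_rational_smult Y r (sign \<sigma>) \<xi>"
proof (rule H1_rational_pullback_sign[OF sign_acts_all[OF _ assms(3)] assms(4)])
  fix n i
  have "r ^ n > 0" using prime_gt_0_nat[OF assms(1)] by simp
  then show "sign_acts (r ^ n) (Transposition.transpose (i + 1) (i + 2))"
    by (rule ex_primitive_root[OF assms(1,2), of n, OF reflection_acts])
qed

end

section \<open>Finite etale algebras over a finite field\<close>

text \<open>Multiplication by a nonzero x permutes the nonzero elements; comparing their products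
  gives the identity, written with an extra factor x.\<close>

lemma power_card_field: "(x :: 'a::{field,finite}) ^ CARD('a) = x"
proof (cases "x = 0")
  case False
  have "x * (\<Prod>y\<in>UNIV-{0}. x * y) = x * x ^ (CARD('a) - 1) * \<Prod>(UNIV-{0})"
    by (simp add: prod.distrib mult_ac)
  also have "x * x ^ (CARD('a) - 1) = x ^ CARD('a)"
    by (metis One_nat_def Suc_pred finite_UNIV_card_ge_0 finite power_Suc)
  also have "(\<Prod>y\<in>UNIV-{0}. x * y) = (\<Prod>y\<in>UNIV-{0}. y)"
    by (rule prod.reindex_bij_witness[of _ "\<lambda>y. y / x" "\<lambda>y. x * y"]) (use False in auto)
  finally show ?thesis by simp
qed (simp add: power_0_left)

lemma card_field_gt_1: "CARD('a::{field,finite}) > 1"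
proof -
  have "card {0, 1 :: 'a} \<le> CARD('a)" by (intro card_mono) auto
  then show ?thesis by simp
qed

text \<open>With q the size of the field, (1 + X)^q - X^q - 1 vanishes at all q elements and has
  degree below q, so all its coefficients are zero. This yields additivity of Frobenius without
  identifying q as a power of the characteristic.\<close>

lemma binomial_card_field:
  assumes "0 < j" "j < CARD('a::{field,finite})" shows "of_nat (CARD('a) choose j) = (0::'a)"
proof -
  let ?q = "CARD('a)"
  define p where "p = ([:1, 1:] :: 'a poly) ^ ?q - (monom 1 ?q + 1)"
  have c: "coeff p i = (if i = 0 \<or> i = ?q then 0 else of_nat (?q choose i))" for i
  proof -
    have "coeff ([:1, 1:] ^ ?q :: 'a poly) i = of_nat (?q choose i)"
    proof (cases "i \<le> ?q")
      case True
      then show ?thesis using coeff_linear_poly_power[of i ?q "1::'a" 1] by simp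
    next
      case False
      moreover have "degree ([:1, 1:] ^ ?q :: 'a poly) \<le> ?q"
        using degree_power_le[of "[:1, 1:] :: 'a poly" ?q] by simp
      ultimately show ?thesis by (simp add: coeff_eq_0 binomial_eq_0)
    qed
    then show ?thesis using assms by (auto simp: p_def coeff_1)
  qed
  have "poly p x = 0" for x
    using power_card_field[of "1 + x"] power_card_field[of x] by (simp add: p_def poly_monom add.commute)
  then have all: "{x. poly p x = 0} = UNIV" by simp
  have "degree p < ?q"
  proof -
    have "degree p \<le> ?q" by (rule degree_le) (auto simp: c binomial_eq_0)
    moreover have "degree p \<noteq> ?q" using c[of ?q] assms by (metis degree_0 leading_coeff_0_iff less_imp_neq less_trans)
    ultimately show ?thesis by simp
  qed
  then have "p = 0" using card_poly_roots_bound[of p] all by fastforce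
  then show ?thesis using c[of j] assms by simp
qed

lemma frobenius_add:
  fixes x y :: "'a::{field,finite} alg_closure"
  shows "(x + y) ^ CARD('a) = x ^ CARD('a) + y ^ CARD('a)"
proof -
  let ?q = "CARD('a)"
  have q: "?q > 0" by simp
  have z: "of_nat (?q choose j) = (0 :: 'a alg_closure)" if "0 < j" "j < ?q" for j
    using binomial_card_field[OF that] by (metis to_ac_0 to_ac_of_nat)
  have "(x + y) ^ ?q = (\<Sum>k\<le>?q. of_nat (?q choose k) * x ^ k * y ^ (?q - k))" by (rule binomial_ring)
  also have "\<dots> = (\<Sum>k\<in>{0, ?q}. of_nat (?q choose k) * x ^ k * y ^ (?q - k))"
    by (rule sum.mono_neutral_right) (auto simp: z)
  finally show ?thesis using q by (simp add: add.commute)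
qed

lemma frobenius_sum:
  "(\<Sum>i\<in>I. f i :: 'a::{field,finite} alg_closure) ^ CARD('a) = (\<Sum>i\<in>I. f i ^ CARD('a))"
  by (induction I rule: infinite_finite_induct) (auto simp: frobenius_add power_0_left)

lemma frobenius_minus: "(- x :: 'a::{field,finite} alg_closure) ^ CARD('a) = - (x ^ CARD('a))"
proof -
  have "(- x + x) ^ CARD('a) = (- x) ^ CARD('a) + x ^ CARD('a)" by (rule frobenius_add)
  then show ?thesis by (simp add: power_0_left eq_neg_iff_add_eq_0)
qed

lemma frobenius_diff: "(x - y :: 'a::{field,finite} alg_closure) ^ CARD('a) = x ^ CARD('a) - y ^ CARD('a)"
  using frobenius_add[of x "- y"] by (simp add: frobenius_minus)

lemma frobenius_inj: "(x :: 'a::{field,finite} alg_closure) ^ CARD('a) = y ^ CARD('a) \<longleftrightarrow> x = y"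
proof
  assume "x ^ CARD('a) = y ^ CARD('a)"
  then have "(x - y) ^ CARD('a) = 0" by (simp add: frobenius_diff)
  then show "x = y" by simp
qed simp

lemma frobenius_to_ac [simp]: "to_ac (x :: 'a::{field,finite}) ^ CARD('a) = to_ac x"
  by (simp flip: to_ac_power add: power_card_field)

text \<open>X^q - X has at most q roots, and the base field already provides q of them.\<close>

lemma frobenius_fixed:
  assumes "(x :: 'a::{field,finite} alg_closure) ^ CARD('a) = x" obtains d where "x = to_ac d"
proof -
  let ?q = "CARD('a)"
  define p where "p = monom 1 ?q - [:0, 1 :: 'a alg_closure:]"
  have q1: "?q > 1" by (rule card_field_gt_1)
  have "coeff p ?q = 1" using q1 by (simp add: p_def coeff_eq_0)
  then have p0: "p \<noteq> 0" by (metis coeff_0 zero_neq_one)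
  have "degree p \<le> ?q" unfolding p_def using q1 by (intro degree_diff_le) (auto simp: degree_monom_le)
  then have b: "card {x. poly p x = 0} \<le> ?q" using card_poly_roots_bound[OF p0] by simp
  have sub: "range to_ac \<subseteq> {x. poly p x = 0}" by (auto simp: p_def poly_monom)
  have "card (range (to_ac :: 'a \<Rightarrow> _)) = ?q" by (simp add: card_image inj_to_ac)
  then have "range to_ac = {x. poly p x = 0}"
    using sub b poly_roots_finite[OF p0] by (metis card_seteq)
  moreover have "poly p x = 0" using assms by (simp add: p_def poly_monom)
  ultimately show ?thesis using that by auto
qed

lemma underdetermined_system:
  fixes T :: "'i \<Rightarrow> 'j \<Rightarrow> 'k::field"
  assumes "finite I" "finite J" "card I < card J"
  shows "\<exists>x. (\<exists>j\<in>J. x j \<noteq> 0) \<and> (\<forall>i\<in>I. (\<Sum>j\<in>J. T i j * x j) = 0)"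
  using assms
proof (induction I arbitrary: J T)
  case empty
  then have "J \<noteq> {}" by auto
  then show ?case by (intro exI[of _ "\<lambda>_. 1"]) auto
next
  case (insert i0 I J T)
  show ?case
  proof (cases "\<forall>j\<in>J. T i0 j = 0")
    case True
    have "card I < card J" using insert by simp
    from insert.IH[OF insert.prems(1) this, of T] True show ?thesis by auto
  next
    case False
    then obtain j0 where j0: "j0 \<in> J" "T i0 j0 \<noteq> 0" by blast
    let ?J = "J - {j0}"
    have "card I < card ?J" using insert j0 by simp
    from insert.IH[OF _ this, of "\<lambda>i j. T i j - T i j0 / T i0 j0 * T i0 j"] insert.prems
    obtain x where x: "\<exists>j\<in>?J. x j \<noteq> 0" "\<forall>i\<in>I. (\<Sum>j\<in>?J. (T i j - T i j0 / T i0 j0 * T i0 j) * x j) = 0" by auto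
    define y where "y = x(j0 := - (\<Sum>j\<in>?J. T i0 j * x j) / T i0 j0)"
    have s: "(\<Sum>j\<in>J. T i j * y j) = T i j0 * y j0 + (\<Sum>j\<in>?J. T i j * x j)" for i
    proof -
      have "(\<Sum>j\<in>J. T i j * y j) = T i j0 * y j0 + (\<Sum>j\<in>?J. T i j * y j)"
        using insert.prems j0 by (simp add: sum.remove)
      also have "(\<Sum>j\<in>?J. T i j * y j) = (\<Sum>j\<in>?J. T i j * x j)" by (intro sum.cong) (auto simp: y_def)
      finally show ?thesis .
    qed
    have "(\<Sum>j\<in>J. T i j * y j) = 0" if "i \<in> insert i0 I" for i
    proof (cases "i = i0")
      case True
      then show ?thesis unfolding s using j0 by (simp add: y_def)
    next
      case False
      then have "(\<Sum>j\<in>?J. T i j * x j) - T i j0 / T i0 j0 * (\<Sum>j\<in>?J. T i0 j * x j) = 0"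
        using x(2) that by (simp add: left_diff_distrib sum_subtractf sum_distrib_left mult.assoc)
      then show ?thesis unfolding s by (simp add: y_def)
    qed
    moreover have "\<exists>j\<in>J. y j \<noteq> 0" using x(1) by (auto simp: y_def)
    ultimately show ?thesis by blast
  qed
qed

lemma ring_hom_0: "is_ring_hom f \<Longrightarrow> f 0 = 0"
proof -
  assume "is_ring_hom f"
  then have "f (0 + 0) = f 0 + f 0" unfolding is_ring_hom_def by metis
  then show ?thesis by simp
qed

lemma ring_hom_minus: "is_ring_hom f \<Longrightarrow> f (- x) = - f x"
proof -
  assume f: "is_ring_hom f"
  then have "f x + f (- x) = f (x + - x)" unfolding is_ring_hom_def by metis
  then have "f x + f (- x) = 0" using ring_hom_0[OF f] by simp
  then show ?thesis by (simp add: add_eq_0_iff)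
qed

lemma ring_hom_power: "is_ring_hom f \<Longrightarrow> f (x ^ n) = f x ^ n"
  by (induction n) (auto simp: is_ring_hom_def)

lemma ring_hom_sum: "is_ring_hom f \<Longrightarrow> f (\<Sum>i\<in>I. g i) = (\<Sum>i\<in>I. f (g i))"
proof -
  assume f: "is_ring_hom f"
  then have add: "f (x + y) = f x + f y" for x y by (simp add: is_ring_hom_def)
  show ?thesis by (induction I rule: infinite_finite_induct) (simp_all add: ring_hom_0[OF f] add)
qed

lemma poly_map_ring_hom:
  assumes "is_ring_hom h"
  shows "poly (map_poly h (p + q)) x = poly (map_poly h p) x + poly (map_poly h q) x"
    "poly (map_poly h (p * q)) x = poly (map_poly h p) x * poly (map_poly h q) x"
    "poly (map_poly h (monom 1 n)) x = x ^ n" "poly (map_poly h [:c:]) x = h c"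
proof -
  note h0 = ring_hom_0[OF assms]
  have h: "h 1 = 1" "h (a + b) = h a + h b" "h (a * b) = h a * h b" for a b
    using assms unfolding is_ring_hom_def by auto
  show add: "poly (map_poly h (p + q)) x = poly (map_poly h p) x + poly (map_poly h q) x" for p q
  proof -
    have "map_poly h (p + q) = map_poly h p + map_poly h q"
      by (rule poly_eqI) (simp add: coeff_map_poly h0 h)
    then show ?thesis by simp
  qed
  have sm: "poly (map_poly h (Polynomial.smult c p)) x = h c * poly (map_poly h p) x" for c p
  proof -
    have "map_poly h (Polynomial.smult c p) = Polynomial.smult (h c) (map_poly h p)"
      by (rule poly_eqI) (simp add: coeff_map_poly h0 h)
    then show ?thesis by simp
  qed
  have pc: "poly (map_poly h (pCons c p)) x = h c + x * poly (map_poly h p) x" for c p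
    by (simp add: map_poly_pCons h0)
  show "poly (map_poly h (p * q)) x = poly (map_poly h p) x * poly (map_poly h q) x"
    by (induction p) (simp_all add: add sm pc h0 algebra_simps)
  show "poly (map_poly h (monom 1 n)) x = x ^ n"
    by (simp add: map_poly_monom h0 h poly_monom)
  show "poly (map_poly h [:c:]) x = h c" using pc[of c 0] by simp
qed

lemma is_ring_hom_to_ac: "is_ring_hom to_ac"
  by (simp add: is_ring_hom_def)

section \<open>Geometric embeddings of a cubic etale algebra\<close>

locale cubic_alg =
  fixes \<iota> :: "'a::{field,finite} \<Rightarrow> 'b::comm_ring_1"
  assumes et: "cubic_etale \<iota>"
begin

abbreviation Emb :: "('b \<Rightarrow> 'a alg_closure) set" where "Emb \<equiv> geom_embeddings \<iota>"

definition bs :: "3 \<Rightarrow> 'b" where "bs = (SOME b. alg_basis \<iota> b)"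

lemma hom_\<iota>: "is_ring_hom \<iota>" using et by (simp add: cubic_etale_def)

lemma \<iota>_simps: "\<iota> 1 = 1" "\<iota> (x + y) = \<iota> x + \<iota> y" "\<iota> (x * y) = \<iota> x * \<iota> y" "\<iota> 0 = 0"
  using hom_\<iota> ring_hom_0[OF hom_\<iota>] by (auto simp: is_ring_hom_def)

lemma basis: "alg_basis \<iota> bs"
proof -
  obtain b :: "3 \<Rightarrow> 'b" where "alg_basis \<iota> b" using et unfolding cubic_etale_def by blast
  then show ?thesis unfolding bs_def by (rule someI[where P = "alg_basis \<iota>"])
qed

lemma basis_expand: obtains c :: "'a^3" where "x = (\<Sum>i\<in>UNIV. \<iota> (c $ i) * bs i)"
proof -
  have "\<exists>!c :: 'a^3. x = (\<Sum>i\<in>UNIV. \<iota> (c $ i) * bs i)" using basis unfolding alg_basis_def by (rule spec)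
  then show ?thesis by (elim ex1E) (rule that)
qed

lemma basis_unique: "(\<Sum>i\<in>UNIV. \<iota> (c $ i) * bs i) = (\<Sum>i\<in>UNIV. \<iota> (d $ i) * bs i) \<Longrightarrow> c = (d :: 'a^3)"
  using basis unfolding alg_basis_def by blast

lemma finite_B: "finite (UNIV :: 'b set)"
proof -
  have "UNIV \<subseteq> range (\<lambda>c :: 'a^3. \<Sum>i\<in>UNIV. \<iota> (c $ i) * bs i)"
    using basis_expand by blast
  then show ?thesis by (rule finite_subset) simp
qed

lemma Emb_hom: "\<phi> \<in> Emb \<Longrightarrow> \<phi> 1 = 1" "\<phi> \<in> Emb \<Longrightarrow> \<phi> (x + y) = \<phi> x + \<phi> y"
  "\<phi> \<in> Emb \<Longrightarrow> \<phi> (x * y) = \<phi> x * \<phi> y" "\<phi> \<in> Emb \<Longrightarrow> \<phi> (\<iota> c) = to_ac c" "\<phi> \<in> Emb \<Longrightarrow> \<phi> 0 = 0"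
  "\<phi> \<in> Emb \<Longrightarrow> \<phi> (\<Sum>i\<in>I. g i) = (\<Sum>i\<in>I. \<phi> (g i))" "\<phi> \<in> Emb \<Longrightarrow> \<phi> (x - y) = \<phi> x - \<phi> y"
proof -
  assume "\<phi> \<in> Emb"
  then have h: "is_ring_hom \<phi>" "\<forall>c. \<phi> (\<iota> c) = to_ac c" by (auto simp: geom_embeddings_def alg_hom_def)
  show "\<phi> 1 = 1" "\<phi> (x + y) = \<phi> x + \<phi> y" "\<phi> (x * y) = \<phi> x * \<phi> y" "\<phi> (\<iota> c) = to_ac c"
    using h by (auto simp: is_ring_hom_def)
  show "\<phi> 0 = 0" using ring_hom_0[OF h(1)] .
  show "\<phi> (\<Sum>i\<in>I. g i) = (\<Sum>i\<in>I. \<phi> (g i))" using ring_hom_sum[OF h(1)] .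
  show "\<phi> (x - y) = \<phi> x - \<phi> y"
  proof -
    have "\<phi> (x + - y) = \<phi> x + \<phi> (- y)" using h(1) unfolding is_ring_hom_def by blast
    then show ?thesis by (simp add: ring_hom_minus[OF h(1)])
  qed
qed

text \<open>Some idempotent e satisfies e x \<noteq> 0, and its factor is a finite field, generated
  by a generator a of its multiplicative group. Sending a to a root of its minimal polynomial in the
  closure defines an embedding, under which x is nonzero because e x is invertible in the
  factor.\<close>

lemma embedding_separates:
  assumes "x \<noteq> 0" shows "\<exists>\<phi>\<in>Emb. \<phi> x \<noteq> 0"
proof -
  obtain S where SS: "etale_decomposition \<iota> S" using et unfolding cubic_etale_def by blast
  have S: "finite S" "\<forall>e\<in>S. e \<noteq> 0 \<and> e * e = e" "\<Sum>S = 1"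
     "\<forall>e\<in>S. \<forall>x. e * x \<noteq> 0 \<longrightarrow> (\<exists>y. (e * x) * (e * y) = e)"
     "\<forall>e\<in>S. \<forall>x. \<exists>p::'a poly. coprime p (pderiv p) \<and> e * poly (map_poly \<iota> p) x = 0"
    using SS unfolding etale_decomposition_def by - (elim conjE, assumption)+
  have "\<exists>e\<in>S. e * x \<noteq> 0"
  proof (rule ccontr)
    assume "\<not> (\<exists>e\<in>S. e * x \<noteq> 0)"
    then have "(\<Sum>e\<in>S. e * x) = 0" by (intro sum.neutral) auto
    moreover have "(\<Sum>e\<in>S. e * x) = x" using S(3) by (simp add: sum_distrib_right[symmetric])
    ultimately show False using assms by simp
  qed
  then obtain e where e: "e \<in> S" "e * x \<noteq> 0" by blast
  have ee: "e * e = e" "e \<noteq> 0" using S(2) e(1) by auto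
  have inv: "\<exists>y. (e * x) * (e * y) = e" if "e * x \<noteq> 0" for x using S(4) e(1) that by blast
  \<comment> \<open>The factor as a ring with its own carrier and unit e, the setting in which
    multiplicative groups of finite fields are known to be cyclic.\<close>
  define Re :: "'b ring" where "Re = \<lparr>carrier = range ((*) e), mult = (*), one = e, zero = 0, add = (+)\<rparr>"
  have eR: "e * y = y" if "y \<in> range ((*) e)" for y
    using that ee by (auto simp: mult.assoc[symmetric])
  have sub: "e * y \<in> range ((*) e)" for y by blast
  have "cring Re"
  proof (rule cringI)
    show "abelian_group Re"
    proof (rule abelian_groupI)
      fix y assume "y \<in> carrier Re"
      then obtain z where "y = e * z" by (auto simp: Re_def)
      then show "\<exists>z\<in>carrier Re. z \<oplus>\<^bsub>Re\<^esub> y = \<zero>\<^bsub>Re\<^esub>"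
        using sub[of "- z"] by (intro bexI[of _ "e * (- z)"]) (auto simp: Re_def)
    next
      fix y z assume "y \<in> carrier Re" "z \<in> carrier Re"
      then show "y \<oplus>\<^bsub>Re\<^esub> z \<in> carrier Re" by (auto simp: Re_def distrib_left[symmetric])
    next
      show "\<zero>\<^bsub>Re\<^esub> \<in> carrier Re" by (auto simp: Re_def image_iff intro: exI[of _ 0])
    qed (auto simp: Re_def algebra_simps)
    show "comm_monoid Re"
    proof (rule comm_monoidI)
      fix y z assume "y \<in> carrier Re" "z \<in> carrier Re"
      then show "y \<otimes>\<^bsub>Re\<^esub> z \<in> carrier Re" by (auto simp: Re_def mult.assoc)
    next
      show "\<one>\<^bsub>Re\<^esub> \<in> carrier Re" using sub[of e] by (simp add: Re_def ee)
    next
      fix y assume "y \<in> carrier Re"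
      then have "y \<in> range ((*) e)" by (simp add: Re_def)
      from eR[OF this] show "\<one>\<^bsub>Re\<^esub> \<otimes>\<^bsub>Re\<^esub> y = y" by (simp add: Re_def)
    qed (auto simp: Re_def algebra_simps)
  qed (auto simp: Re_def algebra_simps)
  then have fld: "field Re"
  proof (rule cring.cring_fieldI2)
    show "\<zero>\<^bsub>Re\<^esub> \<noteq> \<one>\<^bsub>Re\<^esub>" using ee by (simp add: Re_def)
    fix a assume a: "a \<in> carrier Re" "a \<noteq> \<zero>\<^bsub>Re\<^esub>"
    then obtain z where z: "a = e * z" "e * z \<noteq> 0" by (auto simp: Re_def)
    then obtain y where "(e * z) * (e * y) = e" using inv by blast
    then show "\<exists>b\<in>carrier Re. a \<otimes>\<^bsub>Re\<^esub> b = \<one>\<^bsub>Re\<^esub>" using z by (intro bexI[of _ "e * y"]) (auto simp: Re_def)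
  qed
  have "finite (carrier Re)" using finite_B by (rule rev_finite_subset) simp
  from field.finite_field_mult_group_has_gen[OF fld this] obtain a where
    a: "a \<in> carrier (Multiplicative_Group.mult_of Re)" "carrier (Multiplicative_Group.mult_of Re) = {a [^]\<^bsub>Re\<^esub> i | i::nat. i \<in> UNIV}" by blast
  \<comment> \<open>Evaluation of polynomials at a inside the factor.\<close>
  define ev where "ev = (\<lambda>p. e * poly (map_poly \<iota> p) a)"
  note pm = poly_map_ring_hom[OF hom_\<iota>]
  have ev_add: "ev (p + r) = ev p + ev r" for p r by (simp add: ev_def pm algebra_simps)
  have ev_mult: "ev (p * r) = ev p * ev r" for p r
  proof -
    have "ev p * ev r = (e * e) * (poly (map_poly \<iota> p) a * poly (map_poly \<iota> r) a)" by (simp add: ev_def mult_ac)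
    then show ?thesis by (simp add: ev_def pm ee mult.assoc)
  qed
  have ev_const: "ev [:c:] = e * \<iota> c" for c by (simp add: ev_def pm)
  have ev_0: "ev 0 = 0" by (simp add: ev_def)
  have pow: "a [^]\<^bsub>Re\<^esub> (i::nat) = e * a ^ i" for i
  proof (induction i)
    case 0
    then show ?case by (simp add: Re_def)
  next
    case (Suc i)
    then show ?case by (simp add: Re_def mult_ac nat_pow_def)
  qed
  have surj: "\<exists>p. ev p = e * y" for y
  proof (cases "e * y = 0")
    case True
    then show ?thesis using ev_0 by metis
  next
    case False
    then have "e * y \<in> carrier (Multiplicative_Group.mult_of Re)" by (simp add: Re_def)
    then obtain i where "e * y = e * a ^ i" using a(2) pow by auto
    then have "ev (monom 1 i) = e * y" by (simp add: ev_def pm)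
    then show ?thesis by blast
  qed
  \<comment> \<open>It shows that the kernel of \<open>ev\<close> is nonzero; an element f of least
    degree then generates the kernel.\<close>
  obtain p0 where p0: "coprime p0 (pderiv p0)" "ev p0 = 0" using S(5) e(1) unfolding ev_def by blast
  have "p0 \<noteq> 0" using p0(1) by auto
  then have "\<exists>n. \<exists>p. p \<noteq> 0 \<and> ev p = 0 \<and> degree p = n" using p0(2) by blast
  from exists_least_iff[THEN iffD1, OF this] obtain f where f: "f \<noteq> 0" "ev f = 0"
    "\<And>p. p \<noteq> 0 \<Longrightarrow> ev p = 0 \<Longrightarrow> degree f \<le> degree p" by (metis not_less)
  have ker: "f dvd p" if "ev p = 0" for p
  proof (rule ccontr)
    assume "\<not> f dvd p"
    then have nz: "p mod f \<noteq> 0" by (simp add: dvd_eq_mod_eq_0)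
    have "ev p = ev (p div f * f) + ev (p mod f)" by (simp add: ev_add[symmetric])
    then have "ev (p mod f) = 0" using that f(2) by (simp add: ev_mult)
    from f(3)[OF nz this] show False using degree_mod_less[OF f(1), of p] nz by simp
  qed
  have "degree f > 0"
  proof (rule ccontr)
    assume "\<not> degree f > 0"
    then obtain c where c: "f = [:c:]" by (metis degree_eq_zeroE gr0I)
    then have "c \<noteq> 0" "e * \<iota> c = 0" using f(1,2) ev_const by auto
    then have "e * (\<iota> c * \<iota> (inverse c)) = 0" by (simp add: mult.assoc[symmetric])
    moreover have "\<iota> c * \<iota> (inverse c) = 1" using \<open>c \<noteq> 0\<close> by (simp add: \<iota>_simps(3)[symmetric] \<iota>_simps(1))
    ultimately show False using ee(2) by simp
  qed
  moreover have "degree (map_poly to_ac f) = degree f" by (rule degree_map_poly) simp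
  ultimately obtain \<beta> where \<beta>: "poly (map_poly to_ac f) \<beta> = 0" using alg_closed_imp_poly_has_root[of "map_poly to_ac f"] by auto
  note pt = poly_map_ring_hom[OF is_ring_hom_to_ac]
  \<comment> \<open>Any p with \<open>ev p = e * y\<close> gives the same value, because two choices
    differ by a multiple of f and \<beta> is a root of f.\<close>
  define \<phi> where "\<phi> = (\<lambda>y. poly (map_poly to_ac (SOME p. ev p = e * y)) \<beta>)"
  have \<phi>: "\<phi> y = poly (map_poly to_ac p) \<beta>" if "ev p = e * y" for p y
  proof -
    define p' where "p' = (SOME p. ev p = e * y)"
    have p': "ev p' = e * y" unfolding p'_def by (rule someI[of _ p]) (rule that)
    have "ev (p - p') = 0"
      using ev_add[of "p - p'" p'] that p' by simp
    from ker[OF this] obtain r where "p - p' = f * r" by (auto simp: dvd_def)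
    then have "p = f * r + p'" by (simp add: algebra_simps)
    then have "poly (map_poly to_ac p) \<beta> = poly (map_poly to_ac p') \<beta>" by (simp add: pt \<beta>)
    then show ?thesis by (simp add: \<phi>_def p'_def)
  qed
  have "\<phi> \<in> Emb" unfolding geom_embeddings_def alg_hom_def is_ring_hom_def mem_Collect_eq
  proof (intro conjI allI)
    fix y z c
    obtain p r where pr: "ev p = e * y" "ev r = e * z" using surj by metis
    show "\<phi> 1 = 1" using \<phi>[of "[:1:]" 1] by (simp add: ev_const \<iota>_simps pt)
    show "\<phi> (y + z) = \<phi> y + \<phi> z"
      using \<phi>[of "p + r" "y + z"] \<phi>[OF pr(1)] \<phi>[OF pr(2)] pr by (simp add: ev_add pt distrib_left)
    show "\<phi> (y * z) = \<phi> y * \<phi> z"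
    proof -
      have "ev (p * r) = (e * e) * (y * z)" using pr by (simp add: ev_mult mult_ac)
      then have "ev (p * r) = e * (y * z)" by (simp add: ee)
      from \<phi>[OF this] \<phi>[OF pr(1)] \<phi>[OF pr(2)] show ?thesis by (simp add: pt)
    qed
    show "\<phi> (\<iota> c) = to_ac c" using \<phi>[of "[:c:]" "\<iota> c"] by (simp add: ev_const pt)
  qed
  moreover have "\<phi> x \<noteq> 0"
  proof
    assume 0: "\<phi> x = 0"
    obtain y where y: "(e * x) * (e * y) = e" using inv[OF e(2)] by blast
    have "e * (x * y) = (e * e) * (x * y)" by (simp add: ee)
    also have "\<dots> = e * 1" using y by (simp add: mult_ac)
    finally have "e * (x * y) = e * 1" .
    then have "\<phi> (x * y) = \<phi> 1" by (simp add: \<phi>_def)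
    then show False using 0 Emb_hom(1,3)[OF \<open>\<phi> \<in> Emb\<close>] by simp
  qed
  ultimately show ?thesis by blast
qed

text \<open>A relation at y x minus \<phi>0(y) times the relation at x has no term in \<phi>0, and
  the coefficient of \<phi> is multiplied by \<phi>(y) - \<phi>0(y), which is nonzero for a suitable
  y.\<close>

lemma dedekind_independence:
  assumes "finite \<Phi>" "\<Phi> \<subseteq> Emb" "\<And>x. (\<Sum>\<phi>\<in>\<Phi>. c \<phi> * \<phi> x) = 0" "\<phi> \<in> \<Phi>" shows "c \<phi> = 0"
  using assms
proof (induction \<Phi> arbitrary: c \<phi>)
  case (insert \<phi>0 \<Phi>)
  have z: "c \<phi> = 0" if "\<phi> \<in> \<Phi>" for \<phi>
  proof -
    have "\<phi> \<noteq> \<phi>0" using that insert.hyps by auto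
    then obtain y where y: "\<phi> y \<noteq> \<phi>0 y" by blast
    have "(\<Sum>\<phi>\<in>\<Phi>. (c \<phi> * (\<phi> y - \<phi>0 y)) * \<phi> x) = 0" for x
    proof -
      have "(\<Sum>\<phi>\<in>insert \<phi>0 \<Phi>. c \<phi> * \<phi> (y * x)) - \<phi>0 y * (\<Sum>\<phi>\<in>insert \<phi>0 \<Phi>. c \<phi> * \<phi> x) = 0"
        using insert.prems(2) by simp
      moreover have "(\<Sum>\<phi>\<in>insert \<phi>0 \<Phi>. c \<phi> * \<phi> (y * x)) - \<phi>0 y * (\<Sum>\<phi>\<in>insert \<phi>0 \<Phi>. c \<phi> * \<phi> x) =
        (\<Sum>\<phi>\<in>insert \<phi>0 \<Phi>. (c \<phi> * (\<phi> y - \<phi>0 y)) * \<phi> x)"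
        unfolding sum_distrib_left sum_subtractf[symmetric]
        by (intro sum.cong refl) (use insert.prems(1) in \<open>auto simp: Emb_hom algebra_simps\<close>)
      ultimately show ?thesis using insert.hyps by simp
    qed
    from insert.IH[of "\<lambda>\<phi>. c \<phi> * (\<phi> y - \<phi>0 y)", OF _ this that] insert.prems(1) y show ?thesis by auto
  qed
  have "(\<Sum>\<phi>\<in>insert \<phi>0 \<Phi>. c \<phi> * \<phi> 1) = c \<phi>0"
    using insert.hyps insert.prems(1) z by (simp add: Emb_hom)
  then have "c \<phi>0 = 0" using insert.prems(2)[of 1] by simp
  then show ?case using z insert.prems(3) by auto
qed simp

text \<open>Four or more embeddings would be linearly dependent on the three basis elements, hence
  everywhere.\<close>

lemma card_Emb_le:
  assumes "finite \<Phi>" "\<Phi> \<subseteq> Emb" shows "card \<Phi> \<le> 3"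
proof (rule ccontr)
  assume "\<not> card \<Phi> \<le> 3"
  then have "card (UNIV :: 3 set) < card \<Phi>" by simp
  from underdetermined_system[OF _ assms(1) this, of "\<lambda>i \<phi>. \<phi> (bs i)"] obtain c where
    c: "\<exists>\<phi>\<in>\<Phi>. c \<phi> \<noteq> 0" "\<And>i. (\<Sum>\<phi>\<in>\<Phi>. \<phi> (bs i) * c \<phi>) = 0" by auto
  have "(\<Sum>\<phi>\<in>\<Phi>. c \<phi> * \<phi> x) = 0" for x
  proof -
    obtain d :: "'a^3" where d: "x = (\<Sum>i\<in>UNIV. \<iota> (d $ i) * bs i)" by (rule basis_expand)
    have "(\<Sum>\<phi>\<in>\<Phi>. c \<phi> * \<phi> x) = (\<Sum>\<phi>\<in>\<Phi>. \<Sum>i\<in>UNIV. to_ac (d $ i) * (\<phi> (bs i) * c \<phi>))"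
      by (intro sum.cong refl) (use assms(2) in \<open>auto simp: d Emb_hom sum_distrib_left mult_ac\<close>)
    also have "\<dots> = (\<Sum>i\<in>UNIV. \<Sum>\<phi>\<in>\<Phi>. to_ac (d $ i) * (\<phi> (bs i) * c \<phi>))" by (rule sum.swap)
    also have "\<dots> = 0" by (simp add: sum_distrib_left[symmetric] c(2))
    finally show ?thesis .
  qed
  then show False using dedekind_independence[OF assms] c(1) by blast
qed

lemma finite_Emb: "finite Emb"
proof (rule ccontr)
  assume "infinite Emb"
  then obtain \<Phi> where "finite \<Phi>" "card \<Phi> = 4" "\<Phi> \<subseteq> Emb" using infinite_arbitrarily_large by metis
  then show False using card_Emb_le[of \<Phi>] by simp
qed

definition Frob :: "('b \<Rightarrow> 'a alg_closure) \<Rightarrow> 'b \<Rightarrow> 'a alg_closure" where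
  "Frob \<phi> = (\<lambda>x. \<phi> x ^ CARD('a))"

lemma Frob_Emb: "\<phi> \<in> Emb \<Longrightarrow> Frob \<phi> \<in> Emb"
  unfolding geom_embeddings_def alg_hom_def is_ring_hom_def Frob_def
  by (auto simp: frobenius_add power_mult_distrib)

lemma bij_Frob: "bij_betw Frob Emb Emb"
proof -
  have "inj_on Frob Emb" by (rule inj_onI) (auto simp: Frob_def fun_eq_iff frobenius_inj)
  moreover have "Frob ` Emb \<subseteq> Emb" using Frob_Emb by blast
  ultimately show ?thesis using finite_Emb by (simp add: bij_betw_def endo_inj_surj)
qed

text \<open>Galois descent. A nonzero relation is normalized to have a coefficient 1; its Frobenius
  conjugate minus itself has smaller support, so by induction the coefficients are fixed by
  Frobenius and lie in the base field. They then define a nonzero element of B killed by all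
  embeddings.\<close>

lemma Emb_injective_aux:
  fixes c :: "'a alg_closure^3"
  assumes "\<And>\<phi>. \<phi> \<in> Emb \<Longrightarrow> (\<Sum>i\<in>UNIV. c $ i * \<phi> (bs i)) = 0" shows "c = 0"
  using assms
proof (induction "card {i. c $ i \<noteq> 0}" arbitrary: c rule: less_induct)
  case less
  show ?case
  proof (rule ccontr)
    assume "c \<noteq> 0"
    then obtain j where j: "c $ j \<noteq> 0" by (auto simp: vec_eq_iff)
    define d where "d = (\<chi> i. c $ i / c $ j)"
    have dj: "d $ j = 1" using j by (simp add: d_def)
    have rel: "(\<Sum>i\<in>UNIV. d $ i * \<phi> (bs i)) = 0" if "\<phi> \<in> Emb" for \<phi>
      using less.prems[OF that] by (simp add: d_def sum_divide_distrib[symmetric])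
    define d' where "d' = (\<chi> i. d $ i ^ CARD('a) - d $ i)"
    \<comment> \<open>Every embedding is the Frobenius of another one, \<psi>, and the q-th power of
      the relation at \<psi> is a relation at the given one.\<close>
    have rel': "(\<Sum>i\<in>UNIV. d' $ i * \<phi> (bs i)) = 0" if \<phi>: "\<phi> \<in> Emb" for \<phi>
    proof -
      obtain \<psi> where \<psi>: "\<psi> \<in> Emb" "\<phi> = Frob \<psi>" using bij_Frob \<phi> by (auto simp: bij_betw_def)
      have "(\<Sum>i\<in>UNIV. d $ i ^ CARD('a) * \<phi> (bs i)) = (\<Sum>i\<in>UNIV. d $ i * \<psi> (bs i)) ^ CARD('a)"
        by (simp add: \<psi>(2) Frob_def frobenius_sum power_mult_distrib)
      then show ?thesis using rel[OF \<phi>] rel[OF \<psi>(1)] by (simp add: d'_def left_diff_distrib sum_subtractf power_0_left)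
    qed
    have "{i. d' $ i \<noteq> 0} \<subseteq> {i. c $ i \<noteq> 0}" by (auto simp: d'_def d_def power_0_left)
    moreover have "j \<in> {i. c $ i \<noteq> 0}" "j \<notin> {i. d' $ i \<noteq> 0}" using j dj by (auto simp: d'_def)
    ultimately have "{i. d' $ i \<noteq> 0} \<subset> {i. c $ i \<noteq> 0}" by blast
    then have "card {i. d' $ i \<noteq> 0} < card {i. c $ i \<noteq> 0}" by (intro psubset_card_mono) auto
    from less.hyps[OF this rel'] have "d' = 0" .
    then have "d $ i ^ CARD('a) = d $ i" for i by (simp add: d'_def vec_eq_iff)
    then have "\<forall>i. \<exists>a. d $ i = to_ac a" by (metis frobenius_fixed)
    then obtain a where a: "\<And>i. d $ i = to_ac (a i)" by metis
    define x where "x = (\<Sum>i\<in>UNIV. \<iota> ((\<chi> i. a i) $ i) * bs i)"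
    have "\<phi> x = 0" if "\<phi> \<in> Emb" for \<phi>
      using rel[OF that] by (simp add: x_def Emb_hom[OF that] a)
    then have "x = 0" using embedding_separates by blast
    then have "(\<Sum>i\<in>UNIV. \<iota> ((\<chi> i. a i) $ i) * bs i) = (\<Sum>i\<in>UNIV. \<iota> ((0 :: 'a^3) $ i) * bs i)"
      by (simp add: x_def \<iota>_simps)
    from basis_unique[OF this] have "a j = 0" by (simp add: vec_eq_iff)
    then show False using a[of j] dj by simp
  qed
qed

text \<open>With fewer than three embeddings the three basis elements would admit a nonzero
  relation, which descent excludes.\<close>

lemma card_Emb: "card Emb = 3"
proof -
  have "\<not> card Emb < 3"
  proof
    assume "card Emb < 3"
    then have "card Emb < card (UNIV :: 3 set)" by simp
    from underdetermined_system[OF finite_Emb _ this, of "\<lambda>\<phi> i. \<phi> (bs i)"] obtain x where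
      x: "\<exists>j. x j \<noteq> 0" "\<And>\<phi>. \<phi> \<in> Emb \<Longrightarrow> (\<Sum>j\<in>UNIV. \<phi> (bs j) * x j) = 0" by auto
    have "(\<chi> j. x j) = 0" by (rule Emb_injective_aux) (use x(2) in \<open>simp add: mult.commute\<close>)
    then show False using x(1) by (simp add: vec_eq_iff)
  qed
  then show ?thesis using card_Emb_le[OF finite_Emb] by simp
qed

lemma ex_frobenius_perm: "\<exists>\<tau>. frobenius_perm \<iota> \<tau>"
proof -
  obtain e :: "3 \<Rightarrow> _" where e: "bij_betw e UNIV Emb"
    using finite_same_card_bij[of "UNIV :: 3 set" Emb] finite_Emb card_Emb by auto
  define \<tau> where "\<tau> = (\<lambda>i. inv_into UNIV e (Frob (e i)))"
  have "bij_betw (Frob \<circ> e) UNIV Emb" using bij_betw_trans[OF e bij_Frob] .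
  from bij_betw_trans[OF this bij_betw_inv_into[OF e]] have "bij \<tau>" by (simp add: \<tau>_def comp_def)
  moreover have "e (\<tau> i) x = e i x ^ CARD('a)" for i x
  proof -
    have "e i \<in> Emb" using e by (auto simp: bij_betw_def)
    then have "e (\<tau> i) = Frob (e i)" unfolding \<tau>_def using e Frob_Emb by (metis bij_betw_imp_surj_on f_inv_into_f)
    then show ?thesis by (simp add: Frob_def)
  qed
  ultimately show ?thesis using e unfolding frobenius_perm_def by blast
qed

end

section \<open>The algebra as Frobenius-compatible triples\<close>

locale numbered_cubic_alg = cubic_alg \<iota>
  for \<iota> :: "'a::{field,finite} \<Rightarrow> 'b::comm_ring_1" +
  fixes e :: "3 \<Rightarrow> 'b \<Rightarrow> 'a alg_closure" and \<tau> :: "3 \<Rightarrow> 3"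
  assumes bij_e: "bij_betw e UNIV Emb" and bij_\<tau>: "bij \<tau>"
    and e_frob: "e (\<tau> i) x = e i x ^ CARD('a)"
begin

lemma e_Emb: "e i \<in> Emb" using bij_e by (auto simp: bij_betw_def)

lemma Emb_e: "\<phi> \<in> Emb \<Longrightarrow> \<exists>i. \<phi> = e i" using bij_e by (auto simp: bij_betw_def)

lemmas e_simps = Emb_hom[OF e_Emb]

lemma e_eqI: "(\<And>i. e i x = e i y) \<Longrightarrow> x = y"
proof (rule ccontr)
  assume h: "\<And>i. e i x = e i y" and "x \<noteq> y"
  then have "x - y \<noteq> 0" by simp
  from embedding_separates[OF this] obtain \<phi> where "\<phi> \<in> Emb" "\<phi> (x - y) \<noteq> 0" by blast
  then show False using h Emb_e by (metis e_simps(7) diff_self)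
qed

text \<open>The matrix of the isomorphism between the base change of B to the closure and the
  threefold product of the closure.\<close>

definition Em :: "'a alg_closure^3^3" where "Em = (\<chi> i j. e i (bs j))"

lemma Em_inverse: obtains B where "B ** Em = mat 1" "Em ** B = mat 1"
proof -
  have "\<forall>x. Em *v x = 0 \<longrightarrow> x = 0"
  proof (intro allI impI)
    fix x assume "Em *v x = 0"
    then have z: "(\<Sum>j\<in>UNIV. e i (bs j) * x $ j) = 0" for i
      by (simp add: matrix_vector_mult_def Em_def vec_eq_iff)
    show "x = 0"
    proof (rule Emb_injective_aux)
      fix \<phi> assume "\<phi> \<in> Emb"
      then obtain i where "\<phi> = e i" using Emb_e by blast
      then show "(\<Sum>i\<in>UNIV. x $ i * \<phi> (bs i)) = 0" using z[of i] by (simp add: mult.commute)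
    qed
  qed
  then obtain B where "B ** Em = mat 1" unfolding matrix_left_invertible_ker[symmetric] by blast
  then show ?thesis using that matrix_left_right_inverse by blast
qed

text \<open>Over the closure the triple has a unique coordinate vector in the basis. Compatibility
  with \<tau> makes the Frobenius conjugate of this vector another solution, so the coordinates lie
  in the base field.\<close>

lemma ex_tuple:
  assumes "\<And>i. a (\<tau> i) = a i ^ CARD('a)" obtains x where "\<And>i. e i x = a i"
proof -
  obtain B where B: "B ** Em = mat 1" "Em ** B = mat 1" by (rule Em_inverse)
  define c where "c = B *v (\<chi> i. a i)"
  have Ec: "Em *v c = (\<chi> i. a i)" by (simp add: c_def matrix_vector_mul_assoc B)
  then have ca: "(\<Sum>j\<in>UNIV. e i (bs j) * c $ j) = a i" for i
    by (simp add: matrix_vector_mult_def Em_def vec_eq_iff)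
  define c' where "c' = (\<chi> j. c $ j ^ CARD('a))"
  \<comment> \<open>Row \<tau> i of \<open>Em\<close> is the Frobenius conjugate of row i, so the
    k-th entry is the q-th power of entry i.\<close>
  have "(Em *v c') $ k = a k" for k
  proof -
    obtain i where k: "k = \<tau> i" using bij_\<tau> by (metis bij_pointE)
    have "(Em *v c') $ k = (\<Sum>j\<in>UNIV. (e i (bs j) * c $ j) ^ CARD('a))"
      by (simp add: matrix_vector_mult_def Em_def k c'_def e_frob power_mult_distrib)
    then show ?thesis by (simp add: frobenius_sum[symmetric] ca k assms)
  qed
  then have "Em *v c' = Em *v c" by (simp add: Ec vec_eq_iff)
  then have "B *v (Em *v c') = B *v (Em *v c)" by simp
  then have "c' = c" by (simp add: matrix_vector_mul_assoc B)
  then have "c $ j ^ CARD('a) = c $ j" for j by (simp add: c'_def vec_eq_iff)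
  then have "\<forall>j. \<exists>d. c $ j = to_ac d" by (metis frobenius_fixed)
  then obtain d where d: "\<forall>j. c $ j = to_ac (d j)" by (rule choice[THEN exE])
  have "e i (\<Sum>j\<in>UNIV. \<iota> (d j) * bs j) = a i" for i
    using ca[of i] d by (simp add: e_simps mult.commute)
  then show ?thesis by (rule that)
qed

lemma coords_expand: "x = (\<Sum>i\<in>UNIV. \<iota> (coords \<iota> bs x $ i) * bs i)"
proof -
  have "\<exists>!c :: 'a^3. x = (\<Sum>i\<in>UNIV. \<iota> (c $ i) * bs i)" using basis unfolding alg_basis_def by (rule spec)
  from theI'[OF this] show ?thesis unfolding coords_def .
qed

text \<open>The matrix \<open>Em\<close> conjugates multiplication by x into the diagonal matrix of
  the embeddings of x.\<close>

lemma trace_norm_embeddings: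
  "to_ac (cubic_trace \<iota> x) = (\<Sum>i\<in>UNIV. e i x)" "to_ac (cubic_norm \<iota> x) = (\<Prod>i\<in>UNIV. e i x)"
proof -
  obtain B where B: "B ** Em = mat 1" "Em ** B = mat 1" by (rule Em_inverse)
  define M where "M = mult_matrix \<iota> bs x"
  define Mh :: "'a alg_closure^3^3" where "Mh = (\<chi> i j. to_ac (M $ i $ j))"
  define D :: "'a alg_closure^3^3" where "D = (\<chi> i j. if i = j then e i x else 0)"
  have M: "cubic_trace \<iota> x = trace M" "cubic_norm \<iota> x = det M"
    by (simp_all add: M_def cubic_trace_def cubic_norm_def bs_def)
  have "(D ** Em) $ i $ j = (Em ** Mh) $ i $ j" for i j
  proof -
    have "(D ** Em) $ i $ j = e i x * e i (bs j)"
      by (simp add: D_def Em_def matrix_matrix_mult_def if_distrib[of "\<lambda>z. z * _"] cong: if_cong)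
    also have "\<dots> = e i (x * bs j)" by (simp add: e_simps)
    also have "x * bs j = (\<Sum>k\<in>UNIV. \<iota> (M $ k $ j) * bs k)"
      using coords_expand[of "x * bs j"] by (simp add: M_def mult_matrix_def)
    finally show ?thesis by (simp add: Em_def Mh_def matrix_matrix_mult_def e_simps mult.commute)
  qed
  then have DE: "D ** Em = Em ** Mh" by (simp add: vec_eq_iff)
  have "D = D ** (Em ** B)" by (simp add: B)
  also have "\<dots> = Em ** (Mh ** B)" by (simp add: matrix_mul_assoc DE)
  finally have D: "D = Em ** (Mh ** B)" .
  have "trace D = trace Mh" unfolding D by (subst trace_mul_sym) (simp add: matrix_mul_assoc[symmetric] B)
  moreover have "trace D = (\<Sum>i\<in>UNIV. e i x)" by (simp add: trace_def D_def)
  moreover have "trace Mh = to_ac (trace M)" by (simp add: trace_def Mh_def sum_3)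
  ultimately show "to_ac (cubic_trace \<iota> x) = (\<Sum>i\<in>UNIV. e i x)" by (simp add: M)
  have "det Em * det B = 1" using B(2) by (metis det_mul det_I)
  then have "det D = det Mh" unfolding D by (simp add: det_mul mult_ac)
  moreover have "det D = (\<Prod>i\<in>UNIV. e i x)" by (subst det_diagonal) (auto simp: D_def)
  moreover have "det Mh = to_ac (det M)" by (simp add: det_3 Mh_def)
  ultimately show "to_ac (cubic_norm \<iota> x) = (\<Prod>i\<in>UNIV. e i x)" by (simp add: M)
qed

lemma trace_eq_0_iff: "cubic_trace \<iota> x = 0 \<longleftrightarrow> (\<Sum>i\<in>UNIV. e i x) = 0"
  by (simp flip: trace_norm_embeddings)

lemma norm_eq_iff: "cubic_norm \<iota> x = c \<longleftrightarrow> (\<Prod>i\<in>UNIV. e i x) = to_ac c"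
  by (simp flip: trace_norm_embeddings)

text \<open>The inverses of the embeddings again form a compatible triple, which comes from an
  inverse element.\<close>

lemma norm_nonzero_unit:
  assumes "cubic_norm \<iota> x \<noteq> 0" shows "x dvd 1"
proof -
  have nz: "e i x \<noteq> 0" for i
  proof
    assume "e i x = 0"
    then have "(\<Prod>i\<in>UNIV. e i x) = to_ac 0" by (simp add: prod_zero_iff) blast
    then show False using assms norm_eq_iff by blast
  qed
  obtain y where y: "\<And>i. e i y = inverse (e i x)"
    by (rule ex_tuple[of "\<lambda>i. inverse (e i x)"]) (auto simp: e_frob power_inverse)
  have "x * y = 1" by (rule e_eqI) (simp add: e_simps y nz)
  then show ?thesis by (metis dvd_triv_left)
qed

definition twisted_tuples :: "'a \<Rightarrow> (3 \<Rightarrow> 'a alg_closure) set" where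
  "twisted_tuples \<epsilon> = {a. (\<forall>i. a (\<tau> i) = a i ^ CARD('a)) \<and> (\<Sum>i\<in>UNIV. a i) = 0 \<and> (\<Prod>i\<in>UNIV. a i) = to_ac \<epsilon>}"

lemma norm_trace_count_eq:
  assumes "\<epsilon> \<noteq> 0"
  shows "norm_trace_count \<iota> \<epsilon> = card {x. cubic_trace \<iota> x = 0 \<and> cubic_norm \<iota> x = \<epsilon>}"
proof -
  have "{x. x dvd 1 \<and> cubic_trace \<iota> x = 0 \<and> cubic_norm \<iota> x = \<epsilon>}
      = {x. cubic_trace \<iota> x = 0 \<and> cubic_norm \<iota> x = \<epsilon>}" using norm_nonzero_unit assms by blast
  then show ?thesis unfolding norm_trace_count_def by simp
qed

lemma norm_trace_count_tuples:
  assumes "\<epsilon> \<noteq> 0" shows "norm_trace_count \<iota> \<epsilon> = card (twisted_tuples \<epsilon>)"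
proof -
  have "bij_betw (\<lambda>x i. e i x) {x. cubic_trace \<iota> x = 0 \<and> cubic_norm \<iota> x = \<epsilon>} (twisted_tuples \<epsilon>)"
  proof (rule bij_betw_imageI)
    show "inj_on (\<lambda>x i. e i x) {x. cubic_trace \<iota> x = 0 \<and> cubic_norm \<iota> x = \<epsilon>}"
      by (rule inj_onI, rule e_eqI) (simp add: fun_eq_iff)
    show "(\<lambda>x i. e i x) ` {x. cubic_trace \<iota> x = 0 \<and> cubic_norm \<iota> x = \<epsilon>} = twisted_tuples \<epsilon>"
    proof (intro subset_antisym subsetI)
      fix a assume "a \<in> (\<lambda>x i. e i x) ` {x. cubic_trace \<iota> x = 0 \<and> cubic_norm \<iota> x = \<epsilon>}"
      then show "a \<in> twisted_tuples \<epsilon>" by (auto simp: twisted_tuples_def e_frob trace_eq_0_iff norm_eq_iff)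
    next
      fix a assume a: "a \<in> twisted_tuples \<epsilon>"
      obtain x where x: "\<And>i. e i x = a i" by (rule ex_tuple[of a]) (use a in \<open>auto simp: twisted_tuples_def\<close>)
      show "a \<in> (\<lambda>x i. e i x) ` {x. cubic_trace \<iota> x = 0 \<and> cubic_norm \<iota> x = \<epsilon>}"
        by (rule image_eqI[of _ _ x]) (use a in \<open>auto simp: twisted_tuples_def x trace_eq_0_iff norm_eq_iff\<close>)
    qed
  qed
  from bij_betw_same_card[OF this] show ?thesis by (simp add: norm_trace_count_eq[OF assms])
qed

subsection \<open>The projective closure\<close>

definition line :: "'b \<times> 'a \<Rightarrow> ('b \<times> 'a) set" where
  "line v = {(\<iota> c * fst v, c * snd v) | c. c \<noteq> 0}"

definition cone :: "'a \<Rightarrow> ('b \<times> 'a) set" where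
  "cone \<epsilon> = {(x, z). cubic_trace \<iota> x = 0 \<and> cubic_norm \<iota> x = \<epsilon> * z ^ 3} - {0}"

lemma twisted_curve_lines: "twisted_curve \<iota> \<epsilon> = line ` cone \<epsilon>"
  unfolding twisted_curve_def proj_points_def cone_def line_def by (simp add: case_prod_beta)

lemma line_self: "v \<in> line v"
  unfolding line_def by (rule CollectI, rule exI[of _ 1]) (simp add: \<iota>_simps)

lemma line_scale: "c \<noteq> 0 \<Longrightarrow> line (\<iota> c * x, c * z) = line (x, z)"
proof -
  assume c: "c \<noteq> 0"
  have "(\<exists>d. w = (\<iota> d * (\<iota> c * x), d * (c * z)) \<and> d \<noteq> 0) \<longleftrightarrow> (\<exists>d. w = (\<iota> d * x, d * z) \<and> d \<noteq> 0)" for w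
  proof
    assume "\<exists>d. w = (\<iota> d * (\<iota> c * x), d * (c * z)) \<and> d \<noteq> 0"
    then obtain d where "w = (\<iota> d * (\<iota> c * x), d * (c * z))" "d \<noteq> 0" by blast
    then show "\<exists>d. w = (\<iota> d * x, d * z) \<and> d \<noteq> 0" using c
      by (intro exI[of _ "d * c"]) (simp add: \<iota>_simps mult.assoc)
  next
    assume "\<exists>d. w = (\<iota> d * x, d * z) \<and> d \<noteq> 0"
    then obtain d where d: "w = (\<iota> d * x, d * z)" "d \<noteq> 0" by blast
    have "\<iota> (d / c) * (\<iota> c * x) = \<iota> (d / c * c) * x" by (simp only: \<iota>_simps mult.assoc)
    then show "\<exists>d. w = (\<iota> d * (\<iota> c * x), d * (c * z)) \<and> d \<noteq> 0" using d c
      by (intro exI[of _ "d / c"]) simp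
  qed
  then show ?thesis unfolding line_def by auto
qed

lemma infinity_lines: "twisted_curve_infinity \<iota> \<epsilon> = line ` {v \<in> cone \<epsilon>. snd v = 0}"
proof -
  have iff: "(\<forall>(x, z)\<in>line v. z = 0) \<longleftrightarrow> snd v = 0" for v
  proof
    assume h: "\<forall>(x, z)\<in>line v. z = 0"
    from bspec[OF h line_self] show "snd v = 0" by (simp add: case_prod_beta)
  qed (auto simp: line_def)
  have "{P \<in> f ` A. Q P} = f ` {v \<in> A. Q (f v)}" for f :: "'b \<times> 'a \<Rightarrow> ('b \<times> 'a) set" and A Q by blast
  then show ?thesis unfolding twisted_curve_infinity_def twisted_curve_lines by (simp only: iff)
qed

lemma e_zero_iff: "(\<forall>i. e i x = 0) \<longleftrightarrow> x = 0"
  using e_eqI[of x 0] by (auto simp: e_simps)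

lemma cone_scale: "(x, z) \<in> cone \<epsilon> \<Longrightarrow> c \<noteq> 0 \<Longrightarrow> (\<iota> c * x, c * z) \<in> cone \<epsilon>"
proof -
  assume h: "(x, z) \<in> cone \<epsilon>" and c: "c \<noteq> 0"
  have s: "(\<Sum>i\<in>UNIV. e i (\<iota> c * x)) = to_ac c * (\<Sum>i\<in>UNIV. e i x)"
    by (simp add: e_simps sum_distrib_left)
  have p: "(\<Prod>i\<in>UNIV. e i (\<iota> c * x)) = to_ac c ^ 3 * (\<Prod>i\<in>UNIV. e i x)"
    by (simp add: e_simps prod.distrib)
  have "\<iota> c * x \<noteq> 0 \<or> c * z \<noteq> 0"
  proof (cases "z = 0")
    case True
    with h have "x \<noteq> 0" by (simp add: cone_def zero_prod_def)
    then obtain i where "e i x \<noteq> 0" using e_zero_iff by blast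
    then have "e i (\<iota> c * x) \<noteq> 0" using c by (simp add: e_simps)
    then show ?thesis by (metis e_simps(5))
  qed (use c in simp)
  then show ?thesis using h s p
    by (auto simp: cone_def zero_prod_def trace_eq_0_iff norm_eq_iff to_ac_mult to_ac_power power_mult_distrib)
qed

lemma card_twisted_curve:
  assumes "\<epsilon> \<noteq> 0"
  shows "card (twisted_curve \<iota> \<epsilon>) = card (twisted_curve_infinity \<iota> \<epsilon>) + norm_trace_count \<iota> \<epsilon>"
proof -
  define N where "N = {x. cubic_trace \<iota> x = 0 \<and> cubic_norm \<iota> x = \<epsilon>}"
  define F where "F = (\<lambda>x. line (x, 1::'a)) ` N"
  have Ncone: "(x, 1) \<in> cone \<epsilon> \<longleftrightarrow> x \<in> N" for x by (auto simp: N_def cone_def zero_prod_def)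
  have "twisted_curve \<iota> \<epsilon> = twisted_curve_infinity \<iota> \<epsilon> \<union> F"
  proof (intro subset_antisym subsetI)
    fix P assume "P \<in> twisted_curve \<iota> \<epsilon>"
    then obtain x z where P: "P = line (x, z)" "(x, z) \<in> cone \<epsilon>" unfolding twisted_curve_lines by auto
    show "P \<in> twisted_curve_infinity \<iota> \<epsilon> \<union> F"
    proof (cases "z = 0")
      case True
      then show ?thesis using P unfolding infinity_lines by auto
    next
      case False
      then have z: "inverse z \<noteq> 0" by simp
      from cone_scale[OF P(2) z] line_scale[OF z, of x z] False
      have "(\<iota> (inverse z) * x, 1) \<in> cone \<epsilon>" "P = line (\<iota> (inverse z) * x, 1)" by (simp_all add: P(1))
      then show ?thesis unfolding F_def Ncone by blast
    qed
  next
    fix P assume "P \<in> twisted_curve_infinity \<iota> \<epsilon> \<union> F"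
    then show "P \<in> twisted_curve \<iota> \<epsilon>" using Ncone unfolding infinity_lines F_def twisted_curve_lines by auto
  qed
  moreover have "twisted_curve_infinity \<iota> \<epsilon> \<inter> F = {}"
  proof -
    have "\<not> (\<forall>(x, z)\<in>line (y, 1::'a). z = 0)" for y using line_self[of "(y, 1)"] by (auto intro!: bexI[of _ "(y, 1)"])
    then show ?thesis unfolding twisted_curve_infinity_def F_def by auto
  qed
  moreover have "finite (twisted_curve_infinity \<iota> \<epsilon>)" "finite F"
    unfolding infinity_lines F_def using finite_B finite_Prod_UNIV[OF finite_B finite_class.finite_UNIV]
    by (auto intro: finite_imageI rev_finite_subset)
  moreover have "card F = norm_trace_count \<iota> \<epsilon>"
  proof -
    have "inj_on (\<lambda>x. line (x, 1::'a)) N"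
    proof (rule inj_onI)
      fix x y assume "line (x, 1::'a) = line (y, 1)"
      then have "(x, 1) \<in> line (y, 1::'a)" using line_self by blast
      then show "x = y" unfolding line_def by (auto simp: \<iota>_simps)
    qed
    then show ?thesis unfolding F_def norm_trace_count_eq[OF assms] by (simp add: card_image N_def)
  qed
  ultimately show ?thesis by (simp add: card_Un_disjoint)
qed

text \<open>With z = 0 the product of the coordinates is 0, one of them vanishes and the other two
  are opposite and nonzero. Frobenius preserves the unique zero, so its index is fixed by
  \<tau>.\<close>

lemma infinity_tuple:
  assumes "(x, 0) \<in> cone \<epsilon>"
  obtains i where "e i x = 0" "\<And>j. j \<noteq> i \<Longrightarrow> e j x \<noteq> 0" "e (i + 2) x = - e (i + 1) x" "\<tau> i = i"
proof -
  have x: "x \<noteq> 0" "(\<Sum>i\<in>UNIV. e i x) = 0" "(\<Prod>i\<in>UNIV. e i x) = 0"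
    using assms by (auto simp: cone_def zero_prod_def trace_eq_0_iff norm_eq_iff)
  obtain i where i: "e i x = 0" using x(3) by (auto simp: prod_zero_iff)
  have s: "e (i + 1) x + e (i + 2) x = 0" using x(2) i by (simp add: sum_3_shift[of _ i])
  then have m: "e (i + 2) x = - e (i + 1) x" by (simp add: eq_neg_iff_add_eq_0 add.commute)
  have "e (i + 1) x \<noteq> 0"
  proof
    assume "e (i + 1) x = 0"
    then have "e j x = 0" for j using i m exhaust_3_shift[of j i] by auto
    then show False using x(1) e_zero_iff by blast
  qed
  then have nz: "e j x \<noteq> 0" if "j \<noteq> i" for j using exhaust_3_shift[of j i] that m by auto
  have "e (\<tau> i) x = 0" by (simp add: e_frob i power_0_left)
  then have "\<tau> i = i" using nz by blast
  then show ?thesis using i nz m that by blast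
qed

text \<open>The triple (0, w, -w) is compatible as soon as w^q = s w, where s is 1 or -1 according
  to whether \<tau> fixes or exchanges the other two indices; a (q-1)-th root of s serves as
  w.\<close>

lemma infinity_exists:
  assumes "\<tau> i = i" obtains x where "(x, 0) \<in> cone \<epsilon>" "e i x = 0"
proof -
  have inj: "inj \<tau>" using bij_\<tau> by (rule bij_is_inj)
  have other: "\<tau> j \<noteq> i" if "j \<noteq> i" for j using that assms injD[OF inj] by metis
  obtain s :: "'a alg_closure" where s: "s = 1 \<and> \<tau> (i + 1) = i + 1 \<and> \<tau> (i + 2) = i + 2 \<or>
      s = -1 \<and> \<tau> (i + 1) = i + 2 \<and> \<tau> (i + 2) = i + 1"
  proof -
    have "\<tau> (i + 1) = i + 1 \<or> \<tau> (i + 1) = i + 2" "\<tau> (i + 2) = i + 1 \<or> \<tau> (i + 2) = i + 2"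
      using other[of "i + 1"] other[of "i + 2"] exhaust_3_shift[of _ i] shift_3_neq[of i] by metis+
    moreover have "\<tau> (i + 1) \<noteq> \<tau> (i + 2)" using injD[OF inj] shift_3_neq[of i] by metis
    ultimately show ?thesis using that by metis
  qed
  have q: "CARD('a) - 1 > 0" using card_field_gt_1[where 'a = 'a] by simp
  obtain w where w: "w ^ (CARD('a) - 1) = s" using nth_root_exists[OF q, of s] by blast
  have w0: "w \<noteq> 0" using w s q by (auto simp: power_0_left)
  have "w ^ CARD('a) = w ^ Suc (CARD('a) - 1)" using q by simp
  also have "\<dots> = s * w" unfolding power_Suc w by (rule mult.commute)
  finally have wq: "w ^ CARD('a) = s * w" .
  define a where "a = (\<lambda>j. if j = i then 0 else if j = i + 1 then w else - w)"
  have a: "a i = 0" "a (i + 1) = w" "a (i + 2) = - w" using shift_3_neq[of i] by (auto simp: a_def)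
  have "a (\<tau> j) = a j ^ CARD('a)" for j
    using exhaust_3_shift[of j i] s a assms wq by (auto simp: power_0_left frobenius_minus)
  then obtain x where x: "\<And>j. e j x = a j" by (rule ex_tuple) blast
  have "x \<noteq> 0" using x[of "i + 1"] a w0 e_simps(5) by metis
  then have "(x, 0) \<in> cone \<epsilon>"
    by (simp add: cone_def zero_prod_def trace_eq_0_iff norm_eq_iff x sum_3_shift[of _ i] prod_3_shift[of _ i] a)
  then show ?thesis using that x a by metis
qed

text \<open>Two triples with their zero at the same index are proportional over the closure, and
  comparing their coordinates at an index and at its image under \<tau> shows that the factor is
  fixed by Frobenius.\<close>

lemma infinity_unique:
  assumes x: "(x, 0) \<in> cone \<epsilon>" "e i x = 0" and y: "(y, 0) \<in> cone \<epsilon>" "e i y = 0"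
  shows "line (x, 0) = line (y, 0)"
proof -
  obtain k where k: "e k x = 0" "\<And>j. j \<noteq> k \<Longrightarrow> e j x \<noteq> 0" "e (k + 2) x = - e (k + 1) x" "\<tau> k = k"
    by (rule infinity_tuple[OF x(1)]) blast
  obtain l where l: "e l y = 0" "\<And>j. j \<noteq> l \<Longrightarrow> e j y \<noteq> 0" "e (l + 2) y = - e (l + 1) y"
    by (rule infinity_tuple[OF y(1)]) blast
  have kl: "k = i" "l = i" using k(2)[of i] l(2)[of i] x(2) y(2) by blast+
  define c where "c = e (i + 1) x / e (i + 1) y"
  have nz: "e (i + 1) x \<noteq> 0" "e (i + 1) y \<noteq> 0" using k l kl shift_3_neq[of i] by auto
  have cj: "e j x = c * e j y" for j
    using exhaust_3_shift[of j i] k(1,3) l(1,3) kl nz by (auto simp: c_def)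
  let ?j = "\<tau> (i + 1)"
  have "?j \<noteq> i" using k(4) kl bij_is_inj[OF bij_\<tau>] shift_3_neq[of i] by (metis injD)
  then have ynz: "e ?j y \<noteq> 0" using l kl by blast
  have "c * e ?j y = e (i + 1) x ^ CARD('a)" using cj[of ?j] e_frob[of "i + 1" x] by simp
  also have "\<dots> = c ^ CARD('a) * e ?j y" by (simp add: cj[of "i + 1"] e_frob power_mult_distrib)
  finally have "c ^ CARD('a) = c" using ynz by simp
  then obtain d where d: "c = to_ac d" by (rule frobenius_fixed)
  have "d \<noteq> 0" using d nz by (auto simp: c_def)
  have "x = \<iota> d * y" by (rule e_eqI) (simp add: e_simps cj d)
  then show ?thesis using line_scale[OF \<open>d \<noteq> 0\<close>, of y 0] by simp
qed

text \<open>The index of the zero coordinate is a bijection from the rational points at infinity to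
  the fixed points of \<tau>.\<close>

lemma card_infinity: "card (twisted_curve_infinity \<iota> \<epsilon>) = card {i. \<tau> i = i}"
proof -
  have "\<forall>i\<in>{i. \<tau> i = i}. \<exists>x. (x, 0) \<in> cone \<epsilon> \<and> e i x = 0" using infinity_exists by blast
  then obtain h where h: "\<forall>i\<in>{i. \<tau> i = i}. (h i, 0) \<in> cone \<epsilon> \<and> e i (h i) = 0" by (rule bchoice[THEN exE])
  have "bij_betw (\<lambda>i. line (h i, 0)) {i. \<tau> i = i} (twisted_curve_infinity \<iota> \<epsilon>)"
  proof (rule bij_betw_imageI)
    show "inj_on (\<lambda>i. line (h i, 0)) {i. \<tau> i = i}"
    proof (rule inj_onI)
      fix i j assume ij: "i \<in> {i. \<tau> i = i}" "j \<in> {i. \<tau> i = i}" "line (h i, 0) = line (h j, 0)"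
      have "(h i, 0) \<in> line (h j, 0)" using line_self[of "(h i, 0)"] ij(3) by simp
      then obtain c where "h i = \<iota> c * h j" unfolding line_def by auto
      then have "e j (h i) = 0" using h ij by (simp add: e_simps)
      obtain k where k: "\<And>j. j \<noteq> k \<Longrightarrow> e j (h i) \<noteq> 0"
        by (rule infinity_tuple[of "h i"]) (use h ij in blast)+
      have "e i (h i) = 0" using h ij by blast
      then show "i = j" using k[of i] k[of j] \<open>e j (h i) = 0\<close> by metis
    qed
    show "(\<lambda>i. line (h i, 0)) ` {i. \<tau> i = i} = twisted_curve_infinity \<iota> \<epsilon>"
    proof (intro subset_antisym subsetI)
      fix P assume "P \<in> (\<lambda>i. line (h i, 0)) ` {i. \<tau> i = i}"
      then show "P \<in> twisted_curve_infinity \<iota> \<epsilon>" using h unfolding infinity_lines by auto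
    next
      fix P assume "P \<in> twisted_curve_infinity \<iota> \<epsilon>"
      then obtain x where x: "P = line (x, 0)" "(x, 0) \<in> cone \<epsilon>" unfolding infinity_lines by auto
      obtain i where i: "e i x = 0" "\<tau> i = i" by (rule infinity_tuple[OF x(2)]) blast
      have "(h i, 0) \<in> cone \<epsilon>" "e i (h i) = 0" using h i(2) by simp_all
      from infinity_unique[OF x(2) i(1) this] have "P = line (h i, 0)" by (simp add: x(1))
      then show "P \<in> (\<lambda>i. line (h i, 0)) ` {i. \<tau> i = i}" using i by blast
    qed
  qed
  from bij_betw_same_card[OF this] show ?thesis by simp
qed

end

section \<open>Counting tuples of roots of a cubic\<close>

lemma numerals_3: "(4::3) = 1" "(5::3) = 2" by simp_all

definition perm3 :: "3 \<Rightarrow> 3 \<Rightarrow> 3 \<Rightarrow> 3 \<Rightarrow> 3" where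
  "perm3 a b c = (\<lambda>k. if k = 1 then a else if k = 2 then b else c)"

lemma perm3_simps [simp]: "perm3 a b c 1 = a" "perm3 a b c 2 = b" "perm3 a b c 3 = c"
  by (simp_all add: perm3_def)

lemma ex_3: "(\<exists>i::3. P i) \<longleftrightarrow> P 1 \<or> P 2 \<or> P 3"
  by (metis exhaust_3)

lemma fun3_eq_iff: "f = g \<longleftrightarrow> f 1 = g 1 \<and> f 2 = g 2 \<and> f (3::3) = g 3"
  by (metis exhaust_3 ext)

lemma bij_perm3:
  "{\<sigma> :: 3 \<Rightarrow> 3. bij \<sigma>} = {perm3 1 2 3, perm3 2 3 1, perm3 3 1 2, perm3 1 3 2, perm3 3 2 1, perm3 2 1 3}"
proof -
  have "bij \<sigma> \<longleftrightarrow> \<sigma> 1 \<noteq> \<sigma> 2 \<and> \<sigma> 1 \<noteq> \<sigma> 3 \<and> \<sigma> 2 \<noteq> \<sigma> 3" for \<sigma> :: "3 \<Rightarrow> 3"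
  proof
    assume "bij \<sigma>"
    then have "inj \<sigma>" by (rule bij_is_inj)
    then show "\<sigma> 1 \<noteq> \<sigma> 2 \<and> \<sigma> 1 \<noteq> \<sigma> 3 \<and> \<sigma> 2 \<noteq> \<sigma> 3" by (auto simp: inj_eq)
  next
    assume "\<sigma> 1 \<noteq> \<sigma> 2 \<and> \<sigma> 1 \<noteq> \<sigma> 3 \<and> \<sigma> 2 \<noteq> \<sigma> 3"
    then have "inj \<sigma>" by (intro injI) (metis exhaust_3)
    then show "bij \<sigma>" by (simp add: bij_def finite_UNIV_inj_surj)
  qed
  moreover have "\<sigma> 1 \<noteq> \<sigma> 2 \<and> \<sigma> 1 \<noteq> \<sigma> 3 \<and> \<sigma> 2 \<noteq> \<sigma> 3 \<longleftrightarrow>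
    \<sigma> \<in> {perm3 1 2 3, perm3 2 3 1, perm3 3 1 2, perm3 1 3 2, perm3 3 2 1, perm3 2 1 3}" for \<sigma> :: "3 \<Rightarrow> 3"
    unfolding insert_iff empty_iff fun3_eq_iff
    using exhaust_3[of "\<sigma> 1"] exhaust_3[of "\<sigma> 2"] exhaust_3[of "\<sigma> 3"] by (elim disjE) simp_all
  ultimately show ?thesis by blast
qed

lemma sign_perm3_simps [simp]:
  "sign (perm3 1 2 3) = 1" "sign (perm3 2 3 1) = 1" "sign (perm3 3 1 2) = 1"
  "sign (perm3 1 3 2) = -1" "sign (perm3 3 2 1) = -1" "sign (perm3 2 1 3) = -1"
proof -
  have "perm3 1 2 3 = id" "perm3 2 3 1 = (\<lambda>k. k + 1)" "perm3 3 1 2 = (\<lambda>k. k + 2)"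
    "perm3 1 3 2 = Transposition.transpose (1 + 1) (1 + 2)"
    "perm3 3 2 1 = Transposition.transpose (2 + 1) (2 + 2)"
    "perm3 2 1 3 = Transposition.transpose (3 + 1) (3 + 2)"
    by (simp_all add: fun3_eq_iff Transposition.transpose_def)
  then show "sign (perm3 1 2 3) = 1" "sign (perm3 2 3 1) = 1" "sign (perm3 3 1 2) = 1"
    "sign (perm3 1 3 2) = -1" "sign (perm3 3 2 1) = -1" "sign (perm3 2 1 3) = -1"
    by (simp_all only: sign_perm3 sign_id)
qed

lemma card_fix3: "card {i. (f :: 3 \<Rightarrow> 3) i = i} = of_bool (f 1 = 1) + of_bool (f 2 = 2) + of_bool (f 3 = 3)"
proof -
  have "card {i. f i = i} = (\<Sum>i\<in>UNIV. of_bool (f i = i))" by (simp add: sum_of_bool_eq)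
  then show ?thesis by (simp add: sum_3)
qed

text \<open>By character theory of \<open>S\<^sub>3\<close>: the number is the sum over the irreducible characters of the
  products of their values at \<open>\<tau>\<close> and \<open>f\<close>.\<close>

lemma card_intertwiners3:
  assumes "bij (\<tau> :: 3 \<Rightarrow> 3)" "bij (f :: 3 \<Rightarrow> 3)"
  shows "int (card {\<rho>. bij \<rho> \<and> \<rho> \<circ> \<tau> = f \<circ> \<rho>}) =
    1 + sign \<tau> * sign f + (int (card {i. \<tau> i = i}) - 1) * (int (card {i. f i = i}) - 1)"
proof -
  let ?S = "{perm3 1 2 3, perm3 2 3 1, perm3 3 1 2, perm3 1 3 2, perm3 3 2 1, perm3 2 1 3}"
  have "{\<rho>. bij \<rho> \<and> \<rho> \<circ> \<tau> = f \<circ> \<rho>} = ?S \<inter> {\<rho>. \<rho> \<circ> \<tau> = f \<circ> \<rho>}" unfolding bij_perm3[symmetric] by blast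
  then have "int (card {\<rho>. bij \<rho> \<and> \<rho> \<circ> \<tau> = f \<circ> \<rho>}) = (\<Sum>\<rho>\<in>?S. of_bool (\<rho> \<circ> \<tau> = f \<circ> \<rho>))"
    by (simp only: sum_of_bool_eq finite.intros)
  also have "\<dots> = of_bool (perm3 1 2 3 \<circ> \<tau> = f \<circ> perm3 1 2 3) + of_bool (perm3 2 3 1 \<circ> \<tau> = f \<circ> perm3 2 3 1)
     + of_bool (perm3 3 1 2 \<circ> \<tau> = f \<circ> perm3 3 1 2) + of_bool (perm3 1 3 2 \<circ> \<tau> = f \<circ> perm3 1 3 2)
     + of_bool (perm3 3 2 1 \<circ> \<tau> = f \<circ> perm3 3 2 1) + of_bool (perm3 2 1 3 \<circ> \<tau> = f \<circ> perm3 2 1 3)"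
    by (simp add: fun3_eq_iff[of "perm3 _ _ _" "perm3 _ _ _"])
  finally have c: "int (card {\<rho>. bij \<rho> \<and> \<rho> \<circ> \<tau> = f \<circ> \<rho>}) = \<dots>" .
  have "\<tau> \<in> ?S" "f \<in> ?S" using assms unfolding bij_perm3[symmetric] by auto
  then show ?thesis unfolding c card_fix3 insert_iff empty_iff
    by (elim disjE FalseE; hypsubst; simp add: fun3_eq_iff)
qed

text \<open>A root x of T^3 + u T - v leaves the quadratic factor T^2 + x T + x^2 + u; with y one of
  its roots, the third root is -x - y.\<close>

lemma ex_cubic_roots:
  fixes u v :: "'k::alg_closed_field"
  obtains a :: "3 \<Rightarrow> 'k" where "a 1 + a 2 + a 3 = 0" "a 1 * a 2 + a 2 * a 3 + a 3 * a 1 = u" "a 1 * a 2 * a 3 = v"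
proof -
  obtain x where "poly [:- v, u, 0, 1:] x = 0" using alg_closed_imp_poly_has_root[of "[:- v, u, 0, 1:]"] by auto
  then have x: "v = x * (x * x + u)" by (simp add: algebra_simps eq_neg_iff_add_eq_0)
  obtain y where "poly [:x * x + u, x, 1:] y = 0" using alg_closed_imp_poly_has_root[of "[:x * x + u, x, 1:]"] by auto
  then have "x * x + u + x * y + y * y = 0" by (simp add: algebra_simps)
  then have u: "u = - (x * x + x * y + y * y)" by (simp add: eq_neg_iff_add_eq_0 algebra_simps)
  show ?thesis
    by (rule that[of "\<lambda>k. if k = 1 then x else if k = 2 then y else - x - y"])
      (simp_all add: x u algebra_simps)
qed

lemma cubic_factor:
  fixes x y z T :: "'k::field"
  assumes "x + y + z = 0"
  shows "(T - x) * (T - y) * (T - z) = T ^ 3 + (x * y + y * z + z * x) * T - x * y * z"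
proof -
  have z: "z = - (x + y)" using minus_unique[OF assms] by simp
  show ?thesis unfolding z by (simp add: algebra_simps power3_eq_cube)
qed

lemma cubic_discriminant:
  fixes x y z :: "'k::field"
  assumes "x + y + z = 0"
  shows "((x - y) * (y - z) * (z - x)) ^ 2 = - 4 * (x * y + y * z + z * x) ^ 3 - 27 * (x * y * z) ^ 2"
proof -
  have z: "z = - (x + y)" using minus_unique[OF assms] by simp
  show ?thesis unfolding z by (simp add: algebra_simps power2_eq_square power3_eq_cube)
qed


text \<open>The square root \<delta> is rational exactly when Frobenius fixes it, that is for s = 1;
  in characteristic other than 2 it is then one of two rational roots, and for s = -1 there is
  none.\<close>

lemma card_square_roots:
  fixes D :: "'a::{field,finite}" and \<delta> :: "'a alg_closure"
  assumes two: "(2::'a) \<noteq> 0" and \<delta>: "\<delta> \<noteq> 0" "\<delta> ^ 2 = to_ac D" and s: "s = 1 \<or> s = -1" "\<delta> ^ CARD('a) = of_int s * \<delta>"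
  shows "int (card {V. V ^ 2 = D}) = 1 + s"
proof -
  have V: "V ^ 2 = D \<longleftrightarrow> to_ac V = \<delta> \<or> to_ac V = - \<delta>" for V
  proof -
    have "V ^ 2 = D \<longleftrightarrow> to_ac V ^ 2 = \<delta> ^ 2" by (simp add: \<delta> flip: to_ac_power)
    then show ?thesis by (simp add: power2_eq_iff)
  qed
  have two': "(2::'a alg_closure) \<noteq> 0" using two to_ac_eq_0_iff[of "2::'a"] by simp
  from s(1) show ?thesis
  proof
    assume s1: "s = 1"
    then have "\<delta> ^ CARD('a) = \<delta>" using s(2) by simp
    then obtain d where d: "\<delta> = to_ac d" by (rule frobenius_fixed)
    have "{V. V ^ 2 = D} = {d, - d}" unfolding V d by (auto simp flip: to_ac_minus)
    moreover have "d \<noteq> - d"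
    proof
      assume "d = - d"
      then have "2 * d = 0" by (metis add.right_inverse mult_2)
      then show False using two \<delta>(1) d by simp
    qed
    ultimately show ?thesis using s1 by simp
  next
    assume s1: "s = -1"
    have "\<not> V ^ 2 = D" for V
    proof
      assume "V ^ 2 = D"
      then have "\<delta> = to_ac V \<or> \<delta> = to_ac (- V)" unfolding V by auto
      then have "\<delta> ^ CARD('a) = \<delta>" by (elim disjE) (simp_all only: frobenius_to_ac)
      then have "\<delta> = - \<delta>" using s(2) s1 by simp
      then have "2 * \<delta> = 0" by (metis add.right_inverse mult_2)
      then show False using \<delta>(1) two' by simp
    qed
    then show ?thesis using s1 by simp
  qed
qed

locale twisted_count =
  fixes \<tau> :: "3 \<Rightarrow> 3" and \<epsilon> :: "'a::{field,finite}"
  assumes bij_\<tau>: "bij \<tau>" and eps: "\<epsilon> \<noteq> 0" and two: "(2::'a) \<noteq> 0" and three: "(3::'a) \<noteq> 0"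
begin

definition root_tuple :: "'a \<Rightarrow> (3 \<Rightarrow> 'a alg_closure) \<Rightarrow> bool" where
  "root_tuple U a \<longleftrightarrow> a 1 + a 2 + a 3 = 0 \<and> a 1 * a 2 + a 2 * a 3 + a 3 * a 1 = to_ac U \<and> a 1 * a 2 * a 3 = to_ac \<epsilon>"

definition twisted_roots :: "'a \<Rightarrow> (3 \<Rightarrow> 'a alg_closure) set" where
  "twisted_roots U = {a. root_tuple U a \<and> (\<forall>i. a (\<tau> i) = a i ^ CARD('a))}"

lemma root_iff: "root_tuple U a \<Longrightarrow> T ^ 3 + to_ac U * T = to_ac \<epsilon> \<longleftrightarrow> (\<exists>i. T = a i)"
proof -
  assume "root_tuple U a"
  then have "(T - a 1) * (T - a 2) * (T - a 3) = T ^ 3 + to_ac U * T - to_ac \<epsilon>"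
    using cubic_factor[of "a 1" "a 2" "a 3" T] by (simp add: root_tuple_def)
  then have "T ^ 3 + to_ac U * T = to_ac \<epsilon> \<longleftrightarrow> (T - a 1) * (T - a 2) * (T - a 3) = 0" by simp
  then show ?thesis unfolding ex_3 by simp
qed

lemma root_tuple_discriminant:
  assumes "root_tuple U a"
  shows "((a 1 - a 2) * (a 2 - a 3) * (a 3 - a 1)) ^ 2 = to_ac (- 4 * U ^ 3 - 27 * \<epsilon> ^ 2)"
  using cubic_discriminant[of "a 1" "a 2" "a 3"] assms by (simp add: root_tuple_def)

text \<open>The number of intertwiners of \<tau> with the Frobenius permutation f of the roots,
  where sgn f is replaced by the number of rational square roots of the discriminant minus 1, and
  the fixed points of f by the rational roots. In this form it makes sense for multiple roots
  too.\<close>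

abbreviation count_formula :: "'a \<Rightarrow> int" where
  "count_formula U \<equiv> 1 + sign \<tau> * (int (card {V. V ^ 2 = - 4 * U ^ 3 - 27 * \<epsilon> ^ 2}) - 1)
     + (int (card {i. \<tau> i = i}) - 1) * (int (card {T. T ^ 3 + U * T = \<epsilon>}) - 1)"

text \<open>All triples with the given symmetric functions are renumberings a \<circ> \<rho> of one
  of them, and compatibility with \<tau> becomes \<rho> \<circ> \<tau> = f \<circ> \<rho>.\<close>

lemma count_distinct_roots:
  assumes a: "root_tuple U a" and inj: "inj a"
  shows "finite (twisted_roots U)" "int (card (twisted_roots U)) = count_formula U"
proof -
  have perm: "root_tuple U b \<longleftrightarrow> (\<exists>\<rho>. bij \<rho> \<and> b = a \<circ> \<rho>)" for b
  proof
    assume b: "root_tuple U b"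
    have "\<forall>i. \<exists>j. b i = a j" using root_iff[OF a] root_iff[OF b] by metis
    then obtain \<rho> where \<rho>: "\<forall>i. b i = a (\<rho> i)" by (rule choice[THEN exE])
    have "\<exists>i. j = \<rho> i" for j
    proof -
      obtain i where "a j = b i" using root_iff[OF a] root_iff[OF b] by metis
      then show ?thesis using \<rho> inj by (auto simp: inj_eq)
    qed
    then have "surj \<rho>" by blast
    then have "bij \<rho>" by (simp add: bij_def finite_UNIV_surj_inj)
    then show "\<exists>\<rho>. bij \<rho> \<and> b = a \<circ> \<rho>" using \<rho> by (auto simp: fun_eq_iff)
  next
    assume "\<exists>\<rho>. bij \<rho> \<and> b = a \<circ> \<rho>"
    then obtain \<rho> where \<rho>: "bij \<rho>" and b: "b = a \<circ> \<rho>" by blast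
    from \<rho> have "\<rho> \<in> {\<rho>. bij \<rho>}" by simp
    then show "root_tuple U b" using a unfolding bij_perm3 b root_tuple_def insert_iff empty_iff
      by (elim disjE FalseE; hypsubst; simp add: ac_simps)
  qed
  have "\<exists>j. a i ^ CARD('a) = a j" for i
  proof -
    have "a i ^ 3 + to_ac U * a i = to_ac \<epsilon>" using root_iff[OF a] by blast
    then have "(a i ^ 3 + to_ac U * a i) ^ CARD('a) = to_ac \<epsilon>" by simp
    then have "(a i ^ CARD('a)) ^ 3 + to_ac U * a i ^ CARD('a) = to_ac \<epsilon>"
      by (simp add: frobenius_add power_mult_distrib power_mult[symmetric] mult.commute)
    then show ?thesis using root_iff[OF a] by blast
  qed
  then have "\<forall>i. \<exists>j. a i ^ CARD('a) = a j" by blast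
  then obtain f where f: "\<forall>i. a i ^ CARD('a) = a (f i)" by (rule choice[THEN exE])
  have "inj f"
  proof (rule injI)
    fix i j assume "f i = f j"
    then have "a i ^ CARD('a) = a j ^ CARD('a)" using f by simp
    then show "i = j" using inj by (simp add: frobenius_inj inj_eq)
  qed
  then have bf: "bij f" by (simp add: bij_def finite_UNIV_inj_surj)
  have im: "twisted_roots U = (\<lambda>\<rho>. a \<circ> \<rho>) ` {\<rho>. bij \<rho> \<and> \<rho> \<circ> \<tau> = f \<circ> \<rho>}"
  proof -
    have "(\<forall>i. (a \<circ> \<rho>) (\<tau> i) = (a \<circ> \<rho>) i ^ CARD('a)) \<longleftrightarrow> \<rho> \<circ> \<tau> = f \<circ> \<rho>" for \<rho>
      using f inj by (auto simp: fun_eq_iff inj_eq)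
    then show ?thesis unfolding twisted_roots_def perm by blast
  qed
  have injc: "inj_on (\<lambda>\<rho>. a \<circ> \<rho>) S" for S :: "(3 \<Rightarrow> 3) set"
    using inj by (auto intro!: inj_onI simp: fun_eq_iff inj_eq)
  show "finite (twisted_roots U)" unfolding im by simp
  have n: "int (card (twisted_roots U)) =
      1 + sign \<tau> * sign f + (int (card {i. \<tau> i = i}) - 1) * (int (card {i. f i = i}) - 1)"
    unfolding im card_image[OF injc] by (rule card_intertwiners3[OF bij_\<tau> bf])
  \<comment> \<open>A square root of the discriminant; Frobenius permutes the roots by f and
    multiplies \<delta> by sgn f.\<close>
  define \<delta> where "\<delta> = (a 1 - a 2) * (a 2 - a 3) * (a 3 - a 1)"
  have ne: "a 1 \<noteq> a 2" "a 2 \<noteq> a 3" "a 3 \<noteq> a 1" using inj by (simp_all add: inj_eq)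
  have "f \<in> {f. bij f}" using bf by simp
  then have "\<delta> ^ CARD('a) = of_int (sign f) * \<delta>"
    unfolding bij_perm3 insert_iff empty_iff \<delta>_def power_mult_distrib frobenius_diff f[THEN spec]
    by (elim disjE FalseE; hypsubst; simp add: algebra_simps)
  moreover have "sign f = 1 \<or> sign f = -1" by (simp add: sign_def)
  ultimately have V: "int (card {V. V ^ 2 = - 4 * U ^ 3 - 27 * \<epsilon> ^ 2}) = 1 + sign f"
    by (intro card_square_roots[OF two _ _, of \<delta>]) (use ne root_tuple_discriminant[OF a] in \<open>auto simp: \<delta>_def\<close>)
  have "to_ac ` {T. T ^ 3 + U * T = \<epsilon>} = a ` {i. f i = i}"
  proof -
    have T: "T ^ 3 + U * T = \<epsilon> \<longleftrightarrow> (\<exists>i. to_ac T = a i)" for T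
      by (simp flip: root_iff[OF a] to_ac_power to_ac_mult to_ac_add)
    show ?thesis
    proof (intro subset_antisym subsetI)
      fix t assume "t \<in> to_ac ` {T. T ^ 3 + U * T = \<epsilon>}"
      then obtain T i where Ti: "t = to_ac T" "to_ac T = a i" using T by auto
      then have "a (f i) = a i" using f by (metis frobenius_to_ac)
      then show "t \<in> a ` {i. f i = i}" using Ti inj by (auto simp: inj_eq)
    next
      fix t assume "t \<in> a ` {i. f i = i}"
      then obtain i where i: "t = a i" "f i = i" by auto
      then have "t ^ CARD('a) = t" using f by simp
      then obtain T where "t = to_ac T" by (rule frobenius_fixed)
      moreover from this have "T ^ 3 + U * T = \<epsilon>" unfolding T using i(1) by metis
      ultimately show "t \<in> to_ac ` {T. T ^ 3 + U * T = \<epsilon>}" by blast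
    qed
  qed
  then have "card (to_ac ` {T. T ^ 3 + U * T = \<epsilon>}) = card (a ` {i. f i = i})" by simp
  then have "card {T. T ^ 3 + U * T = \<epsilon>} = card {i. f i = i}"
    using inj by (simp add: card_image inj_on_def)
  then show "int (card (twisted_roots U)) = count_formula U" using n V by simp
qed

lemma root_tuple_shift:
  "root_tuple U a \<longleftrightarrow> a i + a (i + 1) + a (i + 2) = 0 \<and>
     a i * a (i + 1) + a (i + 1) * a (i + 2) + a (i + 2) * a i = to_ac U \<and> a i * a (i + 1) * a (i + 2) = to_ac \<epsilon>"
  unfolding root_tuple_def using exhaust_3[of i] by (elim disjE; hypsubst; simp add: numerals_3 ac_simps)

text \<open>As the roots sum to 0, they are y, y, -2y with y rational, and a numbering is given by
  the position m of -2y. It is compatible exactly when \<tau> fixes m.\<close>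

lemma count_multiple_root:
  assumes a: "root_tuple U a" and ninj: "\<not> inj a"
  shows "finite (twisted_roots U)" "int (card (twisted_roots U)) = count_formula U"
proof -
  obtain i where i: "a (i + 1) = a (i + 2)"
  proof -
    have "a 1 = a 2 \<or> a 2 = a 3 \<or> a 3 = a 1" using ninj unfolding inj_def by (metis exhaust_3)
    then show ?thesis using that[of 1] that[of 2] that[of 3] by (auto simp: numerals_3)
  qed
  define y where "y = a (i + 1)"
  have ai: "a i = - 2 * y" and U: "to_ac U = - 3 * y ^ 2" and \<epsilon>: "to_ac \<epsilon> = - 2 * y ^ 3"
  proof -
    have s: "a i + y + y = 0" "a i * y + y * y + y * a i = to_ac U" "a i * y * y = to_ac \<epsilon>"
      using a unfolding root_tuple_shift[of U a i] i[symmetric] y_def by auto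
    have "a i = - (y + y)" using s(1) by (simp only: eq_neg_iff_add_eq_0 add.assoc)
    then show ai: "a i = - 2 * y" by (simp only: mult_minus_left mult_2)
    show "to_ac U = - 3 * y ^ 2" "to_ac \<epsilon> = - 2 * y ^ 3"
      unfolding s(2)[symmetric] s(3)[symmetric] ai by (simp_all add: power2_eq_square power3_eq_cube)
  qed
  have y0: "y \<noteq> 0" using \<epsilon> eps by auto
  have two': "(2::'a alg_closure) \<noteq> 0" and three': "(3::'a alg_closure) \<noteq> 0"
    using two three to_ac_eq_0_iff[of "2::'a"] to_ac_eq_0_iff[of "3::'a"] by simp_all
  have y3: "3 * y \<noteq> 0" "y \<noteq> - 2 * y"
  proof -
    show "3 * y \<noteq> 0" using y0 three' by simp
    moreover have "3 * y = y - (- 2 * y)" by (simp add: algebra_simps)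
    ultimately show "y \<noteq> - 2 * y" by (metis right_minus_eq)
  qed
  have U0: "U \<noteq> 0" using U y0 three' by auto
  have "(6::'a alg_closure) = 2 * 3" by simp
  then have "(6::'a alg_closure) \<noteq> 0" using two' three' by (metis mult_eq_0_iff)
  \<comment> \<open>From U = -3 y^2 and \<epsilon> = -2 y^3 the double root is 3 \<epsilon> / (2 U),
    hence lies in the base field.\<close>
  then have "to_ac (3 * \<epsilon> / (2 * U)) = y" using y0 two' three'
    by (simp add: U \<epsilon> field_simps power2_eq_square power3_eq_cube)
  then obtain t where t: "y = to_ac t" by metis
  have yq: "y ^ CARD('a) = y" by (simp add: t)
  have roots: "T ^ 3 + to_ac U * T = to_ac \<epsilon> \<longleftrightarrow> T = y \<or> T = - 2 * y" for T
  proof -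
    have "(\<exists>j. T = a j) \<longleftrightarrow> T = a i \<or> T = a (i + 1) \<or> T = a (i + 2)" by (metis exhaust_3_shift)
    then show ?thesis unfolding root_iff[OF a] using i ai y_def by auto
  qed
  define g where "g = (\<lambda>m j :: 3. if j = m then - 2 * y else y)"
  have g: "root_tuple U b \<longleftrightarrow> (\<exists>m. b = g m)" for b
  proof
    assume b: "root_tuple U b"
    have v: "b j = y \<or> b j = - 2 * y" for j using root_iff[OF b] roots by blast
    obtain m where m: "b m = - 2 * y" using root_iff[OF b] roots by metis
    have s: "b m + b (m + 1) + b (m + 2) = 0" using b unfolding root_tuple_shift[of U b m] by simp
    have 6: "2 * (3 * y) \<noteq> 0" by (rule no_zero_divisors[OF two' y3(1)])
    have "b (m + 1) = y \<and> b (m + 2) = y"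
    proof -
      have e: "b (m + 1) + b (m + 2) = 2 * y" using s m by (simp add: algebra_simps)
      have "b (m + 1) \<noteq> - 2 * y"
      proof
        assume "b (m + 1) = - 2 * y"
        then have "b (m + 2) = 4 * y" using e by (simp add: algebra_simps)
        then have "4 * y = y \<or> 4 * y = - 2 * y" using v[of "m + 2"] by simp
        moreover have "3 * y = 4 * y - y" "2 * (3 * y) = 4 * y - (- 2 * y)" by (simp_all add: algebra_simps)
        ultimately show False using y3(1) 6 by (metis right_minus_eq)
      qed
      then have "b (m + 1) = y" using v by blast
      moreover from this have "y + b (m + 2) = y + y" using e by (simp only: mult_2)
      ultimately show ?thesis by simp
    qed
    then have "b j = g m j" for j using exhaust_3_shift[of j m] m shift_3_neq[of m] by (auto simp: g_def)
    then show "\<exists>m. b = g m" by blast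
  next
    assume "\<exists>m. b = g m"
    then obtain m where m: "b = g m" by blast
    have "b m = - 2 * y" "b (m + 1) = y" "b (m + 2) = y" using shift_3_neq[of m] by (simp_all add: m g_def)
    then show "root_tuple U b" unfolding root_tuple_shift[of U b m]
      by (simp add: U \<epsilon> power2_eq_square power3_eq_cube)
  qed
  have ginj: "inj g" using y3(2) by (auto simp: inj_def g_def fun_eq_iff split: if_splits)
  have im: "twisted_roots U = g ` {m. \<tau> m = m}"
  proof -
    have "(\<forall>j. g m (\<tau> j) = g m j ^ CARD('a)) \<longleftrightarrow> \<tau> m = m" for m
    proof -
      have "g m j ^ CARD('a) = g m j" for j
        by (simp add: g_def t flip: to_ac_minus to_ac_numeral to_ac_mult)
      moreover have "(\<forall>j. g m (\<tau> j) = g m j) \<longleftrightarrow> \<tau> m = m"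
      proof
        assume "\<forall>j. g m (\<tau> j) = g m j"
        then have "g m (\<tau> m) = - 2 * y" by (simp add: g_def)
        then show "\<tau> m = m" using y3(2) by (auto simp: g_def split: if_splits)
      next
        assume "\<tau> m = m"
        then have "\<tau> j = m \<longleftrightarrow> j = m" for j using bij_is_inj[OF bij_\<tau>] by (metis injD)
        then show "\<forall>j. g m (\<tau> j) = g m j" by (simp add: g_def)
      qed
      ultimately show ?thesis by simp
    qed
    then show ?thesis unfolding twisted_roots_def g by blast
  qed
  show "finite (twisted_roots U)" unfolding im by simp
  have n: "card (twisted_roots U) = card {m. \<tau> m = m}"
    unfolding im by (rule card_image) (use ginj in \<open>rule inj_on_subset, simp\<close>)
  have "to_ac (- 4 * U ^ 3 - 27 * \<epsilon> ^ 2) = 0"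
    unfolding root_tuple_discriminant[OF a, symmetric] using i exhaust_3[of i] by (auto simp: numerals_3)
  then have "- 4 * U ^ 3 - 27 * \<epsilon> ^ 2 = 0" by (simp only: to_ac_eq_0_iff)
  then have V: "{V. V ^ 2 = - 4 * U ^ 3 - 27 * \<epsilon> ^ 2} = {0}" by simp
  have "{T. T ^ 3 + U * T = \<epsilon>} = {t, - 2 * t}"
  proof -
    have "T ^ 3 + U * T = \<epsilon> \<longleftrightarrow> to_ac T = to_ac t \<or> to_ac T = to_ac (- 2 * t)" for T
    proof -
      have "T ^ 3 + U * T = \<epsilon> \<longleftrightarrow> to_ac T ^ 3 + to_ac U * to_ac T = to_ac \<epsilon>"
        by (simp flip: to_ac_power to_ac_mult to_ac_add)
      then show ?thesis unfolding roots t by simp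
    qed
    then show ?thesis unfolding to_ac_eq_iff by blast
  qed
  moreover have "t \<noteq> - 2 * t"
  proof
    assume "t = - 2 * t"
    then have "to_ac t = - 2 * to_ac t" by (metis to_ac_minus to_ac_mult to_ac_numeral)
    then show False using y3(2) t by simp
  qed
  ultimately have "card {T. T ^ 3 + U * T = \<epsilon>} = 2" by simp
  \<comment> \<open>The zero discriminant has one square root, which removes the sign term; the two
    rational roots leave 1 + (number of fixed points - 1).\<close>
  then show "int (card (twisted_roots U)) = count_formula U" unfolding n V by simp
qed

lemma count_twisted_roots: "finite (twisted_roots U)" "int (card (twisted_roots U)) = count_formula U"
proof -
  obtain a :: "3 \<Rightarrow> 'a alg_closure" where "a 1 + a 2 + a 3 = 0"
    "a 1 * a 2 + a 2 * a 3 + a 3 * a 1 = to_ac U" "a 1 * a 2 * a 3 = to_ac \<epsilon>" by (rule ex_cubic_roots)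
  then have a: "root_tuple U a" by (simp add: root_tuple_def)
  show "finite (twisted_roots U)" "int (card (twisted_roots U)) = count_formula U"
    using count_distinct_roots[OF a] count_multiple_root[OF a] by blast+
qed

end

section \<open>Point counts\<close>

text \<open>At infinity the first coordinate vanishes because 4 is invertible, so there is one
  point; the other points are the affine solutions.\<close>

lemma card_ell_curve:
  fixes \<epsilon> :: "'a::{field,finite}"
  assumes two: "(2::'a) \<noteq> 0"
  shows "card (ell_curve \<epsilon>) = 1 + (\<Sum>U\<in>UNIV. card {V. V ^ 2 = - 4 * U ^ 3 - 27 * \<epsilon> ^ 2})"
proof -
  define E where "E = {v :: 'a^3. (v $ 2) ^ 2 * v $ 3 = - 4 * (v $ 1) ^ 3 - 27 * \<epsilon> ^ 2 * (v $ 3) ^ 3}"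
  define l where "l = (\<lambda>v :: 'a^3. {c *s v | c. c \<noteq> 0})"
  define pt where "pt = (\<lambda>(U, V). vector [U, V, 1] :: 'a^3)"
  define A where "A = (SIGMA U : UNIV. {V. V ^ 2 = - 4 * U ^ 3 - 27 * \<epsilon> ^ 2})"
  have lself: "v \<in> l v" for v unfolding l_def by (rule CollectI, rule exI[of _ 1]) simp
  have lscale: "l (c *s v) = l v" if c: "c \<noteq> 0" for c v
  proof -
    have "(\<exists>d. w = d *s (c *s v) \<and> d \<noteq> 0) \<longleftrightarrow> (\<exists>d. w = d *s v \<and> d \<noteq> 0)" for w
    proof
      assume "\<exists>d. w = d *s (c *s v) \<and> d \<noteq> 0"
      then obtain d where "w = d *s (c *s v)" "d \<noteq> 0" by blast
      then show "\<exists>d. w = d *s v \<and> d \<noteq> 0" using c by (intro exI[of _ "d * c"]) simp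
    next
      assume "\<exists>d. w = d *s v \<and> d \<noteq> 0"
      then obtain d where "w = d *s v" "d \<noteq> 0" by blast
      then show "\<exists>d. w = d *s (c *s v) \<and> d \<noteq> 0" using c by (intro exI[of _ "d / c"]) simp
    qed
    then show ?thesis unfolding l_def by auto
  qed
  have four: "(4::'a) \<noteq> 0"
  proof -
    have "(4::'a) = 2 * 2" by simp
    then show ?thesis using two by (metis mult_eq_0_iff)
  qed
  define O' where "O' = (vector [0, 1, 0] :: 'a^3)"
  have ell: "ell_curve \<epsilon> = l ` (E - {0})" by (simp add: ell_curve_def proj_points_def E_def l_def)
  have "l ` (E - {0}) = insert (l O') ((\<lambda>p. l (pt p)) ` A)"
  proof (intro subset_antisym subsetI)
    fix P assume "P \<in> l ` (E - {0})"
    then obtain v where v: "P = l v" "v \<in> E" "v \<noteq> 0" by blast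
    show "P \<in> insert (l O') ((\<lambda>p. l (pt p)) ` A)"
    proof (cases "v $ 3 = 0")
      case True
      then have "v $ 1 = 0" using v(2) four by (simp add: E_def)
      then have "v = v $ 2 *s O'" using True by (simp add: vec_eq_iff forall_3 O'_def)
      moreover from this have "v $ 2 \<noteq> 0" using v(3) by auto
      ultimately show ?thesis using lscale v(1) by (metis insertI1)
    next
      case False
      define U V where "U = v $ 1 / v $ 3" and "V = v $ 2 / v $ 3"
      have v': "v $ 1 = U * v $ 3" "v $ 2 = V * v $ 3" using False by (simp_all add: U_def V_def)
      have "v = v $ 3 *s pt (U, V)" using v' by (simp add: vec_eq_iff forall_3 pt_def)
      then have P: "P = l (pt (U, V))" using lscale[OF False] v(1) by metis
      have "(V * v $ 3) ^ 2 * v $ 3 = - 4 * (U * v $ 3) ^ 3 - 27 * \<epsilon> ^ 2 * (v $ 3) ^ 3"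
        using v(2) v' by (simp add: E_def)
      then have "(v $ 3) ^ 3 * V ^ 2 = (v $ 3) ^ 3 * (- 4 * U ^ 3 - 27 * \<epsilon> ^ 2)"
        by (simp add: algebra_simps power2_eq_square power3_eq_cube)
      then have "V ^ 2 = - 4 * U ^ 3 - 27 * \<epsilon> ^ 2" using False by (simp only: mult_cancel_left power_eq_0_iff) simp
      then show ?thesis using P by (intro insertI2 image_eqI[of _ _ "(U, V)"]) (auto simp: A_def)
    qed
  next
    fix P assume "P \<in> insert (l O') ((\<lambda>p. l (pt p)) ` A)"
    then show "P \<in> l ` (E - {0})"
    proof
      assume "P = l O'"
      moreover have "O' \<in> E - {0}" by (simp add: E_def O'_def vec_eq_iff forall_3)
      ultimately show ?thesis by blast
    next
      assume "P \<in> (\<lambda>p. l (pt p)) ` A"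
      then obtain U V where UV: "P = l (pt (U, V))" "V ^ 2 = - 4 * U ^ 3 - 27 * \<epsilon> ^ 2" by (auto simp: A_def)
      have "pt (U, V) \<in> E - {0}" using UV(2) by (simp add: E_def pt_def vec_eq_iff forall_3)
      then show ?thesis using UV(1) by blast
    qed
  qed
  moreover have "l O' \<notin> (\<lambda>p. l (pt p)) ` A"
  proof
    assume "l O' \<in> (\<lambda>p. l (pt p)) ` A"
    then obtain p where "l O' = l (pt p)" by blast
    then have "pt p \<in> l O'" using lself by blast
    then obtain c where "pt p = c *s O'" unfolding l_def by blast
    then have "pt p $ 3 = (c *s O') $ 3" by simp
    then show False by (simp add: pt_def O'_def case_prod_beta)
  qed
  moreover have "card ((\<lambda>p. l (pt p)) ` A) = card A"
  proof (rule card_image, rule inj_onI)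
    fix p p' assume "l (pt p) = l (pt p')"
    then have "pt p \<in> l (pt p')" using lself by blast
    then obtain c where c: "pt p = c *s pt p'" unfolding l_def by blast
    from arg_cong[OF this, of "\<lambda>v. v $ 3"] have "c = 1" by (simp add: pt_def case_prod_beta)
    with c have "pt p = pt p'" by simp
    then show "p = p'" by (simp add: pt_def case_prod_beta vec_eq_iff forall_3 prod_eq_iff)
  qed
  moreover have "card A = (\<Sum>U\<in>UNIV. card {V. V ^ 2 = - 4 * U ^ 3 - 27 * \<epsilon> ^ 2})"
    unfolding A_def by (rule card_SigmaI) auto
  moreover have "finite A" unfolding A_def by (intro finite_SigmaI) auto
  ultimately show ?thesis by (simp add: ell)
qed

text \<open>For each nonzero T exactly one U satisfies the equation, and T = 0 is excluded by
  \<epsilon> \<noteq> 0.\<close>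

lemma sum_card_cubic_roots:
  fixes \<epsilon> :: "'a::{field,finite}"
  assumes "\<epsilon> \<noteq> 0"
  shows "(\<Sum>U\<in>UNIV. card {T. T ^ 3 + U * T = \<epsilon>}) = CARD('a) - 1"
proof -
  have "(\<Sum>U\<in>UNIV. card {T. T ^ 3 + U * T = \<epsilon>}) = card (SIGMA U : UNIV. {T. T ^ 3 + U * T = \<epsilon>})"
    by (rule card_SigmaI[symmetric]) auto
  also have "(SIGMA U : UNIV. {T. T ^ 3 + U * T = \<epsilon>}) = (\<lambda>T. ((\<epsilon> - T ^ 3) / T, T)) ` (UNIV - {0})"
  proof (intro subset_antisym subsetI)
    fix p assume "p \<in> (SIGMA U : UNIV. {T. T ^ 3 + U * T = \<epsilon>})"
    then obtain U T where p: "p = (U, T)" "T ^ 3 + U * T = \<epsilon>" by auto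
    then have T: "T \<noteq> 0" using assms by auto
    have "\<epsilon> - T ^ 3 = U * T" using p(2) by auto
    then have "U = (\<epsilon> - T ^ 3) / T" using T by simp
    then show "p \<in> (\<lambda>T. ((\<epsilon> - T ^ 3) / T, T)) ` (UNIV - {0})" using p(1) T by blast
  qed auto
  also have "card \<dots> = card (UNIV - {0 :: 'a})" by (rule card_image) (auto intro: inj_onI)
  finally show ?thesis by (simp add: card_Diff_singleton)
qed

lemma (in twisted_count) card_twisted:
  "int (card {a :: 3 \<Rightarrow> 'a alg_closure. (\<forall>i. a (\<tau> i) = a i ^ CARD('a)) \<and> (\<Sum>i\<in>UNIV. a i) = 0 \<and> (\<Prod>i\<in>UNIV. a i) = to_ac \<epsilon>})
    = int CARD('a) + 1 + sign \<tau> * ell_A \<epsilon> - int (card {i. \<tau> i = i})" (is "int (card ?S) = _")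
proof -
  have "?S = (\<Union>U. twisted_roots U)"
  proof (intro subset_antisym subsetI)
    fix a assume "a \<in> ?S"
    then have a: "\<forall>i. a (\<tau> i) = a i ^ CARD('a)" "a 1 + a 2 + a 3 = 0" "a 1 * a 2 * a 3 = to_ac \<epsilon>"
      by (simp_all add: sum_3 prod_3_shift[of _ 1] numerals_3)
    define w where "w = a 1 * a 2 + a 2 * a 3 + a 3 * a 1"
    have "w ^ CARD('a) = a (\<tau> 1) * a (\<tau> 2) + a (\<tau> 2) * a (\<tau> 3) + a (\<tau> 3) * a (\<tau> 1)"
      by (simp add: w_def frobenius_add power_mult_distrib a(1))
    also have "\<dots> = w"
    proof -
      have "\<tau> \<in> {\<tau>. bij \<tau>}" using bij_\<tau> by simp
      then show ?thesis unfolding bij_perm3 w_def insert_iff empty_iff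
        by (elim disjE FalseE; hypsubst; simp add: ac_simps)
    qed
    finally obtain U where "w = to_ac U" by (rule frobenius_fixed)
    then have "a \<in> twisted_roots U" using a by (simp add: twisted_roots_def root_tuple_def w_def)
    then show "a \<in> (\<Union>U. twisted_roots U)" by blast
  next
    fix a assume "a \<in> (\<Union>U. twisted_roots U)"
    then show "a \<in> ?S" by (auto simp: twisted_roots_def root_tuple_def sum_3 prod_3_shift[of _ 1] numerals_3)
  qed
  moreover have "card (\<Union>U. twisted_roots U) = (\<Sum>U\<in>UNIV. card (twisted_roots U))"
    by (rule card_UN_disjoint) (use count_twisted_roots(1) in \<open>auto simp: twisted_roots_def root_tuple_def\<close>)
  ultimately have "int (card ?S) = (\<Sum>U\<in>UNIV. count_formula U)" by (simp add: count_twisted_roots(2))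
  \<comment> \<open>Over all U the excess of square roots over 1 sums to \<open>ell_A\<close>, and
    that of rational cubic roots to -1, which produces the negative number of fixed points.\<close>
  also have "\<dots> = int CARD('a) + sign \<tau> * (int (\<Sum>U\<in>UNIV. card {V. V ^ 2 = - 4 * U ^ 3 - 27 * \<epsilon> ^ 2}) - int CARD('a))
      + (int (card {i. \<tau> i = i}) - 1) * (int (\<Sum>U\<in>UNIV. card {T. T ^ 3 + U * T = \<epsilon>}) - int CARD('a))"
    by (simp add: sum.distrib sum_distrib_left[symmetric] sum_subtractf)
  also have "int (\<Sum>U\<in>UNIV. card {T. T ^ 3 + U * T = \<epsilon>}) = int CARD('a) - 1"
    unfolding sum_card_cubic_roots[OF eps] by (simp add: of_nat_diff Suc_leI)
  also have "int (\<Sum>U\<in>UNIV. card {V. V ^ 2 = - 4 * U ^ 3 - 27 * \<epsilon> ^ 2}) = ell_A \<epsilon> + int CARD('a)"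
    by (simp add: ell_A_def card_ell_curve[OF two])
  finally show ?thesis by (simp add: algebra_simps)
qed

text \<open>All elements would be roots of X^q - X.\<close>

lemma card_le_if_frobenius_trivial:
  assumes "\<And>y :: 'c::field. y ^ q = y" "q > 1"
  shows "card (UNIV :: 'c set) \<le> q"
proof -
  define p where "p = monom 1 q - [:0, 1 :: 'c:]"
  have "coeff p q = 1" using assms(2) by (cases q) (auto simp: p_def coeff_pCons split: nat.splits)
  then have "p \<noteq> 0" by auto
  have "{y. poly p y = 0} = UNIV" using assms(1) by (auto simp: p_def poly_monom)
  then have "card (UNIV :: 'c set) \<le> degree p" using card_poly_roots_bound[OF \<open>p \<noteq> 0\<close>] by simp
  also have "degree p \<le> q" unfolding p_def by (rule degree_diff_le) (use assms(2) in \<open>auto simp: degree_monom_eq\<close>)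
  finally show ?thesis .
qed

section \<open>Frobenius permutation in the three splitting types\<close>

context numbered_cubic_alg
begin

lemma fixed_iff: "\<tau> i = i \<longleftrightarrow> (\<forall>x. e i x ^ CARD('a) = e i x)"
proof -
  have "e (\<tau> i) = e i \<longleftrightarrow> \<tau> i = i" using bij_e by (auto simp: bij_betw_def inj_eq)
  then show ?thesis by (simp add: fun_eq_iff e_frob)
qed

lemma e_power: "e i (x ^ n) = e i x ^ n"
  using e_Emb[of i] by (intro ring_hom_power) (auto simp: geom_embeddings_def alg_hom_def)

lemma perm_split:
  assumes "alg_iso3 \<iota> id id id" shows "card {i. \<tau> i = i} = 3" "sign \<tau> = 1"
proof -
  obtain f g h where fgh: "alg_hom \<iota> id f" "alg_hom \<iota> id g" "alg_hom \<iota> id h" "bij (\<lambda>x. (f x, g x, h x))"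
    using assms unfolding alg_iso3_def by blast
  have "x ^ CARD('a) = x" for x :: 'b
  proof -
    have "(f (x ^ CARD('a)), g (x ^ CARD('a)), h (x ^ CARD('a))) = (f x, g x, h x)"
      using fgh(1-3) by (simp add: alg_hom_def ring_hom_power power_card_field)
    then show ?thesis using bij_is_inj[OF fgh(4)] by (auto dest: injD)
  qed
  then have "\<tau> i = i" for i unfolding fixed_iff e_power[symmetric] by simp
  then have "\<tau> = id" by auto
  then show "card {i. \<tau> i = i} = 3" "sign \<tau> = 1" by (simp_all add: sign_id)
qed

text \<open>The projection to the base field is an embedding fixed by Frobenius, and \<tau> = id
  would force x^q = x on the field of q^2 elements. A nontrivial permutation of three indices with a
  fixed point is a transposition.\<close>

lemma perm_quadratic:
  fixes \<kappa> :: "'a \<Rightarrow> 'c::field"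
  assumes "CARD('c) = CARD('a) ^ 2" "alg_iso2 \<iota> id \<kappa>"
  shows "card {i. \<tau> i = i} = 1" "sign \<tau> = - 1"
proof -
  obtain f g where fg: "alg_hom \<iota> id f" "alg_hom \<iota> \<kappa> g" "bij (\<lambda>x. (f x, g x))"
    using assms unfolding alg_iso2_def by blast
  have q: "CARD('a) > 1" by (rule card_field_gt_1)
  have "(\<lambda>x. to_ac (f x)) \<in> Emb" using fg(1)
    by (simp add: geom_embeddings_def alg_hom_def is_ring_hom_def)
  then obtain i where i: "(\<lambda>x. to_ac (f x)) = e i" using Emb_e by blast
  have hasfix: "\<exists>i. \<tau> i = i" unfolding fixed_iff by (rule exI[of _ i]) (simp flip: i)
  have nid: "\<tau> \<noteq> id"
  proof
    assume "\<tau> = id"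
    then have "e i x ^ CARD('a) = e i x" for i x using fixed_iff by simp
    then have x: "x ^ CARD('a) = x" for x :: 'b by (intro e_eqI) (simp add: e_power)
    have "y ^ CARD('a) = y" for y :: 'c
    proof -
      obtain x where "(0, y) = (f x, g x)" by (rule surjE[OF bij_is_surj[OF fg(3)]])
      then have y: "y = g x" by simp
      have "g (x ^ CARD('a)) = g x ^ CARD('a)" using fg(2) by (intro ring_hom_power) (simp add: alg_hom_def)
      then show ?thesis unfolding y x by simp
    qed
    from card_le_if_frobenius_trivial[OF this q] show False using assms(1) q by (simp add: power2_eq_square)
  qed
  have "\<tau> \<in> {\<tau>. bij \<tau>}" using bij_\<tau> by simp
  then have "card {i. \<tau> i = i} = 1 \<and> sign \<tau> = - 1" using hasfix nid
    unfolding bij_perm3 insert_iff empty_iff ex_3 card_fix3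
    by (elim disjE FalseE; hypsubst; simp add: fun3_eq_iff)
  then show "card {i. \<tau> i = i} = 1" "sign \<tau> = - 1" by auto
qed

text \<open>An embedding fixed by Frobenius is injective, as B is a field, and would force x^q = x
  on q^3 elements. Without fixed points \<tau> is a 3-cycle.\<close>

lemma perm_cubic:
  fixes \<kappa> :: "'a \<Rightarrow> 'd::field"
  assumes "CARD('d) = CARD('a) ^ 3" "alg_iso1 \<iota> \<kappa>"
  shows "card {i. \<tau> i = i} = 0" "sign \<tau> = 1"
proof -
  obtain f where f: "alg_hom \<iota> \<kappa> f" "bij f" using assms unfolding alg_iso1_def by blast
  have hf: "is_ring_hom f" using f(1) by (simp add: alg_hom_def)
  have q: "CARD('a) > 1" by (rule card_field_gt_1)
  have nofix: "\<nexists>i. \<tau> i = i"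
  proof
    assume "\<exists>i. \<tau> i = i"
    then obtain i where i: "\<And>x. e i x ^ CARD('a) = e i x" using fixed_iff by blast
    have inj: "x = 0" if "e i x = 0" for x
    proof (rule ccontr)
      assume "x \<noteq> 0"
      then have "f x \<noteq> 0" using ring_hom_0[OF hf] bij_is_inj[OF f(2)] by (metis injD)
      obtain z where z: "inverse (f x) = f z" by (rule surjE[OF bij_is_surj[OF f(2)]])
      have "f (x * z) = f x * f z" "f 1 = 1" using hf by (simp_all add: is_ring_hom_def)
      then have "f (x * z) = f 1" using \<open>f x \<noteq> 0\<close> by (simp flip: z)
      then have "x * z = 1" using bij_is_inj[OF f(2)] by (metis injD)
      then have "e i x * e i z = 1" by (metis e_simps(1,3))
      then show False using that by simp
    qed
    have "y ^ CARD('a) = y" for y :: 'd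
    proof -
      obtain x where x: "y = f x" by (rule surjE[OF bij_is_surj[OF f(2)]])
      have "e i (x ^ CARD('a) - x) = 0" by (simp add: e_simps e_power i)
      then have "x ^ CARD('a) = x" using inj by fastforce
      then show ?thesis using x ring_hom_power[OF hf, of x "CARD('a)"] by simp
    qed
    from card_le_if_frobenius_trivial[OF this q] have "CARD('a) ^ 3 \<le> CARD('a) ^ 1" using assms(1) by simp
    then show False using q by (simp only: power_increasing_iff)
  qed
  have "\<tau> \<in> {\<tau>. bij \<tau>}" using bij_\<tau> by simp
  then have "card {i. \<tau> i = i} = 0 \<and> sign \<tau> = 1" using nofix
    unfolding bij_perm3 insert_iff empty_iff ex_3 card_fix3
    by (elim disjE FalseE; hypsubst; simp)
  then show "card {i. \<tau> i = i} = 0" "sign \<tau> = 1" by auto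
qed

end

text \<open>For 2: translation by 1 preserves the sum of all elements, so the odd number q is 0 in
  the field, which is incompatible with 2 = 0. For 3: the characteristic would divide 3.\<close>

lemma char_conditions:
  assumes "odd CARD('a::{field,finite})" "CHAR('a) \<noteq> 3"
  shows "(2::'a) \<noteq> 0" "(3::'a) \<noteq> 0"
proof -
  show "(2::'a) \<noteq> 0"
  proof
    assume z: "(2::'a) = 0"
    have "(\<Sum>x\<in>UNIV. x + 1) = (\<Sum>x\<in>UNIV. x :: 'a)"
      by (rule sum.reindex_bij_witness[of _ "\<lambda>x. x - 1" "\<lambda>x. x + 1"]) auto
    then have "of_nat CARD('a) = (0::'a)" by (simp add: sum.distrib)
    moreover obtain m where "CARD('a) = 2 * m + 1" using assms(1) by (elim oddE)
    ultimately have "2 * of_nat m + 1 = (0::'a)" by (metis of_nat_add of_nat_mult of_nat_1 of_nat_numeral)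
    then show False by (simp add: z)
  qed
  show "(3::'a) \<noteq> 0"
  proof
    assume "(3::'a) = 0"
    then have "of_nat 3 = (0::'a)" by simp
    then have "CHAR('a) dvd 3" by (simp only: of_nat_eq_0_iff_char_dvd)
    moreover have "Factorial_Ring.prime (3::nat)" by simp
    ultimately have "CHAR('a) = 1" using assms(2) by (auto simp: prime_nat_iff)
    then show False by simp
  qed
qed

theorem theorem2p3:
  fixes \<epsilon> :: "'a::{field,finite}"
    and r :: nat
    and \<iota> :: "'a \<Rightarrow> 'b::comm_ring_1"
    and \<kappa>2 :: "'a \<Rightarrow> 'c::field"
    and \<kappa>3 :: "'a \<Rightarrow> 'd::field"
  assumes "odd CARD('a)"
    and "CHAR('a) \<noteq> 3"
    and "\<epsilon> \<noteq> 0"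
    and "Factorial_Ring.prime r"
    and "r \<noteq> CHAR('a)"
    and "cubic_etale \<iota>"
  shows
    "(\<forall>\<sigma> :: 3 \<Rightarrow> 3. bij \<sigma> \<longrightarrow>
        (\<forall>\<xi> \<in> H1_rational (proj_curve (to_ac \<epsilon>)) r.
           H1_rational_pullback (proj_curve (to_ac \<epsilon>)) r (perm_point \<sigma>) \<xi> =
           H1_rational_smult (proj_curve (to_ac \<epsilon>)) r (sign \<sigma>) \<xi>)) \<and>
     (\<exists>\<tau>. frobenius_perm \<iota> \<tau>) \<and>
     (\<forall>\<tau>. frobenius_perm \<iota> \<tau> \<longrightarrow>
        int (card (twisted_curve \<iota> \<epsilon>)) = int CARD('a) + 1 + sign \<tau> * ell_A \<epsilon> \<and>
        card (twisted_curve_infinity \<iota> \<epsilon>) = card {i. \<tau> i = i} \<and>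
        int (norm_trace_count \<iota> \<epsilon>) =
          int CARD('a) + 1 + sign \<tau> * ell_A \<epsilon> - int (card {i. \<tau> i = i})) \<and>
     (alg_iso3 \<iota> id id id \<longrightarrow>
        int (norm_trace_count \<iota> \<epsilon>) = int (card (ell_curve \<epsilon>)) - 3) \<and>
     (is_ring_hom \<kappa>2 \<and> CARD('c) = CARD('a) ^ 2 \<and> alg_iso2 \<iota> id \<kappa>2 \<longrightarrow>
        int (norm_trace_count \<iota> \<epsilon>) = 2 * int CARD('a) + 1 - int (card (ell_curve \<epsilon>))) \<and>
     (is_ring_hom \<kappa>3 \<and> CARD('d) = CARD('a) ^ 3 \<and> alg_iso1 \<iota> \<kappa>3 \<longrightarrow>
        norm_trace_count \<iota> \<epsilon> = card (ell_curve \<epsilon>))"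
proof -
  have char: "(2::'a) \<noteq> 0" "(3::'a) \<noteq> 0" using char_conditions[OF assms(1,2)] .
  have char': "(2::'a alg_closure) \<noteq> 0" "(3::'a alg_closure) \<noteq> 0"
    using char to_ac_eq_0_iff[of "2::'a"] to_ac_eq_0_iff[of "3::'a"] by simp_all
  have r: "of_nat r \<noteq> (0::'a alg_closure)"
  proof
    assume "of_nat r = (0::'a alg_closure)"
    then have "CHAR('a alg_closure) dvd r" by (simp only: of_nat_eq_0_iff_char_dvd)
    then have "CHAR('a) = 1" using assms(4,5) by (auto simp: prime_nat_iff)
    then show False by simp
  qed
  interpret cubic_curve "to_ac \<epsilon>" by unfold_locales (use assms(3) char' in auto)
  interpret cubic_alg \<iota> by unfold_locales (rule assms(6))
  have counts: "int (card (twisted_curve \<iota> \<epsilon>)) = int CARD('a) + 1 + sign \<tau> * ell_A \<epsilon> \<and>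
        card (twisted_curve_infinity \<iota> \<epsilon>) = card {i. \<tau> i = i} \<and>
        int (norm_trace_count \<iota> \<epsilon>) =
          int CARD('a) + 1 + sign \<tau> * ell_A \<epsilon> - int (card {i. \<tau> i = i})"
    if fp: "frobenius_perm \<iota> \<tau>" for \<tau>
  proof -
    obtain e where "bij_betw e UNIV Emb" "\<forall>i x. e (\<tau> i) x = e i x ^ CARD('a)" and bij: "bij \<tau>"
      using fp unfolding frobenius_perm_def by blast
    then interpret numbered_cubic_alg \<iota> e \<tau> by unfold_locales auto
    interpret twisted_count \<tau> \<epsilon> by unfold_locales (use bij assms(3) char in auto)
    have n: "int (norm_trace_count \<iota> \<epsilon>) = int CARD('a) + 1 + sign \<tau> * ell_A \<epsilon> - int (card {i. \<tau> i = i})"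
      unfolding norm_trace_count_tuples[OF assms(3)] twisted_tuples_def by (rule card_twisted)
    then show ?thesis by (simp add: card_twisted_curve[OF assms(3)] card_infinity)
  qed
  obtain \<tau> where \<tau>: "frobenius_perm \<iota> \<tau>" using ex_frobenius_perm by blast
  obtain e where e: "bij_betw e UNIV Emb" "\<forall>i x. e (\<tau> i) x = e i x ^ CARD('a)" "bij \<tau>"
    using \<tau> unfolding frobenius_perm_def by blast
  then interpret numbered_cubic_alg \<iota> e \<tau> by unfold_locales auto
  have n: "int (norm_trace_count \<iota> \<epsilon>) = int CARD('a) + 1 + sign \<tau> * ell_A \<epsilon> - int (card {i. \<tau> i = i})"
    using counts[OF \<tau>] by blast
  have iso3: "int (norm_trace_count \<iota> \<epsilon>) = int (card (ell_curve \<epsilon>)) - 3" if "alg_iso3 \<iota> id id id"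
    unfolding n perm_split[OF that] by (simp add: ell_A_def)
  have iso2: "int (norm_trace_count \<iota> \<epsilon>) = 2 * int CARD('a) + 1 - int (card (ell_curve \<epsilon>))"
    if "CARD('c) = CARD('a) ^ 2" "alg_iso2 \<iota> id \<kappa>2"
    unfolding n perm_quadratic[OF that] by (simp add: ell_A_def)
  have iso1: "norm_trace_count \<iota> \<epsilon> = card (ell_curve \<epsilon>)"
    if "CARD('d) = CARD('a) ^ 3" "alg_iso1 \<iota> \<kappa>3"
  proof -
    have "int (norm_trace_count \<iota> \<epsilon>) = int (card (ell_curve \<epsilon>))"
      unfolding n perm_cubic[OF that] by (simp add: ell_A_def)
    then show ?thesis by simp
  qed
  show ?thesis
  proof (intro conjI)
    show "\<forall>\<sigma> :: 3 \<Rightarrow> 3. bij \<sigma> \<longrightarrow>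
        (\<forall>\<xi> \<in> H1_rational (proj_curve (to_ac \<epsilon>)) r.
           H1_rational_pullback (proj_curve (to_ac \<epsilon>)) r (perm_point \<sigma>) \<xi> =
           H1_rational_smult (proj_curve (to_ac \<epsilon>)) r (sign \<sigma>) \<xi>)"
      by (intro allI impI ballI) (rule sign_action[OF assms(4) r])
    show "\<exists>\<tau>. frobenius_perm \<iota> \<tau>" by (rule ex_frobenius_perm)
    show "\<forall>\<tau>. frobenius_perm \<iota> \<tau> \<longrightarrow>
        int (card (twisted_curve \<iota> \<epsilon>)) = int CARD('a) + 1 + sign \<tau> * ell_A \<epsilon> \<and>
        card (twisted_curve_infinity \<iota> \<epsilon>) = card {i. \<tau> i = i} \<and>
        int (norm_trace_count \<iota> \<epsilon>) =
          int CARD('a) + 1 + sign \<tau> * ell_A \<epsilon> - int (card {i. \<tau> i = i})"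
      by (intro allI impI) (rule counts)
  qed (use iso3 iso2 iso1 in blast)+
qed

end
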